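(* Let $K$ be a field of characteristic zero, let $N=\mathrm{UT}(n,K)$, let $D$ be a basic subset of $\Delta^+$ and let $\varphi:D\to K^*$ be a map. The field of invariants of the coadjoint action of $N$ on the basic variety $V_{D,\varphi}$, i.e. the field of $N$-invariant rational functions on $V_{D,\varphi}$, is a purely transcendental extension of $K$ of degree $|C(D)|-|D|$.
   Context: Roots. Fix $n\ge 1$. A positive root is a pair $(i,j)$ with $n\ge i>j\ge 1$; $\Delta^+$ is the set of positive roots; $\mathrm{row}(i,j)=i$, $\mathrm{col}(i,j)=j$. For positive roots, $\gamma=\alpha+\beta$ means $\gamma=(i,k)$ and $\{\alpha,\beta\}=\{(i,j),(j,k)\}$ for some $i>j>k$. A subset $D\subset\Delta^+$ is basic if every row and every column contains at most one root of $D$. A positive root $\alpha$ is $D$-singular if there is a positive root $\beta$ with $\alpha+\beta\in D$; $S(D)$ is the set of $D$-singular roots, $R(D)=\Delta^+\setminus S(D)$, and $M(D)=R(D)\setminus D$. Order and the set $C(D)$. Order $\Delta^+$ linearly by: $(k,m)\succ(i,j)$ if $m<j$, or $m=j$ and $k>i$. The diagram of $D$ is a filling of the places $(i,j)\in\Delta^+$ with symbols $\otimes,\bullet,+,-$ built as follows. Step 0: fill all places of $M(D)$ with $\bullet$. Step $i$ ($i\ge1$): let $\xi_i$ be the greatest (for $\succ$) place that is still empty; fill it with $\otimes$. For every decomposition $\xi_i=\alpha+\beta$ into positive roots with $\mathrm{col}(\alpha)=\mathrm{col}(\xi_i)$ and $\mathrm{row}(\beta)=\mathrm{row}(\xi_i)$: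 if both places $\alpha,\beta$ are empty, fill $\alpha$ with $+$ and $\beta$ with $-$; if one of them is already filled, do not fill the other. Continue until no place is empty. $C(D)=\{\xi_1\succ\xi_2\succ\dots\succ\xi_c\}$ is the set of places filled with $\otimes$. Varieties. $N=\mathrm{UT}(n,K)$ is the group of upper unitriangular $n\times n$ matrices, $\mathfrak n$ the Lie algebra of strictly upper triangular matrices, $\mathfrak n_-$ the space of strictly lower triangular matrices, identified with $\mathfrak n^*$ through the form $(A,B)=\mathrm{Tr}\,AB$. Under this identification the coadjoint action of $g\in N$ sends $X\in\mathfrak n_-$ to the strictly lower triangular part of $gXg^{-1}$, and the left-right action of $(g,h)\in N\times N$ sends $X$ to the strictly lower triangular part of $gXh^{-1}$. For a basic subset $D$ and a map $\varphi:D\to K^*$ put $X_{D,\varphi}=\sum_{\xi\in D}\varphi(\xi)E_\xi$, where $E_{(i,j)}$ is the matrix unit. The basic variety $V_{D,\varphi}\subset\mathfrak n_-$ is the $N\times N$-orbit of $X_{D,\varphi}$; it is invariant under the coadjoint action of $N$. *)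

theory Defs
  imports
    "HOL-Library.FuncSet"
    "HOL-Algebra.Ring"
    "HOL-Algebra.Subrings"
    "HOL-Algebra.Generated_Fields"
    "Jordan_Normal_Form.Matrix"
begin

section \<open>Positive roots and the diagram of a basic subset\<close>

text \<open>Rows and columns are numbered from 1. The matrices of
  Jordan\_Normal\_Form are indexed from 0; the shift occurs only in \<open>basic_mat\<close> below.\<close>

type_synonym root = "nat \<times> nat"

definition pos_roots :: "nat \<Rightarrow> root set" where
  "pos_roots n = {(i, j). n \<ge> i \<and> i > j \<and> j \<ge> 1}"

abbreviation root_row :: "root \<Rightarrow> nat" where "root_row \<equiv> fst"
abbreviation root_col :: "root \<Rightarrow> nat" where "root_col \<equiv> snd"

definition root_sum :: "root \<Rightarrow> root \<Rightarrow> root \<Rightarrow> bool" where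
  "root_sum \<gamma> \<alpha> \<beta> \<longleftrightarrow> (\<exists>i j k. i > j \<and> j > k \<and> \<gamma> = (i, k) \<and> {\<alpha>, \<beta>} = {(i, j), (j, k)})"

definition basic_subset :: "nat \<Rightarrow> root set \<Rightarrow> bool" where
  "basic_subset n D \<longleftrightarrow> D \<subseteq> pos_roots n
     \<and> (\<forall>\<alpha>\<in>D. \<forall>\<beta>\<in>D. root_row \<alpha> = root_row \<beta> \<longrightarrow> \<alpha> = \<beta>)
     \<and> (\<forall>\<alpha>\<in>D. \<forall>\<beta>\<in>D. root_col \<alpha> = root_col \<beta> \<longrightarrow> \<alpha> = \<beta>)"

definition singular_roots :: "nat \<Rightarrow> root set \<Rightarrow> root set" where
  "singular_roots n D =
     {\<alpha> \<in> pos_roots n. \<exists>\<beta> \<in> pos_roots n. \<exists>\<gamma> \<in> D. root_sum \<gamma> \<alpha> \<beta>}"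

definition regular_roots :: "nat \<Rightarrow> root set \<Rightarrow> root set" where
  "regular_roots n D = pos_roots n - singular_roots n D"

definition M_roots :: "nat \<Rightarrow> root set \<Rightarrow> root set" where
  "M_roots n D = regular_roots n D - D"

definition root_succ :: "root \<Rightarrow> root \<Rightarrow> bool" where
  "root_succ \<alpha> \<beta> \<longleftrightarrow> root_col \<alpha> < root_col \<beta> \<or> (root_col \<alpha> = root_col \<beta> \<and> root_row \<alpha> > root_row \<beta>)"

datatype symbol = Cross | Dot | Plus | Minus

text \<open>A partially filled diagram; \<open>None\<close> marks an empty place.\<close>

type_synonym filling = "root \<Rightarrow> symbol option"

definition empty_places :: "nat \<Rightarrow> filling \<Rightarrow> root set" where
  "empty_places n f = {\<alpha> \<in> pos_roots n. f \<alpha> = None}"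

definition greatest_empty :: "nat \<Rightarrow> filling \<Rightarrow> root" where
  "greatest_empty n f =
     (THE \<xi>. \<xi> \<in> empty_places n f \<and> (\<forall>\<eta> \<in> empty_places n f. \<eta> \<noteq> \<xi> \<longrightarrow> root_succ \<xi> \<eta>))"

text \<open>\<open>open_pair n f \<xi> \<alpha> \<beta>\<close>: \<open>\<xi> = \<alpha> + \<beta>\<close> is a decomposition with \<open>\<alpha>\<close> in the column and
  \<open>\<beta>\<close> in the row of \<open>\<xi>\<close>, and both places are empty. Distinct decompositions of \<open>\<xi>\<close> involve
  disjoint places, none of them \<open>\<xi>\<close>, so they can be treated simultaneously.\<close>

definition open_pair :: "nat \<Rightarrow> filling \<Rightarrow> root \<Rightarrow> root \<Rightarrow> root \<Rightarrow> bool" where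
  "open_pair n f \<xi> \<alpha> \<beta> \<longleftrightarrow> root_sum \<xi> \<alpha> \<beta> \<and> root_col \<alpha> = root_col \<xi> \<and> root_row \<beta> = root_row \<xi>
     \<and> \<alpha> \<in> empty_places n f \<and> \<beta> \<in> empty_places n f"

definition fill_step :: "nat \<Rightarrow> filling \<Rightarrow> filling" where
  "fill_step n f =
     (if empty_places n f = {} then f
      else (let \<xi> = greatest_empty n f in
        (\<lambda>\<alpha>. if \<alpha> = \<xi> then Some Cross
             else if \<exists>\<beta>. open_pair n f \<xi> \<alpha> \<beta> then Some Plus
             else if \<exists>\<beta>. open_pair n f \<xi> \<beta> \<alpha> then Some Minus
             else f \<alpha>)))"

text \<open>\<open>diagram n D i\<close> is the filling after Step \<open>i\<close>; it is stationary once no place is empty.\<close>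

primrec diagram :: "nat \<Rightarrow> root set \<Rightarrow> nat \<Rightarrow> filling" where
  "diagram n D 0 = (\<lambda>\<alpha>. if \<alpha> \<in> M_roots n D then Some Dot else None)"
| "diagram n D (Suc i) = fill_step n (diagram n D i)"

definition C_roots :: "nat \<Rightarrow> root set \<Rightarrow> root set" where
  "C_roots n D = {\<xi> \<in> pos_roots n. \<exists>i. diagram n D i \<xi> = Some Cross}"


section \<open>Unitriangular group, coadjoint action, basic varieties\<close>

definition UT :: "nat \<Rightarrow> 'a :: field mat monoid" where
  "UT n = \<lparr> carrier = {g \<in> carrier_mat n n. upper_triangular g \<and> (\<forall>i<n. g $$ (i, i) = 1)},
            monoid.mult = (*), one = 1\<^sub>m n \<rparr>"

definition strict_lower :: "nat \<Rightarrow> 'a :: field mat \<Rightarrow> 'a mat" where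
  "strict_lower n A = mat n n (\<lambda>(i, j). if i > j then A $$ (i, j) else 0)"

definition left_right_act :: "nat \<Rightarrow> 'a :: field mat \<Rightarrow> 'a mat \<Rightarrow> 'a mat \<Rightarrow> 'a mat" where
  "left_right_act n g h X = strict_lower n (g * X * inv\<^bsub>UT n\<^esub> h)"

definition coadj_act :: "nat \<Rightarrow> 'a :: field mat \<Rightarrow> 'a mat \<Rightarrow> 'a mat" where
  "coadj_act n g X = strict_lower n (g * X * inv\<^bsub>UT n\<^esub> g)"

text \<open>The matrix \<open>\<Sum>\<xi>\<in>D. \<phi>(\<xi>) E\<^sub>\<xi>\<close>, given by its entries.\<close>

definition basic_mat :: "nat \<Rightarrow> root set \<Rightarrow> (root \<Rightarrow> 'a :: field) \<Rightarrow> 'a mat" where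
  "basic_mat n D \<phi> =
     mat n n (\<lambda>(i, j). if (Suc i, Suc j) \<in> D then \<phi> (Suc i, Suc j) else 0)"

definition basic_variety :: "nat \<Rightarrow> root set \<Rightarrow> (root \<Rightarrow> 'a :: field) \<Rightarrow> 'a mat set" where
  "basic_variety n D \<phi> =
     {left_right_act n g h (basic_mat n D \<phi>) | g h. g \<in> carrier (UT n) \<and> h \<in> carrier (UT n)}"


section \<open>Field of fractions and purely transcendental extensions\<close>

definition frac_rel :: "('a, 'b) ring_scheme \<Rightarrow> (('a \<times> 'a) \<times> ('a \<times> 'a)) set" where
  "frac_rel R = {((a, b), (c, d)).
     a \<in> carrier R \<and> b \<in> carrier R - {\<zero>\<^bsub>R\<^esub>} \<and> c \<in> carrier R \<and> d \<in> carrier R - {\<zero>\<^bsub>R\<^esub>}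
     \<and> a \<otimes>\<^bsub>R\<^esub> d = c \<otimes>\<^bsub>R\<^esub> b}"

definition fraction :: "('a, 'b) ring_scheme \<Rightarrow> 'a \<Rightarrow> 'a \<Rightarrow> ('a \<times> 'a) set" where
  "fraction R a b = frac_rel R `` {(a, b)}"

text \<open>Meaningful when \<open>R\<close> is an integral domain: the operations on classes are then
  independent of representatives, and each union below is a single class.\<close>

definition frac_field :: "('a, 'b) ring_scheme \<Rightarrow> ('a \<times> 'a) set ring" where
  "frac_field R = \<lparr>
     carrier = {fraction R a b | a b. a \<in> carrier R \<and> b \<in> carrier R - {\<zero>\<^bsub>R\<^esub>}},
     monoid.mult = (\<lambda>x y. \<Union>(a, b)\<in>x. \<Union>(c, d)\<in>y. fraction R (a \<otimes>\<^bsub>R\<^esub> c) (b \<otimes>\<^bsub>R\<^esub> d)),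
     one = fraction R \<one>\<^bsub>R\<^esub> \<one>\<^bsub>R\<^esub>,
     zero = fraction R \<zero>\<^bsub>R\<^esub> \<one>\<^bsub>R\<^esub>,
     add = (\<lambda>x y. \<Union>(a, b)\<in>x. \<Union>(c, d)\<in>y.
              fraction R ((a \<otimes>\<^bsub>R\<^esub> d) \<oplus>\<^bsub>R\<^esub> (c \<otimes>\<^bsub>R\<^esub> b)) (b \<otimes>\<^bsub>R\<^esub> d)) \<rparr>"

text \<open>Algebraic independence of \<open>t 0, \<dots>, t (d - 1)\<close> over the subfield \<open>k\<close>: no polynomial
  \<open>\<Sum>e\<in>A. c e * x\<^sup>e\<close> with coefficients in \<open>k\<close>, not all zero, vanishes at \<open>t\<close>. Exponent vectors
  are extensional functions on \<open>{..<d}\<close>, so distinct elements of \<open>A\<close> are distinct monomials.\<close>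

definition alg_independent ::
    "('a, 'b) ring_scheme \<Rightarrow> 'a set \<Rightarrow> nat \<Rightarrow> (nat \<Rightarrow> 'a) \<Rightarrow> bool" where
  "alg_independent R k d t \<longleftrightarrow>
     (\<forall>(A :: (nat \<Rightarrow> nat) set) c.
        finite A \<longrightarrow> A \<subseteq> {..<d} \<rightarrow>\<^sub>E UNIV \<longrightarrow> c \<in> A \<rightarrow> k \<longrightarrow>
        (\<Oplus>\<^bsub>R\<^esub>e\<in>A. c e \<otimes>\<^bsub>R\<^esub> (\<Otimes>\<^bsub>R\<^esub>i\<in>{..<d}. t i [^]\<^bsub>R\<^esub> e i)) = \<zero>\<^bsub>R\<^esub> \<longrightarrow>
        (\<forall>e\<in>A. c e = \<zero>\<^bsub>R\<^esub>))"

text \<open>Inside the field \<open>R\<close>, the subfield \<open>E\<close> is a purely transcendental extension of the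
  subfield \<open>k\<close> of degree \<open>d\<close>.\<close>

definition purely_transcendental ::
    "('a, 'b) ring_scheme \<Rightarrow> 'a set \<Rightarrow> 'a set \<Rightarrow> nat \<Rightarrow> bool" where
  "purely_transcendental R k E d \<longleftrightarrow>
     field R \<and> subfield k R \<and> subfield E R \<and> k \<subseteq> E \<and>
     (\<exists>t. t \<in> {..<d} \<rightarrow> E \<and> alg_independent R k d t \<and>
          E = generate_field R (k \<union> t ` {..<d}))"


section \<open>Rational functions and invariants\<close>

inductive_set poly_functions :: "nat \<Rightarrow> ('a :: field mat \<Rightarrow> 'a) set" for n where
  const: "(\<lambda>X. c) \<in> poly_functions n"
| entry: "i < n \<Longrightarrow> j < n \<Longrightarrow> (\<lambda>X. X $$ (i, j)) \<in> poly_functions n"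
| add: "p \<in> poly_functions n \<Longrightarrow> q \<in> poly_functions n \<Longrightarrow> (\<lambda>X. p X + q X) \<in> poly_functions n"
| mult: "p \<in> poly_functions n \<Longrightarrow> q \<in> poly_functions n \<Longrightarrow> (\<lambda>X. p X * q X) \<in> poly_functions n"

text \<open>The coordinate ring \<open>K[V]\<close>: restrictions to \<open>V\<close> of polynomials in the matrix entries.
  Here \<open>V\<close> is the set of \<open>K\<close>-points, which is adequate for infinite \<open>K\<close> and \<open>V\<close> an orbit of
  a unipotent group, since the \<open>K\<close>-points are then Zariski dense.\<close>

definition coord_ring :: "nat \<Rightarrow> 'a :: field mat set \<Rightarrow> ('a mat \<Rightarrow> 'a) ring" where
  "coord_ring n V = \<lparr>
     carrier = {restrict p V | p. p \<in> poly_functions n},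
     monoid.mult = (\<lambda>p q. \<lambda>X\<in>V. p X * q X),
     one = (\<lambda>X\<in>V. 1),
     zero = (\<lambda>X\<in>V. 0),
     add = (\<lambda>p q. \<lambda>X\<in>V. p X + q X) \<rparr>"

abbreviation rational_functions ::
    "nat \<Rightarrow> 'a :: field mat set \<Rightarrow> (('a mat \<Rightarrow> 'a) \<times> ('a mat \<Rightarrow> 'a)) set ring" where
  "rational_functions n V \<equiv> frac_field (coord_ring n V)"

definition const_functions ::
    "nat \<Rightarrow> 'a :: field mat set \<Rightarrow> (('a mat \<Rightarrow> 'a) \<times> ('a mat \<Rightarrow> 'a)) set set" where
  "const_functions n V = {fraction (coord_ring n V) (\<lambda>X\<in>V. c) (\<lambda>X\<in>V. 1) | c. True}"

text \<open>The induced action on functions is \<open>(g \<cdot> p)(X) = p(g\<inverse> \<cdot> X)\<close>, extended to fractions.\<close>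

definition act_fun :: "nat \<Rightarrow> 'a :: field mat set \<Rightarrow> 'a mat \<Rightarrow> ('a mat \<Rightarrow> 'a) \<Rightarrow> ('a mat \<Rightarrow> 'a)" where
  "act_fun n V g p = (\<lambda>X\<in>V. p (coadj_act n (inv\<^bsub>UT n\<^esub> g) X))"

definition act_rat :: "nat \<Rightarrow> 'a :: field mat set \<Rightarrow> 'a mat \<Rightarrow>
    (('a mat \<Rightarrow> 'a) \<times> ('a mat \<Rightarrow> 'a)) set \<Rightarrow> (('a mat \<Rightarrow> 'a) \<times> ('a mat \<Rightarrow> 'a)) set" where
  "act_rat n V g x = (\<Union>(p, q)\<in>x. fraction (coord_ring n V) (act_fun n V g p) (act_fun n V g q))"

definition invariant_field ::
    "nat \<Rightarrow> 'a :: field mat set \<Rightarrow> (('a mat \<Rightarrow> 'a) \<times> ('a mat \<Rightarrow> 'a)) set set" where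
  "invariant_field n V =
     {x \<in> carrier (rational_functions n V). \<forall>g \<in> carrier (UT n). act_rat n V g x = x}"

end

theory Submission
  imports Defs "HOL-Computational_Algebra.Polynomial" "Jordan_Normal_Form.Determinant"
begin

text \<open>
  The order \<open>\<succ>\<close> makes the coadjoint action triangular: if two points of an orbit agree in all
  coordinates greater than \<open>\<zeta>\<close>, then whether the coordinate \<open>\<zeta>\<close> can still differ is decided by the
  infinitesimal action, and in that case it can be given any value. Such a \<open>\<zeta>\<close> is called a jump of
  the point. The set of jumps is constant along orbits, it contains as many roots as the form
  \<open>(A, B) \<mapsto> tr (X [A, B])\<close> has rank, and for generic points \<open>X\<close> of the basic variety \<open>V\<close> it is one
  fixed set \<open>J\<close>.

  The variety \<open>V\<close> is the graph of a polynomial map over the coordinates in \<open>S = S(D)\<close>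
  (\<open>parametrisation\<close> and \<open>V_determined\<close>); hence \<open>K[V]\<close> is a domain, points of \<open>V\<close> with prescribed
  coordinates in \<open>S\<close> exist, and \<open>J \<subseteq> S\<close>. Moving the coordinates in \<open>J\<close> to \<open>0\<close> one after the other
  carries a generic point \<open>X\<close> to a point \<open>F X\<close> of the slice \<open>{X. X\<^sub>\<zeta> = 0 for \<zeta> \<in> J}\<close>, and each
  step depends rationally on \<open>X\<close> (\<open>normalisation\<close>). By triangularity a generic orbit meets the
  slice only once (\<open>normal_point_unique\<close>), so \<open>F\<close> is constant on orbits and is the identity on the
  slice. An invariant function is therefore determined by its values on the slice, and the entries
  of \<open>F X\<close> in \<open>S - J\<close> generate the field of invariants. They are algebraically independent, because
  on the slice they are the coordinates of \<open>S - J\<close>, which take arbitrary values there. The degree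
  is thus \<open>|S| - |J|\<close>.

  It remains to identify this number with \<open>|C(D)| - |D|\<close>, that is, to compute the generic rank
  \<open>|J|\<close> from the diagram. Every orbit in \<open>V\<close> contains a point each of whose rows vanishes to the left of
  the root of \<open>D\<close> in that row and has the prescribed entry there, or vanishes altogether if there is
  no such root (\<open>row_shape\<close>). The rank at such points is computed column by column. The elements of
  row \<open>m\<close> of the Lie algebra form an abelian ideal, and splitting this ideal off, as in Mackey's construction of induced representations,
  leaves the stabiliser of the functional given by column \<open>m\<close> of \<open>X\<close>. Conjugation by an elementary
  matrix that clears all but the lowest entry \<open>(k, m)\<close> of the column turns this stabiliser into one
  of the same kind, in which the labels of \<open>m\<close> and \<open>k\<close> are interchanged. The lowest entries met in
  this process are the places of the symbol \<open>\<otimes>\<close> in the diagram, and the pairs of roots lost at a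
  transposition are the pairs filled with \<open>+\<close> and \<open>-\<close>. Thus if \<open>q\<close> symbols \<open>+\<close> occur, then the
  rank is \<open>2 q\<close> (\<open>dual_pairs_upper\<close>, \<open>dual_pairs_lower\<close>), while \<open>|S \<union> D| = |C(D)| + 2 q\<close> counts the
  places not filled with a dot (\<open>crosses_count\<close>). As \<open>D\<close> is basic, \<open>S\<close> and \<open>D\<close> are disjoint, and
  \<open>|S| - |J| = |C(D)| - |D|\<close> follows.
\<close>

section \<open>Algebras of functions\<close>

text \<open>Polynomial functions occur in several guises: in one variable, in a family of coordinates, in the
  entries of a matrix, and with powers of a fixed denominator. Only closure under the ring
  operations matters for most arguments.\<close>

definition function_algebra :: "('x \<Rightarrow> 'a::field) set \<Rightarrow> bool" where
  "function_algebra P \<longleftrightarrow> (\<forall>c. (\<lambda>_. c) \<in> P)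
     \<and> (\<forall>p\<in>P. \<forall>q\<in>P. (\<lambda>x. p x + q x) \<in> P \<and> (\<lambda>x. p x * q x) \<in> P)"

lemma function_algebraD:
  assumes "function_algebra P"
  shows "(\<lambda>_. c) \<in> P" "p \<in> P \<Longrightarrow> q \<in> P \<Longrightarrow> (\<lambda>x. p x + q x) \<in> P"
    "p \<in> P \<Longrightarrow> q \<in> P \<Longrightarrow> (\<lambda>x. p x * q x) \<in> P"
  using assms by (auto simp: function_algebra_def)

lemma function_algebra_uminus:
  assumes "function_algebra P" "p \<in> P"
  shows "(\<lambda>x. - p x) \<in> P"
  using function_algebraD(3)[OF assms(1) function_algebraD(1)[OF assms(1), of "-1"] assms(2)] by simp

lemma function_algebra_diff:
  assumes "function_algebra P" "p \<in> P" "q \<in> P"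
  shows "(\<lambda>x. p x - q x) \<in> P"
  using function_algebraD(2)[OF assms(1,2) function_algebra_uminus[OF assms(1,3)]] by simp

lemma function_algebra_sum:
  assumes "function_algebra P" "\<And>i. i \<in> I \<Longrightarrow> f i \<in> P"
  shows "(\<lambda>x. \<Sum>i\<in>I. f i x) \<in> P"
  using assms(2)
proof (induction I rule: infinite_finite_induct)
  case (insert i I)
  then show ?case by (simp add: function_algebraD(2)[OF assms(1)])
qed (simp_all add: function_algebraD(1)[OF assms(1)])

lemma function_algebra_prod:
  assumes "function_algebra P" "\<And>i. i \<in> I \<Longrightarrow> f i \<in> P"
  shows "(\<lambda>x. \<Prod>i\<in>I. f i x) \<in> P"
  using assms(2)
proof (induction I rule: infinite_finite_induct)
  case (insert i I)
  then show ?case by (simp add: function_algebraD(3)[OF assms(1)])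
qed (simp_all add: function_algebraD(1)[OF assms(1)])

lemma function_algebra_power:
  assumes "function_algebra P" "f \<in> P"
  shows "(\<lambda>x. f x ^ k) \<in> P"
  using function_algebra_prod[OF assms(1), of "{..<k}" "\<lambda>_. f"] assms(2) by simp

text \<open>If the linear functionals \<open>g i\<close> at the parameter \<open>x0\<close> have a dual family of vectors, then the
  matrix of the functionals has a maximal minor \<open>u\<close> that does not vanish at \<open>x0\<close>, and Cramer's rule
  yields vectors with polynomial coefficients that are dual up to the factor \<open>u\<close>. The induction on
  the number of functionals avoids determinants: a Gram-Schmidt step without divisions adds one
  functional.\<close>

lemma dual_family_extends:
  assumes P: "function_algebra P" and fin: "finite I" "finite K"
    and g: "\<And>i k. i \<in> I \<Longrightarrow> k \<in> K \<Longrightarrow> g i k \<in> P"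
    and dual: "\<And>i j. i \<in> I \<Longrightarrow> j \<in> I \<Longrightarrow> (\<Sum>k\<in>K. g i k x0 * a0 j k) = (if i = j then 1 else 0)"
  shows "\<exists>u\<in>P. u x0 \<noteq> 0 \<and> (\<exists>a. (\<forall>j\<in>I. \<forall>k\<in>K. a j k \<in> P) \<and>
      (\<forall>x. \<forall>i\<in>I. \<forall>j\<in>I. (\<Sum>k\<in>K. g i k x * a j k x) = (if i = j then u x else 0)))"
  using fin(1) g dual
proof (induction I rule: finite_induct)
  case empty
  then show ?case using function_algebraD(1)[OF P, of 1] by (intro bexI[of _ "\<lambda>_. 1"]) auto
next
  case (insert r I)
  obtain u a where u: "u \<in> P" "u x0 \<noteq> 0" and aP: "\<And>j k. j \<in> I \<Longrightarrow> k \<in> K \<Longrightarrow> a j k \<in> P"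
    and ga: "\<And>x i j. i \<in> I \<Longrightarrow> j \<in> I \<Longrightarrow> (\<Sum>k\<in>K. g i k x * a j k x) = (if i = j then u x else 0)"
    using insert.IH insert.prems by (fastforce simp: Ball_def Bex_def)
  define ra where "ra j x = (\<Sum>k\<in>K. g r k x * a j k x)" for j x
  \<comment> \<open>The unit vector at \<open>b\<close>, multiplied by \<open>u\<close> and corrected so that the functionals in \<open>I\<close> vanish on it;
    \<open>v b\<close> is the value of the functional \<open>r\<close> on this vector.\<close>
  define w where "w b k x = (if k = b then u x else 0) - (\<Sum>j\<in>I. g j b x * a j k x)" for b k x
  define v where "v b x = u x * g r b x - (\<Sum>j\<in>I. g j b x * ra j x)" for b x
  have rw: "(\<Sum>k\<in>K. h k * w b k x) = u x * h b - (\<Sum>j\<in>I. g j b x * (\<Sum>k\<in>K. h k * a j k x))"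
    if "b \<in> K" for h b x
  proof -
    have "(\<Sum>k\<in>K. h k * w b k x)
        = (\<Sum>k\<in>K. (if k = b then u x * h k else 0) - (\<Sum>j\<in>I. g j b x * (h k * a j k x)))"
      unfolding w_def by (rule sum.cong) (auto simp: algebra_simps sum_distrib_left)
    also have "\<dots> = u x * h b - (\<Sum>k\<in>K. \<Sum>j\<in>I. g j b x * (h k * a j k x))"
      using that fin(2) by (simp add: sum_subtractf)
    also have "(\<Sum>k\<in>K. \<Sum>j\<in>I. g j b x * (h k * a j k x)) = (\<Sum>j\<in>I. \<Sum>k\<in>K. g j b x * (h k * a j k x))"
      by (rule sum.swap)
    finally show ?thesis by (simp add: sum_distrib_left)
  qed
  have gw: "(\<Sum>k\<in>K. g i k x * w b k x) = 0" if "i \<in> I" "b \<in> K" for i b x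
  proof -
    have "(\<Sum>j\<in>I. g j b x * (\<Sum>k\<in>K. g i k x * a j k x)) = (\<Sum>j\<in>I. if j = i then g j b x * u x else 0)"
      using ga that by (intro sum.cong) auto
    then show ?thesis using rw[OF that(2), of "\<lambda>k. g i k x"] that insert.hyps by simp
  qed
  have rwv: "(\<Sum>k\<in>K. g r k x * w b k x) = v b x" if "b \<in> K" for b x
    using rw[OF that, of "\<lambda>k. g r k x" x] by (simp add: v_def ra_def)
  obtain b where b: "b \<in> K" "v b x0 \<noteq> 0"
  proof (rule ccontr)
    assume "\<not> thesis"
    then have "\<And>b. b \<in> K \<Longrightarrow> v b x0 = 0" using that by blast
    then have "0 = (\<Sum>b\<in>K. v b x0 * a0 r b)" by simp
    also have "\<dots> = u x0 * (\<Sum>b\<in>K. g r b x0 * a0 r b) - (\<Sum>b\<in>K. \<Sum>j\<in>I. ra j x0 * (g j b x0 * a0 r b))"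
      unfolding v_def by (simp add: algebra_simps sum_subtractf sum_distrib_left)
    also have "(\<Sum>b\<in>K. \<Sum>j\<in>I. ra j x0 * (g j b x0 * a0 r b)) = (\<Sum>j\<in>I. ra j x0 * (\<Sum>b\<in>K. g j b x0 * a0 r b))"
      by (subst sum.swap) (simp add: sum_distrib_left)
    also have "\<dots> = 0"
      using insert.prems(2) insert.hyps by (intro sum.neutral) auto
    finally show False using insert.prems(2)[of r r] u by simp
  qed
  \<comment> \<open>The vector for \<open>r\<close> is the corrected unit vector; the old vectors are scaled by \<open>v b\<close> so that their value
    under \<open>r\<close> can be cancelled without division.\<close>
  define a' where "a' j k x = (if j = r then u x * w b k x else v b x * a j k x - ra j x * w b k x)" for j k x
  have gP: "g i k \<in> P" if "i \<in> insert r I" "k \<in> K" for i k using insert.prems(1) that by blast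
  have raP: "(\<lambda>x. ra j x) \<in> P" if "j \<in> I" for j
    unfolding ra_def using gP aP that by (intro function_algebra_sum[OF P] function_algebraD(3)[OF P]) auto
  have uP: "(\<lambda>x. if k = b then u x else 0) \<in> P" for k
    using u function_algebraD(1)[OF P, of 0] by (cases "k = b") auto
  have wP: "(\<lambda>x. w b k x) \<in> P" if "k \<in> K" for k
    unfolding w_def using gP aP that b uP
    by (intro function_algebra_diff[OF P] function_algebra_sum[OF P] function_algebraD(3)[OF P]) auto
  have vP: "(\<lambda>x. v b x) \<in> P"
    unfolding v_def using gP raP b u
    by (intro function_algebra_diff[OF P] function_algebra_sum[OF P] function_algebraD(3)[OF P]) auto
  have a'P: "a' j k \<in> P" if "j \<in> insert r I" "k \<in> K" for j k
  proof (cases "j = r")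
    case True
    then have "a' j k = (\<lambda>x. u x * w b k x)" by (auto simp: a'_def)
    then show ?thesis using function_algebraD(3)[OF P u(1) wP[OF that(2)]] by simp
  next
    case False
    then have "a' j k = (\<lambda>x. v b x * a j k x - ra j x * w b k x)" by (auto simp: a'_def)
    then show ?thesis using that False aP wP vP raP
      by (auto intro!: function_algebra_diff[OF P] function_algebraD(3)[OF P])
  qed
  have "(\<Sum>k\<in>K. g i k x * a' j k x) = (if i = j then u x * v b x else 0)"
    if i: "i \<in> insert r I" and j: "j \<in> insert r I" for i j x
  proof (cases "j = r")
    case True
    have "(\<Sum>k\<in>K. g i k x * a' j k x) = u x * (\<Sum>k\<in>K. g i k x * w b k x)"
      using True by (simp add: a'_def sum_distrib_left algebra_simps)
    then show ?thesis using True i gw[of i b x] rwv[of b x] b insert.hyps by auto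
  next
    case False
    have "(\<Sum>k\<in>K. g i k x * a' j k x) = v b x * (\<Sum>k\<in>K. g i k x * a j k x) - ra j x * (\<Sum>k\<in>K. g i k x * w b k x)"
      using False by (simp add: a'_def sum_distrib_left sum_subtractf algebra_simps)
    then show ?thesis
      using False i j gw[of i b x] rwv[of b x] b insert.hyps ga[of i j x] by (cases "i = r") (auto simp: ra_def)
  qed
  then show ?case
    using u b function_algebraD(3)[OF P u(1) vP] a'P
    by (intro bexI[of _ "\<lambda>x. u x * v b x"] conjI exI[of _ a']) auto
qed

definition univariate_polys :: "('a::field \<Rightarrow> 'a) set" where
  "univariate_polys = {f. \<exists>p. f = poly p}"

lemma function_algebra_univariate: "function_algebra (univariate_polys :: ('a::field \<Rightarrow> 'a) set)"
  unfolding function_algebra_def univariate_polys_def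
proof (intro conjI allI ballI)
  show "(\<lambda>_. c) \<in> {f. \<exists>p. f = poly p}" for c :: 'a
    by (intro CollectI exI[of _ "[:c:]"] ext) simp
next
  fix f g :: "'a \<Rightarrow> 'a" assume "f \<in> {f. \<exists>p. f = poly p}" "g \<in> {f. \<exists>p. f = poly p}"
  then obtain p q where "f = poly p" "g = poly q" by auto
  then have "(\<lambda>x. f x + g x) = poly (p + q)" "(\<lambda>x. f x * g x) = poly (p * q)" by auto
  then show "(\<lambda>x. f x + g x) \<in> {f. \<exists>p. f = poly p}" "(\<lambda>x. f x * g x) \<in> {f. \<exists>p. f = poly p}"
    by blast+
qed

lemma univariate_id: "(\<lambda>t. t) \<in> univariate_polys"
  unfolding univariate_polys_def by (auto intro!: exI[of _ "[:0, 1:]"])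

lemma univariate_zeros_finite:
  assumes "f \<in> univariate_polys" "f t0 \<noteq> 0"
  shows "finite {t. f t = 0}"
proof -
  obtain p where "f = poly p" using assms by (auto simp: univariate_polys_def)
  moreover from this have "p \<noteq> 0" using assms by auto
  ultimately show ?thesis using poly_roots_finite[of p] by simp
qed

text \<open>The irreducibility statements below reduce to this one by restriction to lines.\<close>

lemma univariate_common_nonzero:
  fixes f :: "'i \<Rightarrow> 'a::field_char_0 \<Rightarrow> 'a"
  assumes "finite I" "\<And>i. i \<in> I \<Longrightarrow> f i \<in> univariate_polys" "\<And>i. i \<in> I \<Longrightarrow> \<exists>t. f i t \<noteq> 0"
  shows "\<exists>t. \<forall>i\<in>I. f i t \<noteq> 0"
proof -
  have "finite (\<Union>i\<in>I. {t. f i t = 0})"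
    using assms univariate_zeros_finite by (intro finite_UN_I) blast+
  then have "\<exists>t. t \<notin> (\<Union>i\<in>I. {t. f i t = 0})"
    using infinite_UNIV_char_0 ex_new_if_finite by blast
  then show ?thesis by auto
qed

section \<open>The trace form of a linear functional\<close>

text \<open>Matrices are functions with indices from 1, so that rows and columns carry the same numbers as
  the roots; entries outside the range \<open>{1..n}\<close> are ignored.\<close>

definition mprod :: "nat \<Rightarrow> (nat \<Rightarrow> nat \<Rightarrow> 'a) \<Rightarrow> (nat \<Rightarrow> nat \<Rightarrow> 'a) \<Rightarrow> nat \<Rightarrow> nat \<Rightarrow> 'a::field" where
  "mprod n A B = (\<lambda>i j. \<Sum>l\<in>{1..n}. A i l * B l j)"

definition mtrace :: "nat \<Rightarrow> (nat \<Rightarrow> nat \<Rightarrow> 'a::field) \<Rightarrow> 'a" where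
  "mtrace n A = (\<Sum>i\<in>{1..n}. A i i)"

text \<open>This is \<open>tr (x [A, B])\<close>: the alternating form that the functional \<open>x\<close> induces on the Lie algebra.
  Its rank is the dimension of the coadjoint orbit of \<open>x\<close>.\<close>

definition bracket_form ::
    "nat \<Rightarrow> (nat \<Rightarrow> nat \<Rightarrow> 'a) \<Rightarrow> (nat \<Rightarrow> nat \<Rightarrow> 'a) \<Rightarrow> (nat \<Rightarrow> nat \<Rightarrow> 'a) \<Rightarrow> 'a::field" where
  "bracket_form n x A B = mtrace n (mprod n x (mprod n A B)) - mtrace n (mprod n x (mprod n B A))"

lemma mprod_assoc: "mprod n (mprod n A B) C = mprod n A (mprod n B C)"
proof (intro ext)
  fix i j
  have "mprod n (mprod n A B) C i j = (\<Sum>l\<in>{1..n}. \<Sum>k\<in>{1..n}. A i k * B k l * C l j)"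
    by (simp add: mprod_def sum_distrib_right)
  also have "\<dots> = (\<Sum>k\<in>{1..n}. \<Sum>l\<in>{1..n}. A i k * B k l * C l j)"
    by (rule sum.swap)
  also have "\<dots> = mprod n A (mprod n B C) i j"
    by (simp add: mprod_def sum_distrib_left mult.assoc)
  finally show "mprod n (mprod n A B) C i j = mprod n A (mprod n B C) i j" .
qed

lemma mtrace_mprod_commute: "mtrace n (mprod n A B) = mtrace n (mprod n B A)"
proof -
  have "mtrace n (mprod n A B) = (\<Sum>i\<in>{1..n}. \<Sum>l\<in>{1..n}. A i l * B l i)"
    by (simp add: mtrace_def mprod_def)
  also have "\<dots> = (\<Sum>l\<in>{1..n}. \<Sum>i\<in>{1..n}. A i l * B l i)"
    by (rule sum.swap)
  finally show ?thesis
    by (simp add: mtrace_def mprod_def mult.commute)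
qed

lemma bracket_form_skew: "bracket_form n x B A = - bracket_form n x A B"
  by (simp add: bracket_form_def)

lemma bracket_form_add_left:
  "bracket_form n x (\<lambda>a b. A a b + c * B a b) C = bracket_form n x A C + c * bracket_form n x B C"
  by (simp add: bracket_form_def mtrace_def mprod_def algebra_simps sum.distrib sum_distrib_left)

lemma bracket_form_add_right:
  "bracket_form n x C (\<lambda>a b. A a b + c * B a b) = bracket_form n x C A + c * bracket_form n x C B"
  using bracket_form_add_left[of n x A c B C] bracket_form_skew[of n x C] by simp

lemma bracket_form_diff_left:
  "bracket_form n x (\<lambda>a b. A a b - c * B a b) C = bracket_form n x A C - c * bracket_form n x B C"
  using bracket_form_add_left[of n x A "- c" B C] by simp

lemma bracket_form_diff_right:
  "bracket_form n x C (\<lambda>a b. A a b - c * B a b) = bracket_form n x C A - c * bracket_form n x C B"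
  using bracket_form_add_right[of n x C A "- c" B] by simp

definition elem_mat :: "nat \<Rightarrow> (nat \<Rightarrow> 'a) \<Rightarrow> nat \<Rightarrow> nat \<Rightarrow> 'a::field" where
  "elem_mat k \<nu> = (\<lambda>a b. (if a = b then 1 else 0) + (if b = k then \<nu> a else 0))"

text \<open>Conjugation by \<open>1 + \<nu> e\<^sub>k\<^sup>T\<close>. The inverse of this matrix is \<open>1 - \<nu> e\<^sub>k\<^sup>T\<close> provided that \<open>\<nu>\<close> vanishes
  at \<open>k\<close>, which the lemmas below assume.\<close>

definition elem_conj :: "nat \<Rightarrow> nat \<Rightarrow> (nat \<Rightarrow> 'a) \<Rightarrow> (nat \<Rightarrow> nat \<Rightarrow> 'a) \<Rightarrow> nat \<Rightarrow> nat \<Rightarrow> 'a::field" where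
  "elem_conj n k \<nu> A = mprod n (elem_mat k (\<lambda>a. - \<nu> a)) (mprod n A (elem_mat k \<nu>))"

lemma mprod_elem_left:
  assumes "i \<in> {1..n}" "k \<in> {1..n}"
  shows "mprod n (elem_mat k \<nu>) B i j = B i j + \<nu> i * B k j"
proof -
  have "mprod n (elem_mat k \<nu>) B i j
      = (\<Sum>l\<in>{1..n}. (if i = l then B l j else 0) + (if l = k then \<nu> i * B l j else 0))"
    unfolding mprod_def elem_mat_def by (rule sum.cong) (auto simp: algebra_simps)
  also have "\<dots> = B i j + \<nu> i * B k j"
    using assms by (simp add: sum.distrib)
  finally show ?thesis .
qed

lemma mprod_elem_right:
  assumes "j \<in> {1..n}"
  shows "mprod n A (elem_mat k \<nu>) i j = A i j + (if j = k then \<Sum>l\<in>{1..n}. A i l * \<nu> l else 0)"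
proof -
  have "mprod n A (elem_mat k \<nu>) i j
      = (\<Sum>l\<in>{1..n}. (if l = j then A i l else 0) + (if j = k then A i l * \<nu> l else 0))"
    unfolding mprod_def elem_mat_def by (rule sum.cong) (auto simp: algebra_simps)
  then show ?thesis
    using assms by (simp add: sum.distrib)
qed

lemma elem_conj_entry:
  assumes "i \<in> {1..n}" "j \<in> {1..n}" "k \<in> {1..n}"
  shows "elem_conj n k \<nu> A i j = A i j + (if j = k then \<Sum>l\<in>{1..n}. A i l * \<nu> l else 0)
     - \<nu> i * (A k j + (if j = k then \<Sum>l\<in>{1..n}. A k l * \<nu> l else 0))"
  unfolding elem_conj_def using assms by (simp add: mprod_elem_left mprod_elem_right)

lemma elem_mat_cancel:
  assumes "\<nu> k = 0" "k \<in> {1..n}"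
  shows "mprod n A (mprod n (elem_mat k \<nu>) (mprod n (elem_mat k (\<lambda>a. - \<nu> a)) B)) = mprod n A B"
proof (intro ext)
  fix i j
  show "mprod n A (mprod n (elem_mat k \<nu>) (mprod n (elem_mat k (\<lambda>a. - \<nu> a)) B)) i j = mprod n A B i j"
    unfolding mprod_def[of n A] using assms
    by (intro sum.cong refl arg_cong2[where f = "(*)"]) (simp add: mprod_elem_left)
qed

lemma elem_conj_mprod:
  assumes "\<nu> k = 0" "k \<in> {1..n}"
  shows "mprod n (elem_conj n k \<nu> A) (elem_conj n k \<nu> B) = elem_conj n k \<nu> (mprod n A B)"
  unfolding elem_conj_def using elem_mat_cancel[of \<nu> k n, OF assms] by (simp add: mprod_assoc)

lemma mtrace_elem_conj:
  assumes "\<nu> k = 0" "k \<in> {1..n}"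
  shows "mtrace n (elem_conj n k \<nu> A) = mtrace n A"
proof -
  have "mtrace n (elem_conj n k \<nu> A)
      = mtrace n (mprod n A (mprod n (elem_mat k \<nu>) (elem_mat k (\<lambda>a. - \<nu> a))))"
    unfolding elem_conj_def
    by (subst mtrace_mprod_commute) (simp add: mprod_assoc)
  also have "\<dots> = (\<Sum>i\<in>{1..n}. \<Sum>l\<in>{1..n}. A i l * (if l = i then 1 else 0))"
    unfolding mtrace_def mprod_def[of n A] using assms
    by (intro sum.cong refl arg_cong2[where f = "(*)"])
       (subst mprod_elem_left, auto simp: elem_mat_def)
  also have "\<dots> = mtrace n A"
    unfolding mtrace_def by (rule sum.cong) (auto simp: if_distrib[where f = "\<lambda>u. _ * u"] cong: if_cong)
  finally show ?thesis .
qed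

lemma bracket_form_elem_conj:
  assumes "\<nu> k = 0" "k \<in> {1..n}"
  shows "bracket_form n (elem_conj n k \<nu> x) (elem_conj n k \<nu> A) (elem_conj n k \<nu> B) = bracket_form n x A B"
  unfolding bracket_form_def by (simp add: elem_conj_mprod[of \<nu> k n, OF assms] mtrace_elem_conj[of \<nu> k n, OF assms])

section \<open>Dual pairs\<close>

text \<open>The form has rank at least \<open>s\<close> between \<open>U\<close> and \<open>W\<close>; a dual system expresses this without dimensions.\<close>

definition dual_pairs ::
    "nat \<Rightarrow> (nat \<Rightarrow> nat \<Rightarrow> 'a::field) \<Rightarrow> (nat \<Rightarrow> nat \<Rightarrow> 'a) set \<Rightarrow> (nat \<Rightarrow> nat \<Rightarrow> 'a) set \<Rightarrow> nat \<Rightarrow> bool" where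
  "dual_pairs n x U W s \<longleftrightarrow> (\<exists>A B. (\<forall>i<s. A i \<in> U \<and> B i \<in> W)
     \<and> (\<forall>i<s. \<forall>j<s. bracket_form n x (A i) (B j) = (if i = j then 1 else 0)))"

definition lin_closed :: "(nat \<Rightarrow> nat \<Rightarrow> 'a::field) set \<Rightarrow> bool" where
  "lin_closed U \<longleftrightarrow> (\<forall>A\<in>U. \<forall>B\<in>U. \<forall>c. (\<lambda>a b. A a b + c * B a b) \<in> U)"

lemma lin_closedD: "lin_closed U \<Longrightarrow> A \<in> U \<Longrightarrow> B \<in> U \<Longrightarrow> (\<lambda>a b. A a b + c * B a b) \<in> U"
  by (auto simp: lin_closed_def)

lemma dual_pairs_0 [simp]: "dual_pairs n x U W 0"
  by (auto simp: dual_pairs_def)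

lemma dual_pairsI:
  assumes "\<And>i. i < s \<Longrightarrow> A i \<in> U" "\<And>i. i < s \<Longrightarrow> B i \<in> W"
    "\<And>i j. i < s \<Longrightarrow> j < s \<Longrightarrow> bracket_form n x (A i) (B j) = (if i = j then 1 else 0)"
  shows "dual_pairs n x U W s"
  unfolding dual_pairs_def using assms by blast

lemma dual_pairsE:
  assumes "dual_pairs n x U W s"
  obtains A B where "\<And>i. i < s \<Longrightarrow> A i \<in> U" "\<And>i. i < s \<Longrightarrow> B i \<in> W"
    "\<And>i j. i < s \<Longrightarrow> j < s \<Longrightarrow> bracket_form n x (A i) (B j) = (if i = j then 1 else 0)"
proof -
  from assms obtain A B where "\<forall>i<s. A i \<in> U \<and> B i \<in> W"
    "\<forall>i<s. \<forall>j<s. bracket_form n x (A i) (B j) = (if i = j then 1 else 0)"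
    unfolding dual_pairs_def by blast
  then show thesis by (intro that[of A B]) auto
qed

lemma dual_pairs_mono:
  assumes "dual_pairs n x U W s" and sub: "U \<subseteq> U'" "W \<subseteq> W'" "s' \<le> s"
  shows "dual_pairs n x U' W' s'"
proof -
  obtain A B where 1: "\<And>i. i < s \<Longrightarrow> A i \<in> U" "\<And>i. i < s \<Longrightarrow> B i \<in> W"
    "\<And>i j. i < s \<Longrightarrow> j < s \<Longrightarrow> bracket_form n x (A i) (B j) = (if i = j then 1 else 0)"
    using assms(1) by (rule dual_pairsE) blast
  show ?thesis
    by (rule dual_pairsI[of _ A _ B]) (use 1 sub in \<open>auto dest: less_le_trans\<close>)
qed

lemma dual_pairs_commute:
  assumes "dual_pairs n x U W s" "lin_closed U"
  shows "dual_pairs n x W U s"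
proof -
  obtain A B where 1: "\<forall>i<s. A i \<in> U \<and> B i \<in> W"
    "\<forall>i<s. \<forall>j<s. bracket_form n x (A i) (B j) = (if i = j then 1 else 0)"
    using assms unfolding dual_pairs_def by blast
  \<comment> \<open>The negatives of the \<open>A i\<close>, written as a combination that stays in \<open>U\<close>: exchanging the arguments changes the sign.\<close>
  let ?A = "\<lambda>i a b. A i a b + (-2) * A i a b"
  have "?A i \<in> U" if "i < s" for i
    using lin_closedD[OF assms(2), of "A i" "A i"] 1 that by blast
  moreover have "bracket_form n x (B i) (?A j) = (if i = j then 1 else 0)" if "i < s" "j < s" for i j
    using 1(2) that bracket_form_skew[of n x "B i" "A j"] by (subst bracket_form_add_right) auto
  ultimately show ?thesis
    unfolding dual_pairs_def using 1(1) by (intro exI[of _ B] exI[of _ ?A]) auto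
qed

text \<open>A linear condition lowers the rank by at most one: subtract multiples of one matrix on which the
  functional does not vanish from all the others, and discard it together with its partner.\<close>

lemma dual_pairs_functional:
  assumes dp: "dual_pairs n x U W (Suc s)" and lin: "lin_closed U"
    and f: "\<And>A B c. f (\<lambda>a b. A a b + c * B a b) = f A + c * f B"
  shows "dual_pairs n x {A \<in> U. f A = 0} W s"
proof -
  obtain A B where 1: "\<And>i. i < Suc s \<Longrightarrow> A i \<in> U" "\<And>i. i < Suc s \<Longrightarrow> B i \<in> W"
    "\<And>i j. i < Suc s \<Longrightarrow> j < Suc s \<Longrightarrow> bracket_form n x (A i) (B j) = (if i = j then 1 else 0)"
    using dp unfolding dual_pairs_def by blast
  show ?thesis
  proof (cases "\<forall>i<Suc s. f (A i) = 0")
    case True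
    then show ?thesis unfolding dual_pairs_def using 1
      by (intro exI[of _ A] exI[of _ B]) auto
  next
    case False
    then obtain i0 where i0: "i0 < Suc s" "f (A i0) \<noteq> 0" by blast
    define p where "p j = (if j < i0 then j else Suc j)" for j
    define A' where "A' j = (\<lambda>a b. A (p j) a b + (- f (A (p j)) / f (A i0)) * A i0 a b)" for j
    have p: "p j < Suc s" "p j \<noteq> i0" if "j < s" for j
      using that i0 by (auto simp: p_def)
    have pinj: "p i = p j \<longleftrightarrow> i = j" for i j
      by (auto simp: p_def)
    have "A' j \<in> U" if "j < s" for j
      unfolding A'_def using lin_closedD[OF lin] 1(1) p(1)[OF that] i0(1) by blast
    moreover have "f (A' j) = 0" for j
      unfolding A'_def using i0 by (subst f) simp
    moreover have "bracket_form n x (A' i) (B (p j)) = (if i = j then 1 else 0)"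
      if "i < s" "j < s" for i j
      unfolding A'_def using 1(3)[OF p(1)[OF that(1)] p(1)[OF that(2)]]
        1(3)[OF i0(1) p(1)[OF that(2)]] p(2)[OF that(2)] pinj
      by (subst bracket_form_add_left) auto
    ultimately show ?thesis unfolding dual_pairs_def using 1(2) p(1)
      by (intro exI[of _ A'] exI[of _ "\<lambda>j. B (p j)"]) auto
  qed
qed

lemma dual_pairs_functionals:
  assumes dp: "dual_pairs n x U W s" and lin: "lin_closed U" and fin: "finite I"
    and f: "\<And>i A B c. i \<in> I \<Longrightarrow> f i (\<lambda>a b. A a b + c * B a b) = f i A + c * f i B"
  shows "dual_pairs n x {A \<in> U. \<forall>i\<in>I. f i A = 0} W (s - card I)"
  using fin f
proof (induction I rule: finite_induct)
  case empty
  then show ?case using dp by simp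
next
  case (insert i I)
  let ?U = "{A \<in> U. \<forall>i\<in>I. f i A = 0}"
  have IH: "dual_pairs n x ?U W (s - card I)"
    using insert by simp
  have l: "lin_closed ?U"
    using lin insert.prems by (auto simp: lin_closed_def)
  show ?case
  proof (cases "s - card I")
    case 0
    then have "s - card (insert i I) = 0" using insert by simp
    then show ?thesis by simp
  next
    case (Suc s')
    then have "dual_pairs n x {A \<in> ?U. f i A = 0} W s'"
      using IH insert.prems by (intro dual_pairs_functional[OF _ l]) auto
    moreover have "{A \<in> ?U. f i A = 0} = {A \<in> U. \<forall>i\<in>insert i I. f i A = 0}" by auto
    moreover have "s' = s - card (insert i I)" using Suc insert by simp
    ultimately show ?thesis by simp
  qed
qed

text \<open>A vector \<open>e\<close> with a partner \<open>f\<close> contributes two to the rank beyond the orthogonal complement of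
  \<open>e\<close>. The given dual system of the complement is made orthogonal to \<open>f\<close> by adding multiples of \<open>e\<close>,
  which does not change its mutual pairings.\<close>

lemma dual_pairs_add_hyperbolic:
  assumes dp: "dual_pairs n x {A \<in> U. bracket_form n x e A = 0} {A \<in> U. bracket_form n x e A = 0} s"
    and lin: "lin_closed U" and ef: "e \<in> U" "f \<in> U" "bracket_form n x e f = 1"
    and e0: "bracket_form n x e e = 0"
  shows "dual_pairs n x U U (s + 2)"
proof -
  let ?F = "bracket_form n x"
  obtain A B where 1: "\<And>i. i < s \<Longrightarrow> A i \<in> U \<and> ?F e (A i) = 0" "\<And>i. i < s \<Longrightarrow> B i \<in> U \<and> ?F e (B i) = 0"
    "\<And>i j. i < s \<Longrightarrow> j < s \<Longrightarrow> ?F (A i) (B j) = (if i = j then 1 else 0)"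
    using dp unfolding dual_pairs_def by blast
  define A' where "A' i = (if i < s then (\<lambda>a b. A i a b + (- ?F (A i) f) * e a b)
      else if i = s then e else (\<lambda>a b. f a b + (- ?F f f) * e a b))" for i
  define B' where "B' i = (if i < s then (\<lambda>a b. B i a b + ?F f (B i) * e a b)
      else if i = s then f else (\<lambda>a b. - e a b))" for i
  have m: "(\<lambda>a b. - e a b) \<in> U"
    using lin_closedD[OF lin ef(1) ef(1), of "-2"] by simp
  have ff: "?F f e = -1" using bracket_form_skew[of n x f e] ef by simp
  have Ae: "?F (A i) e = 0" "?F (B i) e = 0" if "i < s" for i
    using bracket_form_skew[of n x "A i" e] bracket_form_skew[of n x "B i" e] 1(1)[OF that] 1(2)[OF that] by auto
  have Fme: "?F C (\<lambda>a b. - e a b) = - ?F C e" for C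
    using bracket_form_add_right[of n x C e "-2" e] by simp
  have "A' i \<in> U" "B' i \<in> U" if "i < s + 2" for i
  proof -
    consider "i < s" | "i = s" | "i > s" by linarith
    then have "A' i \<in> U \<and> B' i \<in> U"
    proof cases
      case 1
      then show ?thesis
        using lin_closedD[OF lin _ ef(1), of "A i"] lin_closedD[OF lin _ ef(1), of "B i"] 
          \<open>\<And>i. i < s \<Longrightarrow> A i \<in> U \<and> ?F e (A i) = 0\<close> \<open>\<And>i. i < s \<Longrightarrow> B i \<in> U \<and> ?F e (B i) = 0\<close>
        unfolding A'_def B'_def by presburger
    next
      case 2
      then show ?thesis using ef by (simp add: A'_def B'_def)
    next
      case 3
      then show ?thesis
        using lin_closedD[OF lin ef(2) ef(1)] m by (auto simp only: A'_def B'_def split: if_split)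
    qed
    then show "A' i \<in> U" "B' i \<in> U" by auto
  qed
  moreover have "?F (A' i) (B' j) = (if i = j then 1 else 0)" if "i < s + 2" "j < s + 2" for i j
  proof -
    have a: "?F (A' i) C = (if i < s then ?F (A i) C - ?F (A i) f * ?F e C
      else if i = s then ?F e C else ?F f C - ?F f f * ?F e C)" for C i
      unfolding A'_def by (simp add: bracket_form_diff_left)
    have b: "?F C (B' j) = (if j < s then ?F C (B j) + ?F f (B j) * ?F C e
      else if j = s then ?F C f else - ?F C e)" for C j
      unfolding B'_def by (simp add: bracket_form_add_right Fme)
    have eB: "j < s \<Longrightarrow> ?F e (B j) = 0" using 1(2) by blast
    consider "i < s" | "i = s" | "i = Suc s" using \<open>i < s + 2\<close> by linarith
    then show ?thesis
    proof cases
      case 1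
      note i = this
      consider "j < s" | "j = s" | "j = Suc s" using \<open>j < s + 2\<close> by linarith
      then show ?thesis by cases (use i in \<open>simp_all add: a b eB e0 ef Ae \<open>\<And>i j. i < s \<Longrightarrow> j < s \<Longrightarrow> ?F (A i) (B j) = (if i = j then 1 else 0)\<close>\<close>)
    next
      case 2
      consider "j < s" | "j = s" | "j = Suc s" using \<open>j < s + 2\<close> by linarith
      then show ?thesis by cases (use 2 in \<open>simp_all add: a b eB e0 ef\<close>)
    next
      case 3
      consider "j < s" | "j = s" | "j = Suc s" using \<open>j < s + 2\<close> by linarith
      then show ?thesis by cases (use 3 in \<open>simp_all add: a b eB e0 ef ff\<close>)
    qed
  qed
  ultimately show ?thesis unfolding dual_pairs_def by blast
qed

lemma dual_pairs_add_hyperbolics: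
  assumes fin: "finite I" and lin: "lin_closed U"
    and e: "\<And>i. i \<in> I \<Longrightarrow> e i \<in> U" and f: "\<And>i. i \<in> I \<Longrightarrow> f i \<in> U"
    and ee: "\<And>i j. i \<in> I \<Longrightarrow> j \<in> I \<Longrightarrow> bracket_form n x (e i) (e j) = 0"
    and ef: "\<And>i j. i \<in> I \<Longrightarrow> j \<in> I \<Longrightarrow> bracket_form n x (e i) (f j) = (if i = j then 1 else 0)"
    and dp: "dual_pairs n x {A \<in> U. \<forall>i\<in>I. bracket_form n x (e i) A = 0}
                {A \<in> U. \<forall>i\<in>I. bracket_form n x (e i) A = 0} s"
  shows "dual_pairs n x U U (s + 2 * card I)"
  using fin lin e f ee ef dp
proof (induction I arbitrary: U s rule: finite_induct)
  case empty
  then show ?case by simp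
next
  case (insert j I)
  let ?F = "bracket_form n x"
  let ?V = "{A \<in> U. \<forall>i\<in>I. ?F (e i) A = 0}"
  have V: "lin_closed ?V"
    using insert.prems(1) by (auto simp: lin_closed_def bracket_form_add_right)
  have eq: "{A \<in> ?V. ?F (e j) A = 0} = {A \<in> U. \<forall>i\<in>insert j I. ?F (e i) A = 0}" by auto
  have "dual_pairs n x {A \<in> ?V. ?F (e j) A = 0} {A \<in> ?V. ?F (e j) A = 0} s"
    using insert.prems(6) unfolding eq .
  then have "dual_pairs n x ?V ?V (s + 2)"
    by (rule dual_pairs_add_hyperbolic[where f = "f j"])
       (use insert.prems insert.hyps V in auto)
  then have "dual_pairs n x U U (s + 2 + 2 * card I)"
    using insert.prems by (intro insert.IH) auto
  then show ?case using insert.hyps by (simp add: algebra_simps)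
qed

section \<open>Splitting off one row\<close>

text \<open>The labels \<open>\<sigma>\<close> describe which positions of a strictly upper triangular matrix are allowed. For
  \<open>m = 1\<close> and \<open>\<sigma> = id\<close> this is the full Lie algebra of the unitriangular group.\<close>

definition pattern_algebra :: "nat \<Rightarrow> nat \<Rightarrow> (nat \<Rightarrow> nat) \<Rightarrow> (nat \<Rightarrow> nat \<Rightarrow> 'a::field) set" where
  "pattern_algebra n m \<sigma> = {A. \<forall>a b. A a b \<noteq> 0 \<longrightarrow> m \<le> a \<and> a < b \<and> b \<le> n \<and> \<sigma> a < \<sigma> b}"

text \<open>The vector \<open>y\<close> is column \<open>m\<close> of a functional, restricted to the rows that row \<open>m\<close> of the pattern
  algebra pairs with. Row \<open>m\<close> is an abelian ideal, and the matrices collected here stabilise the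
  restriction of the functional to that ideal.\<close>

definition column_stabilizer ::
    "nat \<Rightarrow> nat \<Rightarrow> (nat \<Rightarrow> nat) \<Rightarrow> (nat \<Rightarrow> 'a) \<Rightarrow> (nat \<Rightarrow> nat \<Rightarrow> 'a::field) set" where
  "column_stabilizer n m \<sigma> y = {A \<in> pattern_algebra n (Suc m) \<sigma>.
      \<forall>i. m < i \<longrightarrow> \<sigma> m < \<sigma> i \<longrightarrow> (\<Sum>b\<in>{1..n}. A i b * y b) = 0}"

lemma pattern_algebraD:
  "A \<in> pattern_algebra n m \<sigma> \<Longrightarrow> A a b \<noteq> 0 \<Longrightarrow> m \<le> a \<and> a < b \<and> b \<le> n \<and> \<sigma> a < \<sigma> b"
  by (simp add: pattern_algebra_def)

lemma lin_closed_pattern_algebra: "lin_closed (pattern_algebra n m \<sigma>)"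
  unfolding lin_closed_def
proof (intro ballI allI)
  fix A B :: "nat \<Rightarrow> nat \<Rightarrow> 'a" and c
  assume AB: "A \<in> pattern_algebra n m \<sigma>" "B \<in> pattern_algebra n m \<sigma>"
  show "(\<lambda>a b. A a b + c * B a b) \<in> pattern_algebra n m \<sigma>"
    unfolding pattern_algebra_def
  proof (intro CollectI allI impI)
    fix a b assume "A a b + c * B a b \<noteq> 0"
    then have "A a b \<noteq> 0 \<or> B a b \<noteq> 0" by auto
    then show "m \<le> a \<and> a < b \<and> b \<le> n \<and> \<sigma> a < \<sigma> b"
      using AB pattern_algebraD by blast
  qed
qed

text \<open>The situation at a cross \<open>(k, m)\<close> of the diagram: \<open>k\<close> is the lowest row in which the column \<open>y\<close> does
  not vanish, and the rows below \<open>k\<close> whose label exceeds that of \<open>m\<close> have greater labels than all rows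
  between \<open>m\<close> and themselves.\<close>

locale swap_step =
  fixes n m k :: nat and \<sigma> :: "nat \<Rightarrow> nat" and y :: "nat \<Rightarrow> 'a::field"
  assumes m: "1 \<le> m" "m < k" "k \<le> n" and inj: "inj_on \<sigma> {m..n}" and less: "\<sigma> m < \<sigma> k"
    and yk: "y k \<noteq> 0" and supp: "\<And>b. y b \<noteq> 0 \<Longrightarrow> m < b \<and> b \<le> k \<and> \<sigma> m < \<sigma> b"
    and above: "\<And>a b. k < b \<Longrightarrow> b \<le> n \<Longrightarrow> \<sigma> m < \<sigma> b \<Longrightarrow> m < a \<Longrightarrow> a < b \<Longrightarrow> \<sigma> a < \<sigma> b"
begin

definition \<nu> where "\<nu> b = (if b = k then 0 else y b / y k)"
definition \<sigma>' where "\<sigma>' = \<sigma>(m := \<sigma> k, k := \<sigma> m)"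
definition y' where "y' b = (if \<sigma> k < \<sigma> b then y b else 0)"

lemma \<nu>_supp: "\<nu> b \<noteq> 0 \<Longrightarrow> m < b \<and> b < k \<and> \<sigma> m < \<sigma> b"
  using supp[of b] by (auto simp: \<nu>_def split: if_splits)

lemma \<nu>_k [simp]: "\<nu> k = 0" by (simp add: \<nu>_def)

lemma k_range [simp]: "k \<in> {1..n}" using m by auto

lemma \<sigma>'_simps [simp]: "\<sigma>' m = \<sigma> k" "\<sigma>' k = \<sigma> m" "b \<noteq> m \<Longrightarrow> b \<noteq> k \<Longrightarrow> \<sigma>' b = \<sigma> b"
  using m by (auto simp: \<sigma>'_def)

lemma conj_entry:
  assumes A: "A \<in> pattern_algebra n (Suc m) \<tau>" and \<mu>: "\<mu> = \<nu> \<or> \<mu> = (\<lambda>a. - \<nu> a)"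
  shows "elem_conj n k \<mu> A a b = A a b + (if b = k then \<Sum>l\<in>{1..n}. A a l * \<mu> l else 0) - \<mu> a * A k b"
proof -
  have Akl: "A k l * \<mu> l = 0" for l
    using pattern_algebraD[OF A, of k l] \<nu>_supp[of l] \<mu> by (cases "A k l = 0"; cases "\<nu> l = 0") auto
  have out: "A i j = 0" if "i \<notin> {1..n} \<or> j \<notin> {1..n}" for i j
    using pattern_algebraD[OF A, of i j] that m by fastforce
  have \<mu>0: "\<mu> a = 0" if "a \<notin> {1..n}" for a
    using \<nu>_supp[of a] that m \<mu> by fastforce
  show ?thesis
  proof (cases "a \<in> {1..n} \<and> b \<in> {1..n}")
    case True
    then show ?thesis
      using elem_conj_entry[of a n b k \<mu> A, OF _ _ k_range] by (simp only: Akl) simp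
  next
    case False
    then have "elem_conj n k \<mu> A a b = 0"
    proof (cases "a \<in> {1..n}")
      case True
      then have b: "b \<notin> {1..n}" using False by blast
      then have "mprod n A (elem_mat k \<mu>) i b = 0" for i
        using k_range by (auto simp: mprod_def elem_mat_def intro!: sum.neutral)
      then show ?thesis by (simp add: elem_conj_def mprod_def)
    next
      case False
      then have "elem_mat k (\<lambda>a. - \<mu> a) a l = 0" if "l \<in> {1..n}" for l
        using that \<mu>0[OF False] by (auto simp: elem_mat_def)
      then show ?thesis by (auto simp: elem_conj_def mprod_def[of n "elem_mat _ _"] intro!: sum.neutral)
    qed
    moreover have "A a b + (if b = k then \<Sum>l\<in>{1..n}. A a l * \<mu> l else 0) - \<mu> a * A k b = 0"
      using False k_range out \<mu>0 by (auto intro!: sum.neutral)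
    ultimately show ?thesis by simp
  qed
qed

lemma y_eq: "y b = y k * ((if b = k then 1 else 0) + \<nu> b)"
  using yk by (simp add: \<nu>_def)

lemma sum_y: "(\<Sum>b\<in>{1..n}. A i b * y b) = y k * (A i k + (\<Sum>b\<in>{1..n}. A i b * \<nu> b))"
proof -
  have "(\<Sum>b\<in>{1..n}. A i b * y b) = y k * (\<Sum>b\<in>{1..n}. (if b = k then A i b else 0) + A i b * \<nu> b)"
    unfolding sum_distrib_left by (rule sum.cong[OF refl], subst y_eq) (simp add: algebra_simps)
  then show ?thesis using k_range by (simp add: sum.distrib)
qed

text \<open>Conjugation replaces \<open>y\<close> by \<open>y k\<close> times the unit vector at \<open>k\<close>, and the conditions of the stabiliser
  say that column \<open>k\<close> of the conjugate vanishes in the rows whose label exceeds that of \<open>m\<close>. For labels between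
  those of \<open>m\<close> and \<open>k\<close> this is the change of the pattern by the transposition. In the rows with
  greater labels the position in column \<open>k\<close> is excluded by both patterns; there the conditions persist, with the
  truncated vector \<open>y'\<close>.\<close>

lemma conj_column_stabilizer:
  assumes A: "A \<in> column_stabilizer n m \<sigma> y"
  shows "elem_conj n k \<nu> A \<in> column_stabilizer n m \<sigma>' y'"
proof -
  have P: "A \<in> pattern_algebra n (Suc m) \<sigma>" and
    C: "\<And>i. m < i \<Longrightarrow> \<sigma> m < \<sigma> i \<Longrightarrow> (\<Sum>b\<in>{1..n}. A i b * y b) = 0"
    using A by (auto simp: column_stabilizer_def)
  note E = conj_entry[OF P disjI1[OF refl]]
  have col: "elem_conj n k \<nu> A a k = (\<Sum>b\<in>{1..n}. A a b * y b) / y k" for a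
    using E[of a k] sum_y[of A a] pattern_algebraD[OF P, of k k] yk by auto
  have "Suc m \<le> a \<and> a < b \<and> b \<le> n \<and> \<sigma>' a < \<sigma>' b" if nz: "elem_conj n k \<nu> A a b \<noteq> 0" for a b
  proof (cases "b = k")
    case True
    then have s: "(\<Sum>b\<in>{1..n}. A a b * y b) \<noteq> 0" using nz col by auto
    from s obtain l where l: "A a l \<noteq> 0" "y l \<noteq> 0"
      by (rule sum.not_neutral_contains_not_neutral) auto
    then have "Suc m \<le> a" "a < l" "\<sigma> a < \<sigma> l" "l \<le> k" using pattern_algebraD[OF P l(1)] supp[OF l(2)] by auto
    then have 1: "Suc m \<le> a" "a < k" by auto
    have "\<not> \<sigma> m < \<sigma> a" using C[of a] s 1 by auto
    moreover have "\<sigma> m \<noteq> \<sigma> a" using inj_onD[OF inj, of m a] 1 m by auto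
    ultimately show ?thesis using 1 True m by simp
  next
    case False
    then have "A a b \<noteq> 0 \<or> \<nu> a * A k b \<noteq> 0" using nz E[of a b] by auto
    then show ?thesis
    proof
      assume "A a b \<noteq> 0"
      then show ?thesis using pattern_algebraD[OF P, of a b] False less m
        by (cases "a = k") auto
    next
      assume "\<nu> a * A k b \<noteq> 0"
      then have a: "m < a" "a < k" "\<sigma> m < \<sigma> a" and b: "k < b" "b \<le> n" "\<sigma> k < \<sigma> b"
        using \<nu>_supp[of a] pattern_algebraD[OF P, of k b] by auto
      have "\<sigma> a < \<sigma> b" using above[of b a] a b less by auto
      then show ?thesis using a b m by auto
    qed
  qed
  then have "elem_conj n k \<nu> A \<in> pattern_algebra n (Suc m) \<sigma>'" by (simp add: pattern_algebra_def)
  moreover have "(\<Sum>b\<in>{1..n}. elem_conj n k \<nu> A i b * y' b) = 0" if i: "m < i" "\<sigma>' m < \<sigma>' i" for i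
  proof -
    have ik: "i \<noteq> k" using i less by auto
    then have si: "\<sigma> k < \<sigma> i" using i by simp
    have "elem_conj n k \<nu> A i b * y' b = A i b * y b" for b
    proof (cases "y' b = 0")
      case True
      then show ?thesis using pattern_algebraD[OF P, of i b] si by (auto simp: y'_def split: if_splits)
    next
      case False
      then have b: "\<sigma> k < \<sigma> b" "y b \<noteq> 0" "y' b = y b" by (auto simp: y'_def split: if_splits)
      then have "b \<noteq> k" "b \<le> k" using supp by auto
      then have "A k b = 0" using pattern_algebraD[OF P, of k b] by auto
      then show ?thesis using E[of i b] \<open>b \<noteq> k\<close> b by simp
    qed
    then have "(\<Sum>b\<in>{1..n}. elem_conj n k \<nu> A i b * y' b) = (\<Sum>b\<in>{1..n}. A i b * y b)" by simp
    then show ?thesis using C[of i] i(1) si less by simp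
  qed
  ultimately show ?thesis by (auto simp: column_stabilizer_def)
qed

text \<open>The converse inclusion: both stabilisers are isomorphic, so that ranks can be transferred in both
  directions.\<close>

lemma inv_conj_column_stabilizer:
  assumes A: "A \<in> column_stabilizer n m \<sigma>' y'"
  shows "elem_conj n k (\<lambda>a. - \<nu> a) A \<in> column_stabilizer n m \<sigma> y"
proof -
  have P: "A \<in> pattern_algebra n (Suc m) \<sigma>'" and
    C: "\<And>i. m < i \<Longrightarrow> \<sigma> k < \<sigma>' i \<Longrightarrow> (\<Sum>b\<in>{1..n}. A i b * y' b) = 0"
    using A by (auto simp: column_stabilizer_def)
  note E = conj_entry[OF P disjI2[OF refl]]
  define B where "B = elem_conj n k (\<lambda>a. - \<nu> a) A"
  have row: "\<sigma> k < \<sigma> b \<and> k < b \<and> b \<le> n \<and> (\<forall>a. m < a \<longrightarrow> a < b \<longrightarrow> \<sigma> a < \<sigma> b)" if nz: "A k b \<noteq> 0" for b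
  proof -
    have b: "k < b" "b \<le> n" "\<sigma> m < \<sigma> b" using pattern_algebraD[OF P nz] m by auto
    then show ?thesis using above[OF b] m by auto
  qed
  have "Suc m \<le> a \<and> a < b \<and> b \<le> n \<and> \<sigma> a < \<sigma> b" if nz: "B a b \<noteq> 0" for a b
  proof -
    have "A a b \<noteq> 0 \<or> (b = k \<and> (\<Sum>l\<in>{1..n}. A a l * \<nu> l) \<noteq> 0) \<or> \<nu> a * A k b \<noteq> 0"
      using nz E[of a b] unfolding B_def by (auto simp: sum_negf split: if_splits)
    then consider "A a b \<noteq> 0" | "b = k" "(\<Sum>l\<in>{1..n}. A a l * \<nu> l) \<noteq> 0" | "\<nu> a * A k b \<noteq> 0" by blast
    then show ?thesis
    proof cases
      case 1
      have p: "Suc m \<le> a" "a < b" "b \<le> n" "\<sigma>' a < \<sigma>' b" using pattern_algebraD[OF P 1] by auto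
      show ?thesis
      proof (cases "a = k")
        case True
        then show ?thesis using row[of b] 1 p by auto
      next
        case False
        show ?thesis
        proof (cases "b = k")
          case True
          then show ?thesis using p False less by auto
        qed (use p False in auto)
      qed
    next
      case 2
      from 2(2) obtain l where l: "A a l \<noteq> 0" "\<nu> l \<noteq> 0"
        by (rule sum.not_neutral_contains_not_neutral) auto
      then have pl: "Suc m \<le> a" "a < l" "\<sigma>' a < \<sigma>' l" "m < l" "l < k" 
        using pattern_algebraD[OF P l(1)] \<nu>_supp[OF l(2)] by auto
      have "\<not> \<sigma> k < \<sigma> a"
      proof
        assume s: "\<sigma> k < \<sigma> a"
        have "A a l * \<nu> l = A a l * y' l / y k" for l
        proof (cases "A a l = 0 \<or> \<nu> l = 0")
          case True
          then show ?thesis by (auto simp: \<nu>_def y'_def split: if_splits)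
        next
          case False
          then have "\<sigma>' a < \<sigma>' l" "l \<noteq> k" "l \<noteq> m" "\<sigma>' a = \<sigma> a"
            using pattern_algebraD[OF P, of a l] \<nu>_supp[of l] pl by auto
          then show ?thesis using s by (simp add: \<nu>_def y'_def)
        qed
        then have "(\<Sum>l\<in>{1..n}. A a l * \<nu> l) = (\<Sum>l\<in>{1..n}. A a l * y' l) / y k"
          by (simp add: sum_divide_distrib)
        then show False using C[of a] s 2 pl by simp
      qed
      moreover have "\<sigma> a \<noteq> \<sigma> k" using inj_onD[OF inj, of a k] pl m by auto
      ultimately show ?thesis using 2 pl m by auto
    next
      case 3
      then have "m < a" "a < k" "A k b \<noteq> 0" using \<nu>_supp[of a] by auto
      then show ?thesis using row[of b] m by auto
    qed
  qed
  then have BP: "B \<in> pattern_algebra n (Suc m) \<sigma>" by (simp add: pattern_algebra_def)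
  moreover have "(\<Sum>b\<in>{1..n}. B i b * y b) = 0" if i: "m < i" "\<sigma> m < \<sigma> i" for i
  proof -
    have kk: "A k k = 0"
      using pattern_algebraD[OF P, of k k] by auto
    have kl: "A k l * \<nu> l = 0" for l
      using pattern_algebraD[OF P, of k l] \<nu>_supp[of l] by (cases "A k l = 0"; cases "\<nu> l = 0") auto
    have "(\<Sum>b\<in>{1..n}. B i b * \<nu> b) = (\<Sum>b\<in>{1..n}. A i b * \<nu> b)"
    proof (rule sum.cong[OF refl])
      fix b
      show "B i b * \<nu> b = A i b * \<nu> b"
        using E[of i b] kl[of b] unfolding B_def by (cases "b = k") (auto simp: algebra_simps)
    qed
    moreover have "B i k = A i k - (\<Sum>b\<in>{1..n}. A i b * \<nu> b)"
      using E[of i k] kk unfolding B_def by (simp add: sum_negf)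
    ultimately have "(\<Sum>b\<in>{1..n}. B i b * y b) = y k * A i k"
      by (subst sum_y) simp
    moreover have "A i k = 0" using pattern_algebraD[OF P, of i k] i m by (cases "i = k") auto
    ultimately show ?thesis by simp
  qed
  ultimately show ?thesis unfolding B_def by (auto simp: column_stabilizer_def)
qed

lemma dual_pairs_conj:
  assumes "dual_pairs n x (column_stabilizer n m \<sigma> y) (column_stabilizer n m \<sigma> y) s"
  shows "dual_pairs n (elem_conj n k \<nu> x) (column_stabilizer n m \<sigma>' y') (column_stabilizer n m \<sigma>' y') s"
proof -
  obtain A B where 1: "\<And>i. i < s \<Longrightarrow> A i \<in> column_stabilizer n m \<sigma> y"
    "\<And>i. i < s \<Longrightarrow> B i \<in> column_stabilizer n m \<sigma> y"
    "\<And>i j. i < s \<Longrightarrow> j < s \<Longrightarrow> bracket_form n x (A i) (B j) = (if i = j then 1 else 0)"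
    using assms by (rule dual_pairsE) blast
  show ?thesis
    by (rule dual_pairsI[of _ "\<lambda>i. elem_conj n k \<nu> (A i)" _ "\<lambda>i. elem_conj n k \<nu> (B i)"])
       (use 1 conj_column_stabilizer in \<open>auto simp: bracket_form_elem_conj[of \<nu> k n, OF \<nu>_k k_range]\<close>)
qed

lemma dual_pairs_inv_conj:
  assumes "dual_pairs n x (column_stabilizer n m \<sigma>' y') (column_stabilizer n m \<sigma>' y') s"
  shows "dual_pairs n (elem_conj n k (\<lambda>a. - \<nu> a) x) (column_stabilizer n m \<sigma> y) (column_stabilizer n m \<sigma> y) s"
proof -
  obtain A B where 1: "\<And>i. i < s \<Longrightarrow> A i \<in> column_stabilizer n m \<sigma>' y'"
    "\<And>i. i < s \<Longrightarrow> B i \<in> column_stabilizer n m \<sigma>' y'"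
    "\<And>i j. i < s \<Longrightarrow> j < s \<Longrightarrow> bracket_form n x (A i) (B j) = (if i = j then 1 else 0)"
    using assms by (rule dual_pairsE) blast
  show ?thesis
    by (rule dual_pairsI[of _ "\<lambda>i. elem_conj n k (\<lambda>a. - \<nu> a) (A i)" _ "\<lambda>i. elem_conj n k (\<lambda>a. - \<nu> a) (B i)"])
       (use 1 inv_conj_column_stabilizer in \<open>auto simp: bracket_form_elem_conj[of "\<lambda>a. - \<nu> a" k n, OF _ k_range]\<close>)
qed

end

section \<open>The diagram as a sequence of transpositions\<close>

locale basic_roots =
  fixes n :: nat and D :: "root set"
  assumes basic: "basic_subset n D"
begin

lemma D_pos: "(a, b) \<in> D \<Longrightarrow> n \<ge> a \<and> a > b \<and> b \<ge> 1"
  using basic by (auto simp: basic_subset_def pos_roots_def)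

lemma D_row: "(a, b) \<in> D \<Longrightarrow> (a, c) \<in> D \<Longrightarrow> b = c"
  using basic by (fastforce simp: basic_subset_def)

lemma D_col: "(a, b) \<in> D \<Longrightarrow> (c, b) \<in> D \<Longrightarrow> a = c"
  using basic by (fastforce simp: basic_subset_def)

lemma singular_iff:
  "(a, b) \<in> singular_roots n D \<longleftrightarrow> n \<ge> a \<and> a > b \<and> b \<ge> 1 \<and> ((\<exists>l<b. (a, l) \<in> D) \<or> (\<exists>c>a. (c, b) \<in> D))"
proof
  assume "(a, b) \<in> singular_roots n D"
  then show "n \<ge> a \<and> a > b \<and> b \<ge> 1 \<and> ((\<exists>l<b. (a, l) \<in> D) \<or> (\<exists>c>a. (c, b) \<in> D))"
    by (auto simp: singular_roots_def pos_roots_def root_sum_def doubleton_eq_iff)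
next
  assume *: "n \<ge> a \<and> a > b \<and> b \<ge> 1 \<and> ((\<exists>l<b. (a, l) \<in> D) \<or> (\<exists>c>a. (c, b) \<in> D))"
  then have ab: "(a, b) \<in> pos_roots n" by (auto simp: pos_roots_def)
  from * consider l where "l < b" "(a, l) \<in> D" | c where "c > a" "(c, b) \<in> D" by blast
  then obtain \<beta> \<gamma> where "\<beta> \<in> pos_roots n" "\<gamma> \<in> D" "root_sum \<gamma> (a, b) \<beta>"
  proof cases
    case 1
    have "root_sum (a, l) (a, b) (b, l)" "(b, l) \<in> pos_roots n"
      using 1 * D_pos[OF 1(2)] by (auto simp: root_sum_def pos_roots_def)
    then show ?thesis using that 1 by blast
  next
    case 2
    have "root_sum (c, b) (a, b) (c, a)" "(c, a) \<in> pos_roots n"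
      using 2 * D_pos[OF 2(2)] by (auto simp: root_sum_def pos_roots_def)
    then show ?thesis using that 2 by blast
  qed
  then show "(a, b) \<in> singular_roots n D" using ab by (auto simp: singular_roots_def)
qed

lemma M_iff:
  "(a, b) \<in> M_roots n D \<longleftrightarrow> n \<ge> a \<and> a > b \<and> b \<ge> 1 \<and> (\<forall>l\<le>b. (a, l) \<notin> D) \<and> (\<forall>c\<ge>a. (c, b) \<notin> D)"
  unfolding M_roots_def regular_roots_def Diff_iff singular_iff
  by (auto simp: pos_roots_def le_less)

text \<open>The rows of the empty places in column \<open>m\<close>, once all smaller columns are full. In the labels \<open>\<sigma>\<close> the
  previous steps of the diagram are recorded, see \<open>open_places_swap\<close>.\<close>

definition live :: "nat \<Rightarrow> (nat \<Rightarrow> nat) \<Rightarrow> nat set" where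
  "live m \<sigma> = {i. m < i \<and> i \<le> n \<and> \<sigma> m < \<sigma> i \<and> (i, m) \<notin> M_roots n D}"

text \<open>A live row \<open>i\<close> is dominated by a lower live row \<open>b\<close> of greater label if the position \<open>(i, b)\<close> belongs
  to the pattern algebra. The matrix unit at \<open>(i, b)\<close> is then a partner for the matrix unit at \<open>(m, i)\<close>,
  whence dominated rows contribute to the rank.\<close>

definition dominated :: "nat \<Rightarrow> (nat \<Rightarrow> nat) \<Rightarrow> nat set" where
  "dominated m \<sigma> = {i \<in> live m \<sigma>. \<exists>b\<in>live m \<sigma>. i < b \<and> \<sigma> i < \<sigma> b}"

text \<open>One run of the diagram from column \<open>m\<close> on; the last argument counts the symbols \<open>+\<close>.\<close>

inductive swaps :: "nat \<Rightarrow> (nat \<Rightarrow> nat) \<Rightarrow> nat \<Rightarrow> bool" where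
  exhausted: "n \<le> m \<Longrightarrow> swaps m \<sigma> 0"
| next_column: "m < n \<Longrightarrow> live m \<sigma> = {} \<Longrightarrow> swaps (Suc m) \<sigma> q \<Longrightarrow> swaps m \<sigma> q"
| transpose: "live m \<sigma> \<noteq> {} \<Longrightarrow> k = Max (live m \<sigma>) \<Longrightarrow> swaps m (\<sigma>(m := \<sigma> k, k := \<sigma> m)) q \<Longrightarrow>
    swaps m \<sigma> (q + card {j \<in> live m \<sigma>. \<sigma> j < \<sigma> k})"

text \<open>The set \<open>Pd\<close> consists of the pending rows, in which no root of \<open>D\<close> occurs before column \<open>m\<close>. If
  column \<open>m\<close> contains a root of \<open>D\<close> in a live row, the column is open until the cross at that root has been
  placed; the row is then no longer pending, and no live rows remain.\<close>

definition open_column :: "nat \<Rightarrow> (nat \<Rightarrow> nat) \<Rightarrow> nat set \<Rightarrow> bool" where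
  "open_column m \<sigma> Pd \<longleftrightarrow> Pd = {a. m < a \<and> a \<le> n \<and> (\<forall>l<m. (a, l) \<notin> D)} \<and> (\<forall>a\<in>Pd. \<sigma> m < \<sigma> a)"

definition closed_column :: "nat \<Rightarrow> (nat \<Rightarrow> nat) \<Rightarrow> nat set \<Rightarrow> bool" where
  "closed_column m \<sigma> Pd \<longleftrightarrow> Pd = {a. m < a \<and> a \<le> n \<and> (\<forall>l\<le>m. (a, l) \<notin> D)} \<and> live m \<sigma> = {}"

text \<open>The labels of the pending rows increase from top to bottom and exceed the labels of all other rows
  below \<open>m\<close>. Since the dots of column \<open>m\<close> lie in pending rows (\<open>dot_in_Pd\<close>), this controls the position of the
  dots relative to the live rows.\<close>

definition invar :: "nat \<Rightarrow> (nat \<Rightarrow> nat) \<Rightarrow> nat set \<Rightarrow> bool" where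
  "invar m \<sigma> Pd \<longleftrightarrow> inj_on \<sigma> {m..n}
     \<and> (\<forall>a\<in>Pd. \<forall>b\<in>{m<..n}. b \<noteq> a \<longrightarrow> b < a \<or> b \<notin> Pd \<longrightarrow> \<sigma> b < \<sigma> a)
     \<and> (open_column m \<sigma> Pd \<or> closed_column m \<sigma> Pd)"

lemma finite_live: "finite (live m \<sigma>)"
  by (rule finite_subset[of _ "{..n}"]) (auto simp: live_def)

lemma finite_dominated: "finite (dominated m \<sigma>)"
  by (rule finite_subset[OF _ finite_live]) (auto simp: dominated_def)

lemma invar_Pd: "invar m \<sigma> Pd \<Longrightarrow> a \<in> Pd \<Longrightarrow> m < a \<and> a \<le> n"
  by (auto simp: invar_def open_column_def closed_column_def)

lemma invar_less:
  "invar m \<sigma> Pd \<Longrightarrow> a \<in> Pd \<Longrightarrow> m < b \<Longrightarrow> b \<le> n \<Longrightarrow> b \<noteq> a \<Longrightarrow> b < a \<or> b \<notin> Pd \<Longrightarrow> \<sigma> b < \<sigma> a"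
  by (auto simp: invar_def)

lemma dot_in_Pd: "invar m \<sigma> Pd \<Longrightarrow> m < b \<Longrightarrow> (b, m) \<in> M_roots n D \<Longrightarrow> b \<in> Pd"
  by (auto simp: invar_def open_column_def closed_column_def M_iff)

lemma not_live_in_Pd:
  "invar m \<sigma> Pd \<Longrightarrow> m < b \<Longrightarrow> b \<le> n \<Longrightarrow> \<sigma> m < \<sigma> b \<Longrightarrow> b \<notin> live m \<sigma> \<Longrightarrow> b \<in> Pd"
  using dot_in_Pd by (auto simp: live_def)

text \<open>A dot cannot occur in a row that is dominated by a live one: if row \<open>a\<close> has a dot, then both rows are
  pending, and the place \<open>(b, m)\<close> can only be without a dot because of a root of \<open>D\<close> in column \<open>m\<close> at or below
  row \<open>b\<close>. That root is below row \<open>a\<close> as well.\<close>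

lemma live_down_closed:
  assumes inv: "invar m \<sigma> Pd" and b: "b \<in> live m \<sigma>" and a: "m < a" "a < b" "\<sigma> m < \<sigma> a" "\<sigma> a < \<sigma> b"
  shows "a \<in> live m \<sigma>"
proof (rule ccontr)
  assume na: "a \<notin> live m \<sigma>"
  have bn: "b \<le> n" "m < b" using b by (auto simp: live_def)
  have aP: "a \<in> Pd" using not_live_in_Pd[OF inv a(1) _ a(3) na] a bn by auto
  then have bP: "b \<in> Pd" using invar_less[OF inv aP, of b] a bn by (cases "b \<in> Pd") auto
  have M: "(a, m) \<in> M_roots n D" using na a bn by (auto simp: live_def)
  have op: "open_column m \<sigma> Pd" using inv b by (auto simp: invar_def closed_column_def)
  have "\<exists>c\<ge>b. (c, m) \<in> D"
  proof -
    have "(b, m) \<notin> M_roots n D" using b by (auto simp: live_def)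
    moreover have "1 \<le> m" using M by (auto simp: M_iff)
    ultimately have "(\<exists>l\<le>m. (b, l) \<in> D) \<or> (\<exists>c\<ge>b. (c, m) \<in> D)" using bn by (auto simp: M_iff)
    then show ?thesis using op bP by (auto simp: open_column_def le_less)
  qed
  then show False using M a by (auto simp: M_iff)
qed

lemma Max_live:
  assumes "live m \<sigma> \<noteq> {}" "k = Max (live m \<sigma>)"
  shows "k \<in> live m \<sigma>" "j \<in> live m \<sigma> \<Longrightarrow> j \<le> k"
  using assms finite_live Max_in Max_ge by auto

lemma live_cases:
  assumes inv: "invar m \<sigma> Pd" and m: "1 \<le> m" and ne: "live m \<sigma> \<noteq> {}" and k: "k = Max (live m \<sigma>)" and kP: "k \<in> Pd"
  shows "(k, m) \<in> D"
proof -
  have op: "open_column m \<sigma> Pd" using inv ne by (auto simp: invar_def closed_column_def)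
  have kl: "k \<in> live m \<sigma>" using Max_live ne k by blast
  then have "(\<exists>l\<le>m. (k, l) \<in> D) \<or> (\<exists>c\<ge>k. (c, m) \<in> D)" using m by (auto simp: M_iff live_def)
  then consider "(k, m) \<in> D" | c where "c \<ge> k" "(c, m) \<in> D"
    using op kP by (auto simp: open_column_def le_less)
  then show ?thesis
  proof cases
    case 2
    have "c \<in> Pd" using op D_pos[OF 2(2)] D_row[OF 2(2)] by (fastforce simp: open_column_def)
    then have "c \<in> live m \<sigma>" using op D_pos[OF 2(2)] 2 by (auto simp: open_column_def live_def M_iff)
    then have "c \<le> k" using Max_live ne k by blast
    then show ?thesis using 2 by simp
  qed
qed

context
  fixes m k :: nat and \<sigma> :: "nat \<Rightarrow> nat" and Pd :: "nat set"
  assumes inv: "invar m \<sigma> Pd" and m: "1 \<le> m" and ne: "live m \<sigma> \<noteq> {}" and k: "k = Max (live m \<sigma>)"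
begin

abbreviation "\<sigma>' \<equiv> \<sigma>(m := \<sigma> k, k := \<sigma> m)"

lemma k_facts: "m < k" "k \<le> n" "\<sigma> m < \<sigma> k" "k \<in> live m \<sigma>"
  using Max_live(1)[OF ne k] by (auto simp: live_def)

lemma inj: "inj_on \<sigma> {m..n}" using inv by (simp add: invar_def)

lemma open_col: "open_column m \<sigma> Pd" using inv ne by (auto simp: invar_def closed_column_def)

lemma above_Max: "k < b \<Longrightarrow> b \<le> n \<Longrightarrow> \<sigma> m < \<sigma> b \<Longrightarrow> b \<in> Pd \<and> (b, m) \<in> M_roots n D"
  using not_live_in_Pd[OF inv, of b] Max_live(2)[OF ne k, of b] k_facts by (auto simp: live_def)

lemma above_less: "k < b \<Longrightarrow> b \<le> n \<Longrightarrow> \<sigma> m < \<sigma> b \<Longrightarrow> m < a \<Longrightarrow> a < b \<Longrightarrow> \<sigma> a < \<sigma> b"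
  using above_Max[of b] invar_less[OF inv, of b a] by auto

lemma live_swap: "live m \<sigma>' = {i \<in> live m \<sigma>. \<sigma> k < \<sigma> i}"
  using k_facts by (auto simp: live_def)

lemma dominated_swap: "dominated m \<sigma>' = {i \<in> dominated m \<sigma>. \<sigma> k < \<sigma> i}"
proof -
  have *: "\<sigma>' i = \<sigma> i" if "i \<in> live m \<sigma>" "\<sigma> k < \<sigma> i" for i
    using that by (auto simp: live_def)
  have "(\<exists>b\<in>live m \<sigma>'. i < b \<and> \<sigma>' i < \<sigma>' b) \<longleftrightarrow> (\<exists>b\<in>live m \<sigma>. i < b \<and> \<sigma> i < \<sigma> b)"
    if i: "i \<in> live m \<sigma>" "\<sigma> k < \<sigma> i" for i
  proof
    assume "\<exists>b\<in>live m \<sigma>'. i < b \<and> \<sigma>' i < \<sigma>' b"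
    then obtain b where "b \<in> live m \<sigma>" "\<sigma> k < \<sigma> b" "i < b" "\<sigma>' i < \<sigma>' b"
      unfolding live_swap by blast
    then show "\<exists>b\<in>live m \<sigma>. i < b \<and> \<sigma> i < \<sigma> b" using *[of b] *[of i] i by auto
  next
    assume "\<exists>b\<in>live m \<sigma>. i < b \<and> \<sigma> i < \<sigma> b"
    then obtain b where b: "b \<in> live m \<sigma>" "i < b" "\<sigma> i < \<sigma> b" by blast
    then have "\<sigma> k < \<sigma> b" using i by simp
    then show "\<exists>b\<in>live m \<sigma>'. i < b \<and> \<sigma>' i < \<sigma>' b"
      unfolding live_swap using b i *[of b] *[of i] by (intro bexI[of _ b]) (simp_all del: fun_upd_apply)
  qed
  then show ?thesis unfolding dominated_def live_swap by blast
qed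

lemma dominated_split:
  "dominated m \<sigma> = dominated m \<sigma>' \<union> {j \<in> live m \<sigma>. \<sigma> j < \<sigma> k}"
proof (intro Set.set_eqI iffI)
  fix j assume j: "j \<in> dominated m \<sigma>"
  then have jl: "j \<in> live m \<sigma>" by (simp add: dominated_def)
  have "j \<noteq> k" using j Max_live(2)[OF ne k] unfolding dominated_def by fastforce
  then have "\<sigma> j \<noteq> \<sigma> k" using inj_onD[OF inj, of j k] jl k_facts by (auto simp: live_def)
  then show "j \<in> dominated m \<sigma>' \<union> {j \<in> live m \<sigma>. \<sigma> j < \<sigma> k}"
    unfolding dominated_swap using j jl by (cases "\<sigma> j < \<sigma> k") simp_all
next
  fix j assume "j \<in> dominated m \<sigma>' \<union> {j \<in> live m \<sigma>. \<sigma> j < \<sigma> k}"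
  then consider "j \<in> dominated m \<sigma>" | "j \<in> live m \<sigma>" "\<sigma> j < \<sigma> k"
    unfolding dominated_swap by blast
  then show "j \<in> dominated m \<sigma>"
  proof cases
    case 2
    then have "j \<le> k" "j \<noteq> k" using Max_live(2)[OF ne k] by auto
    then show ?thesis unfolding dominated_def using 2 k_facts(4) by (intro CollectI conjI bexI[of _ k]) simp_all
  qed
qed

text \<open>The rows filled with \<open>+\<close> at a cross are exactly the dominated rows that cease to be so after the
  transposition.\<close>

lemma card_dominated:
  "card (dominated m \<sigma>) = card (dominated m \<sigma>') + card {j \<in> live m \<sigma>. \<sigma> j < \<sigma> k}"
proof -
  have "dominated m \<sigma>' \<inter> {j \<in> live m \<sigma>. \<sigma> j < \<sigma> k} = {}" unfolding dominated_swap by force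
  then have "card (dominated m \<sigma>' \<union> {j \<in> live m \<sigma>. \<sigma> j < \<sigma> k})
      = card (dominated m \<sigma>') + card {j \<in> live m \<sigma>. \<sigma> j < \<sigma> k}"
    using finite_dominated[of m \<sigma>'] finite_live[of m \<sigma>] by (intro card_Un_disjoint) simp_all
  then show ?thesis using dominated_split by simp
qed

lemma invar_swap: "invar m \<sigma>' (Pd - {k})"
proof -
  have 1: "inj_on \<sigma>' {m..n}"
  proof (rule inj_onI)
    fix a b assume "a \<in> {m..n}" "b \<in> {m..n}" "\<sigma>' a = \<sigma>' b"
    then show "a = b"
      using inj_onD[OF inj, of a b] inj_onD[OF inj, of a k] inj_onD[OF inj, of a m]
        inj_onD[OF inj, of b k] inj_onD[OF inj, of b m] k_facts
      by (auto split: if_splits)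
  qed
  have 2: "\<sigma>' b < \<sigma>' a" if a: "a \<in> Pd - {k}" and b: "b \<in> {m<..n}" "b \<noteq> a" "b < a \<or> b \<notin> Pd - {k}" for a b
  proof -
    have am: "a \<noteq> m" "a \<noteq> k" "b \<noteq> m" using a b invar_Pd[OF inv, of a] by auto
    show ?thesis
    proof (cases "b = k")
      case True
      then show ?thesis using am a open_col by (auto simp: open_column_def)
    next
      case False
      then show ?thesis using am a b invar_less[OF inv, of a b] by simp
    qed
  qed
  have 3: "open_column m \<sigma>' (Pd - {k}) \<or> closed_column m \<sigma>' (Pd - {k})"
  proof (cases "k \<in> Pd")
    case False
    have "\<sigma>' m < \<sigma>' a" if "a \<in> Pd" for a
      using that False invar_less[OF inv that, of k] invar_Pd[OF inv that] k_facts by auto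
    then have "open_column m \<sigma>' Pd" using open_col unfolding open_column_def by blast
    then show ?thesis using False by simp
  next
    case True
    then have kD: "(k, m) \<in> D" using live_cases[OF inv m ne k] by blast
    have "Pd - {k} = {a. m < a \<and> a \<le> n \<and> (\<forall>l\<le>m. (a, l) \<notin> D)}"
    proof (intro Set.set_eqI iffI)
      fix a assume a: "a \<in> Pd - {k}"
      then have "m < a" "a \<le> n" "\<And>l. l < m \<Longrightarrow> (a, l) \<notin> D" using open_col by (auto simp: open_column_def)
      moreover have "(a, m) \<notin> D" using D_col[OF kD, of a] a by auto
      ultimately show "a \<in> {a. m < a \<and> a \<le> n \<and> (\<forall>l\<le>m. (a, l) \<notin> D)}" by (simp add: le_less)
    next
      fix a assume "a \<in> {a. m < a \<and> a \<le> n \<and> (\<forall>l\<le>m. (a, l) \<notin> D)}"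
      then show "a \<in> Pd - {k}" using open_col kD by (auto simp: open_column_def)
    qed
    moreover have "live m \<sigma>' = {}"
    proof -
      have "\<not> \<sigma> k < \<sigma> i" if i: "i \<in> live m \<sigma>" for i
        using invar_less[OF inv True, of i] Max_live(2)[OF ne k i] i by (cases "i = k") (auto simp: live_def)
      then show ?thesis by (auto simp: live_swap)
    qed
    ultimately show ?thesis by (simp add: closed_column_def)
  qed
  show ?thesis unfolding invar_def using 1 2 3 by blast
qed

end

lemma invar_skip:
  assumes inv: "invar m \<sigma> Pd" and m: "1 \<le> m" "m < n" and e: "live m \<sigma> = {}"
  shows "invar (Suc m) \<sigma> (Pd - {Suc m})" "open_column (Suc m) \<sigma> (Pd - {Suc m})"
proof -
  have P: "Pd = {a. m < a \<and> a \<le> n \<and> (\<forall>l\<le>m. (a, l) \<notin> D)}"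
  proof (cases "closed_column m \<sigma> Pd")
    case False
    then have op: "open_column m \<sigma> Pd" using inv by (auto simp: invar_def)
    have "(a, m) \<notin> D" if a: "a \<in> Pd" for a
    proof
      assume "(a, m) \<in> D"
      then have "a \<in> live m \<sigma>" using op a by (auto simp: open_column_def live_def M_iff)
      then show False using e by simp
    qed
    then show ?thesis using op by (auto simp: open_column_def le_less)
  qed (simp add: closed_column_def)
  show op: "open_column (Suc m) \<sigma> (Pd - {Suc m})"
    unfolding open_column_def
  proof
    show "Pd - {Suc m} = {a. Suc m < a \<and> a \<le> n \<and> (\<forall>l<Suc m. (a, l) \<notin> D)}"
      unfolding P by (auto simp: less_Suc_eq_le)
    show "\<forall>a\<in>Pd - {Suc m}. \<sigma> (Suc m) < \<sigma> a"
    proof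
      fix a assume a: "a \<in> Pd - {Suc m}"
      then have "Suc m < a" using P by auto
      then show "\<sigma> (Suc m) < \<sigma> a" using a m invar_less[OF inv, of a "Suc m"] by auto
    qed
  qed
  have "inj_on \<sigma> {Suc m..n}" using inv by (auto simp: invar_def intro: inj_on_subset)
  moreover have "\<sigma> b < \<sigma> a" if a: "a \<in> Pd - {Suc m}" and b: "b \<in> {Suc m<..n}" "b \<noteq> a" "b < a \<or> b \<notin> Pd - {Suc m}" for a b
    using invar_less[OF inv, of a b] a b by auto
  ultimately show "invar (Suc m) \<sigma> (Pd - {Suc m})" using op by (auto simp: invar_def)
qed

lemma invar_initial: "invar 1 id {1<..n}"
proof -
  have "(a, l) \<notin> D" if "l < 1" for a l using that D_pos[of a l] by auto
  then show ?thesis by (auto simp: invar_def open_column_def)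
qed

end

section \<open>The rank of the trace form in the shape of a basic variety\<close>

lemma lin_closed_sum:
  assumes lin: "lin_closed U" and fin: "finite I" "I \<noteq> {}" and B: "\<And>i. i \<in> I \<Longrightarrow> B i \<in> U"
  shows "(\<lambda>a b. \<Sum>i\<in>I. c i * B i a b) \<in> U"
  using fin B
proof (induction I rule: finite_ne_induct)
  case (singleton i)
  have "(\<lambda>a b. B i a b + (c i - 1) * B i a b) \<in> U" using singleton lin_closedD[OF lin] by blast
  then show ?case by (simp add: algebra_simps)
next
  case (insert i I)
  have "(\<lambda>a b. (\<Sum>j\<in>I. c j * B j a b) + c i * B i a b) \<in> U"
    using insert lin_closedD[OF lin] by blast
  then show ?case using insert by (simp add: add.commute)
qed

lemma bracket_form_sum_right:
  assumes "finite I"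
  shows "bracket_form n x A (\<lambda>a b. \<Sum>i\<in>I. c i * B i a b) = (\<Sum>i\<in>I. c i * bracket_form n x A (B i))"
  using assms
proof (induction I rule: finite_induct)
  case empty
  show ?case using bracket_form_diff_right[of n x A "\<lambda>a b. 0" 1 "\<lambda>a b. 0"] by simp
next
  case (insert i I)
  have "(\<lambda>a b. \<Sum>i\<in>insert i I. c i * B i a b) = (\<lambda>a b. (\<Sum>i\<in>I. c i * B i a b) + c i * B i a b)"
    using insert by (simp add: add.commute)
  then show ?case using insert by (simp add: bracket_form_add_right)
qed

lemma bracket_form_add_matrix:
  "bracket_form n (\<lambda>a b. x a b + t * z a b) A B = bracket_form n x A B + t * bracket_form n z A B"
  by (simp add: bracket_form_def mtrace_def mprod_def algebra_simps sum.distrib sum_distrib_left)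

lemma bracket_form_cong:
  assumes "A \<in> pattern_algebra n m \<sigma>" "B \<in> pattern_algebra n m \<sigma>"
    "\<And>a b. m \<le> b \<Longrightarrow> x a b = z a b"
  shows "bracket_form n x A B = bracket_form n z A B"
proof -
  have "x i l * (\<Sum>j\<in>{1..n}. A l j * B j i) = z i l * (\<Sum>j\<in>{1..n}. A l j * B j i)"
    if "A \<in> pattern_algebra n m \<sigma>" for A B :: "nat \<Rightarrow> nat \<Rightarrow> 'a" and i l
  proof (cases "m \<le> l")
    case False
    then have "A l j = 0" for j using pattern_algebraD[OF that, of l j] by auto
    then show ?thesis by simp
  qed (simp add: assms(3))
  then have "mtrace n (mprod n x (mprod n A B)) = mtrace n (mprod n z (mprod n A B))"
    if "A \<in> pattern_algebra n m \<sigma>" for A B :: "nat \<Rightarrow> nat \<Rightarrow> 'a"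
    unfolding mtrace_def mprod_def using that by (intro sum.cong refl) blast
  then show ?thesis using assms(1,2) by (simp add: bracket_form_def)
qed

lemma dual_pairs_map:
  assumes "dual_pairs n x U W s" and "\<And>A. A \<in> U \<Longrightarrow> g A \<in> U'" "\<And>A. A \<in> W \<Longrightarrow> g A \<in> W'"
    and form: "\<And>A B. A \<in> U \<Longrightarrow> B \<in> W \<Longrightarrow> bracket_form n x A B = bracket_form n z (g A) (g B)"
  shows "dual_pairs n z U' W' s"
proof -
  obtain A B where 1: "\<And>i. i < s \<Longrightarrow> A i \<in> U" "\<And>i. i < s \<Longrightarrow> B i \<in> W"
    "\<And>i j. i < s \<Longrightarrow> j < s \<Longrightarrow> bracket_form n x (A i) (B j) = (if i = j then 1 else 0)"
    using assms(1) by (rule dual_pairsE) blast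
  show ?thesis
  proof (rule dual_pairsI[of _ "\<lambda>i. g (A i)" _ "\<lambda>i. g (B i)"])
    show "g (A i) \<in> U'" "g (B i) \<in> W'" if "i < s" for i using 1 assms(2,3) that by auto
    show "bracket_form n z (g (A i)) (g (B j)) = (if i = j then 1 else 0)" if "i < s" "j < s" for i j
      using form[OF 1(1)[OF that(1)] 1(2)[OF that(2)]] 1(3)[OF that] by simp
  qed
qed

text \<open>Row \<open>m\<close> pairs with the rest of the algebra through column \<open>m\<close> of \<open>x\<close> only, and not with itself.\<close>

lemma bracket_form_first_row:
  assumes A: "A \<in> pattern_algebra n m \<sigma>" and B: "B \<in> pattern_algebra n m \<sigma>" and m: "m \<in> {1..n}"
  shows "bracket_form n x A B = bracket_form n x (\<lambda>a b. if a = m then 0 else A a b) (\<lambda>a b. if a = m then 0 else B a b)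
     + (\<Sum>j\<in>{1..n}. A m j * (\<Sum>i\<in>{1..n}. B j i * x i m)) - (\<Sum>j\<in>{1..n}. B m j * (\<Sum>i\<in>{1..n}. A j i * x i m))"
proof -
  have half: "mtrace n (mprod n x (mprod n A B))
      = mtrace n (mprod n x (mprod n (\<lambda>a b. if a = m then 0 else A a b) (\<lambda>a b. if a = m then 0 else B a b)))
        + (\<Sum>j\<in>{1..n}. A m j * (\<Sum>i\<in>{1..n}. B j i * x i m))"
    if A: "A \<in> pattern_algebra n m \<sigma>" for A B
  proof -
    let ?A = "\<lambda>a b. if a = m then 0 else A a b" and ?B = "\<lambda>a b. if a = m then 0 else B a b"
    have Am: "A l m = 0" for l using pattern_algebraD[OF A, of l m] by fastforce
    have "mtrace n (mprod n x (mprod n A B)) = (\<Sum>i\<in>{1..n}. \<Sum>l\<in>{1..n}. \<Sum>j\<in>{1..n}. x i l * (A l j * B j i))"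
      by (simp add: mtrace_def mprod_def sum_distrib_left)
    also have "\<dots> = (\<Sum>i\<in>{1..n}. \<Sum>l\<in>{1..n}. \<Sum>j\<in>{1..n}. x i l * (?A l j * ?B j i)
        + (if l = m then A m j * (B j i * x i m) else 0))"
      using Am by (intro sum.cong refl) auto
    also have "\<dots> = (\<Sum>i\<in>{1..n}. \<Sum>l\<in>{1..n}. \<Sum>j\<in>{1..n}. x i l * (?A l j * ?B j i))
        + (\<Sum>i\<in>{1..n}. \<Sum>l\<in>{1..n}. \<Sum>j\<in>{1..n}. (if l = m then A m j * (B j i * x i m) else 0))"
      by (simp only: sum.distrib)
    also have "(\<Sum>i\<in>{1..n}. \<Sum>l\<in>{1..n}. \<Sum>j\<in>{1..n}. (if l = m then A m j * (B j i * x i m) else 0))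
        = (\<Sum>i\<in>{1..n}. \<Sum>l\<in>{1..n}. if l = m then \<Sum>j\<in>{1..n}. A m j * (B j i * x i m) else 0)"
      by (intro sum.cong refl) auto
    also have "\<dots> = (\<Sum>i\<in>{1..n}. \<Sum>j\<in>{1..n}. A m j * (B j i * x i m))"
      using m by simp
    also have "\<dots> = (\<Sum>j\<in>{1..n}. A m j * (\<Sum>i\<in>{1..n}. B j i * x i m))"
      by (subst sum.swap) (simp add: sum_distrib_left)
    finally show ?thesis by (simp add: mtrace_def mprod_def sum_distrib_left)
  qed
  show ?thesis unfolding bracket_form_def using half[OF A, of B] half[OF B, of A] by simp
qed

locale weighted_roots = basic_roots n D for n D +
  fixes \<phi> :: "root \<Rightarrow> 'a::field_char_0"
  assumes nonzero: "\<And>\<xi>. \<xi> \<in> D \<Longrightarrow> \<phi> \<xi> \<noteq> 0"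
begin

text \<open>In the rows of \<open>Pd\<close>, from column \<open>m\<close> on, the functional looks like \<open>X\<^sub>D w\<close> with \<open>w\<close> unitriangular: it
  is zero before the root of \<open>D\<close> in that row, which carries its weight, and free behind it.\<close>

definition row_shape :: "nat \<Rightarrow> nat set \<Rightarrow> (nat \<Rightarrow> nat \<Rightarrow> 'a) \<Rightarrow> bool" where
  "row_shape m Pd x \<longleftrightarrow> (\<forall>a\<in>Pd. \<forall>j. m \<le> j \<longrightarrow> j < a \<longrightarrow>
      ((\<forall>l\<le>j. (a, l) \<notin> D) \<longrightarrow> x a j = 0) \<and> ((a, j) \<in> D \<longrightarrow> x a j = \<phi> (a, j)))"

text \<open>The entries in live rows that are not dominated serve as pivots and have to be nonzero; a pending row can
  contribute one only at a root of \<open>D\<close>.\<close>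

definition pivot_column :: "nat \<Rightarrow> (nat \<Rightarrow> nat) \<Rightarrow> nat set \<Rightarrow> (nat \<Rightarrow> 'a) \<Rightarrow> bool" where
  "pivot_column m \<sigma> Pd y \<longleftrightarrow> (\<forall>b. y b \<noteq> 0 \<longrightarrow> b \<in> live m \<sigma>) \<and> (\<forall>a\<in>Pd. (a, m) \<notin> D \<longrightarrow> y a = 0)
     \<and> (\<forall>i\<in>live m \<sigma> - dominated m \<sigma>. y i \<noteq> 0)"

lemma row_shape_elem_conj:
  assumes sh: "row_shape (Suc m) Q x" and k: "k \<in> {1..n}" and P: "P \<subseteq> {m<..n}"
    and PQ: "\<And>a. a \<in> P \<Longrightarrow> (a, m) \<notin> D \<Longrightarrow> a \<in> Q \<and> \<nu> a = 0"
    and \<nu>: "\<And>b. \<nu> b \<noteq> 0 \<Longrightarrow> m < b \<and> b < k"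
  shows "row_shape (Suc m) P (elem_conj n k \<nu> x)"
  unfolding row_shape_def
proof (intro ballI allI impI)
  fix a j assume a: "a \<in> P" and j: "Suc m \<le> j" "j < a"
  show "((\<forall>l\<le>j. (a, l) \<notin> D) \<longrightarrow> elem_conj n k \<nu> x a j = 0) \<and> ((a, j) \<in> D \<longrightarrow> elem_conj n k \<nu> x a j = \<phi> (a, j))"
  proof (cases "(a, m) \<in> D")
    case True
    then show ?thesis using j D_row[OF True, of j] by auto
  next
    case False
    then have aQ: "a \<in> Q" "\<nu> a = 0" using PQ a by auto
    have e: "elem_conj n k \<nu> x a j = x a j + (if j = k then \<Sum>l\<in>{1..n}. x a l * \<nu> l else 0)"
      using elem_conj_entry[of a n j k \<nu> x] k aQ a P j by fastforce
    have 0: "(\<Sum>l\<in>{1..n}. x a l * \<nu> l) = 0" if jk: "j = k" and d: "(\<forall>l<j. (a, l) \<notin> D)"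
    proof (rule sum.neutral, rule ballI)
      fix l
      show "x a l * \<nu> l = 0"
      proof (cases "\<nu> l = 0")
        case False
        then have "m < l" "l < k" using \<nu> by auto
        moreover have "\<forall>l'\<le>l. (a, l') \<notin> D" using d jk \<open>l < k\<close> by auto
        ultimately show ?thesis using sh aQ jk j by (auto simp: row_shape_def)
      qed simp
    qed
    have s: "(\<forall>l\<le>j. (a, l) \<notin> D) \<longrightarrow> x a j = 0" "(a, j) \<in> D \<longrightarrow> x a j = \<phi> (a, j)"
      using sh aQ j by (auto simp: row_shape_def)
    show ?thesis
    proof (intro conjI impI)
      assume d: "\<forall>l\<le>j. (a, l) \<notin> D"
      then show "elem_conj n k \<nu> x a j = 0" using e 0 s(1) by (cases "j = k") simp_all
    next
      assume d: "(a, j) \<in> D"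
      have "\<forall>l<j. (a, l) \<notin> D" using D_row[OF d] by blast
      then show "elem_conj n k \<nu> x a j = \<phi> (a, j)" using e 0 s(2) d by (cases "j = k") simp_all
    qed
  qed
qed

context
  fixes m k :: nat and \<sigma> :: "nat \<Rightarrow> nat" and Pd :: "nat set" and y :: "nat \<Rightarrow> 'a"
  assumes inv: "invar m \<sigma> Pd" and m: "1 \<le> m" and ne: "live m \<sigma> \<noteq> {}" and k: "k = Max (live m \<sigma>)"
    and y: "pivot_column m \<sigma> Pd y"
begin

lemma Max_not_dominated: "k \<in> live m \<sigma> - dominated m \<sigma>"
proof -
  have "k \<notin> dominated m \<sigma>" using Max_live(2)[OF ne k] unfolding dominated_def by fastforce
  then show ?thesis using Max_live(1)[OF ne k] by simp
qed

lemma swap_step_Max: "swap_step n m k \<sigma> y"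
proof
  show "1 \<le> m" "m < k" "k \<le> n" "\<sigma> m < \<sigma> k" using k_facts[OF inv m ne k] m by auto
  show "inj_on \<sigma> {m..n}" using inv by (simp add: invar_def)
  show "y k \<noteq> 0" using y Max_not_dominated by (auto simp: pivot_column_def)
  show "m < b \<and> b \<le> k \<and> \<sigma> m < \<sigma> b" if "y b \<noteq> 0" for b
  proof -
    have "b \<in> live m \<sigma>" using y that by (auto simp: pivot_column_def)
    then show ?thesis using Max_live(2)[OF ne k] by (auto simp: live_def)
  qed
  show "\<sigma> a < \<sigma> b" if "k < b" "b \<le> n" "\<sigma> m < \<sigma> b" "m < a" "a < b" for a b
    using above_less[OF inv m ne k that] .
qed

lemma pivot_column_swap:
  "pivot_column m (\<sigma>(m := \<sigma> k, k := \<sigma> m)) (Pd - {k}) (\<lambda>b. if \<sigma> k < \<sigma> b then y b else 0)"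
  unfolding pivot_column_def live_swap[OF inv m ne k] dominated_swap[OF inv m ne k]
proof (intro conjI allI impI ballI)
  fix b assume "(if \<sigma> k < \<sigma> b then y b else 0) \<noteq> 0"
  then have "\<sigma> k < \<sigma> b" "y b \<noteq> 0" by (simp_all split: if_splits)
  then show "b \<in> {i \<in> live m \<sigma>. \<sigma> k < \<sigma> i}" using y by (simp add: pivot_column_def)
next
  fix a assume "a \<in> Pd - {k}" "(a, m) \<notin> D"
  then show "(if \<sigma> k < \<sigma> a then y a else 0) = 0" using y by (simp add: pivot_column_def)
next
  fix i assume "i \<in> {i \<in> live m \<sigma>. \<sigma> k < \<sigma> i} - {i \<in> dominated m \<sigma>. \<sigma> k < \<sigma> i}"
  then have "i \<in> live m \<sigma> - dominated m \<sigma>" "\<sigma> k < \<sigma> i" by blast+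
  then show "(if \<sigma> k < \<sigma> i then y i else 0) \<noteq> 0" using y by (simp add: pivot_column_def)
qed

end

text \<open>Imposing on both sides the conditions of the stabiliser in the dominated rows costs twice their
  number. The conditions in all other rows hold automatically, and row \<open>m\<close> itself no longer pairs
  with anything.\<close>

lemma upper_pattern_pivots:
  assumes UW: "\<forall>x y s. row_shape (Suc m) Pd x \<longrightarrow> pivot_column m \<sigma> Pd y \<longrightarrow>
      dual_pairs n x (column_stabilizer n m \<sigma> y) (column_stabilizer n m \<sigma> y) s \<longrightarrow> s + 2 * card (dominated m \<sigma>) \<le> 2 * q"
    and inv: "invar m \<sigma> Pd" and m: "1 \<le> m" "m \<le> n" and op: "open_column m \<sigma> Pd"
    and sh: "row_shape m Pd x" and piv: "\<And>i. i \<in> live m \<sigma> - dominated m \<sigma> \<Longrightarrow> x i m \<noteq> 0"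
    and dp: "dual_pairs n x (pattern_algebra n m \<sigma>) (pattern_algebra n m \<sigma>) s"
  shows "s \<le> 2 * q"
proof -
  define y where "y i = (if i \<in> live m \<sigma> then x i m else 0)" for i
  define f where "f i A = (\<Sum>b\<in>{1..n}. A i b * y b)" for i and A :: "nat \<Rightarrow> nat \<Rightarrow> 'a"
  let ?P = "pattern_algebra n m \<sigma> :: (nat \<Rightarrow> nat \<Rightarrow> 'a) set"
  let ?U = "{A \<in> ?P. \<forall>i\<in>dominated m \<sigma>. f i A = 0}"
  let ?c = "card (dominated m \<sigma>)"
  let ?st = "\<lambda>A a b. if a = m then 0 else A a b"
  have flin: "f i (\<lambda>a b. A a b + c * B a b) = f i A + c * f i B" for i A B c
    by (simp add: f_def algebra_simps sum.distrib sum_distrib_left)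
  have lin: "lin_closed ?P" by (rule lin_closed_pattern_algebra)
  have linU: "lin_closed ?U" using lin by (auto simp: lin_closed_def flin)
  have "dual_pairs n x ?U ?P (s - ?c)"
    using dual_pairs_functionals[OF dp lin finite_dominated, where f = f] flin by simp
  then have "dual_pairs n x ?P ?U (s - ?c)"
    using linU by (rule dual_pairs_commute)
  then have "dual_pairs n x ?U ?U (s - ?c - ?c)"
    using dual_pairs_functionals[OF _ lin finite_dominated, where f = f and W = ?U and s = "s - ?c"] flin by simp
  then have dpU: "dual_pairs n x ?U ?U (s - 2 * ?c)" by (simp add: mult_2)
  have yx: "y b = x b m" if "m < b" "b \<le> n" "\<sigma> m < \<sigma> b" for b
  proof (cases "b \<in> live m \<sigma>")
    case False
    then have "b \<in> Pd" "(b, m) \<in> M_roots n D" using not_live_in_Pd[OF inv that] that by (auto simp: live_def)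
    then have "x b m = 0" using sh that by (auto simp: row_shape_def M_iff)
    then show ?thesis using False by (simp add: y_def)
  qed (simp add: y_def)
  have f0: "f i A = 0" if A: "A \<in> ?U" and i: "m < i" "\<sigma> m < \<sigma> i" for i A
  proof (rule ccontr)
    assume nz: "f i A \<noteq> 0"
    then obtain b where b: "A i b \<noteq> 0" "y b \<noteq> 0"
      unfolding f_def by (rule sum.not_neutral_contains_not_neutral) auto
    then have bl: "b \<in> live m \<sigma>" by (auto simp: y_def split: if_splits)
    have "i < b" "\<sigma> i < \<sigma> b" using A b(1) pattern_algebraD[of A n m \<sigma> i b] by auto
    then have "i \<in> dominated m \<sigma>"
      using live_down_closed[OF inv bl i(1) _ i(2)] bl by (auto simp: dominated_def)
    then show False using A nz by auto
  qed
  have row: "A m j * (\<Sum>i\<in>{1..n}. B j i * x i m) = 0" if A: "A \<in> ?U" and B: "B \<in> ?U" for A B j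
  proof (cases "A m j = 0")
    case False
    then have j: "m < j" "\<sigma> m < \<sigma> j" using A pattern_algebraD[of A n m \<sigma> m j] by auto
    have "B j i * x i m = B j i * y i" for i
    proof (cases "B j i = 0")
      case False
      then have "j < i" "i \<le> n" "\<sigma> j < \<sigma> i" using B pattern_algebraD[of B n m \<sigma> j i] by auto
      then show ?thesis using yx[of i] j by simp
    qed simp
    then have "(\<Sum>i\<in>{1..n}. B j i * x i m) = f j B" unfolding f_def by (intro sum.cong refl)
    then show ?thesis using f0[OF B j] by simp
  qed simp
  have form: "bracket_form n x A B = bracket_form n x (?st A) (?st B)" if "A \<in> ?U" "B \<in> ?U" for A B
  proof -
    have "(\<Sum>j\<in>{1..n}. A m j * (\<Sum>i\<in>{1..n}. B j i * x i m)) = 0"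
      "(\<Sum>j\<in>{1..n}. B m j * (\<Sum>i\<in>{1..n}. A j i * x i m)) = 0"
      using row[OF that] row[OF that(2) that(1)] by (simp_all only: sum.neutral_const)
    moreover have "A \<in> ?P" "B \<in> ?P" "m \<in> {1..n}" using that m by auto
    ultimately show ?thesis using bracket_form_first_row[of A n m \<sigma> B x] by simp
  qed
  have st: "?st A \<in> column_stabilizer n m \<sigma> y" if A: "A \<in> ?U" for A
  proof -
    have AP: "A \<in> ?P" using A by simp
    have "(\<Sum>b\<in>{1..n}. ?st A i b * y b) = 0" if "m < i" "\<sigma> m < \<sigma> i" for i
      using f0[OF A that] that by (simp add: f_def)
    moreover have "?st A \<in> pattern_algebra n (Suc m) \<sigma>"
      unfolding pattern_algebra_def
    proof (intro CollectI allI impI)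
      fix a b assume "?st A a b \<noteq> 0"
      then have "A a b \<noteq> 0" "a \<noteq> m" by (auto split: if_splits)
      then show "Suc m \<le> a \<and> a < b \<and> b \<le> n \<and> \<sigma> a < \<sigma> b" using pattern_algebraD[OF AP, of a b] by auto
    qed
    ultimately show ?thesis by (simp add: column_stabilizer_def)
  qed
  have "dual_pairs n x (column_stabilizer n m \<sigma> y) (column_stabilizer n m \<sigma> y) (s - 2 * ?c)"
    using dpU st st form by (rule dual_pairs_map[where g = ?st])
  moreover have "row_shape (Suc m) Pd x" using sh by (auto simp: row_shape_def)
  moreover have "pivot_column m \<sigma> Pd y"
    unfolding pivot_column_def
  proof (intro conjI)
    show "\<forall>b. y b \<noteq> 0 \<longrightarrow> b \<in> live m \<sigma>" by (simp add: y_def)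
    show "\<forall>i\<in>live m \<sigma> - dominated m \<sigma>. y i \<noteq> 0" using piv by (simp add: y_def)
    show "\<forall>a\<in>Pd. (a, m) \<notin> D \<longrightarrow> y a = 0"
    proof (intro ballI impI)
      fix a assume a: "a \<in> Pd" "(a, m) \<notin> D"
      then have "\<forall>l\<le>m. (a, l) \<notin> D" "m < a" using op by (auto simp: open_column_def le_less)
      then show "y a = 0" using sh a by (auto simp: row_shape_def y_def)
    qed
  qed
  ultimately have "s - 2 * ?c + 2 * ?c \<le> 2 * q" using UW by blast
  then show ?thesis by simp
qed

end

text \<open>The rank of the form is lower semicontinuous along a line of functionals.\<close>

lemma dual_pairs_perturb:
  fixes x z :: "nat \<Rightarrow> nat \<Rightarrow> 'a::field_char_0"
  assumes dp: "dual_pairs n x U W s" and lin: "lin_closed W"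
  shows "\<exists>u\<in>univariate_polys. u 0 \<noteq> 0 \<and> (\<forall>t. u t \<noteq> 0 \<longrightarrow> dual_pairs n (\<lambda>a b. x a b + t * z a b) U W s)"
proof -
  obtain A B where 1: "\<And>i. i < s \<Longrightarrow> A i \<in> U" "\<And>i. i < s \<Longrightarrow> B i \<in> W"
    "\<And>i j. i < s \<Longrightarrow> j < s \<Longrightarrow> bracket_form n x (A i) (B j) = (if i = j then 1 else 0)"
    using dp by (rule dual_pairsE) blast
  let ?x = "\<lambda>t a b. x a b + t * z a b"
  let ?P = "univariate_polys :: ('a \<Rightarrow> 'a) set"
  note P = function_algebra_univariate[where 'a = 'a]
  define g where "g i k t = bracket_form n (?x t) (A i) (B k)" for i k t
  have g: "g i k \<in> ?P" for i k
  proof -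
    have "g i k = (\<lambda>t. bracket_form n x (A i) (B k) + t * bracket_form n z (A i) (B k))"
      by (rule ext) (simp only: g_def bracket_form_add_matrix)
    then show ?thesis
      using function_algebraD(2)[OF P function_algebraD(1)[OF P] function_algebraD(3)[OF P univariate_id function_algebraD(1)[OF P]]]
      by simp
  qed
  have 0: "(\<Sum>k\<in>{..<s}. g i k 0 * (if j = k then 1 else 0)) = (if i = j then 1 else 0)"
    if "i \<in> {..<s}" "j \<in> {..<s}" for i j
  proof -
    have "(\<Sum>k\<in>{..<s}. g i k 0 * (if j = k then 1 else 0)) = (\<Sum>k\<in>{..<s}. if k = j then g i k 0 else 0)"
      by (intro sum.cong refl) auto
    then show ?thesis using that 1(3) by (simp add: g_def)
  qed
  obtain u a where u: "u \<in> ?P" "u 0 \<noteq> 0" and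
    ga: "\<forall>t. \<forall>i\<in>{..<s}. \<forall>j\<in>{..<s}. (\<Sum>k\<in>{..<s}. g i k t * a j k t) = (if i = j then u t else 0)"
    using dual_family_extends[OF P, of "{..<s}" "{..<s}" g 0 "\<lambda>j k. if j = k then 1 else 0", OF _ _ g 0] by blast
  have "dual_pairs n (?x t) U W s" if t: "u t \<noteq> 0" for t
  proof (cases "s = 0")
    case False
    define B' where "B' j = (\<lambda>p q. \<Sum>k\<in>{..<s}. (a j k t / u t) * B k p q)" for j
    have "B' j \<in> W" for j
      unfolding B'_def using False 1(2) by (intro lin_closed_sum[OF lin]) auto
    moreover have "bracket_form n (?x t) (A i) (B' j) = (if i = j then 1 else 0)" if "i < s" "j < s" for i j
    proof -
      have "bracket_form n (?x t) (A i) (B' j) = (\<Sum>k\<in>{..<s}. (a j k t / u t) * g i k t)"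
        unfolding B'_def by (subst bracket_form_sum_right) (simp_all add: g_def)
      also have "\<dots> = (\<Sum>k\<in>{..<s}. g i k t * a j k t) / u t"
        by (simp add: sum_divide_distrib mult.commute)
      finally show ?thesis using ga that t by simp
    qed
    ultimately show ?thesis using 1(1) by (intro dual_pairsI[of _ A _ B'])
  qed simp
  then show ?thesis using u by blast
qed

lemma sum_matrix_unit:
  fixes n b :: nat
  assumes "(\<And>l. l \<in> {1..n} \<Longrightarrow> l \<noteq> b \<Longrightarrow> h l = 0)" "b \<in> {1..n}"
  shows "(\<Sum>l\<in>{1..n}. h l) = (h b :: 'a::field)"
proof -
  have "(\<Sum>l\<in>{1..n}. h l) = (\<Sum>l\<in>{b}. h l)"
    by (rule sum.mono_neutral_right) (use assms in auto)
  then show ?thesis by simp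
qed

context weighted_roots
begin

lemma undominated_Pd:
  assumes inv: "invar m \<sigma> Pd" and op: "open_column m \<sigma> Pd" and m: "1 \<le> m"
    and i: "i \<in> live m \<sigma> - dominated m \<sigma>" "i \<in> Pd"
  shows "(i, m) \<in> D"
proof -
  have "(\<exists>l\<le>m. (i, l) \<in> D) \<or> (\<exists>c\<ge>i. (c, m) \<in> D)"
    using i m by (auto simp: live_def M_iff)
  then consider "(i, m) \<in> D" | c where "c \<ge> i" "(c, m) \<in> D"
    using op i by (auto simp: open_column_def le_less)
  then show ?thesis
  proof cases
    case 2
    have cP: "c \<in> Pd" using op D_pos[OF 2(2)] D_row[OF 2(2)] by (fastforce simp: open_column_def)
    then have cl: "c \<in> live m \<sigma>" using op D_pos[OF 2(2)] 2 by (auto simp: open_column_def live_def M_iff)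
    show ?thesis
    proof (cases "c = i")
      case False
      then have "i < c" "\<sigma> i < \<sigma> c"
        using 2 invar_less[OF inv cP, of i] i by (auto simp: live_def)
      then have "i \<in> dominated m \<sigma>" using cl i by (auto simp: dominated_def)
      then show ?thesis using i by simp
    qed (use 2 in simp)
  qed
qed

text \<open>The bound for columns with pivots extends to all columns: rows outside \<open>Pd\<close> are free to be
  perturbed, and a pivot in a row of \<open>Pd\<close> is a root of \<open>D\<close>, hence has nonzero weight.\<close>

lemma upper_pattern:
  assumes UW: "\<forall>x y s. row_shape (Suc m) Pd x \<longrightarrow> pivot_column m \<sigma> Pd y \<longrightarrow>
      dual_pairs n x (column_stabilizer n m \<sigma> y) (column_stabilizer n m \<sigma> y) s \<longrightarrow> s + 2 * card (dominated m \<sigma>) \<le> 2 * q"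
    and inv: "invar m \<sigma> Pd" and m: "1 \<le> m" "m \<le> n" and op: "open_column m \<sigma> Pd"
    and sh: "row_shape m Pd x"
    and dp: "dual_pairs n x (pattern_algebra n m \<sigma>) (pattern_algebra n m \<sigma>) s"
  shows "s \<le> 2 * q"
proof -
  let ?K = "live m \<sigma> - dominated m \<sigma>"
  \<comment> \<open>The perturbation concerns pivots in rows that are not pending, so that the row shape is preserved.\<close>
  define z where "z a b = (if b = m \<and> a \<in> ?K \<and> a \<notin> Pd then 1 else 0 :: 'a)" for a b
  obtain u where u: "u \<in> univariate_polys" "u 0 \<noteq> 0"
    and dpt: "\<And>t. u t \<noteq> 0 \<Longrightarrow> dual_pairs n (\<lambda>a b. x a b + t * z a b) (pattern_algebra n m \<sigma>) (pattern_algebra n m \<sigma>) s"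
    using dual_pairs_perturb[OF dp lin_closed_pattern_algebra, of z] by blast
  \<comment> \<open>The index 0, which is not a row, stands for the condition that the rank is preserved.\<close>
  define f where "f i t = (if i = 0 then u t else x i m + t)" for i and t :: 'a
  have f: "f i \<in> univariate_polys" for i
  proof (cases "i = 0")
    case False
    then have "f i = (\<lambda>t. x i m + t)" by (simp add: f_def fun_eq_iff)
    then show ?thesis
      using function_algebraD(2)[OF function_algebra_univariate function_algebraD(1)[OF function_algebra_univariate] univariate_id] by simp
  next
    case True
    then have "f i = u" by (simp add: f_def fun_eq_iff)
    then show ?thesis using u by simp
  qed
  have "\<exists>t. \<forall>i\<in>insert 0 (?K - Pd). f i t \<noteq> 0"
  proof (rule univariate_common_nonzero)
    show "finite (insert 0 (?K - Pd))" using finite_live by simp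
    show "f i \<in> univariate_polys" for i by (rule f)
    show "\<exists>t. f i t \<noteq> 0" for i
      using u by (cases "i = 0") (auto simp: f_def intro: exI[of _ 0] exI[of _ "1 - x i m"])
  qed
  then obtain t where t: "\<And>i. i \<in> insert 0 (?K - Pd) \<Longrightarrow> f i t \<noteq> 0" by blast
  define xt where "xt a b = x a b + t * z a b" for a b
  have ut: "u t \<noteq> 0" using t[of 0] by (simp add: f_def)
  have "row_shape m Pd xt" using sh by (auto simp: row_shape_def xt_def z_def)
  moreover have "xt i m \<noteq> 0" if i: "i \<in> ?K" for i
  proof (cases "i \<in> Pd")
    case True
    then have iD: "(i, m) \<in> D" using undominated_Pd[OF inv op m(1) i] by blast
    then have "x i m = \<phi> (i, m)" using sh True D_pos[OF iD] by (auto simp: row_shape_def)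
    then show ?thesis using nonzero[OF iD] True by (simp add: xt_def z_def)
  next
    case False
    have "i \<noteq> 0" using i by (auto simp: live_def)
    then show ?thesis using t[of i] False i by (simp add: f_def xt_def z_def)
  qed
  moreover have "dual_pairs n xt (pattern_algebra n m \<sigma>) (pattern_algebra n m \<sigma>) s"
    using dpt[OF ut] unfolding xt_def .
  ultimately show ?thesis
    using upper_pattern_pivots[OF UW inv m op, of xt s] by blast
qed

text \<open>Choose the column \<open>m\<close> with entries 1 in the live rows that are not pending. Each dominated row \<open>i\<close>
  is dominated by an undominated row \<open>p i\<close>, and the matrix units at \<open>(m, i)\<close> and \<open>(i, p i)\<close> form
  hyperbolic pairs that are added to the system of the stabiliser.\<close>

lemma lower_pattern:
  assumes LW: "\<forall>y. pivot_column m \<sigma> Pd y \<longrightarrow> (\<exists>x s. row_shape (Suc m) Pd x \<and>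
      dual_pairs n x (column_stabilizer n m \<sigma> y) (column_stabilizer n m \<sigma> y) s \<and> s + 2 * card (dominated m \<sigma>) = 2 * q)"
    and inv: "invar m \<sigma> Pd" and m: "1 \<le> m" "m \<le> n" and op: "open_column m \<sigma> Pd"
  shows "\<exists>x. row_shape m Pd x \<and> dual_pairs n x (pattern_algebra n m \<sigma>) (pattern_algebra n m \<sigma>) (2 * q)"
proof -
  let ?P = "pattern_algebra n m \<sigma> :: (nat \<Rightarrow> nat \<Rightarrow> 'a) set"
  define y where "y i = (if i \<in> live m \<sigma> then if i \<in> Pd then if (i, m) \<in> D then \<phi> (i, m) else 0 else 1 else 0)" for i
  have y: "pivot_column m \<sigma> Pd y"
    using undominated_Pd[OF inv op m(1)] nonzero by (auto simp: pivot_column_def y_def)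
  obtain x s where x: "row_shape (Suc m) Pd x"
    "dual_pairs n x (column_stabilizer n m \<sigma> y) (column_stabilizer n m \<sigma> y) s" "s + 2 * card (dominated m \<sigma>) = 2 * q"
    using LW y by blast
  define z where "z a b = (if b = m then y a else x a b)" for a b
  have shz: "row_shape m Pd z"
    unfolding row_shape_def
  proof (intro ballI allI impI)
    fix a j assume a: "a \<in> Pd" and j: "m \<le> j" "j < a"
    show "((\<forall>l\<le>j. (a, l) \<notin> D) \<longrightarrow> z a j = 0) \<and> ((a, j) \<in> D \<longrightarrow> z a j = \<phi> (a, j))"
    proof (cases "j = m")
      case True
      have "a \<in> live m \<sigma>" if "(a, m) \<in> D"
        using a op that D_pos[OF that] by (auto simp: open_column_def live_def M_iff)
      then show ?thesis using a True by (auto simp: z_def y_def)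
    next
      case False
      then show ?thesis using x(1) a j by (auto simp: row_shape_def z_def)
    qed
  qed
  have stab: "column_stabilizer n m \<sigma> y \<subseteq> ?P"
    by (auto simp: column_stabilizer_def pattern_algebra_def dest: Suc_leD)
  have dpz: "dual_pairs n z (column_stabilizer n m \<sigma> y) (column_stabilizer n m \<sigma> y) s"
  proof (rule dual_pairs_map[OF x(2), where g = "\<lambda>A. A"])
    fix A B assume "A \<in> column_stabilizer n m \<sigma> y" "B \<in> column_stabilizer n m \<sigma> y"
    then have "A \<in> pattern_algebra n (Suc m) \<sigma>" "B \<in> pattern_algebra n (Suc m) \<sigma>"
      by (auto simp: column_stabilizer_def)
    then show "bracket_form n x A B = bracket_form n z A B"
      by (rule bracket_form_cong) (simp add: z_def)
  qed auto
  have "\<exists>b. b \<in> live m \<sigma> - dominated m \<sigma> \<and> i < b \<and> \<sigma> i < \<sigma> b" if i: "i \<in> dominated m \<sigma>" for i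
  proof -
    let ?S = "{b \<in> live m \<sigma>. i < b \<and> \<sigma> i < \<sigma> b}"
    have S: "finite ?S" "?S \<noteq> {}" using finite_live i by (auto simp: dominated_def)
    let ?b = "Max ?S"
    have b: "?b \<in> ?S" using Max_in[OF S] .
    have "?b \<notin> dominated m \<sigma>"
    proof
      assume "?b \<in> dominated m \<sigma>"
      then obtain c where c: "c \<in> live m \<sigma>" "?b < c" "\<sigma> ?b < \<sigma> c" by (auto simp: dominated_def)
      then have "c \<in> ?S" using b by auto
      then show False using Max_ge[OF S(1), of c] c by simp
    qed
    then show ?thesis using b by blast
  qed
  then obtain p where p: "\<And>i. i \<in> dominated m \<sigma> \<Longrightarrow> p i \<in> live m \<sigma> - dominated m \<sigma> \<and> i < p i \<and> \<sigma> i < \<sigma> (p i)"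
    by metis
  define e where "e i = (\<lambda>a b. if a = m \<and> b = i then 1 else 0 :: 'a)" for i :: nat
  define f where "f i = (\<lambda>a b. if a = i \<and> b = p i then 1 / y (p i) else 0 :: 'a)" for i
  have dom: "m < i \<and> i \<le> n \<and> \<sigma> m < \<sigma> i" if "i \<in> dominated m \<sigma>" for i
    using that by (auto simp: dominated_def live_def)
  have eP: "e i \<in> ?P" if "i \<in> dominated m \<sigma>" for i
    using dom[OF that] by (auto simp: e_def pattern_algebra_def)
  have fP: "f i \<in> ?P" if "i \<in> dominated m \<sigma>" for i
    using dom[OF that] p[OF that] by (auto simp: f_def pattern_algebra_def live_def)
  have form: "bracket_form n z (e i) A = (\<Sum>b\<in>{1..n}. A i b * y b)" if i: "i \<in> dominated m \<sigma>" and A: "A \<in> ?P" "\<And>b. A m b = 0" for i A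
  proof -
    have "(\<lambda>a b. if a = m then 0 else e i a b) = (\<lambda>a b. 0)" by (auto simp: e_def fun_eq_iff)
    then have "bracket_form n z (e i) A = bracket_form n z (\<lambda>a b. 0) (\<lambda>a b. if a = m then 0 else A a b)
       + (\<Sum>j\<in>{1..n}. e i m j * (\<Sum>b\<in>{1..n}. A j b * y b))"
      using bracket_form_first_row[OF eP[OF i] A(1), of z] m A(2) by (simp add: z_def)
    also have "bracket_form n z (\<lambda>a b. 0) (\<lambda>a b. if a = m then 0 else A a b) = 0"
      by (simp add: bracket_form_def mtrace_def mprod_def)
    also have "(\<Sum>j\<in>{1..n}. e i m j * (\<Sum>b\<in>{1..n}. A j b * y b)) = e i m i * (\<Sum>b\<in>{1..n}. A i b * y b)"
      by (rule sum_matrix_unit) (use dom[OF i] m in \<open>auto simp: e_def\<close>)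
    finally show ?thesis by (simp add: e_def)
  qed
  have ee: "bracket_form n z (e i) (e j) = 0" if "i \<in> dominated m \<sigma>" "j \<in> dominated m \<sigma>" for i j
  proof -
    have z0: "(\<lambda>a b. if a = m then 0 else e i a b) = (\<lambda>a b. 0)" for i by (auto simp: e_def fun_eq_iff)
    have "e i m b * (\<Sum>c\<in>{1..n}. e j b c * z c m) = 0" if "i \<in> dominated m \<sigma>" for i j b
      using dom[OF that] by (auto simp: e_def)
    then have "(\<Sum>b\<in>{1..n}. e i m b * (\<Sum>c\<in>{1..n}. e j b c * z c m)) = 0" if "i \<in> dominated m \<sigma>" for i j
      using that by (simp only: sum.neutral_const)
    then show ?thesis using bracket_form_first_row[OF eP[OF that(1)] eP[OF that(2)], of z] m that
      by (simp add: z0 bracket_form_def mtrace_def mprod_def)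
  qed
  have ef: "bracket_form n z (e i) (f j) = (if i = j then 1 else 0)" if i: "i \<in> dominated m \<sigma>" and j: "j \<in> dominated m \<sigma>" for i j
  proof -
    have "bracket_form n z (e i) (f j) = (\<Sum>b\<in>{1..n}. f j i b * y b)"
      by (rule form[OF i fP[OF j]]) (use dom[OF j] in \<open>auto simp: f_def\<close>)
    also have "\<dots> = f j i (p j) * y (p j)"
      by (rule sum_matrix_unit) (use p[OF j] in \<open>auto simp: f_def live_def\<close>)
    also have "\<dots> = (if i = j then 1 else 0)"
      using y p[OF j] by (auto simp: f_def pivot_column_def)
    finally show ?thesis .
  qed
  have sub: "column_stabilizer n m \<sigma> y \<subseteq> {A \<in> ?P. \<forall>i\<in>dominated m \<sigma>. bracket_form n z (e i) A = 0}"
  proof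
    fix A assume A: "A \<in> column_stabilizer n m \<sigma> y"
    have AP: "A \<in> ?P" using A stab by blast
    have "A m b = 0" for b
      using A pattern_algebraD[of A n "Suc m" \<sigma> m b] by (auto simp: column_stabilizer_def)
    then have "bracket_form n z (e i) A = 0" if "i \<in> dominated m \<sigma>" for i
      using form[OF that AP] A dom[OF that] by (auto simp: column_stabilizer_def)
    then show "A \<in> {A \<in> ?P. \<forall>i\<in>dominated m \<sigma>. bracket_form n z (e i) A = 0}" using AP by blast
  qed
  have "dual_pairs n z ?P ?P (s + 2 * card (dominated m \<sigma>))"
    by (rule dual_pairs_add_hyperbolics[OF finite_dominated lin_closed_pattern_algebra eP fP ee ef])
       (use dual_pairs_mono[OF dpz sub sub order_refl] in simp_all)
  then show ?thesis using shz x(3) by auto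
qed

text \<open>The rank of the form on column stabilisers, by induction along a run of the diagram. Since
  a transposition removes \<open>card {j \<in> live m \<sigma>. \<sigma> j < \<sigma> k}\<close> dominated rows and \<open>q\<close> drops by the same
  number, the quantity \<open>2 * q - 2 * card (dominated m \<sigma>)\<close> does not change. When the column has no
  live rows left, the stabiliser is the whole pattern algebra of the next column.\<close>

theorem dual_pairs_column_stabilizer:
  assumes "swaps m \<sigma> q" "1 \<le> m" "invar m \<sigma> Pd"
  shows "(\<forall>x y s. row_shape (Suc m) Pd x \<longrightarrow> pivot_column m \<sigma> Pd y \<longrightarrow>
      dual_pairs n x (column_stabilizer n m \<sigma> y) (column_stabilizer n m \<sigma> y) s \<longrightarrow> s + 2 * card (dominated m \<sigma>) \<le> 2 * q)
    \<and> (\<forall>y. pivot_column m \<sigma> Pd y \<longrightarrow> (\<exists>x s. row_shape (Suc m) Pd x \<and>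
      dual_pairs n x (column_stabilizer n m \<sigma> y) (column_stabilizer n m \<sigma> y) s \<and> s + 2 * card (dominated m \<sigma>) = 2 * q))"
  using assms
proof (induction arbitrary: Pd rule: swaps.induct)
  case (exhausted m \<sigma>)
  have l: "dominated m \<sigma> = {}" using exhausted by (auto simp: dominated_def live_def)
  have Pd: "Pd = {}" using invar_Pd[OF exhausted(3)] exhausted(1) by fastforce
  have zero: "A = (\<lambda>a b. 0)" if "A \<in> column_stabilizer n m \<sigma> y" for A :: "nat \<Rightarrow> nat \<Rightarrow> 'a" and y
  proof (intro ext)
    fix a b show "A a b = 0"
      using that pattern_algebraD[of A n "Suc m" \<sigma> a b] exhausted(1) by (fastforce simp: column_stabilizer_def)
  qed
  have s0: "s = 0" if dp: "dual_pairs n x (column_stabilizer n m \<sigma> y) (column_stabilizer n m \<sigma> y) s" for x s and y :: "nat \<Rightarrow> 'a"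
  proof (rule ccontr)
    assume "s \<noteq> 0"
    obtain A B where 1: "\<And>i. i < s \<Longrightarrow> A i \<in> column_stabilizer n m \<sigma> y" 
      "\<And>i. i < s \<Longrightarrow> B i \<in> column_stabilizer n m \<sigma> y" "\<And>i j. i < s \<Longrightarrow> j < s \<Longrightarrow> bracket_form n x (A i) (B j) = (if i = j then 1 else 0)"
      using dp by (rule dual_pairsE) blast
    then have "bracket_form n x (\<lambda>a b. 0) (B 0) = 1"
      using zero[of "A 0" y] \<open>s \<noteq> 0\<close> by force
    then show False by (simp add: bracket_form_def mtrace_def mprod_def)
  qed
  show ?case
    using l Pd s0 by (auto simp: row_shape_def intro!: exI[of _ "\<lambda>_ _. 0"] exI[of _ 0])
next
  case (next_column m \<sigma> q)
  let ?P' = "Pd - {Suc m}"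
  have m: "1 \<le> Suc m" "Suc m \<le> n" using next_column by auto
  have inv: "invar (Suc m) \<sigma> ?P'" and op: "open_column (Suc m) \<sigma> ?P'"
    using invar_skip[OF next_column(6) next_column(5) next_column(1) next_column(2)] by auto
  note IH = next_column(4)[OF m(1) inv]
  have d: "dominated m \<sigma> = {}" using next_column(2) by (auto simp: dominated_def)
  have y0: "column_stabilizer n m \<sigma> y = pattern_algebra n (Suc m) \<sigma>" if "pivot_column m \<sigma> Pd y" for y :: "nat \<Rightarrow> 'a"
  proof -
    have "y b = 0" for b using that next_column(2) by (auto simp: pivot_column_def)
    then show ?thesis by (simp add: column_stabilizer_def)
  qed
  show ?case
  proof (intro conjI allI impI)
    fix x y s assume "row_shape (Suc m) Pd x" "pivot_column m \<sigma> Pd y"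
      "dual_pairs n x (column_stabilizer n m \<sigma> y) (column_stabilizer n m \<sigma> y) s"
    then have "s \<le> 2 * q"
      using upper_pattern[OF conjunct1[OF IH] inv m op, of x s] y0[of y] by (auto simp: row_shape_def)
    then show "s + 2 * card (dominated m \<sigma>) \<le> 2 * q" by (simp add: d)
  next
    fix y assume y: "pivot_column m \<sigma> Pd y"
    obtain x where x: "row_shape (Suc m) ?P' x" "dual_pairs n x (pattern_algebra n (Suc m) \<sigma>) (pattern_algebra n (Suc m) \<sigma>) (2 * q)"
      using lower_pattern[OF conjunct2[OF IH] inv m op] by blast
    have "row_shape (Suc m) Pd x" using x(1) by (auto simp: row_shape_def)
    then show "\<exists>x s. row_shape (Suc m) Pd x \<and> dual_pairs n x (column_stabilizer n m \<sigma> y) (column_stabilizer n m \<sigma> y) s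
        \<and> s + 2 * card (dominated m \<sigma>) = 2 * q"
      using x(2) by (auto simp: d y0[OF y])
  qed
next
  case (transpose m \<sigma> k q)
  let ?s = "\<sigma>(m := \<sigma> k, k := \<sigma> m)" and ?T = "{j \<in> live m \<sigma>. \<sigma> j < \<sigma> k}"
  note ne = transpose(1) and k = transpose(2) and m = transpose(5) and inv = transpose(6)
  note IH = transpose(4)[OF m invar_swap[OF inv m ne k]]
  note card = card_dominated[OF inv m ne k]
  have kf: "m < k" "k \<le> n" using k_facts[OF inv m ne k] by auto
  show ?case
  proof (intro conjI allI impI)
    fix x y s assume x: "row_shape (Suc m) Pd x" and y: "pivot_column m \<sigma> Pd y"
      and dp: "dual_pairs n x (column_stabilizer n m \<sigma> y) (column_stabilizer n m \<sigma> y) s"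
    interpret S: swap_step n m k \<sigma> y by (rule swap_step_Max[OF inv m ne k y])
    have "row_shape (Suc m) (Pd - {k}) (elem_conj n k S.\<nu> x)"
    proof (rule row_shape_elem_conj[OF x])
      show "k \<in> {1..n}" by (rule S.k_range)
      show "Pd - {k} \<subseteq> {m<..n}" using invar_Pd[OF inv] by auto
      show "a \<in> Pd \<and> S.\<nu> a = 0" if "a \<in> Pd - {k}" "(a, m) \<notin> D" for a
        using that y by (simp add: S.\<nu>_def pivot_column_def)
      show "m < b \<and> b < k" if "S.\<nu> b \<noteq> 0" for b using S.\<nu>_supp[OF that] by blast
    qed
    moreover have "pivot_column m ?s (Pd - {k}) S.y'"
      using pivot_column_swap[OF inv m ne k y] by (simp add: S.y'_def[abs_def])
    moreover have "dual_pairs n (elem_conj n k S.\<nu> x) (column_stabilizer n m ?s S.y') (column_stabilizer n m ?s S.y') s"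
      using S.dual_pairs_conj[OF dp] by (simp add: S.\<sigma>'_def)
    ultimately have "s + 2 * card (dominated m ?s) \<le> 2 * q" using IH by blast
    then show "s + 2 * card (dominated m \<sigma>) \<le> 2 * (q + card ?T)" using card by simp
  next
    fix y assume y: "pivot_column m \<sigma> Pd y"
    interpret S: swap_step n m k \<sigma> y by (rule swap_step_Max[OF inv m ne k y])
    have y': "pivot_column m ?s (Pd - {k}) S.y'"
      using pivot_column_swap[OF inv m ne k y] by (simp add: S.y'_def[abs_def])
    then obtain x s where x: "row_shape (Suc m) (Pd - {k}) x"
      "dual_pairs n x (column_stabilizer n m ?s S.y') (column_stabilizer n m ?s S.y') s" "s + 2 * card (dominated m ?s) = 2 * q"
      using IH by blast
    have kD: "(k, m) \<in> D" if "k \<in> Pd" using live_cases[OF inv m ne k that] .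
    have "row_shape (Suc m) Pd (elem_conj n k (\<lambda>a. - S.\<nu> a) x)"
    proof (rule row_shape_elem_conj[OF x(1)])
      show "k \<in> {1..n}" by (rule S.k_range)
      show "Pd \<subseteq> {m<..n}" using invar_Pd[OF inv] by auto
      show "a \<in> Pd - {k} \<and> - S.\<nu> a = 0" if "a \<in> Pd" "(a, m) \<notin> D" for a
        using that y kD by (auto simp: S.\<nu>_def pivot_column_def)
      show "m < b \<and> b < k" if "- S.\<nu> b \<noteq> 0" for b using S.\<nu>_supp[of b] that by simp
    qed
    moreover have "dual_pairs n (elem_conj n k (\<lambda>a. - S.\<nu> a) x) (column_stabilizer n m \<sigma> y) (column_stabilizer n m \<sigma> y) s"
      using S.dual_pairs_inv_conj x(2) by (simp add: S.\<sigma>'_def)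
    ultimately show "\<exists>x s. row_shape (Suc m) Pd x \<and> dual_pairs n x (column_stabilizer n m \<sigma> y) (column_stabilizer n m \<sigma> y) s
        \<and> s + 2 * card (dominated m \<sigma>) = 2 * (q + card ?T)"
      using x(3) card by (intro exI[of _ "elem_conj n k (\<lambda>a. - S.\<nu> a) x"] exI[of _ s]) simp
  qed
qed

theorem
  assumes "swaps 1 id q" "1 \<le> n"
  shows dual_pairs_upper: "row_shape 1 {1<..n} x \<Longrightarrow>
      dual_pairs n x (pattern_algebra n 1 id) (pattern_algebra n 1 id) s \<Longrightarrow> s \<le> 2 * q"
    and dual_pairs_lower: "\<exists>x. row_shape 1 {1<..n} x \<and> dual_pairs n x (pattern_algebra n 1 id) (pattern_algebra n 1 id) (2 * q)"
proof -
  have op: "open_column 1 id {1<..n}"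
  proof -
    have "(a, l) \<notin> D" if "l < 1" for a l using that D_pos[of a l] by auto
    then show ?thesis by (auto simp: open_column_def)
  qed
  note W = dual_pairs_column_stabilizer[OF assms(1) order_refl invar_initial]
  show "s \<le> 2 * q" if "row_shape 1 {1<..n} x" "dual_pairs n x (pattern_algebra n 1 id) (pattern_algebra n 1 id) s"
    using upper_pattern[OF conjunct1[OF W] invar_initial order_refl assms(2) op that] .
  show "\<exists>x. row_shape 1 {1<..n} x \<and> dual_pairs n x (pattern_algebra n 1 id) (pattern_algebra n 1 id) (2 * q)"
    using lower_pattern[OF conjunct2[OF W] invar_initial order_refl assms(2) op] .
qed

end

section \<open>Counting the crosses of the diagram\<close>

lemma greatest_empty_eq:
  assumes "(k, m) \<in> empty_places n f" "\<And>a b. (a, b) \<in> empty_places n f \<Longrightarrow> m < b \<or> (m = b \<and> a \<le> k)"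
  shows "greatest_empty n f = (k, m)"
  unfolding greatest_empty_def
proof (rule the_equality)
  show "(k, m) \<in> empty_places n f \<and> (\<forall>\<eta>\<in>empty_places n f. \<eta> \<noteq> (k, m) \<longrightarrow> root_succ (k, m) \<eta>)"
    using assms by (fastforce simp: root_succ_def)
next
  fix \<xi> assume \<xi>: "\<xi> \<in> empty_places n f \<and> (\<forall>\<eta>\<in>empty_places n f. \<eta> \<noteq> \<xi> \<longrightarrow> root_succ \<xi> \<eta>)"
  show "\<xi> = (k, m)"
  proof (rule ccontr)
    assume "\<xi> \<noteq> (k, m)"
    then have "root_succ \<xi> (k, m)" using bspec[OF conjunct2[OF \<xi>] assms(1)] by simp
    then show False using assms(2)[of "fst \<xi>" "snd \<xi>"] \<xi> by (auto simp: root_succ_def)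
  qed
qed

lemma greatest_empty_in:
  assumes "empty_places n f \<noteq> {}"
  shows "greatest_empty n f \<in> empty_places n f"
proof -
  let ?E = "empty_places n f"
  have fin: "finite ?E"
    by (rule finite_subset[of _ "{..n} \<times> {..n}"]) (auto simp: empty_places_def pos_roots_def)
  define m where "m = Min (snd ` ?E)"
  have m: "m \<in> snd ` ?E" unfolding m_def using fin assms by (intro Min_in) auto
  let ?K = "{a. (a, m) \<in> ?E}"
  have K: "finite ?K" "?K \<noteq> {}"
  proof -
    have "?K \<subseteq> fst ` ?E" by force
    then show "finite ?K" using finite_imageI[OF fin] by (rule finite_subset)
    show "?K \<noteq> {}" using m by auto
  qed
  have k: "(Max ?K, m) \<in> ?E" using Max_in[OF K] by simp
  have "greatest_empty n f = (Max ?K, m)"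
  proof (rule greatest_empty_eq[OF k])
    fix a b assume ab: "(a, b) \<in> ?E"
    then have "m \<le> b" unfolding m_def using fin by (intro Min_le) (auto intro: rev_image_eqI[OF ab])
    then show "m < b \<or> (m = b \<and> a \<le> Max ?K)"
      using ab Max_ge[OF K(1), of a] by (cases "m = b") auto
  qed
  then show ?thesis using k by simp
qed

lemma fill_step_mono:
  assumes "f \<alpha> = Some s"
  shows "fill_step n f \<alpha> = Some s"
proof -
  have "\<alpha> \<notin> empty_places n f" using assms by (simp add: empty_places_def)
  then show ?thesis
    using assms greatest_empty_in[of n f] by (auto simp: fill_step_def Let_def open_pair_def)
qed

lemma diagram_mono: "diagram n D t \<alpha> = Some s \<Longrightarrow> t \<le> t' \<Longrightarrow> diagram n D t' \<alpha> = Some s"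
proof (induction t')
  case (Suc t')
  then show ?case by (cases "t = Suc t'") (auto simp: fill_step_mono)
qed simp

context basic_roots
begin

text \<open>The places without a dot that are not inversions of the labels. These are the empty places of the
  diagram, each step of which transposes two labels.\<close>

definition open_places :: "nat \<Rightarrow> (nat \<Rightarrow> nat) \<Rightarrow> root set" where
  "open_places m \<sigma> = {(k, j). m \<le> j \<and> j < k \<and> k \<le> n \<and> \<sigma> j < \<sigma> k \<and> (k, j) \<notin> M_roots n D}"

lemma live_eq: "live m \<sigma> = {k. (k, m) \<in> open_places m \<sigma>}"
  by (auto simp: live_def open_places_def)

lemma finite_open_places: "finite (open_places m \<sigma>)"
  by (rule finite_subset[of _ "{..n} \<times> {..n}"]) (auto simp: open_places_def)

lemma open_places_next: "live m \<sigma> = {} \<Longrightarrow> open_places m \<sigma> = open_places (Suc m) \<sigma>"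
  by (fastforce simp: live_eq open_places_def le_eq_less_or_eq Suc_le_eq)

context
  fixes m k :: nat and \<sigma> :: "nat \<Rightarrow> nat" and Pd T
  assumes inv: "invar m \<sigma> Pd" and m: "1 \<le> m" and ne: "live m \<sigma> \<noteq> {}" and k: "k = Max (live m \<sigma>)"
    and T: "T = {j \<in> live m \<sigma>. \<sigma> j < \<sigma> k}"
begin

lemma T_less: "j \<in> T \<Longrightarrow> m < j \<and> j < k"
  using Max_live(2)[OF ne k, of j] unfolding T by (cases "j = k") (auto simp: live_def)

text \<open>Row \<open>k\<close> contains a root of \<open>D\<close> in column \<open>m\<close> or before, so that no dots follow in that row.\<close>

lemma Max_row_singular: "m < j \<Longrightarrow> (k, j) \<notin> M_roots n D"
proof -
  assume j: "m < j"
  have "\<exists>l\<le>m. (k, l) \<in> D"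
  proof (cases "k \<in> Pd")
    case True
    then show ?thesis using live_cases[OF inv m ne k] by auto
  next
    case False
    then show ?thesis
      using open_col[OF inv m ne k] k_facts[OF inv m ne k] by (auto simp: open_column_def)
  qed
  then show ?thesis using j by (auto simp: M_iff)
qed

lemma T_open: "j \<in> T \<longleftrightarrow> m < j \<and> (j, m) \<in> open_places m \<sigma> \<and> (k, j) \<in> open_places m \<sigma>"
  using T_less[of j] Max_row_singular[of j] k_facts[OF inv m ne k]
  by (auto simp: T live_eq open_places_def)

text \<open>Transposing the labels of \<open>m\<close> and \<open>k\<close> makes \<open>(k, m)\<close> and the places \<open>(j, m)\<close>, \<open>(k, j)\<close> with label
  between those of \<open>m\<close> and \<open>k\<close> inversions. These are the places that a step of the diagram fills
  with \<open>\<otimes>\<close>, \<open>+\<close> and \<open>-\<close>.\<close>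

lemma open_places_swap:
  "open_places m (\<sigma>(m := \<sigma> k, k := \<sigma> m))
    = open_places m \<sigma> - ({(k, m)} \<union> (\<lambda>j. (j, m)) ` T \<union> (\<lambda>j. (k, j)) ` T)" (is "?L = ?R")
proof -
  note kf = k_facts[OF inv m ne k]
  have inj: "inj_on \<sigma> {m..n}" using inv by (simp add: invar_def)
  let ?s = "\<sigma>(m := \<sigma> k, k := \<sigma> m)"
  have "(a, b) \<in> ?L \<longleftrightarrow> (a, b) \<in> ?R" for a b
  proof (cases "m \<le> b \<and> b < a \<and> a \<le> n \<and> (a, b) \<notin> M_roots n D")
    case True
    then have ab: "m \<le> b" "b < a" "a \<le> n" "(a, b) \<notin> M_roots n D" by auto
    have L: "(a, b) \<in> ?L \<longleftrightarrow> ?s b < ?s a" and O: "(a, b) \<in> open_places m \<sigma> \<longleftrightarrow> \<sigma> b < \<sigma> a"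
      using ab by (auto simp: open_places_def)
    have Tl: "j \<in> T \<longleftrightarrow> j \<in> live m \<sigma> \<and> \<sigma> j < \<sigma> k" for j by (simp add: T)
    consider "b = m" "a = k" | "b = m" "a \<noteq> k" | "b \<noteq> m" "a = k" | "b = k" | "b \<noteq> m" "b \<noteq> k" "a \<noteq> k" by blast
    then show ?thesis
    proof cases
      case 1
      then show ?thesis using L kf by simp
    next
      case 2
      have "\<sigma> a \<noteq> \<sigma> k" using inj_onD[OF inj, of a k] 2 ab kf by auto
      moreover have "a \<in> live m \<sigma> \<longleftrightarrow> \<sigma> m < \<sigma> a" using ab 2 by (auto simp: live_def)
      ultimately show ?thesis using 2 L O Tl[of a] kf ab by auto
    next
      case 3
      have bm: "m < b" using 3 ab by simp
      have "b \<in> live m \<sigma>" if s: "\<sigma> m < \<sigma> b" "\<sigma> b < \<sigma> k"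
        using live_down_closed[OF inv kf(4) bm _ s] ab 3 by simp
      moreover have "\<sigma> m \<noteq> \<sigma> b" using inj_onD[OF inj, of m b] bm ab by auto
      ultimately show ?thesis using 3 L O Tl[of b] kf ab by (auto simp: live_def)
    next
      case 4
      have "\<sigma> k < \<sigma> a" if "\<sigma> m < \<sigma> a"
        using above_less[OF inv m ne k, of a k] ab 4 that kf by simp
      then show ?thesis using 4 L O kf ab by auto
    next
      case 5
      then show ?thesis using L O ab by auto
    qed
  next
    case False
    then show ?thesis by (auto simp: open_places_def)
  qed
  then show ?thesis by auto
qed

lemma card_open_places:
  "card (open_places m \<sigma>) = card (open_places m (\<sigma>(m := \<sigma> k, k := \<sigma> m))) + 1 + 2 * card T"
proof -
  let ?A = "{(k, m)} \<union> (\<lambda>j. (j, m)) ` T \<union> (\<lambda>j. (k, j)) ` T"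
  have fT: "finite T" using finite_live by (simp add: T)
  have "(k, m) \<in> open_places m \<sigma>" using k_facts(4)[OF inv m ne k] by (simp add: live_eq)
  then have sub: "?A \<subseteq> open_places m \<sigma>" using T_open by auto
  have "(k, m) \<notin> (\<lambda>j. (j, m)) ` T" "({(k, m)} \<union> (\<lambda>j. (j, m)) ` T) \<inter> (\<lambda>j. (k, j)) ` T = {}"
    using T_less by auto
  then have "card ?A = 1 + card ((\<lambda>j. (j, m)) ` T) + card ((\<lambda>j. (k, j)) ` T)"
    using fT by (simp add: card_Un_disjoint)
  also have "\<dots> = 1 + 2 * card T"
    by (simp add: card_image inj_on_def)
  finally have A: "card ?A = 1 + 2 * card T" .
  have "card (open_places m \<sigma> - ?A) = card (open_places m \<sigma>) - card ?A"
    using finite_subset[OF sub finite_open_places] sub by (rule card_Diff_subset)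
  then show ?thesis
    unfolding open_places_swap using A card_mono[OF finite_open_places sub] by simp
qed

lemma fill_step_swap:
  assumes f: "empty_places n f = open_places m \<sigma>"
  shows "fill_step n f = (\<lambda>\<alpha>. if \<alpha> = (k, m) then Some Cross
     else if \<alpha> \<in> (\<lambda>j. (j, m)) ` T then Some Plus else if \<alpha> \<in> (\<lambda>j. (k, j)) ` T then Some Minus else f \<alpha>)"
proof -
  note kf = k_facts[OF inv m ne k]
  have g: "greatest_empty n f = (k, m)"
  proof (rule greatest_empty_eq)
    show "(k, m) \<in> empty_places n f" using kf(4) by (simp add: f live_eq)
    show "m < b \<or> (m = b \<and> a \<le> k)" if "(a, b) \<in> empty_places n f" for a b
      using that Max_live(2)[OF ne k, of a] unfolding f by (cases "b = m") (auto simp: live_eq open_places_def)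
  qed
  have ne': "empty_places n f \<noteq> {}" using kf(4) by (auto simp: f live_eq)
  have op: "open_pair n f (k, m) \<alpha> \<beta> \<longleftrightarrow> (\<exists>j\<in>T. \<alpha> = (j, m) \<and> \<beta> = (k, j))" for \<alpha> \<beta>
  proof
    assume o: "open_pair n f (k, m) \<alpha> \<beta>"
    then obtain j where j: "k > j" "j > m" "{\<alpha>, \<beta>} = {(k, j), (j, m)}" "snd \<alpha> = m" "fst \<beta> = k"
      by (auto simp: open_pair_def root_sum_def)
    then have "\<alpha> = (j, m)" "\<beta> = (k, j)" by (auto simp: doubleton_eq_iff)
    moreover from this have "j \<in> T" using o j by (auto simp: T_open open_pair_def f)
    ultimately show "\<exists>j\<in>T. \<alpha> = (j, m) \<and> \<beta> = (k, j)" by blast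
  next
    assume "\<exists>j\<in>T. \<alpha> = (j, m) \<and> \<beta> = (k, j)"
    then obtain j where j: "j \<in> T" "\<alpha> = (j, m)" "\<beta> = (k, j)" by blast
    then show "open_pair n f (k, m) \<alpha> \<beta>"
      using T_less[OF j(1)] T_open[of j] by (auto simp: open_pair_def root_sum_def f)
  qed
  have 1: "(\<exists>\<beta>. open_pair n f (k, m) \<alpha> \<beta>) \<longleftrightarrow> \<alpha> \<in> (\<lambda>j. (j, m)) ` T" for \<alpha> unfolding op by blast
  have 2: "(\<exists>\<beta>. open_pair n f (k, m) \<beta> \<alpha>) \<longleftrightarrow> \<alpha> \<in> (\<lambda>j. (k, j)) ` T" for \<alpha> unfolding op by blast
  show ?thesis unfolding fill_step_def Let_def g using ne' by (simp only: 1 2 if_False)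
qed

lemma empty_places_swap:
  assumes f: "empty_places n f = open_places m \<sigma>"
  shows "empty_places n (fill_step n f) = open_places m (\<sigma>(m := \<sigma> k, k := \<sigma> m))"
  unfolding open_places_swap f[symmetric] fill_step_swap[OF f] empty_places_def by auto

end

definition later_crosses :: "nat \<Rightarrow> root set" where
  "later_crosses t = {\<xi> \<in> empty_places n (diagram n D t). \<exists>i. diagram n D i \<xi> = Some Cross}"

lemma card_live: "card (live m \<sigma>) \<le> n"
proof -
  have "live m \<sigma> \<subseteq> {1..n}" by (auto simp: live_def)
  then show ?thesis using card_mono[of "{1..n}" "live m \<sigma>"] by simp
qed

text \<open>The measure is lexicographic: either the column increases, or the number of live rows, at most \<open>n\<close>,
  decreases.\<close>

theorem swaps_count:
  assumes "1 \<le> m" "invar m \<sigma> Pd" "empty_places n (diagram n D t) = open_places m \<sigma>"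
  shows "\<exists>q. swaps m \<sigma> q \<and> card (open_places m \<sigma>) = card (later_crosses t) + 2 * q"
  using assms
proof (induction "(n - m) * Suc n + card (live m \<sigma>)" arbitrary: m \<sigma> Pd t rule: less_induct)
  case less
  note m = less.prems(1) and inv = less.prems(2) and E = less.prems(3)
  consider "n \<le> m" | "m < n" "live m \<sigma> = {}" | "live m \<sigma> \<noteq> {}" by linarith
  then show ?case
  proof cases
    case 1
    then have "open_places m \<sigma> = {}" by (auto simp: open_places_def)
    then show ?thesis using exhausted[OF 1] E by (intro exI[of _ 0]) (simp add: later_crosses_def)
  next
    case 2
    have lt: "(n - Suc m) * Suc n + card (live (Suc m) \<sigma>) < (n - m) * Suc n + card (live m \<sigma>)"
    proof -
      have "(n - m) * Suc n = (n - Suc m) * Suc n + Suc n"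
        using 2(1) by (metis Suc_diff_Suc add.commute mult_Suc)
      then show ?thesis using card_live[of "Suc m" \<sigma>] by simp
    qed
    have E': "empty_places n (diagram n D t) = open_places (Suc m) \<sigma>"
      using E open_places_next[OF 2(2)] by simp
    obtain q where "swaps (Suc m) \<sigma> q" "card (open_places (Suc m) \<sigma>) = card (later_crosses t) + 2 * q"
      using less.hyps[OF lt _ invar_skip(1)[OF inv m 2(1) 2(2)] E'] by auto
    then show ?thesis using next_column[OF 2] open_places_next[OF 2(2)] by auto
  next
    case 3
    define k where "k = Max (live m \<sigma>)"
    define T where "T = {j \<in> live m \<sigma>. \<sigma> j < \<sigma> k}"
    let ?s = "\<sigma>(m := \<sigma> k, k := \<sigma> m)"
    note kf = k_facts[OF inv m 3 k_def]
    have "live m ?s \<subset> live m \<sigma>"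
      using live_swap[OF inv m 3 k_def] kf(4) by auto
    then have lt: "(n - m) * Suc n + card (live m ?s) < (n - m) * Suc n + card (live m \<sigma>)"
      using psubset_card_mono[OF finite_live] by simp
    have E': "empty_places n (diagram n D (Suc t)) = open_places m ?s"
      using empty_places_swap[OF inv m 3 k_def T_def E] by simp
    obtain q where q: "swaps m ?s q" "card (open_places m ?s) = card (later_crosses (Suc t)) + 2 * q"
      using less.hyps[OF lt m invar_swap[OF inv m 3 k_def] E'] by auto
    have d: "diagram n D (Suc t) = (\<lambda>\<alpha>. if \<alpha> = (k, m) then Some Cross
     else if \<alpha> \<in> (\<lambda>j. (j, m)) ` T then Some Plus else if \<alpha> \<in> (\<lambda>j. (k, j)) ` T then Some Minus else diagram n D t \<alpha>)"
      using fill_step_swap[OF inv m 3 k_def T_def E] by simp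
    have notcross: "diagram n D i \<xi> \<noteq> Some Cross"
      if \<xi>: "\<xi> \<in> (\<lambda>j. (j, m)) ` T \<union> (\<lambda>j. (k, j)) ` T" for i \<xi>
    proof
      assume c: "diagram n D i \<xi> = Some Cross"
      have "\<xi> \<noteq> (k, m)" using \<xi> T_less[OF inv m 3 k_def T_def] by auto
      then have s: "diagram n D (Suc t) \<xi> = Some Plus \<or> diagram n D (Suc t) \<xi> = Some Minus"
        using \<xi> unfolding d by auto
      show False
      proof (cases "i \<le> Suc t")
        case True
        then show ?thesis using diagram_mono[OF c True] s by auto
      next
        case False
        then show ?thesis using s c diagram_mono[of n D "Suc t" \<xi> Plus i] diagram_mono[of n D "Suc t" \<xi> Minus i] by auto
      qed
    qed
    have kin: "(k, m) \<in> open_places m \<sigma>" using kf(4) by (simp add: live_eq)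
    have "later_crosses t = insert (k, m) (later_crosses (Suc t))"
    proof (intro equalityI subsetI)
      fix \<xi> assume \<xi>: "\<xi> \<in> later_crosses t"
      then have "\<xi> \<in> open_places m \<sigma>" "\<xi> \<notin> (\<lambda>j. (j, m)) ` T \<union> (\<lambda>j. (k, j)) ` T"
        using notcross E by (auto simp: later_crosses_def)
      then have "\<xi> = (k, m) \<or> \<xi> \<in> empty_places n (diagram n D (Suc t))"
        unfolding E' open_places_swap[OF inv m 3 k_def T_def] by blast
      then show "\<xi> \<in> insert (k, m) (later_crosses (Suc t))"
        using \<xi> by (auto simp: later_crosses_def)
    next
      fix \<xi> assume "\<xi> \<in> insert (k, m) (later_crosses (Suc t))"
      then show "\<xi> \<in> later_crosses t"
      proof
        assume "\<xi> = (k, m)"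
        moreover have "diagram n D (Suc t) (k, m) = Some Cross" unfolding d by simp
        ultimately show ?thesis using kin E by (auto simp: later_crosses_def simp del: diagram.simps)
      next
        assume \<xi>: "\<xi> \<in> later_crosses (Suc t)"
        then have "\<xi> \<in> open_places m ?s" using E' by (simp add: later_crosses_def del: diagram.simps)
        then have "\<xi> \<in> open_places m \<sigma>" unfolding open_places_swap[OF inv m 3 k_def T_def] by blast
        then show ?thesis using \<xi> E by (simp add: later_crosses_def del: diagram.simps)
      qed
    qed
    moreover have "(k, m) \<notin> later_crosses (Suc t)"
      unfolding later_crosses_def E' open_places_swap[OF inv m 3 k_def T_def] by blast
    moreover have "finite (later_crosses (Suc t))"
      using finite_subset[OF _ finite_open_places[of m ?s]] E' by (auto simp: later_crosses_def simp del: diagram.simps)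
    ultimately have "card (later_crosses t) = Suc (card (later_crosses (Suc t)))" by simp
    then have "card (open_places m \<sigma>) = card (later_crosses t) + 2 * (q + card T)"
      using card_open_places[OF inv m 3 k_def T_def] q(2) by simp
    moreover have "swaps m \<sigma> (q + card T)"
      unfolding T_def using swaps.transpose[OF 3 k_def q(1)] .
    ultimately show ?thesis by blast
  qed
qed

theorem crosses_count:
  "\<exists>q. swaps 1 id q \<and> card (singular_roots n D \<union> D) = card (C_roots n D) + 2 * q"
proof -
  have e: "empty_places n (diagram n D 0) = open_places 1 id"
    by (auto simp: empty_places_def open_places_def pos_roots_def)
  have "open_places 1 id = singular_roots n D \<union> D"
    using D_pos by (auto simp: open_places_def M_roots_def regular_roots_def pos_roots_def singular_roots_def)
  moreover have "later_crosses 0 = C_roots n D"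
  proof -
    have "diagram n D 0 \<xi> = None" if "\<xi> \<in> C_roots n D" for \<xi>
    proof (rule ccontr)
      assume "diagram n D 0 \<xi> \<noteq> None"
      then have "diagram n D 0 \<xi> = Some Dot" by (auto split: if_splits)
      then have "diagram n D i \<xi> = Some Dot" for i by (rule diagram_mono) simp
      then show False using that by (simp add: C_roots_def)
    qed
    then show ?thesis by (auto simp: later_crosses_def C_roots_def empty_places_def simp del: diagram.simps)
  qed
  ultimately show ?thesis using swaps_count[OF order_refl invar_initial e] by simp
qed

end

section \<open>The unitriangular group and its actions\<close>

text \<open>The shift between matrices, which are indexed from 0, and functions on rows and columns from 1.\<close>

definition entry :: "'a mat \<Rightarrow> nat \<Rightarrow> nat \<Rightarrow> 'a" where
  "entry X i j = X $$ (i - 1, j - 1)"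

lemma sum_shift: "(\<Sum>l\<in>{0..<n}. f l) = (\<Sum>l\<in>{1..n::nat}. f (l - 1))"
  by (rule sum.reindex_bij_witness[of _ "\<lambda>l. l - 1" Suc]) auto

lemma entry_mult:
  assumes "A \<in> carrier_mat n n" "B \<in> carrier_mat n n" "i \<in> {1..n}" "j \<in> {1..n}"
  shows "entry (A * B) i j = mprod n (entry A) (entry B) i j"
proof -
  have "entry (A * B) i j = (\<Sum>l\<in>{0..<n}. A $$ (i - 1, l) * B $$ (l, j - 1))"
    using assms by (auto simp: entry_def scalar_prod_def)
  then show ?thesis by (simp add: sum_shift mprod_def entry_def)
qed

lemma UT_iff:
  "g \<in> carrier (UT n) \<longleftrightarrow> g \<in> carrier_mat n n \<and> (\<forall>i<n. \<forall>j<i. g $$ (i, j) = 0) \<and> (\<forall>i<n. g $$ (i, i) = 1)"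
  by (auto simp: UT_def upper_triangular_def)

lemma UT_mat: "g \<in> carrier (UT n) \<Longrightarrow> g \<in> carrier_mat n n" by (simp add: UT_iff)

lemma UT_simps: "monoid.mult (UT n) = (*)" "one (UT n) = 1\<^sub>m n" by (simp_all add: UT_def)

lemma UT_entry:
  assumes "g \<in> carrier (UT n)" "i \<in> {1..n}" "j \<in> {1..n}"
  shows "j < i \<Longrightarrow> entry g i j = 0" "i = j \<Longrightarrow> entry g i j = 1"
  using assms by (auto simp: UT_iff entry_def)

lemma UT_mult_closed:
  assumes g: "g \<in> carrier (UT n)" and h: "h \<in> carrier (UT n :: 'a::field mat monoid)"
  shows "g * h \<in> carrier (UT n)"
proof -
  have e: "(g * h) $$ (i, j) = (\<Sum>l\<in>{0..<n}. g $$ (i, l) * h $$ (l, j))" if "i < n" "j < n" for i j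
    using g h that by (auto simp: UT_iff scalar_prod_def)
  have "(g * h) $$ (i, j) = 0" if "i < n" "j < i" for i j
  proof -
    have "g $$ (i, l) * h $$ (l, j) = 0" if "l < n" for l
      using g h that \<open>i < n\<close> \<open>j < i\<close> by (cases "l < i") (auto simp: UT_iff)
    then have "(\<Sum>l\<in>{0..<n}. g $$ (i, l) * h $$ (l, j)) = 0" by (intro sum.neutral) auto
    then show ?thesis using e[of i j] that by simp
  qed
  moreover have "(g * h) $$ (i, i) = 1" if "i < n" for i
  proof -
    have "(g * h) $$ (i, i) = (\<Sum>l\<in>{0..<n}. if l = i then 1 else 0)"
      unfolding e[OF that that]
    proof (rule sum.cong[OF refl])
      fix l assume "l \<in> {0..<n}"
      then show "g $$ (i, l) * h $$ (l, i) = (if l = i then 1 else 0)"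
        using g h that by (cases "l < i"; cases "l = i") (auto simp: UT_iff)
    qed
    then show ?thesis using that by simp
  qed
  ultimately show ?thesis using g h by (auto simp: UT_iff)
qed

text \<open>The inverse exists by the determinant; that it is unitriangular follows by reading \<open>h * g = 1\<close>
  column by column.\<close>

lemma UT_left_inverse:
  assumes g: "g \<in> carrier (UT n :: 'a::field mat monoid)"
  shows "\<exists>h\<in>carrier (UT n). h * g = 1\<^sub>m n"
proof -
  have gm: "g \<in> carrier_mat n n" "upper_triangular g" using g by (auto simp: UT_def)
  have "diag_mat g = replicate n 1"
    using g by (auto simp: diag_mat_def UT_iff intro!: nth_equalityI)
  then have "det g \<noteq> 0" using det_upper_triangular[OF gm(2,1)] by simp
  then have "g \<in> Units (ring_mat TYPE('a) n n)" by (rule det_non_zero_imp_unit[OF gm(1)])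
  then obtain h where h: "h \<in> carrier_mat n n" "h * g = 1\<^sub>m n"
    by (auto simp: Units_def ring_mat_def)
  have e: "(\<Sum>l\<in>{0..<n}. h $$ (i, l) * g $$ (l, j)) = (if i = j then 1 else 0)" if "i < n" "j < n" for i j
  proof -
    have "(h * g) $$ (i, j) = (\<Sum>l\<in>{0..<n}. h $$ (i, l) * g $$ (l, j))"
      using gm h(1) that by (auto simp: scalar_prod_def)
    moreover have "(h * g) $$ (i, j) = (if i = j then 1 else 0)" unfolding h(2) using that by simp
    ultimately show ?thesis by simp
  qed
  have "(\<forall>i<n. j < i \<longrightarrow> h $$ (i, j) = 0) \<and> h $$ (j, j) = 1" if "j < n" for j
    using that
  proof (induction j rule: less_induct)
    case (less j)
    have *: "h $$ (i, j) = (if i = j then 1 else 0)" if i: "i < n" "j \<le> i" for i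
    proof -
      have "(\<Sum>l\<in>{0..<n}. h $$ (i, l) * g $$ (l, j)) = (\<Sum>l\<in>{0..<n}. if l = j then h $$ (i, j) else 0)"
      proof (rule sum.cong[OF refl])
        fix l assume l: "l \<in> {0..<n}"
        consider "l < j" | "l = j" | "j < l" by linarith
        then show "h $$ (i, l) * g $$ (l, j) = (if l = j then h $$ (i, j) else 0)"
        proof cases
          case 1
          then have "h $$ (i, l) = 0" using less i by auto
          then show ?thesis using 1 by simp
        qed (use g l less in \<open>auto simp: UT_iff\<close>)
      qed
      then show ?thesis using e[OF i(1) less.prems] less.prems by simp
    qed
    then show ?case using less.prems by auto
  qed
  then have "h \<in> carrier (UT n)" using h by (auto simp: UT_iff)
  then show ?thesis using h by blast
qed

lemma UT_group: "group (UT n :: 'a::field mat monoid)"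
proof (rule groupI)
  show "\<one>\<^bsub>UT n\<^esub> \<in> carrier (UT n :: 'a mat monoid)" by (auto simp: UT_def)
  show "x \<otimes>\<^bsub>UT n\<^esub> y \<in> carrier (UT n)" if "x \<in> carrier (UT n)" "y \<in> carrier (UT n :: 'a mat monoid)" for x y
    using UT_mult_closed[OF that] by (simp add: UT_simps)
  show "x \<otimes>\<^bsub>UT n\<^esub> y \<otimes>\<^bsub>UT n\<^esub> z = x \<otimes>\<^bsub>UT n\<^esub> (y \<otimes>\<^bsub>UT n\<^esub> z)"
    if "x \<in> carrier (UT n)" "y \<in> carrier (UT n)" "z \<in> carrier (UT n :: 'a mat monoid)" for x y z
    using that assoc_mult_mat[of x n n y n z n] by (simp add: UT_simps UT_mat)
  show "\<one>\<^bsub>UT n\<^esub> \<otimes>\<^bsub>UT n\<^esub> x = x" if "x \<in> carrier (UT n :: 'a mat monoid)" for x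
    using left_mult_one_mat[OF UT_mat[OF that]] by (simp add: UT_simps)
  show "\<exists>y\<in>carrier (UT n). y \<otimes>\<^bsub>UT n\<^esub> x = \<one>\<^bsub>UT n\<^esub>" if "x \<in> carrier (UT n :: 'a mat monoid)" for x
    using UT_left_inverse[OF that] by (simp add: UT_simps)
qed

lemma UT_inv:
  assumes "g \<in> carrier (UT n :: 'a::field mat monoid)"
  shows "inv\<^bsub>UT n\<^esub> g \<in> carrier (UT n)" "inv\<^bsub>UT n\<^esub> g * g = 1\<^sub>m n" "g * inv\<^bsub>UT n\<^esub> g = 1\<^sub>m n"
    "inv\<^bsub>UT n\<^esub> g \<in> carrier_mat n n" "inv\<^bsub>UT n\<^esub> (inv\<^bsub>UT n\<^esub> g) = g"
  using group.inv_closed[OF UT_group assms] group.l_inv[OF UT_group assms] group.r_inv[OF UT_group assms]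
    group.inv_inv[OF UT_group assms]
  by (simp_all add: UT_simps UT_mat)

lemma UT_inv_mult:
  assumes "g \<in> carrier (UT n)" "h \<in> carrier (UT n :: 'a::field mat monoid)"
  shows "inv\<^bsub>UT n\<^esub> (g * h) = inv\<^bsub>UT n\<^esub> h * inv\<^bsub>UT n\<^esub> g"
  using group.inv_mult_group[OF UT_group assms] by (simp add: UT_simps)

definition strictly_lower :: "nat \<Rightarrow> 'a::field mat set" where
  "strictly_lower n = {X \<in> carrier_mat n n. \<forall>i<n. \<forall>j<n. i \<le> j \<longrightarrow> X $$ (i, j) = 0}"

lemma strictly_lower_mat: "X \<in> strictly_lower n \<Longrightarrow> X \<in> carrier_mat n n"
  by (simp add: strictly_lower_def)

lemma strict_lower_in: "strict_lower n A \<in> strictly_lower n"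
  by (auto simp: strict_lower_def strictly_lower_def)

lemma strict_lower_id: "X \<in> strictly_lower n \<Longrightarrow> strict_lower n X = X"
  by (rule eq_matI) (auto simp: strict_lower_def strictly_lower_def)

lemma strict_lower_eqI:
  assumes "\<And>i j. j < i \<Longrightarrow> i < n \<Longrightarrow> A $$ (i, j) = B $$ (i, j)"
  shows "strict_lower n A = strict_lower n B"
  by (rule eq_matI) (auto simp: strict_lower_def assms)

lemma strictly_lower_eqI:
  assumes "X \<in> strictly_lower n" "Y \<in> strictly_lower n"
    "\<And>i j. (i, j) \<in> pos_roots n \<Longrightarrow> entry X i j = entry Y i j"
  shows "X = Y"
proof -
  have "strict_lower n X = strict_lower n Y"
    using assms(3)[of "Suc _" "Suc _"] by (intro strict_lower_eqI) (auto simp: pos_roots_def entry_def)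
  then show ?thesis using assms by (simp add: strict_lower_id)
qed

lemma triple_index:
  assumes "A \<in> carrier_mat n n" "B \<in> carrier_mat n n" "C \<in> carrier_mat n n" "i < n" "j < n"
  shows "(A * B * C) $$ (i, j) = (\<Sum>l\<in>{0..<n}. (\<Sum>k\<in>{0..<n}. A $$ (i, k) * B $$ (k, l)) * C $$ (l, j))"
proof -
  have "(A * B * C) $$ (i, j) = (\<Sum>l\<in>{0..<n}. (A * B) $$ (i, l) * C $$ (l, j))"
    using assms by (simp add: scalar_prod_def del: assoc_mult_mat)
  also have "\<dots> = (\<Sum>l\<in>{0..<n}. (\<Sum>k\<in>{0..<n}. A $$ (i, k) * B $$ (k, l)) * C $$ (l, j))"
    using assms by (intro sum.cong refl) (simp add: scalar_prod_def)
  finally show ?thesis .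
qed

text \<open>Truncation to the strictly lower part commutes with the action because the upper triangular
  matrices form an invariant subspace.\<close>

lemma strict_lower_sandwich:
  assumes g: "g \<in> carrier (UT n)" and h: "h \<in> carrier (UT n)" and A: "A \<in> carrier_mat n n"
  shows "strict_lower n (g * strict_lower n A * h) = strict_lower n (g * A * h)"
proof (rule strict_lower_eqI)
  fix i j assume ij: "j < i" "i < n"
  have S: "strict_lower n A \<in> carrier_mat n n" by (simp add: strict_lower_def)
  have "(\<Sum>k\<in>{0..<n}. g $$ (i, k) * strict_lower n A $$ (k, l)) * h $$ (l, j)
      = (\<Sum>k\<in>{0..<n}. g $$ (i, k) * A $$ (k, l)) * h $$ (l, j)" if l: "l < n" for l
  proof (cases "l \<le> j")
    case True
    have "(\<Sum>k\<in>{0..<n}. g $$ (i, k) * strict_lower n A $$ (k, l)) = (\<Sum>k\<in>{0..<n}. g $$ (i, k) * A $$ (k, l))"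
    proof (rule sum.cong[OF refl])
      fix k assume "k \<in> {0..<n}"
      then show "g $$ (i, k) * strict_lower n A $$ (k, l) = g $$ (i, k) * A $$ (k, l)"
        using g True ij by (cases "k < i") (auto simp: UT_iff strict_lower_def)
    qed
    then show ?thesis by simp
  next
    case False
    then show ?thesis using h l by (auto simp: UT_iff)
  qed
  then show "(g * strict_lower n A * h) $$ (i, j) = (g * A * h) $$ (i, j)"
    unfolding triple_index[OF UT_mat[OF g] S UT_mat[OF h] ij(2) less_trans[OF ij]]
      triple_index[OF UT_mat[OF g] A UT_mat[OF h] ij(2) less_trans[OF ij]]
    by (intro sum.cong refl) simp
qed

lemma coadj_in: "coadj_act n g X \<in> strictly_lower n"
  by (simp add: coadj_act_def strict_lower_in)

lemma coadj_mult:
  assumes g: "g \<in> carrier (UT n)" and h: "h \<in> carrier (UT n)" and X: "X \<in> carrier_mat n n"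
  shows "coadj_act n (g * h) X = coadj_act n g (coadj_act n h X)"
proof -
  note m = UT_mat[OF g] UT_mat[OF h] UT_inv(4)[OF g] UT_inv(4)[OF h]
  have "g * (h * X * inv\<^bsub>UT n\<^esub> h) * inv\<^bsub>UT n\<^esub> g = g * h * X * (inv\<^bsub>UT n\<^esub> h * inv\<^bsub>UT n\<^esub> g)"
    using m X by (simp add: assoc_mult_mat[of _ n n _ n _ n])
  moreover have "h * X * inv\<^bsub>UT n\<^esub> h \<in> carrier_mat n n" using m X by simp
  ultimately show ?thesis
    unfolding coadj_act_def using strict_lower_sandwich[OF g UT_inv(1)[OF g]] by (simp add: UT_inv_mult[OF g h])
qed

lemma coadj_one: "X \<in> strictly_lower n \<Longrightarrow> coadj_act n (1\<^sub>m n) X = X"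
proof -
  assume X: "X \<in> strictly_lower n"
  have "inv\<^bsub>UT n\<^esub> (1\<^sub>m n) = (1\<^sub>m n :: 'a mat)"
    using monoid.inv_one[OF group.is_monoid[OF UT_group], of n] by (simp add: UT_simps)
  then show ?thesis using X strictly_lower_mat[OF X] by (simp add: coadj_act_def strict_lower_id)
qed

lemma coadj_inv:
  assumes g: "g \<in> carrier (UT n)" and X: "X \<in> strictly_lower n"
  shows "coadj_act n (inv\<^bsub>UT n\<^esub> g) (coadj_act n g X) = X" "coadj_act n g (coadj_act n (inv\<^bsub>UT n\<^esub> g) X) = X"
  using coadj_mult[OF UT_inv(1)[OF g] g strictly_lower_mat[OF X]] coadj_mult[OF g UT_inv(1)[OF g] strictly_lower_mat[OF X]]
    UT_inv(2,3)[OF g] coadj_one[OF X] by simp_all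

text \<open>The relation \<open>Y g = g X\<close> holds below the diagonal, where it avoids the inverse of \<open>g\<close>.\<close>

lemma coadj_relation:
  assumes g: "g \<in> carrier (UT n)" and X: "X \<in> carrier_mat n n" and ij: "(i, j) \<in> pos_roots n"
  shows "mprod n (entry g) (entry X) i j = mprod n (entry (coadj_act n g X)) (entry g) i j"
proof -
  let ?Y = "coadj_act n g X" and ?Z = "g * X * inv\<^bsub>UT n\<^esub> g"
  have Z: "?Z \<in> carrier_mat n n" using UT_mat[OF g] X UT_inv(4)[OF g] by simp
  have Y: "?Y \<in> carrier_mat n n" using coadj_in strictly_lower_mat by blast
  have r: "i \<in> {1..n}" "j \<in> {1..n}" "j < i" using ij by (auto simp: pos_roots_def)
  have "g * X = ?Z * g"
    using UT_mat[OF g] X UT_inv(4)[OF g] UT_inv(2)[OF g] by (simp add: assoc_mult_mat[of _ n n _ n _ n])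
  then have "mprod n (entry g) (entry X) i j = mprod n (entry ?Z) (entry g) i j"
    using entry_mult[OF UT_mat[OF g] X r(1,2)] entry_mult[OF Z UT_mat[OF g] r(1,2)] by simp
  also have "\<dots> = mprod n (entry ?Y) (entry g) i j"
    unfolding mprod_def
  proof (rule sum.cong[OF refl])
    fix l assume l: "l \<in> {1..n}"
    show "entry ?Z i l * entry g l j = entry ?Y i l * entry g l j"
    proof (cases "j < l")
      case True
      then show ?thesis using UT_entry(1)[OF g l r(2)] by simp
    next
      case False
      then have "entry ?Y i l = entry ?Z i l"
        using l r Z by (auto simp: entry_def coadj_act_def strict_lower_def)
      then show ?thesis by simp
    qed
  qed
  finally show ?thesis .
qed

section \<open>The infinitesimal coadjoint action\<close>

abbreviation nilradical :: "nat \<Rightarrow> (nat \<Rightarrow> nat \<Rightarrow> 'a::field) set" where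
  "nilradical n \<equiv> pattern_algebra n 1 id"

lemma nilradical_iff: "A \<in> nilradical n \<longleftrightarrow> (\<forall>a b. A a b \<noteq> 0 \<longrightarrow> 1 \<le> a \<and> a < b \<and> b \<le> n)"
  by (auto simp: pattern_algebra_def)

lemma nilradicalD: "A \<in> nilradical n \<Longrightarrow> A a b \<noteq> 0 \<Longrightarrow> 1 \<le> a \<and> a < b \<and> b \<le> n"
  by (auto simp: pattern_algebra_def)

text \<open>The derivative of the coadjoint action at \<open>x\<close> in the direction \<open>A\<close>.\<close>

definition ad :: "nat \<Rightarrow> (nat \<Rightarrow> nat \<Rightarrow> 'a::field) \<Rightarrow> (nat \<Rightarrow> nat \<Rightarrow> 'a) \<Rightarrow> root \<Rightarrow> 'a" where
  "ad n x A = (\<lambda>(i, j). mprod n A x i j - mprod n x A i j)"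

lemma ad_add: "ad n x (\<lambda>a b. A a b + c * B a b) \<xi> = ad n x A \<xi> + c * ad n x B \<xi>"
  by (cases \<xi>) (simp add: ad_def mprod_def algebra_simps sum.distrib sum_distrib_left)

lemma bracket_form_ad:
  "bracket_form n x A B = - (\<Sum>i\<in>{1..n}. \<Sum>j\<in>{1..n}. ad n x A (i, j) * B j i)"
proof -
  have tr: "mtrace n (mprod n C B) = (\<Sum>i\<in>{1..n}. \<Sum>j\<in>{1..n}. C i j * B j i)" for C
    by (simp add: mtrace_def mprod_def)
  have "bracket_form n x A B = mtrace n (mprod n (mprod n x A) B) - mtrace n (mprod n (mprod n A x) B)"
    unfolding bracket_form_def mprod_assoc
    using mtrace_mprod_commute[of n A "mprod n x B"] by (simp add: mprod_assoc)
  then show ?thesis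
    by (simp add: tr ad_def sum_subtractf[symmetric] sum_negf[symmetric] algebra_simps)
qed

text \<open>The linear substitute \<open>1 + A\<close> of the exponential. It reaches the whole group, and on the first coordinate
  that changes its effect is the infinitesimal one.\<close>

definition exp1 :: "nat \<Rightarrow> (nat \<Rightarrow> nat \<Rightarrow> 'a::field) \<Rightarrow> 'a mat" where
  "exp1 n A = mat n n (\<lambda>(i, j). (if i = j then 1 else 0) + A (Suc i) (Suc j))"

lemma exp1_in: "A \<in> nilradical n \<Longrightarrow> exp1 n A \<in> carrier (UT n)"
proof -
  assume A: "A \<in> pattern_algebra n 1 id"
  have "A (Suc i) (Suc j) = 0" if "j \<le> i" for i j
    using nilradicalD[OF A, of "Suc i" "Suc j"] that by linarith
  then show ?thesis unfolding UT_iff exp1_def by simp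
qed

lemma exp1_entry: "i \<in> {1..n} \<Longrightarrow> j \<in> {1..n} \<Longrightarrow> entry (exp1 n A) i j = (if i = j then 1 else 0) + A i j"
  by (auto simp: exp1_def entry_def)

lemma UT_exp1:
  assumes "g \<in> carrier (UT n)"
  obtains A where "A \<in> nilradical n" "g = exp1 n A"
proof -
  define A where "A i j = (if 1 \<le> i \<and> i < j \<and> j \<le> n then entry g i j else 0)" for i j
  have "A \<in> nilradical n" unfolding nilradical_iff by (auto simp: A_def)
  moreover have "g = exp1 n A"
    using assms by (intro eq_matI) (auto simp: exp1_def A_def UT_iff entry_def not_less le_less)
  ultimately show thesis by (rule that)
qed

text \<open>The error of the linear approximation involves only changes of coordinates in the same row to the
  left, which precede \<open>(i, j)\<close> in the order.\<close>

lemma coadj_exp1: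
  assumes A: "A \<in> nilradical n" and X: "X \<in> strictly_lower n" and ij: "(i, j) \<in> pos_roots n"
  shows "entry (coadj_act n (exp1 n A) X) i j - entry X i j = ad n (entry X) A (i, j)
     - (\<Sum>l\<in>{1..<j}. (entry (coadj_act n (exp1 n A) X) i l - entry X i l) * A l j)"
proof -
  let ?Y = "coadj_act n (exp1 n A) X" and ?g = "exp1 n A"
  have r: "i \<in> {1..n}" "j \<in> {1..n}" "j < i" using ij by (auto simp: pos_roots_def)
  have "mprod n (entry ?g) (entry X) i j = entry X i j + mprod n A (entry X) i j"
  proof -
    have "mprod n (entry ?g) (entry X) i j = (\<Sum>l\<in>{1..n}. (if l = i then entry X l j else 0) + A i l * entry X l j)"
      unfolding mprod_def by (rule sum.cong) (use r in \<open>auto simp: exp1_entry algebra_simps\<close>)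
    then show ?thesis using r by (simp add: sum.distrib mprod_def)
  qed
  moreover have "mprod n (entry ?Y) (entry ?g) i j = entry ?Y i j + mprod n (entry ?Y) A i j"
  proof -
    have "mprod n (entry ?Y) (entry ?g) i j = (\<Sum>l\<in>{1..n}. (if l = j then entry ?Y i l else 0) + entry ?Y i l * A l j)"
      unfolding mprod_def by (rule sum.cong) (use r in \<open>auto simp: exp1_entry algebra_simps\<close>)
    then show ?thesis using r by (simp add: sum.distrib mprod_def)
  qed
  moreover have "mprod n (entry ?Y) A i j - mprod n (entry X) A i j = (\<Sum>l\<in>{1..<j}. (entry ?Y i l - entry X i l) * A l j)"
  proof -
    have "mprod n (entry ?Y) A i j - mprod n (entry X) A i j = (\<Sum>l\<in>{1..n}. (entry ?Y i l - entry X i l) * A l j)"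
      by (simp add: mprod_def sum_subtractf algebra_simps)
    also have "\<dots> = (\<Sum>l\<in>{1..<j}. (entry ?Y i l - entry X i l) * A l j)"
    proof (rule sum.mono_neutral_right)
      show "\<forall>l\<in>{1..n} - {1..<j}. (entry ?Y i l - entry X i l) * A l j = 0"
      proof
        fix l assume "l \<in> {1..n} - {1..<j}"
        then have "A l j = 0" using nilradicalD[OF A, of l j] by auto
        then show "(entry ?Y i l - entry X i l) * A l j = 0" by simp
      qed
    qed (use r in auto)
    finally show ?thesis .
  qed
  ultimately show ?thesis
    using coadj_relation[OF exp1_in[OF A] strictly_lower_mat[OF X] ij] by (simp add: ad_def algebra_simps)
qed

lemma coadj_exp1_step:
  assumes A: "A \<in> nilradical n" and X: "X \<in> strictly_lower n" and ij: "(i, j) \<in> pos_roots n"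
    and eq: "\<And>l. 1 \<le> l \<Longrightarrow> l < j \<Longrightarrow> entry (coadj_act n (exp1 n A) X) i l = entry X i l"
  shows "entry (coadj_act n (exp1 n A) X) i j = entry X i j + ad n (entry X) A (i, j)"
proof -
  have "(\<Sum>l\<in>{1..<j}. (entry (coadj_act n (exp1 n A) X) i l - entry X i l) * A l j) = 0"
    using eq by (intro sum.neutral) auto
  then show ?thesis using coadj_exp1[OF A X ij] by (simp add: algebra_simps)
qed

lemma coadj_exp1_keeps:
  assumes A: "A \<in> nilradical n" and X: "X \<in> strictly_lower n"
    and z: "\<And>\<eta>. \<eta> \<in> pos_roots n \<Longrightarrow> root_succ \<eta> \<zeta> \<Longrightarrow> ad n (entry X) A \<eta> = 0"
    and ij: "(i, j) \<in> pos_roots n" "root_succ (i, j) \<zeta>"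
  shows "entry (coadj_act n (exp1 n A) X) i j = entry X i j"
  using ij
proof (induction j rule: less_induct)
  case (less j)
  have "entry (coadj_act n (exp1 n A) X) i l = entry X i l" if "1 \<le> l" "l < j" for l
    using less.IH[OF that(2)] that less.prems by (auto simp: pos_roots_def root_succ_def)
  then show ?case using coadj_exp1_step[OF A X less.prems(1)] z[OF less.prems] by simp
qed

section \<open>Jumps of the coadjoint action\<close>

text \<open>Row \<open>\<zeta>\<close> of the matrix of \<open>A \<mapsto> ad n x A\<close> is not a combination of the rows of greater roots.\<close>

definition jump :: "nat \<Rightarrow> (nat \<Rightarrow> nat \<Rightarrow> 'a::field) \<Rightarrow> root \<Rightarrow> bool" where
  "jump n x \<zeta> \<longleftrightarrow> (\<exists>A\<in>nilradical n. (\<forall>\<eta>\<in>pos_roots n. root_succ \<eta> \<zeta> \<longrightarrow> ad n x A \<eta> = 0) \<and> ad n x A \<zeta> \<noteq> 0)"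

definition jumps :: "nat \<Rightarrow> (nat \<Rightarrow> nat \<Rightarrow> 'a::field) \<Rightarrow> root set" where
  "jumps n x = {\<zeta> \<in> pos_roots n. jump n x \<zeta>}"

text \<open>The functionals \<open>A \<mapsto> ad n x A \<eta>\<close> for \<open>\<eta> \<in> I\<close> are linearly independent, expressed by a dual family.\<close>

definition row_independent :: "nat \<Rightarrow> (nat \<Rightarrow> nat \<Rightarrow> 'a::field) \<Rightarrow> root set \<Rightarrow> bool" where
  "row_independent n x I \<longleftrightarrow> (\<exists>A. \<forall>\<eta>\<in>I. A \<eta> \<in> nilradical n \<and>
      (\<forall>\<eta>'\<in>I. ad n x (A \<eta>) \<eta>' = (if \<eta> = \<eta>' then 1 else 0)))"

lemma finite_pos_roots: "finite (pos_roots n)"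
  by (rule finite_subset[of _ "{..n} \<times> {..n}"]) (auto simp: pos_roots_def)

lemma finite_jumps: "finite (jumps n x)"
  by (rule finite_subset[OF _ finite_pos_roots]) (auto simp: jumps_def)

lemma root_succ_total: "\<xi> \<noteq> \<eta> \<Longrightarrow> root_succ \<xi> \<eta> \<or> root_succ \<eta> \<xi>"
  by (cases \<xi>; cases \<eta>) (auto simp: root_succ_def)

lemma root_succ_trans: "root_succ \<xi> \<eta> \<Longrightarrow> root_succ \<eta> \<zeta> \<Longrightarrow> root_succ \<xi> \<zeta>"
  by (auto simp: root_succ_def)

lemma root_succ_irrefl: "\<not> root_succ \<xi> \<xi>"
  by (simp add: root_succ_def)

text \<open>Induction from greater to smaller roots.\<close>

lemma root_succ_induct [consumes 1, case_names step]:
  assumes "\<xi> \<in> pos_roots n"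
    and "\<And>\<xi>. \<xi> \<in> pos_roots n \<Longrightarrow> (\<And>\<eta>. \<eta> \<in> pos_roots n \<Longrightarrow> root_succ \<eta> \<xi> \<Longrightarrow> P \<eta>) \<Longrightarrow> P \<xi>"
  shows "P \<xi>"
proof -
  define h where "h \<xi> = card {\<eta> \<in> pos_roots n. root_succ \<eta> \<xi>}" for \<xi>
  show ?thesis using assms(1)
  proof (induction "h \<xi>" arbitrary: \<xi> rule: less_induct)
    case less
    show ?case
    proof (rule assms(2)[OF less.prems])
      fix \<eta> assume \<eta>: "\<eta> \<in> pos_roots n" "root_succ \<eta> \<xi>"
      have "{\<zeta> \<in> pos_roots n. root_succ \<zeta> \<eta>} \<subset> {\<zeta> \<in> pos_roots n. root_succ \<zeta> \<xi>}"
        using \<eta> root_succ_trans root_succ_irrefl by blast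
      then have "h \<eta> < h \<xi>" unfolding h_def using finite_pos_roots by (intro psubset_card_mono) simp_all
      then show "P \<eta>" using less.hyps \<eta> by blast
    qed
  qed
qed

lemma nilradical_lin: "A \<in> nilradical n \<Longrightarrow> B \<in> nilradical n \<Longrightarrow> (\<lambda>a b. A a b + c * B a b) \<in> nilradical n"
  by (rule lin_closedD[OF lin_closed_pattern_algebra])

lemma nilradical_scale: 
  assumes "A \<in> nilradical n"
  shows "(\<lambda>a b. c * A a b) \<in> nilradical n"
  using nilradical_lin[OF assms assms, of "c - 1"] by (simp add: algebra_simps)

lemma ad_scale: "ad n x (\<lambda>a b. c * A a b) \<xi> = c * ad n x A \<xi>"
  by (cases \<xi>) (simp add: ad_def mprod_def sum_distrib_left algebra_simps)

lemma ad_vanishes: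
  assumes A: "A \<in> nilradical n" and z: "\<And>\<eta>. \<eta> \<in> jumps n x \<Longrightarrow> root_succ \<eta> \<zeta> \<Longrightarrow> ad n x A \<eta> = 0"
    and \<eta>: "\<eta> \<in> pos_roots n" "root_succ \<eta> \<zeta>"
  shows "ad n x A \<eta> = 0"
  using \<eta>
proof (induction rule: root_succ_induct)
  case (step \<xi>)
  have "\<And>\<eta>. \<eta> \<in> pos_roots n \<Longrightarrow> root_succ \<eta> \<xi> \<Longrightarrow> ad n x A \<eta> = 0"
    using step root_succ_trans by blast
  then show ?case
    using z[of \<xi>] step A by (cases "jump n x \<xi>") (auto simp: jumps_def jump_def)
qed

text \<open>A triangular system with nonzero diagonal is brought to diagonal form, beginning with the smallest
  root.\<close>

lemma row_independent_triangular:
  assumes fin: "finite I" and I: "I \<subseteq> pos_roots n"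
    and A: "\<And>\<zeta>. \<zeta> \<in> I \<Longrightarrow> \<exists>A\<in>nilradical n. (\<forall>\<eta>\<in>I. root_succ \<eta> \<zeta> \<longrightarrow> ad n x A \<eta> = 0) \<and> ad n x A \<zeta> \<noteq> 0"
  shows "row_independent n x I"
proof -
  have "\<exists>B\<in>nilradical n. \<forall>\<eta>\<in>I. ad n x B \<eta> = (if \<eta> = \<zeta> then 1 else 0)" if "\<zeta> \<in> I" for \<zeta>
    using that
  proof (induction "card {\<eta> \<in> I. root_succ \<zeta> \<eta>}" arbitrary: \<zeta> rule: less_induct)
    case less
    obtain A where A: "A \<in> nilradical n" "\<And>\<eta>. \<eta> \<in> I \<Longrightarrow> root_succ \<eta> \<zeta> \<Longrightarrow> ad n x A \<eta> = 0" "ad n x A \<zeta> \<noteq> 0"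
      using assms(3)[OF less.prems] by blast
    define S where "S = {\<eta> \<in> I. root_succ \<zeta> \<eta>}"
    have S: "finite S" "S \<subseteq> I" using fin by (auto simp: S_def)
    have IH: "\<exists>B\<in>nilradical n. \<forall>\<eta>\<in>I. ad n x B \<eta> = (if \<eta> = \<xi> then 1 else 0)" if \<xi>: "\<xi> \<in> S" for \<xi>
    proof (rule less.hyps)
      have "{\<eta> \<in> I. root_succ \<xi> \<eta>} \<subset> {\<eta> \<in> I. root_succ \<zeta> \<eta>}"
        using \<xi> root_succ_trans root_succ_irrefl unfolding S_def by blast
      then show "card {\<eta> \<in> I. root_succ \<xi> \<eta>} < card {\<eta> \<in> I. root_succ \<zeta> \<eta>}"
        using fin by (intro psubset_card_mono) simp_all
      show "\<xi> \<in> I" using \<xi> S by blast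
    qed
    obtain B where "\<forall>\<xi>\<in>S. B \<xi> \<in> nilradical n \<and> (\<forall>\<eta>\<in>I. ad n x (B \<xi>) \<eta> = (if \<eta> = \<xi> then 1 else 0))"
      using bchoice[of S "\<lambda>\<xi> B. B \<in> nilradical n \<and> (\<forall>\<eta>\<in>I. ad n x B \<eta> = (if \<eta> = \<xi> then 1 else 0))"] IH by blast
    then have B: "\<And>\<xi>. \<xi> \<in> S \<Longrightarrow> B \<xi> \<in> nilradical n"
      "\<And>\<xi> \<eta>. \<xi> \<in> S \<Longrightarrow> \<eta> \<in> I \<Longrightarrow> ad n x (B \<xi>) \<eta> = (if \<eta> = \<xi> then 1 else 0)"
      by blast+
    have "\<exists>C\<in>nilradical n. \<forall>\<eta>\<in>I. ad n x C \<eta> = (if \<eta> \<in> T then 0 else ad n x A \<eta>)" if "finite T" "T \<subseteq> S" for T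
      using that
    proof (induction T rule: finite_induct)
      case empty
      show ?case by (rule bexI[OF _ A(1)]) simp
    next
      case (insert \<xi> T)
      then have "T \<subseteq> S" by simp
      then obtain C where C: "C \<in> nilradical n" "\<And>\<eta>. \<eta> \<in> I \<Longrightarrow> ad n x C \<eta> = (if \<eta> \<in> T then 0 else ad n x A \<eta>)"
        using insert.IH by blast
      let ?C = "\<lambda>a b. C a b + (- ad n x A \<xi>) * B \<xi> a b"
      have m1: "?C \<in> nilradical n" using nilradical_lin C(1) B(1) insert.prems by blast
      have m2: "ad n x ?C \<eta> = (if \<eta> \<in> insert \<xi> T then 0 else ad n x A \<eta>)" if "\<eta> \<in> I" for \<eta>
        using C(2)[OF that] B(2)[OF _ that, of \<xi>] insert.hyps insert.prems ad_add[of n x C "- ad n x A \<xi>" "B \<xi>" \<eta>] by simp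
      show ?case by (rule bexI[OF _ m1], rule ballI, rule m2)
    qed
    then obtain C where C: "C \<in> nilradical n" "\<And>\<eta>. \<eta> \<in> I \<Longrightarrow> ad n x C \<eta> = (if \<eta> \<in> S then 0 else ad n x A \<eta>)"
      using S(1) order_refl by meson
    let ?C = "\<lambda>a b. (1 / ad n x A \<zeta>) * C a b"
    have m2: "ad n x ?C \<eta> = (if \<eta> = \<zeta> then 1 else 0)" if \<eta>: "\<eta> \<in> I" for \<eta>
    proof -
      consider "\<eta> = \<zeta>" | "root_succ \<eta> \<zeta>" "\<eta> \<noteq> \<zeta>" | "\<eta> \<in> S" "\<eta> \<noteq> \<zeta>"
        using root_succ_total[of \<eta> \<zeta>] \<eta> by (auto simp: S_def)
      then show ?thesis
        unfolding ad_scale using C(2)[OF \<eta>] A(2)[OF \<eta>] A(3) root_succ_irrefl[of \<zeta>] by cases (simp_all add: S_def)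
    qed
    show ?case by (rule bexI[OF _ nilradical_scale[OF C(1)]], rule ballI, rule m2)
  qed
  then obtain B where "\<forall>\<zeta>\<in>I. B \<zeta> \<in> nilradical n \<and> (\<forall>\<eta>\<in>I. ad n x (B \<zeta>) \<eta> = (if \<eta> = \<zeta> then 1 else 0))"
    using bchoice[of I "\<lambda>\<zeta> B. B \<in> nilradical n \<and> (\<forall>\<eta>\<in>I. ad n x B \<eta> = (if \<eta> = \<zeta> then 1 else 0))"] by blast
  then show ?thesis unfolding row_independent_def by (intro exI[of _ B]) simp
qed

lemma row_independent_jumps: "row_independent n x (jumps n x)"
proof (rule row_independent_triangular[OF finite_jumps])
  show "\<exists>A\<in>nilradical n. (\<forall>\<eta>\<in>jumps n x. root_succ \<eta> \<zeta> \<longrightarrow> ad n x A \<eta> = 0) \<and> ad n x A \<zeta> \<noteq> 0" if "\<zeta> \<in> jumps n x" for \<zeta>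
    using that by (auto simp: jumps_def jump_def)
qed (auto simp: jumps_def)

text \<open>If \<open>x0\<close> has the most independent sets of coordinates, then the jumps of \<open>x0\<close> are the lexicographically
  first basis among the rows, and this basis is the same for every \<open>x\<close> for which these rows remain
  independent: a further jump \<open>\<zeta>\<close> of \<open>x\<close> would be independent of the greater jumps of \<open>x0\<close> at \<open>x\<close>, hence
  also at \<open>x0\<close>.\<close>

lemma jumps_eq:
  assumes ind: "row_independent n x (jumps n x0)"
    and max: "\<And>I. I \<subseteq> pos_roots n \<Longrightarrow> row_independent n x I \<Longrightarrow> row_independent n x0 I"
  shows "jumps n x = jumps n x0"
proof -
  let ?J = "jumps n x0"
  obtain A where A: "\<And>\<eta>. \<eta> \<in> ?J \<Longrightarrow> A \<eta> \<in> nilradical n"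
    "\<And>\<eta> \<eta>'. \<eta> \<in> ?J \<Longrightarrow> \<eta>' \<in> ?J \<Longrightarrow> ad n x (A \<eta>) \<eta>' = (if \<eta> = \<eta>' then 1 else 0)"
    using ind unfolding row_independent_def by blast
  have sub: "jumps n x \<subseteq> ?J"
  proof
    fix \<zeta> assume \<zeta>: "\<zeta> \<in> jumps n x"
    then obtain B where B: "B \<in> nilradical n" "\<And>\<eta>. \<eta> \<in> pos_roots n \<Longrightarrow> root_succ \<eta> \<zeta> \<Longrightarrow> ad n x B \<eta> = 0" "ad n x B \<zeta> \<noteq> 0"
      by (auto simp: jumps_def jump_def)
    let ?I = "insert \<zeta> {\<eta> \<in> ?J. root_succ \<eta> \<zeta>}"
    have "row_independent n x ?I"
    proof (rule row_independent_triangular)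
      show "finite ?I" using finite_subset[OF _ finite_jumps[of n x0], of "{\<eta> \<in> ?J. root_succ \<eta> \<zeta>}"] by auto
      show "?I \<subseteq> pos_roots n" using \<zeta> by (auto simp: jumps_def)
      fix \<xi> assume \<xi>: "\<xi> \<in> ?I"
      show "\<exists>A\<in>nilradical n. (\<forall>\<eta>\<in>?I. root_succ \<eta> \<xi> \<longrightarrow> ad n x A \<eta> = 0) \<and> ad n x A \<xi> \<noteq> 0"
      proof (cases "\<xi> = \<zeta>")
        case True
        have "\<forall>\<eta>\<in>?I. root_succ \<eta> \<xi> \<longrightarrow> ad n x B \<eta> = 0"
          using B(2) True root_succ_irrefl[of \<zeta>] by (simp add: jumps_def)
        then show ?thesis using B(1,3) True by blast
      next
        case False
        then have \<xi>J: "\<xi> \<in> ?J" "root_succ \<xi> \<zeta>" using \<xi> by auto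
        then have "\<not> root_succ \<zeta> \<xi>" using root_succ_trans root_succ_irrefl by blast
        have "\<forall>\<eta>\<in>?I. root_succ \<eta> \<xi> \<longrightarrow> ad n x (A \<xi>) \<eta> = 0"
        proof (intro ballI impI)
          fix \<eta> assume "\<eta> \<in> ?I" "root_succ \<eta> \<xi>"
          then have "\<eta> \<in> ?J" "\<xi> \<noteq> \<eta>" using \<open>\<not> root_succ \<zeta> \<xi>\<close> root_succ_irrefl by blast+
          then show "ad n x (A \<xi>) \<eta> = 0" using A(2)[OF \<xi>J(1)] by simp
        qed
        then show ?thesis using A(2)[OF \<xi>J(1) \<xi>J(1)] by (intro bexI[OF _ A(1)[OF \<xi>J(1)]]) simp
      qed
    qed
    then have "row_independent n x0 ?I"
      using max[of ?I] \<zeta> by (auto simp: jumps_def)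
    then obtain C where C: "C \<in> nilradical n" "\<And>\<eta>. \<eta> \<in> ?I \<Longrightarrow> ad n x0 C \<eta> = (if \<zeta> = \<eta> then 1 else 0)"
      unfolding row_independent_def by blast
    have "ad n x0 C \<eta> = 0" if "\<eta> \<in> pos_roots n" "root_succ \<eta> \<zeta>" for \<eta>
    proof (rule ad_vanishes[OF C(1) _ that])
      fix \<xi> assume "\<xi> \<in> ?J" "root_succ \<xi> \<zeta>"
      then have "\<xi> \<in> ?I" "\<zeta> \<noteq> \<xi>" using root_succ_irrefl by blast+
      then show "ad n x0 C \<xi> = 0" using C(2)[of \<xi>] by simp
    qed
    then have "jump n x0 \<zeta>" unfolding jump_def using C(2)[of \<zeta>] by (intro bexI[OF _ C(1)]) simp
    then show "\<zeta> \<in> ?J" using \<zeta> by (auto simp: jumps_def)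
  qed
  moreover have "?J \<subseteq> jumps n x"
  proof
    fix \<zeta> assume \<zeta>: "\<zeta> \<in> ?J"
    have "ad n x (A \<zeta>) \<eta> = 0" if "\<eta> \<in> pos_roots n" "root_succ \<eta> \<zeta>" for \<eta>
    proof (rule ad_vanishes[OF A(1)[OF \<zeta>] _ that])
      fix \<xi> assume "\<xi> \<in> jumps n x" "root_succ \<xi> \<zeta>"
      then have "\<xi> \<in> ?J" "\<zeta> \<noteq> \<xi>" using sub root_succ_irrefl by blast+
      then show "ad n x (A \<zeta>) \<xi> = 0" using A(2)[OF \<zeta>, of \<xi>] by simp
    qed
    then have "jump n x \<zeta>" unfolding jump_def using A(2)[OF \<zeta> \<zeta>] by (intro bexI[OF _ A(1)[OF \<zeta>]]) simp
    then show "\<zeta> \<in> jumps n x" using \<zeta> by (auto simp: jumps_def)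
  qed
  ultimately show ?thesis by blast
qed

text \<open>A matrix whose infinitesimal action kills all the jump coordinates kills every coordinate, so the
  conditions at the jumps cut out the radical of the form.\<close>

lemma dual_pairs_le_card_jumps:
  assumes dp: "dual_pairs n x (nilradical n) (nilradical n) s"
  shows "s \<le> card (jumps n x)"
proof -
  let ?U = "{A \<in> nilradical n. \<forall>\<eta>\<in>jumps n x. ad n x A \<eta> = 0}"
  have "dual_pairs n x ?U (nilradical n) (s - card (jumps n x))"
    by (rule dual_pairs_functionals[OF dp lin_closed_pattern_algebra finite_jumps]) (rule ad_add)
  moreover have "bracket_form n x A B = 0" if A: "A \<in> ?U" and B: "B \<in> nilradical n" for A B
  proof -
    have "ad n x A (i, j) * B j i = 0" if ij: "i \<in> {1..n}" "j \<in> {1..n}" for i j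
    proof (cases "B j i = 0")
      case False
      then have "(i, j) \<in> pos_roots n" using nilradicalD[OF B False] by (auto simp: pos_roots_def)
      then have "ad n x A (i, j) = 0"
        \<comment> \<open>All roots in columns up to \<open>j\<close> precede the pair \<open>(0, Suc j)\<close>.\<close>
        using A ad_vanishes[of A n x "(0, Suc j)" "(i, j)"] by (auto simp: root_succ_def)
      then show ?thesis by simp
    qed simp
    then have "(\<Sum>i\<in>{1..n}. \<Sum>j\<in>{1..n}. ad n x A (i, j) * B j i) = 0"
      by (intro sum.neutral ballI) simp
    then show ?thesis by (simp add: bracket_form_ad)
  qed
  ultimately have "s - card (jumps n x) = 0"
  proof (rule_tac ccontr)
    assume s: "s - card (jumps n x) \<noteq> 0" and dp': "dual_pairs n x ?U (nilradical n) (s - card (jumps n x))"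
      and 0: "\<And>A B. A \<in> ?U \<Longrightarrow> B \<in> nilradical n \<Longrightarrow> bracket_form n x A B = 0"
    obtain A B where 1: "\<And>i. i < s - card (jumps n x) \<Longrightarrow> A i \<in> ?U" "\<And>i. i < s - card (jumps n x) \<Longrightarrow> B i \<in> nilradical n"
      "\<And>i j. i < s - card (jumps n x) \<Longrightarrow> j < s - card (jumps n x) \<Longrightarrow> bracket_form n x (A i) (B j) = (if i = j then 1 else 0)"
      using dp' by (rule dual_pairsE) blast
    show False using 1(3)[of 0 0] 0[OF 1(1)[of 0] 1(2)[of 0]] s by simp
  qed
  then show ?thesis by simp
qed

definition matrix_unit :: "nat \<Rightarrow> nat \<Rightarrow> nat \<Rightarrow> nat \<Rightarrow> 'a::field" where
  "matrix_unit i j = (\<lambda>a b. if a = i \<and> b = j then 1 else 0)"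

lemma bracket_form_unit:
  assumes "(i, j) \<in> pos_roots n"
  shows "bracket_form n x A (matrix_unit j i) = - ad n x A (i, j)"
proof -
  have r: "i \<in> {1..n}" "j \<in> {1..n}" using assms by (auto simp: pos_roots_def)
  have "(\<Sum>a\<in>{1..n}. \<Sum>b\<in>{1..n}. ad n x A (a, b) * matrix_unit j i b a)
      = (\<Sum>a\<in>{1..n}. \<Sum>b\<in>{1..n}. if b = j then if a = i then ad n x A (i, j) else 0 else 0)"
    by (intro sum.cong refl) (auto simp: matrix_unit_def)
  also have "\<dots> = ad n x A (i, j)" using r by simp
  finally show ?thesis by (simp add: bracket_form_ad)
qed

text \<open>Matrix units extract the single coordinates of \<open>ad n x A\<close> from the form.\<close>

lemma row_independent_dual_pairs:
  assumes "row_independent n x I" "I \<subseteq> pos_roots n"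
  shows "dual_pairs n x (nilradical n) (nilradical n) (card I)"
proof -
  obtain A where A: "\<And>\<eta>. \<eta> \<in> I \<Longrightarrow> A \<eta> \<in> nilradical n"
    "\<And>\<eta> \<eta>'. \<eta> \<in> I \<Longrightarrow> \<eta>' \<in> I \<Longrightarrow> ad n x (A \<eta>) \<eta>' = (if \<eta> = \<eta>' then 1 else 0)"
    using assms(1) unfolding row_independent_def by blast
  have fin: "finite I" using finite_subset[OF assms(2) finite_pos_roots] .
  then obtain h where h: "bij_betw h {0..<card I} I" using ex_bij_betw_nat_finite by blast
  have hI: "h i \<in> I" "h i \<in> pos_roots n" if "i < card I" for i
    using bij_betwE[OF h] that assms(2) by auto
  show ?thesis
  proof (rule dual_pairsI[of _ "\<lambda>i. A (h i)" _ "\<lambda>i a b. (-1) * matrix_unit (snd (h i)) (fst (h i)) a b"])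
    fix i assume i: "i < card I"
    show "A (h i) \<in> nilradical n" using A(1) hI i by blast
    have "matrix_unit (snd (h i)) (fst (h i)) \<in> nilradical n"
      using hI(2)[OF i] unfolding nilradical_iff by (auto simp: matrix_unit_def pos_roots_def)
    then show "(\<lambda>a b. (-1) * matrix_unit (snd (h i)) (fst (h i)) a b) \<in> nilradical n"
      by (rule nilradical_scale)
  next
    fix i j assume ij: "i < card I" "j < card I"
    have "bracket_form n x (A (h i)) (\<lambda>a b. (-1) * matrix_unit (snd (h j)) (fst (h j)) a b)
        = - bracket_form n x (A (h i)) (matrix_unit (snd (h j)) (fst (h j)))"
      using bracket_form_add_right[of n x "A (h i)" "matrix_unit (snd (h j)) (fst (h j))" "-2" "matrix_unit (snd (h j)) (fst (h j))"]
      by simp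
    also have "\<dots> = ad n x (A (h i)) (h j)"
      using bracket_form_unit[of "fst (h j)" "snd (h j)" n x "A (h i)"] hI(2)[OF ij(2)] by simp
    also have "\<dots> = (if i = j then 1 else 0)"
      using A(2)[OF hI(1)[OF ij(1)] hI(1)[OF ij(2)]] inj_onD[OF bij_betw_imp_inj_on[OF h], of i j] ij by auto
    finally show "bracket_form n x (A (h i)) (\<lambda>a b. (-1) * matrix_unit (snd (h j)) (fst (h j)) a b) = (if i = j then 1 else 0)" .
  qed
qed

section \<open>Polynomial functions\<close>

text \<open>Polynomial functions of a family of coordinates with an arbitrary index type.\<close>

inductive_set coord_polys :: "(('i \<Rightarrow> 'a::field) \<Rightarrow> 'a) set" where
  const: "(\<lambda>c. a) \<in> coord_polys"
| coord: "(\<lambda>c. c i) \<in> coord_polys"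
| add: "p \<in> coord_polys \<Longrightarrow> q \<in> coord_polys \<Longrightarrow> (\<lambda>c. p c + q c) \<in> coord_polys"
| mult: "p \<in> coord_polys \<Longrightarrow> q \<in> coord_polys \<Longrightarrow> (\<lambda>c. p c * q c) \<in> coord_polys"

lemma function_algebra_coord_polys: "function_algebra coord_polys"
  by (auto simp: function_algebra_def intro: coord_polys.intros)

lemma function_algebra_poly_functions: "function_algebra (poly_functions n)"
  by (auto simp: function_algebra_def intro: poly_functions.intros)

lemma coord_polys_comp:
  assumes P: "function_algebra P" and F: "\<And>i. (\<lambda>x. F x i) \<in> P" and f: "f \<in> coord_polys"
  shows "(\<lambda>x. f (F x)) \<in> P"
  using f by induction (use F function_algebraD[OF P] in auto)

lemma poly_functions_comp:
  assumes P: "function_algebra P" and F: "\<And>i j. i < n \<Longrightarrow> j < n \<Longrightarrow> (\<lambda>x. F x $$ (i, j)) \<in> P"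
    and f: "f \<in> poly_functions n"
  shows "(\<lambda>x. f (F x)) \<in> P"
  using f by induction (use F function_algebraD[OF P] in auto)

lemma coord_polys_line:
  assumes "f \<in> coord_polys"
  shows "(\<lambda>t. f (\<lambda>i. a i + t * b i)) \<in> univariate_polys"
  by (rule coord_polys_comp[OF function_algebra_univariate _ assms])
     (intro function_algebraD(1-3)[OF function_algebra_univariate] univariate_id)

lemma entry_poly: "i \<in> {1..n} \<Longrightarrow> j \<in> {1..n} \<Longrightarrow> (\<lambda>X. entry X i j) \<in> poly_functions n"
  unfolding entry_def by (rule poly_functions.entry) auto

section \<open>Coordinates on a basic variety\<close>

lemma mprod_inverse_left:
  assumes "A \<in> carrier_mat n n" "B \<in> carrier_mat n n" "A * B = 1\<^sub>m n" "C \<in> carrier_mat n n" "i \<in> {1..n}" "j \<in> {1..n}"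
  shows "mprod n (entry A) (mprod n (entry B) (entry C)) i j = entry C i j"
proof -
  have "mprod n (entry A) (mprod n (entry B) (entry C)) i j = mprod n (entry A) (entry (B * C)) i j"
    unfolding mprod_def[of n "entry A"] using assms by (intro sum.cong refl) (simp add: entry_mult)
  also have "\<dots> = entry (A * (B * C)) i j" using assms by (simp add: entry_mult)
  also have "A * (B * C) = C"
    using assms by (simp add: assoc_mult_mat[symmetric, of A n n B n C n])
  finally show ?thesis .
qed

context weighted_roots
begin

abbreviation V :: "'a mat set" where "V \<equiv> basic_variety n D \<phi>"
abbreviation XD :: "'a mat" where "XD \<equiv> basic_mat n D \<phi>"
abbreviation S :: "root set" where "S \<equiv> singular_roots n D"

lemma XD_mat: "XD \<in> carrier_mat n n" by (simp add: basic_mat_def)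

lemma XD_entry: "i \<in> {1..n} \<Longrightarrow> j \<in> {1..n} \<Longrightarrow> entry XD i j = (if (i, j) \<in> D then \<phi> (i, j) else 0)"
  by (auto simp: basic_mat_def entry_def)

lemma V_iff: "X \<in> V \<longleftrightarrow> (\<exists>g\<in>carrier (UT n). \<exists>h\<in>carrier (UT n). X = strict_lower n (g * XD * h))"
proof
  assume "X \<in> V"
  then show "\<exists>g\<in>carrier (UT n). \<exists>h\<in>carrier (UT n). X = strict_lower n (g * XD * h)"
    unfolding basic_variety_def left_right_act_def using UT_inv(1) by blast
next
  assume "\<exists>g\<in>carrier (UT n). \<exists>h\<in>carrier (UT n). X = strict_lower n (g * XD * h)"
  then obtain g h where gh: "g \<in> carrier (UT n)" "h \<in> carrier (UT n)" "X = strict_lower n (g * XD * h)" by blast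
  then have "X = left_right_act n g (inv\<^bsub>UT n\<^esub> h) XD" by (simp add: left_right_act_def UT_inv(5))
  then show "X \<in> V" unfolding basic_variety_def using gh UT_inv(1) by blast
qed

lemma V_strictly_lower: "X \<in> V \<Longrightarrow> X \<in> strictly_lower n"
  by (auto simp: V_iff strict_lower_in)

lemma coadj_V:
  assumes g: "g \<in> carrier (UT n)" and X: "X \<in> V"
  shows "coadj_act n g X \<in> V"
proof -
  obtain a b where ab: "a \<in> carrier (UT n)" "b \<in> carrier (UT n)" "X = strict_lower n (a * XD * b)"
    using X by (auto simp: V_iff)
  note m = UT_mat[OF g] UT_mat[OF ab(1)] UT_mat[OF ab(2)] UT_inv(4)[OF g] XD_mat
  have "coadj_act n g X = strict_lower n (g * (a * XD * b) * inv\<^bsub>UT n\<^esub> g)"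
    unfolding coadj_act_def ab(3) using m by (intro strict_lower_sandwich[OF g UT_inv(1)[OF g]]) simp
  also have "g * (a * XD * b) * inv\<^bsub>UT n\<^esub> g = (g * a) * XD * (b * inv\<^bsub>UT n\<^esub> g)"
    using m by (simp add: assoc_mult_mat[of _ n n _ n _ n])
  finally show ?thesis
    using UT_mult_closed[OF g ab(1)] UT_mult_closed[OF ab(2) UT_inv(1)[OF g]] by (auto simp: V_iff)
qed

lemma strict_lower_entry: "(i, j) \<in> pos_roots n \<Longrightarrow> entry (strict_lower n A) i j = entry A i j"
  by (auto simp: strict_lower_def entry_def pos_roots_def)

text \<open>If \<open>(k, m)\<close> is not singular, then row \<open>k\<close> of \<open>X\<^sub>D\<close> has no root of \<open>D\<close> before column \<open>m\<close>. Up to column \<open>m\<close>,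
  row \<open>k\<close> of \<open>X\<close> is therefore a combination of the lower rows of \<open>X\<close>, up to the weight at \<open>(k, m)\<close>.\<close>

lemma V_row_relation:
  assumes X: "X \<in> V" and km: "(k, m) \<in> pos_roots n" "(k, m) \<notin> S"
  shows "\<exists>\<alpha>. \<forall>j\<in>{1..m}. entry X k j = (\<Sum>a\<in>{k<..n}. \<alpha> a * entry X a j) + (if j = m \<and> (k, m) \<in> D then \<phi> (k, m) else 0)"
proof -
  obtain g h where gh: "g \<in> carrier (UT n)" "h \<in> carrier (UT n)" "X = strict_lower n (g * XD * h)"
    using X by (auto simp: V_iff)
  note m = UT_mat[OF gh(1)] UT_mat[OF gh(2)] UT_inv(4)[OF gh(1)] XD_mat
  define g' where "g' = inv\<^bsub>UT n\<^esub> g"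
  have r: "k \<in> {1..n}" "m \<in> {1..n}" "m < k" using km by (auto simp: pos_roots_def)
  show ?thesis
  proof (intro exI[of _ "\<lambda>a. - entry g' k a"] ballI)
    fix j assume j: "j \<in> {1..m}"
    then have jn: "j \<in> {1..n}" using r by auto
    let ?Z = "XD * h"
    have Zm: "?Z \<in> carrier_mat n n" using m by simp
    have gZ: "mprod n (entry g) (entry ?Z) a j = entry X a j" if a: "a \<in> {k..n}" for a
    proof -
      have "mprod n (entry g) (entry ?Z) a j = entry (g * ?Z) a j"
        using entry_mult[OF m(1) Zm, of a j] a r jn by auto
      also have "g * ?Z = g * XD * h" using m by (simp add: assoc_mult_mat[of _ n n _ n _ n])
      finally show ?thesis
        unfolding gh(3) using strict_lower_entry[of a j "g * XD * h"] a r j by (auto simp: pos_roots_def)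
    qed
    have "entry ?Z k j = mprod n (entry g') (mprod n (entry g) (entry ?Z)) k j"
      using mprod_inverse_left[of g' n g ?Z k j] m r jn UT_inv(2)[OF gh(1)] by (simp add: g'_def)
    also have "\<dots> = (\<Sum>a\<in>{k..n}. entry g' k a * mprod n (entry g) (entry ?Z) a j)"
      unfolding mprod_def[of n "entry g'"]
      using UT_entry(1)[OF UT_inv(1)[OF gh(1)] r(1)] r by (intro sum.mono_neutral_right) (auto simp: g'_def)
    also have "\<dots> = (\<Sum>a\<in>{k..n}. entry g' k a * entry X a j)"
      using gZ by (intro sum.cong refl) simp
    also have "{k..n} = insert k {k<..n}" using r by auto
    also have "(\<Sum>a\<in>insert k {k<..n}. entry g' k a * entry X a j) = entry X k j + (\<Sum>a\<in>{k<..n}. entry g' k a * entry X a j)"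
      using UT_entry(2)[OF UT_inv(1)[OF gh(1)] r(1,1) refl] by (simp add: g'_def)
    finally have 1: "entry X k j = entry ?Z k j + (\<Sum>a\<in>{k<..n}. - entry g' k a * entry X a j)"
      by (simp add: sum_negf)
    have "entry ?Z k j = (\<Sum>b\<in>{1..n}. entry XD k b * entry h b j)"
      using entry_mult[OF XD_mat m(2) r(1) jn] by (simp add: mprod_def)
    also have "\<dots> = (\<Sum>b\<in>{1..n}. if b = m then (if j = m \<and> (k, m) \<in> D then \<phi> (k, m) else 0) else 0)"
    proof (rule sum.cong[OF refl])
      fix b assume b: "b \<in> {1..n}"
      have noD: "(k, b) \<notin> D" if "b < m" using km that singular_iff[of k m] by (auto simp: pos_roots_def)
      show "entry XD k b * entry h b j = (if b = m then (if j = m \<and> (k, m) \<in> D then \<phi> (k, m) else 0) else 0)"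
      proof (cases "b < m")
        case True
        then show ?thesis using noD XD_entry[OF r(1) b] by simp
      next
        case False
        then consider "b = m" "j = m" | "b = m" "j < m" | "m < b" "j < b" using j by force
        then show ?thesis
          by cases (use UT_entry[OF gh(2) b jn] XD_entry[OF r(1) b] in auto)
      qed
    qed
    also have "\<dots> = (if j = m \<and> (k, m) \<in> D then \<phi> (k, m) else 0)" using r by simp
    finally show "entry X k j = (\<Sum>a\<in>{k<..n}. - entry g' k a * entry X a j) + (if j = m \<and> (k, m) \<in> D then \<phi> (k, m) else 0)"
      using 1 by simp
  qed
qed

text \<open>The same for columns: no root of \<open>D\<close> lies below \<open>(k, m)\<close> in column \<open>m\<close>.\<close>

lemma V_column_relation:
  assumes X: "X \<in> V" and km: "(k, m) \<in> pos_roots n" "(k, m) \<notin> S"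
  shows "\<exists>\<beta>. \<forall>a\<in>{k..n}. entry X a m = (\<Sum>j\<in>{1..<m}. entry X a j * \<beta> j) + (if a = k \<and> (k, m) \<in> D then \<phi> (k, m) else 0)"
proof -
  obtain g h where gh: "g \<in> carrier (UT n)" "h \<in> carrier (UT n)" "X = strict_lower n (g * XD * h)"
    using X by (auto simp: V_iff)
  note m = UT_mat[OF gh(1)] UT_mat[OF gh(2)] UT_inv(4)[OF gh(2)] XD_mat
  define h' where "h' = inv\<^bsub>UT n\<^esub> h"
  have r: "k \<in> {1..n}" "m \<in> {1..n}" "m < k" using km by (auto simp: pos_roots_def)
  show ?thesis
  proof (intro exI[of _ "\<lambda>j. - entry h' j m"] ballI)
    fix a assume a: "a \<in> {k..n}"
    then have an: "a \<in> {1..n}" using r by auto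
    let ?W = "g * XD"
    have Wm: "?W \<in> carrier_mat n n" "?W * h \<in> carrier_mat n n" using m by simp_all
    have "?W * h * h' = ?W"
      using m UT_inv(3)[OF gh(2)] by (simp add: h'_def assoc_mult_mat[of _ n n _ n _ n])
    then have "entry ?W a m = mprod n (entry (?W * h)) (entry h') a m"
      using entry_mult[OF Wm(2) _ an r(2), of h'] m by (simp add: h'_def)
    also have "\<dots> = (\<Sum>j\<in>{1..m}. entry (?W * h) a j * entry h' j m)"
      unfolding mprod_def
    proof (rule sum.mono_neutral_right)
      show "\<forall>i\<in>{1..n} - {1..m}. entry (?W * h) a i * entry h' i m = 0"
        using UT_entry(1)[OF UT_inv(1)[OF gh(2)] _ r(2)] by (auto simp: h'_def)
    qed (use r in auto)
    also have "\<dots> = (\<Sum>j\<in>{1..m}. entry X a j * entry h' j m)"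
    proof (intro sum.cong refl)
      fix j assume j: "j \<in> {1..m}"
      then have "(a, j) \<in> pos_roots n" using a r by (auto simp: pos_roots_def)
      then show "entry (?W * h) a j * entry h' j m = entry X a j * entry h' j m"
        unfolding gh(3) by (simp add: strict_lower_entry)
    qed
    also have "{1..m} = insert m {1..<m}" using r by auto
    also have "(\<Sum>j\<in>insert m {1..<m}. entry X a j * entry h' j m) = entry X a m + (\<Sum>j\<in>{1..<m}. entry X a j * entry h' j m)"
      using UT_entry(2)[OF UT_inv(1)[OF gh(2)] r(2,2) refl] by (simp add: h'_def)
    finally have 1: "entry X a m = entry ?W a m + (\<Sum>j\<in>{1..<m}. entry X a j * - entry h' j m)"
      by (simp add: sum_negf)
    have "entry ?W a m = (\<Sum>b\<in>{1..n}. entry g a b * entry XD b m)"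
      using entry_mult[OF m(1) XD_mat an r(2)] by (simp add: mprod_def)
    also have "\<dots> = (\<Sum>b\<in>{1..n}. if b = k then (if a = k \<and> (k, m) \<in> D then \<phi> (k, m) else 0) else 0)"
    proof (rule sum.cong[OF refl])
      fix b assume b: "b \<in> {1..n}"
      have noD: "(b, m) \<notin> D" if "k < b" using km that singular_iff[of k m] by (auto simp: pos_roots_def)
      show "entry g a b * entry XD b m = (if b = k then (if a = k \<and> (k, m) \<in> D then \<phi> (k, m) else 0) else 0)"
      proof (cases "k < b")
        case True
        then show ?thesis using noD XD_entry[OF b r(2)] by simp
      next
        case False
        then consider "b = k" "a = k" | "b = k" "k < a" | "b < k" "b < a" using a by force
        then show ?thesis
          by cases (use UT_entry[OF gh(1) an b] XD_entry[OF b r(2)] in auto)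
      qed
    qed
    also have "\<dots> = (if a = k \<and> (k, m) \<in> D then \<phi> (k, m) else 0)" using r by simp
    finally show "entry X a m = (\<Sum>j\<in>{1..<m}. entry X a j * - entry h' j m) + (if a = k \<and> (k, m) \<in> D then \<phi> (k, m) else 0)"
      using 1 by simp
  qed
qed

text \<open>Outside \<open>S\<close> a coordinate is determined by the greater ones: by the column relation for \<open>Y\<close> and the
  row relation for \<open>X\<close>, both entries are the same bilinear expression in the common entries of lower
  rows and smaller columns, plus the weight if \<open>(k, m)\<close> is in \<open>D\<close>.\<close>

lemma V_determined:
  assumes X: "X \<in> V" and Y: "Y \<in> V" and km: "(k, m) \<in> pos_roots n" "(k, m) \<notin> S"
    and eq: "\<And>a b. (a, b) \<in> pos_roots n \<Longrightarrow> root_succ (a, b) (k, m) \<Longrightarrow> entry X a b = entry Y a b"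
  shows "entry X k m = entry Y k m"
proof -
  let ?e = "if (k, m) \<in> D then \<phi> (k, m) else 0"
  have r: "k \<in> {1..n}" "m \<in> {1..n}" "m < k" using km by (auto simp: pos_roots_def)
  obtain \<alpha> where \<alpha>: "\<And>j. j \<in> {1..m} \<Longrightarrow> entry X k j = (\<Sum>a\<in>{k<..n}. \<alpha> a * entry X a j) + (if j = m \<and> (k, m) \<in> D then \<phi> (k, m) else 0)"
    using V_row_relation[OF X km] by blast
  obtain \<beta> where \<beta>: "\<And>a. a \<in> {k..n} \<Longrightarrow> entry Y a m = (\<Sum>j\<in>{1..<m}. entry Y a j * \<beta> j) + (if a = k \<and> (k, m) \<in> D then \<phi> (k, m) else 0)"
    using V_column_relation[OF Y km] by blast
  have e1: "entry Y a j = entry X a j" if "a \<in> {k..n}" "j \<in> {1..<m}" for a j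
    using eq[of a j] that r by (auto simp: pos_roots_def root_succ_def)
  have e2: "entry Y a m = entry X a m" if "a \<in> {k<..n}" for a
    using eq[of a m] that r by (auto simp: pos_roots_def root_succ_def)
  have "entry Y k m = (\<Sum>j\<in>{1..<m}. entry X k j * \<beta> j) + ?e"
    using \<beta>[of k] e1[of k] r by simp
  also have "(\<Sum>j\<in>{1..<m}. entry X k j * \<beta> j) = (\<Sum>j\<in>{1..<m}. \<Sum>a\<in>{k<..n}. \<alpha> a * (entry X a j * \<beta> j))"
    using \<alpha> by (intro sum.cong refl) (auto simp: sum_distrib_right mult.assoc)
  also have "\<dots> = (\<Sum>a\<in>{k<..n}. \<alpha> a * (\<Sum>j\<in>{1..<m}. entry X a j * \<beta> j))"
    by (subst sum.swap) (simp add: sum_distrib_left)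
  also have "\<dots> = (\<Sum>a\<in>{k<..n}. \<alpha> a * entry X a m)"
  proof (intro sum.cong refl)
    fix a assume a: "a \<in> {k<..n}"
    then have "entry X a m = (\<Sum>j\<in>{1..<m}. entry Y a j * \<beta> j)" using \<beta>[of a] e2[of a] by auto
    also have "\<dots> = (\<Sum>j\<in>{1..<m}. entry X a j * \<beta> j)" using e1[of a] a by (intro sum.cong refl) auto
    finally show "\<alpha> a * (\<Sum>j\<in>{1..<m}. entry X a j * \<beta> j) = \<alpha> a * entry X a m" by simp
  qed
  finally show ?thesis using \<alpha>[of m] r by simp
qed

text \<open>A jump outside \<open>S\<close> would move a coordinate that is determined by the greater ones.\<close>

lemma jumps_V: "X \<in> V \<Longrightarrow> jumps n (entry X) \<subseteq> S"
proof
  fix \<zeta> assume X: "X \<in> V" and \<zeta>: "\<zeta> \<in> jumps n (entry X)"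
  obtain k m where km: "\<zeta> = (k, m)" by (cases \<zeta>)
  obtain A where A: "A \<in> nilradical n" "\<And>\<eta>. \<eta> \<in> pos_roots n \<Longrightarrow> root_succ \<eta> \<zeta> \<Longrightarrow> ad n (entry X) A \<eta> = 0" "ad n (entry X) A \<zeta> \<noteq> 0"
    using \<zeta> by (auto simp: jumps_def jump_def)
  let ?Y = "coadj_act n (exp1 n A) X"
  have p: "(k, m) \<in> pos_roots n" using \<zeta> km by (auto simp: jumps_def)
  have keep: "entry ?Y a b = entry X a b" if "(a, b) \<in> pos_roots n" "root_succ (a, b) (k, m)" for a b
    by (rule coadj_exp1_keeps[OF A(1) V_strictly_lower[OF X] A(2) that[folded km(1)]]) 
  have "entry ?Y k m = entry X k m + ad n (entry X) A (k, m)"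
    by (rule coadj_exp1_step[OF A(1) V_strictly_lower[OF X] p])
       (use keep p in \<open>auto simp: pos_roots_def root_succ_def\<close>)
  then have "entry ?Y k m \<noteq> entry X k m" using A(3) km by simp
  then have "(k, m) \<in> S"
    using V_determined[OF coadj_V[OF exp1_in[OF A(1)] X] X p] keep by blast
  then show "\<zeta> \<in> S" using km by simp
qed

end

section \<open>Jumps along an orbit\<close>

lemma coadj_entry_formula:
  assumes A: "A \<in> nilradical n" and X: "X \<in> strictly_lower n" and ij: "(i, j) \<in> pos_roots n"
  shows "entry (coadj_act n (exp1 n A) X) i j = entry X i j + (\<Sum>l\<in>{i<..n}. A i l * entry X l j)
     - (\<Sum>l\<in>{1..<j}. entry (coadj_act n (exp1 n A) X) i l * A l j)"
proof -
  have r: "i \<in> {1..n}" "j \<in> {1..n}" "j < i" using ij by (auto simp: pos_roots_def)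
  have "mprod n A (entry X) i j = (\<Sum>l\<in>{i<..n}. A i l * entry X l j)"
    unfolding mprod_def
  proof (rule sum.mono_neutral_right)
    show "\<forall>l\<in>{1..n} - {i<..n}. A i l * entry X l j = 0"
      using nilradicalD[OF A, of i] by fastforce
  qed (use r in auto)
  moreover have "mprod n (entry X) A i j = (\<Sum>l\<in>{1..<j}. entry X i l * A l j)"
    unfolding mprod_def
  proof (rule sum.mono_neutral_right)
    show "\<forall>l\<in>{1..n} - {1..<j}. entry X i l * A l j = 0"
      using nilradicalD[OF A, of _ j] by fastforce
  qed (use r in auto)
  ultimately show ?thesis
    using coadj_exp1[OF A X ij] by (simp add: ad_def algebra_simps sum_subtractf)
qed

text \<open>Up to and including the first coordinate in which two points differ, the group acts on their
  difference trivially.\<close>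

lemma coadj_triangular:
  assumes g: "g \<in> carrier (UT n)" and X: "X \<in> strictly_lower n" and Y: "Y \<in> strictly_lower n"
    and eq: "\<And>a b. (a, b) \<in> pos_roots n \<Longrightarrow> root_succ (a, b) \<zeta> \<Longrightarrow> entry X a b = entry Y a b"
    and ij: "(i, j) \<in> pos_roots n" "root_succ (i, j) \<zeta> \<or> (i, j) = \<zeta>"
  shows "entry (coadj_act n g X) i j - entry (coadj_act n g Y) i j = entry X i j - entry Y i j"
  using ij
proof (induction j rule: less_induct)
  case (less j)
  obtain A where A: "A \<in> nilradical n" "g = exp1 n A" using UT_exp1[OF g] .
  have 1: "entry X l j = entry Y l j" if "l \<in> {i<..n}" for l
    using less.prems that by (intro eq) (auto simp: pos_roots_def root_succ_def)
  have 2: "entry (coadj_act n g X) i l = entry (coadj_act n g Y) i l" if l: "l \<in> {1..<j}" for l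
  proof -
    have "(i, l) \<in> pos_roots n" "root_succ (i, l) \<zeta>"
      using less.prems l by (auto simp: pos_roots_def root_succ_def)
    then show ?thesis using less.IH[of l] eq[of i l] l by simp
  qed
  have "(\<Sum>l\<in>{i<..n}. A i l * entry X l j) = (\<Sum>l\<in>{i<..n}. A i l * entry Y l j)"
    using 1 by (intro sum.cong refl) simp
  moreover have "(\<Sum>l\<in>{1..<j}. entry (coadj_act n g X) i l * A l j) = (\<Sum>l\<in>{1..<j}. entry (coadj_act n g Y) i l * A l j)"
    using 2 by (intro sum.cong refl) simp
  ultimately show ?case
    using coadj_entry_formula[OF A(1) X less.prems(1)] coadj_entry_formula[OF A(1) Y less.prems(1)]
    unfolding A(2) by simp
qed

text \<open>The first coordinate that a group element changes is a jump.\<close>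

lemma jumpI_coadj:
  assumes g: "g \<in> carrier (UT n)" and X: "X \<in> strictly_lower n" and \<zeta>: "(k, m) \<in> pos_roots n"
    and eq: "\<And>a b. (a, b) \<in> pos_roots n \<Longrightarrow> root_succ (a, b) (k, m) \<Longrightarrow> entry (coadj_act n g X) a b = entry X a b"
    and neq: "entry (coadj_act n g X) k m \<noteq> entry X k m"
  shows "(k, m) \<in> jumps n (entry X)"
proof -
  obtain A where A: "A \<in> nilradical n" "g = exp1 n A" using UT_exp1[OF g] .
  have step: "entry (coadj_act n g X) a b = entry X a b + ad n (entry X) A (a, b)"
    if ab: "(a, b) \<in> pos_roots n" "root_succ (a, b) (k, m) \<or> (a, b) = (k, m)" for a b
    unfolding A(2)
  proof (rule coadj_exp1_step[OF A(1) X ab(1)])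
    fix l assume "1 \<le> l" "l < b"
    then have "(a, l) \<in> pos_roots n" "root_succ (a, l) (k, m)"
      using ab by (auto simp: pos_roots_def root_succ_def)
    then show "entry (coadj_act n (exp1 n A) X) a l = entry X a l" using eq A(2) by blast
  qed
  have "ad n (entry X) A \<eta> = 0" if "\<eta> \<in> pos_roots n" "root_succ \<eta> (k, m)" for \<eta>
    using step[of "fst \<eta>" "snd \<eta>"] eq[of "fst \<eta>" "snd \<eta>"] that by simp
  moreover have "ad n (entry X) A (k, m) \<noteq> 0" using step[OF \<zeta>] neq by auto
  ultimately show ?thesis using A(1) \<zeta> unfolding jumps_def jump_def by blast
qed

text \<open>Conversely, at a jump the coordinate can be moved to any value \<open>t\<close> without changing the greater ones.\<close>

lemma jumpE_coadj:
  assumes X: "X \<in> strictly_lower n" and \<zeta>: "(k, m) \<in> jumps n (entry X)"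
  obtains g where "g \<in> carrier (UT n)"
    "\<And>a b. (a, b) \<in> pos_roots n \<Longrightarrow> root_succ (a, b) (k, m) \<Longrightarrow> entry (coadj_act n g X) a b = entry X a b"
    "entry (coadj_act n g X) k m = t"
proof -
  obtain A where A: "A \<in> nilradical n" "\<And>\<eta>. \<eta> \<in> pos_roots n \<Longrightarrow> root_succ \<eta> (k, m) \<Longrightarrow> ad n (entry X) A \<eta> = 0"
    "ad n (entry X) A (k, m) \<noteq> 0" and p: "(k, m) \<in> pos_roots n"
    using \<zeta> by (auto simp: jumps_def jump_def)
  define B where "B = (\<lambda>a b. ((t - entry X k m) / ad n (entry X) A (k, m)) * A a b)"
  have B: "B \<in> nilradical n" unfolding B_def by (rule nilradical_scale[OF A(1)])
  have adB: "ad n (entry X) B \<eta> = ((t - entry X k m) / ad n (entry X) A (k, m)) * ad n (entry X) A \<eta>" for \<eta>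
    unfolding B_def by (rule ad_scale)
  have keep: "entry (coadj_act n (exp1 n B) X) a b = entry X a b" if "(a, b) \<in> pos_roots n" "root_succ (a, b) (k, m)" for a b
    by (rule coadj_exp1_keeps[OF B X _ that]) (simp add: adB A(2))
  have "entry (coadj_act n (exp1 n B) X) k m = entry X k m + ad n (entry X) B (k, m)"
    by (rule coadj_exp1_step[OF B X p]) (use keep p in \<open>auto simp: pos_roots_def root_succ_def\<close>)
  then have "entry (coadj_act n (exp1 n B) X) k m = t" using A(3) by (simp add: adB)
  then show thesis using that[OF exp1_in[OF B] keep] by blast
qed

text \<open>If \<open>h\<close> moves the coordinate \<open>\<zeta>\<close> of \<open>X\<close> first, then the conjugate of \<open>h\<close> by \<open>g\<close> moves the coordinate \<open>\<zeta>\<close>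
  of the translate of \<open>X\<close> first, by triangularity.\<close>

lemma jumps_coadj_subset:
  assumes g: "g \<in> carrier (UT n)" and X: "X \<in> strictly_lower n"
  shows "jumps n (entry X) \<subseteq> jumps n (entry (coadj_act n g X))"
proof
  fix \<zeta> assume \<zeta>: "\<zeta> \<in> jumps n (entry X)"
  obtain k m where km: "\<zeta> = (k, m)" by (cases \<zeta>)
  have p: "(k, m) \<in> pos_roots n" using \<zeta> km by (simp add: jumps_def)
  let ?Y = "coadj_act n g X"
  obtain h where h: "h \<in> carrier (UT n)"
    "\<And>a b. (a, b) \<in> pos_roots n \<Longrightarrow> root_succ (a, b) (k, m) \<Longrightarrow> entry (coadj_act n h X) a b = entry X a b"
    "entry (coadj_act n h X) k m = entry X k m + 1"
    using jumpE_coadj[OF X \<zeta>[unfolded km], where t = "entry X k m + 1"] by blast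
  let ?h = "g * h * inv\<^bsub>UT n\<^esub> g"
  have gh: "g * h \<in> carrier (UT n)" "?h \<in> carrier (UT n)"
    using UT_mult_closed[OF g h(1)] UT_mult_closed[OF UT_mult_closed[OF g h(1)] UT_inv(1)[OF g]] by auto
  have e: "coadj_act n ?h ?Y = coadj_act n g (coadj_act n h X)"
    using coadj_mult[OF gh(1) UT_inv(1)[OF g] strictly_lower_mat[OF coadj_in]] coadj_inv(1)[OF g X]
      coadj_mult[OF g h(1) strictly_lower_mat[OF X]] by simp
  note tri = coadj_triangular[OF g coadj_in[of n h X] X, where \<zeta> = "(k, m)"]
  have "(k, m) \<in> jumps n (entry ?Y)"
  proof (rule jumpI_coadj[OF gh(2) coadj_in p])
    show "entry (coadj_act n ?h ?Y) a b = entry ?Y a b" if "(a, b) \<in> pos_roots n" "root_succ (a, b) (k, m)" for a b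
      unfolding e using tri[OF h(2), of a b] h(2)[OF that] that by simp
    show "entry (coadj_act n ?h ?Y) k m \<noteq> entry ?Y k m"
      unfolding e using tri[OF h(2) p] h(3) by auto
  qed
  then show "\<zeta> \<in> jumps n (entry ?Y)" using km by simp
qed

lemma jumps_coadj:
  assumes g: "g \<in> carrier (UT n)" and X: "X \<in> strictly_lower n"
  shows "jumps n (entry (coadj_act n g X)) = jumps n (entry X)"
  using jumps_coadj_subset[OF g X] jumps_coadj_subset[OF UT_inv(1)[OF g] coadj_in[of n g X]]
    coadj_inv(1)[OF g X] by auto

section \<open>Independence of coordinate functionals is an open condition\<close>

text \<open>The roots index the coordinates of the functional, the transposed positions those of the Lie
  algebra.\<close>

definition matrix_of :: "nat \<Rightarrow> (root \<Rightarrow> 'a::field) \<Rightarrow> nat \<Rightarrow> nat \<Rightarrow> 'a" where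
  "matrix_of n v = (\<lambda>a b. if (b, a) \<in> pos_roots n then v (b, a) else 0)"

lemma matrix_of_nilradical: "matrix_of n v \<in> nilradical n"
  unfolding nilradical_iff by (auto simp: matrix_of_def pos_roots_def)

lemma matrix_of_eq:
  assumes "A \<in> nilradical n"
  shows "A = matrix_of n (\<lambda>\<beta>. A (snd \<beta>) (fst \<beta>))"
proof (intro ext)
  fix a b show "A a b = matrix_of n (\<lambda>\<beta>. A (snd \<beta>) (fst \<beta>)) a b"
    using nilradicalD[OF assms, of a b] by (cases "A a b = 0") (auto simp: matrix_of_def pos_roots_def)
qed

lemma ad_matrix_of:
  "ad n x (matrix_of n v) \<eta> = (\<Sum>\<beta>\<in>pos_roots n. ad n x (matrix_unit (snd \<beta>) (fst \<beta>)) \<eta> * v \<beta>)"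
proof -
  have "ad n x (\<lambda>a b. \<Sum>\<beta>\<in>I. v \<beta> * matrix_unit (snd \<beta>) (fst \<beta>) a b) \<eta>
      = (\<Sum>\<beta>\<in>I. ad n x (matrix_unit (snd \<beta>) (fst \<beta>)) \<eta> * v \<beta>)" if "finite I" for I
    using that
  proof (induction I rule: finite_induct)
    case empty
    show ?case by (cases \<eta>) (simp add: ad_def mprod_def)
  next
    case (insert \<beta> I)
    have "(\<lambda>a b. \<Sum>\<beta>\<in>insert \<beta> I. v \<beta> * matrix_unit (snd \<beta>) (fst \<beta>) a b)
        = (\<lambda>a b. (\<Sum>\<beta>\<in>I. v \<beta> * matrix_unit (snd \<beta>) (fst \<beta>) a b) + v \<beta> * matrix_unit (snd \<beta>) (fst \<beta>) a b)"
      using insert.hyps by (simp add: add.commute)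
    then show ?case using insert by (simp add: ad_add)
  qed
  moreover have "matrix_of n v = (\<lambda>a b. \<Sum>\<beta>\<in>pos_roots n. v \<beta> * matrix_unit (snd \<beta>) (fst \<beta>) a b)"
  proof (intro ext)
    fix a b
    have "(\<Sum>\<beta>\<in>pos_roots n. v \<beta> * matrix_unit (snd \<beta>) (fst \<beta>) a b)
        = (\<Sum>\<beta>\<in>pos_roots n. if \<beta> = (b, a) then v (b, a) else 0)"
      by (intro sum.cong refl) (auto simp: matrix_unit_def)
    then show "matrix_of n v a b = (\<Sum>\<beta>\<in>pos_roots n. v \<beta> * matrix_unit (snd \<beta>) (fst \<beta>) a b)"
      by (simp add: matrix_of_def finite_pos_roots)
  qed
  ultimately show ?thesis using finite_pos_roots[of n] by simp
qed

lemma ad_poly: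
  assumes "(i, j) \<in> pos_roots n"
  shows "(\<lambda>X. ad n (entry X) A (i, j)) \<in> poly_functions n"
proof -
  have r: "i \<in> {1..n}" "j \<in> {1..n}" using assms by (auto simp: pos_roots_def)
  note P = function_algebra_poly_functions[of n]
  show ?thesis
    unfolding ad_def mprod_def prod.case
    by (intro function_algebra_diff[OF P] function_algebra_sum[OF P] function_algebraD(3)[OF P]
        function_algebraD(1)[OF P] entry_poly) (use r in auto)
qed

text \<open>Where the polynomial \<open>u\<close> does not vanish, the functionals have a dual family whose coefficients are
  polynomial in the point, up to the common factor \<open>u\<close>.\<close>

lemma row_independent_open:
  assumes ind: "row_independent n (entry X1) I" and I: "I \<subseteq> pos_roots n"
  shows "\<exists>u\<in>poly_functions n. u X1 \<noteq> 0 \<and> (\<exists>a. (\<forall>\<eta>\<in>I. \<forall>\<beta>\<in>pos_roots n. a \<eta> \<beta> \<in> poly_functions n) \<and>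
      (\<forall>X. \<forall>\<eta>\<in>I. \<forall>\<eta>'\<in>I. ad n (entry X) (matrix_of n (\<lambda>\<beta>. a \<eta> \<beta> X)) \<eta>' = (if \<eta> = \<eta>' then u X else 0)))"
proof -
  obtain A where A: "\<And>\<eta>. \<eta> \<in> I \<Longrightarrow> A \<eta> \<in> nilradical n"
    "\<And>\<eta> \<eta>'. \<eta> \<in> I \<Longrightarrow> \<eta>' \<in> I \<Longrightarrow> ad n (entry X1) (A \<eta>) \<eta>' = (if \<eta> = \<eta>' then 1 else 0)"
    using ind unfolding row_independent_def by blast
  define g where "g \<eta> \<beta> X = ad n (entry X) (matrix_unit (snd \<beta>) (fst \<beta>)) \<eta>" for \<eta> \<beta> :: root and X :: "'a mat"
  have g: "g \<eta> \<beta> \<in> poly_functions n" if "\<eta> \<in> I" for \<eta> \<beta>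
    unfolding g_def[abs_def] using ad_poly[of "fst \<eta>" "snd \<eta>" n] that I by auto
  have d: "(\<Sum>\<beta>\<in>pos_roots n. g \<eta>' \<beta> X1 * A \<eta> (snd \<beta>) (fst \<beta>)) = (if \<eta>' = \<eta> then 1 else 0)"
    if "\<eta>' \<in> I" "\<eta> \<in> I" for \<eta>' \<eta>
  proof -
    have "(\<Sum>\<beta>\<in>pos_roots n. g \<eta>' \<beta> X1 * A \<eta> (snd \<beta>) (fst \<beta>)) = ad n (entry X1) (matrix_of n (\<lambda>\<beta>. A \<eta> (snd \<beta>) (fst \<beta>))) \<eta>'"
      unfolding g_def by (rule ad_matrix_of[symmetric])
    also have "\<dots> = ad n (entry X1) (A \<eta>) \<eta>'" by (simp only: matrix_of_eq[OF A(1)[OF that(2)], symmetric])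
    also have "\<dots> = (if \<eta>' = \<eta> then 1 else 0)" using A(2)[OF that(2,1)] by auto
    finally show ?thesis .
  qed
  obtain u a where u: "u \<in> poly_functions n" "u X1 \<noteq> 0" and a: "\<forall>j\<in>I. \<forall>k\<in>pos_roots n. a j k \<in> poly_functions n"
    "\<forall>X. \<forall>i\<in>I. \<forall>j\<in>I. (\<Sum>k\<in>pos_roots n. g i k X * a j k X) = (if i = j then u X else 0)"
    using dual_family_extends[OF function_algebra_poly_functions finite_subset[OF I finite_pos_roots] finite_pos_roots,
        where g = g and ?x0.0 = X1 and ?a0.0 = "\<lambda>\<eta> \<beta>. A \<eta> (snd \<beta>) (fst \<beta>)", OF g d] by blast
  have "ad n (entry X) (matrix_of n (\<lambda>\<beta>. a \<eta> \<beta> X)) \<eta>' = (if \<eta> = \<eta>' then u X else 0)" if "\<eta> \<in> I" "\<eta>' \<in> I" for X \<eta> \<eta>'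
    using a(2) that by (simp add: ad_matrix_of g_def eq_commute)
  then show ?thesis using u a(1) by blast
qed

lemma row_independentI_dual:
  assumes "u \<noteq> 0" "\<And>\<eta> \<eta>'. \<eta> \<in> I \<Longrightarrow> \<eta>' \<in> I \<Longrightarrow> ad n x (matrix_of n (a \<eta>)) \<eta>' = (if \<eta> = \<eta>' then u else 0)"
  shows "row_independent n x I"
  unfolding row_independent_def
proof (intro exI[of _ "\<lambda>\<eta> p q. (1 / u) * matrix_of n (a \<eta>) p q"] ballI conjI)
  show "(\<lambda>p q. (1 / u) * matrix_of n (a \<eta>) p q) \<in> nilradical n" for \<eta>
    by (rule nilradical_scale[OF matrix_of_nilradical])
  show "ad n x (\<lambda>p q. (1 / u) * matrix_of n (a \<eta>) p q) \<eta>' = (if \<eta> = \<eta>' then 1 else 0)" if "\<eta> \<in> I" "\<eta>' \<in> I" for \<eta> \<eta>'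
    unfolding ad_scale using assms that by simp
qed

section \<open>Parametrisation of the basic variety\<close>

lemma finite_has_least_root:
  assumes "finite T" "T \<noteq> {}"
  shows "\<exists>\<zeta>\<in>T. \<forall>\<eta>\<in>T. \<eta> \<noteq> \<zeta> \<longrightarrow> root_succ \<eta> \<zeta>"
  using assms
proof (induction T rule: finite_ne_induct)
  case (insert \<xi> T)
  then obtain \<zeta> where \<zeta>: "\<zeta> \<in> T" "\<And>\<eta>. \<eta> \<in> T \<Longrightarrow> \<eta> \<noteq> \<zeta> \<Longrightarrow> root_succ \<eta> \<zeta>" by blast
  show ?case
  proof (cases "root_succ \<xi> \<zeta>")
    case True
    then show ?thesis using \<zeta> by blast
  next
    case False
    then have s: "root_succ \<zeta> \<xi>" using root_succ_total[of \<xi> \<zeta>] \<zeta>(1) insert.hyps by blast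
    have "root_succ \<eta> \<xi>" if "\<eta> \<in> T" for \<eta>
      using \<zeta>(2)[OF that] s root_succ_trans[of \<eta> \<zeta> \<xi>] by (cases "\<eta> = \<zeta>") auto
    then show ?thesis by blast
  qed
qed simp

context weighted_roots
begin

lemma XD_row: 
  assumes "(k, j) \<in> D" "h \<in> carrier (UT n)" "b \<in> {1..n}"
  shows "entry (XD * h) k b = \<phi> (k, j) * entry h j b"
proof -
  have r: "k \<in> {1..n}" "j \<in> {1..n}" using D_pos[OF assms(1)] by auto
  have "entry (XD * h) k b = (\<Sum>l\<in>{1..n}. entry XD k l * entry h l b)"
    using entry_mult[OF XD_mat UT_mat[OF assms(2)] r(1) assms(3)] by (simp add: mprod_def)
  also have "\<dots> = (\<Sum>l\<in>{1..n}. if l = j then \<phi> (k, j) * entry h j b else 0)"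
  proof (intro sum.cong refl)
    fix l assume "l \<in> {1..n}"
    moreover have "(k, l) \<notin> D" if "l \<noteq> j" using D_row[OF assms(1), of l] that by blast
    ultimately show "entry XD k l * entry h l b = (if l = j then \<phi> (k, j) * entry h j b else 0)"
      using XD_entry[OF r(1), of l] assms(1) by (cases "l = j") simp_all
  qed
  finally show ?thesis using r by simp
qed

lemma XD_column:
  assumes "(i, l) \<in> D" "g \<in> carrier (UT n)" "a \<in> {1..n}"
  shows "entry (g * XD) a l = entry g a i * \<phi> (i, l)"
proof -
  have r: "i \<in> {1..n}" "l \<in> {1..n}" using D_pos[OF assms(1)] by auto
  have "entry (g * XD) a l = (\<Sum>p\<in>{1..n}. entry g a p * entry XD p l)"
    using entry_mult[OF UT_mat[OF assms(2)] XD_mat assms(3) r(2)] by (simp add: mprod_def)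
  also have "\<dots> = (\<Sum>p\<in>{1..n}. if p = i then entry g a i * \<phi> (i, l) else 0)"
  proof (intro sum.cong refl)
    fix p assume "p \<in> {1..n}"
    moreover have "(p, l) \<notin> D" if "p \<noteq> i" using D_col[OF assms(1), of p] that by blast
    ultimately show "entry g a p * entry XD p l = (if p = i then entry g a i * \<phi> (i, l) else 0)"
      using XD_entry[OF _ r(2), of p] assms(1) by (cases "p = i") simp_all
  qed
  finally show ?thesis using r by simp
qed

text \<open>Multiplication by an elementary matrix changes more than one entry; adding \<open>t\<close> to a single entry
  above the diagonal stays in the group and has a simpler effect on products.\<close>

definition shift_entry :: "'a mat \<Rightarrow> nat \<Rightarrow> nat \<Rightarrow> 'a \<Rightarrow> 'a mat" where
  "shift_entry g i k t = mat n n (\<lambda>(p, q). g $$ (p, q) + (if p = i - 1 \<and> q = k - 1 then t else 0))"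

lemma shift_entry_UT: "g \<in> carrier (UT n) \<Longrightarrow> 1 \<le> i \<Longrightarrow> i < k \<Longrightarrow> shift_entry g i k t \<in> carrier (UT n)"
  by (auto simp: UT_iff shift_entry_def)

lemma shift_entry_entry:
  "i \<in> {1..n} \<Longrightarrow> k \<in> {1..n} \<Longrightarrow> a \<in> {1..n} \<Longrightarrow> b \<in> {1..n} \<Longrightarrow>
    entry (shift_entry g i k t) a b = entry g a b + (if a = i \<and> b = k then t else 0)"
  by (auto simp: shift_entry_def entry_def)

lemma mprod_shift_left:
  assumes "g \<in> carrier (UT n)" "B \<in> carrier_mat n n" "1 \<le> i" "i < k" "k \<le> n" "a \<in> {1..n}" "b \<in> {1..n}"
  shows "entry (shift_entry g i k t * B) a b = entry (g * B) a b + (if a = i then t * entry B k b else 0)"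
proof -
  have g: "shift_entry g i k t \<in> carrier_mat n n" using UT_mat[OF shift_entry_UT[OF assms(1,3,4)]] .
  have "entry (shift_entry g i k t * B) a b = (\<Sum>l\<in>{1..n}. entry g a l * entry B l b + (if l = k then if a = i then t * entry B k b else 0 else 0))"
    unfolding entry_mult[OF g assms(2,6,7)] mprod_def
    using assms by (intro sum.cong refl) (auto simp: shift_entry_entry algebra_simps)
  then show ?thesis using assms entry_mult[OF UT_mat[OF assms(1)] assms(2,6,7)] by (simp add: sum.distrib mprod_def)
qed

lemma mprod_shift_right:
  assumes "h \<in> carrier (UT n)" "B \<in> carrier_mat n n" "1 \<le> i" "i < k" "k \<le> n" "a \<in> {1..n}" "b \<in> {1..n}"
  shows "entry (B * shift_entry h i k t) a b = entry (B * h) a b + (if b = k then entry B a i * t else 0)"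
proof -
  have h: "shift_entry h i k t \<in> carrier_mat n n" using UT_mat[OF shift_entry_UT[OF assms(1,3,4)]] .
  have "entry (B * shift_entry h i k t) a b = (\<Sum>l\<in>{1..n}. entry B a l * entry h l b + (if l = i then if b = k then entry B a i * t else 0 else 0))"
    unfolding entry_mult[OF assms(2) h assms(6,7)] mprod_def
    using assms by (intro sum.cong refl) (auto simp: shift_entry_entry algebra_simps)
  then show ?thesis using assms entry_mult[OF assms(2) UT_mat[OF assms(1)] assms(6,7)] by (simp add: sum.distrib mprod_def)
qed

definition poly_matrix :: "(('i \<Rightarrow> 'a) \<Rightarrow> 'a mat) \<Rightarrow> bool" where
  "poly_matrix g \<longleftrightarrow> (\<forall>c. g c \<in> carrier (UT n)) \<and> (\<forall>i<n. \<forall>j<n. (\<lambda>c. g c $$ (i, j)) \<in> coord_polys)"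

lemma poly_matrix_shift:
  assumes "poly_matrix g" "t \<in> coord_polys" "1 \<le> i" "i < k"
  shows "poly_matrix (\<lambda>c. shift_entry (g c) i k (t c))"
proof -
  have "(\<lambda>c. shift_entry (g c) i k (t c) $$ (p, q)) \<in> coord_polys" if pq: "p < n" "q < n" for p q
  proof (cases "p = i - 1 \<and> q = k - 1")
    case True
    then show ?thesis using assms pq by (auto simp: shift_entry_def poly_matrix_def intro: coord_polys.add)
  next
    case False
    then have "(\<lambda>c. shift_entry (g c) i k (t c) $$ (p, q)) = (\<lambda>c. g c $$ (p, q))"
      using pq by (auto simp: shift_entry_def)
    then show ?thesis using assms pq by (auto simp: poly_matrix_def)
  qed
  then show ?thesis using assms shift_entry_UT by (auto simp: poly_matrix_def)
qed

lemma poly_matrix_product: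
  assumes "poly_matrix g" "poly_matrix h" "i < n" "j < n"
  shows "(\<lambda>c. (g c * XD * h c) $$ (i, j)) \<in> coord_polys"
proof -
  note P = function_algebra_coord_polys
  have "(\<lambda>c. (g c * XD * h c) $$ (i, j)) = (\<lambda>c. \<Sum>l\<in>{0..<n}. (\<Sum>k\<in>{0..<n}. g c $$ (i, k) * XD $$ (k, l)) * h c $$ (l, j))"
    using triple_index[OF UT_mat XD_mat UT_mat assms(3,4)] assms(1,2) by (auto simp: poly_matrix_def)
  also have "\<dots> \<in> coord_polys"
    using assms by (intro function_algebra_sum[OF P] function_algebraD(3)[OF P] function_algebraD(1)[OF P])
       (auto simp: poly_matrix_def)
  finally show ?thesis .
qed

text \<open>The prescribed coordinates are realised one at a time, from the greatest to the least. A root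
  \<open>(i, j)\<close> of \<open>S\<close> has a root of \<open>D\<close> either below it, in some row \<open>k\<close>, or to its left, in some column \<open>l\<close>.
  Adding a suitable multiple of the defect \<open>\<delta>\<close> to the entry \<open>(i, k)\<close> of the left factor, or to the entry
  \<open>(l, j)\<close> of the right factor, corrects the coordinate \<open>(i, j)\<close> and affects only coordinates in the same row
  to the right, or in the same column above, none of which has been treated before.\<close>

lemma section_exists:
  assumes "finite T" "T \<subseteq> S"
  shows "\<exists>g h. poly_matrix g \<and> poly_matrix h \<and> (\<forall>c. \<forall>\<zeta>\<in>T. entry (g c * XD * h c) (fst \<zeta>) (snd \<zeta>) = c \<zeta>)"
  using assms
proof (induction "card T" arbitrary: T rule: less_induct)
  case less
  show ?case
  proof (cases "T = {}")
    case True
    have "poly_matrix (\<lambda>c. 1\<^sub>m n)"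
      by (auto simp: poly_matrix_def UT_iff intro: coord_polys.const)
    then show ?thesis using True by blast
  next
    case False
    obtain \<zeta> where \<zeta>: "\<zeta> \<in> T" "\<And>\<eta>. \<eta> \<in> T \<Longrightarrow> \<eta> \<noteq> \<zeta> \<Longrightarrow> root_succ \<eta> \<zeta>"
      using finite_has_least_root[OF less.prems(1) False] by blast
    obtain i j where ij: "\<zeta> = (i, j)" by (cases \<zeta>)
    have "card (T - {\<zeta>}) < card T" using less.prems(1) \<zeta>(1) by (rule card_Diff1_less)
    then obtain g h where gh: "poly_matrix g" "poly_matrix h"
      "\<And>c \<eta>. \<eta> \<in> T - {\<zeta>} \<Longrightarrow> entry (g c * XD * h c) (fst \<eta>) (snd \<eta>) = c \<eta>"
      using less.hyps[of "T - {\<zeta>}"] less.prems by blast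
    have UT: "g c \<in> carrier (UT n)" "h c \<in> carrier (UT n)" for c using gh by (auto simp: poly_matrix_def)
    note mats = UT_mat[OF UT(1)] UT_mat[OF UT(2)] XD_mat
    have s: "n \<ge> i" "i > j" "j \<ge> 1" using \<zeta>(1) less.prems(2) ij singular_iff[of i j] by auto
    have r: "i \<in> {1..n}" "j \<in> {1..n}" using s by auto
    have Tr: "a \<in> {1..n} \<and> b \<in> {1..n}" if "(a, b) \<in> T" for a b
      using that less.prems(2) singular_iff[of a b] by auto
    \<comment> \<open>The defect of the coordinate to be corrected, itself a polynomial in the prescribed values.\<close>
    define \<delta> where "\<delta> c = c \<zeta> - entry (g c * XD * h c) i j" for c
    have \<delta>P: "\<delta> \<in> coord_polys"
      unfolding \<delta>_def[abs_def] using poly_matrix_product[OF gh(1,2), of "i - 1" "j - 1"] r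
      by (intro function_algebra_diff[OF function_algebra_coord_polys] coord_polys.coord) (auto simp: entry_def)
    have scale: "(\<lambda>c. \<delta> c / x) \<in> coord_polys" for x
      using coord_polys.mult[OF \<delta>P coord_polys.const[of "1 / x"]] by simp
    have later: "b < j \<or> (b = j \<and> i < a)" if "(a, b) \<in> T" "(a, b) \<noteq> \<zeta>" for a b
      using \<zeta>(2)[OF that] ij by (auto simp: root_succ_def)
    have "(i, j) \<in> S" using \<zeta>(1) less.prems(2) ij by auto
    then consider k where "k > i" "(k, j) \<in> D" | l where "l < j" "(i, l) \<in> D" using singular_iff[of i j] by blast
    then show ?thesis
    proof cases
      case 1
      have k: "k \<in> {1..n}" "k \<le> n" using D_pos[OF 1(2)] by auto
      let ?g = "\<lambda>c. shift_entry (g c) i k (\<delta> c / \<phi> (k, j))"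
      have e: "entry (?g c * XD * h c) a b = entry (g c * XD * h c) a b + (if a = i then \<delta> c * entry (h c) j b else 0)"
        if ab: "a \<in> {1..n}" "b \<in> {1..n}" for a b c
      proof -
        have gm: "?g c \<in> carrier_mat n n" using UT_mat[OF shift_entry_UT[OF UT(1) _ 1(1)]] r(1) by simp
        have "entry (?g c * XD * h c) a b = entry (?g c * (XD * h c)) a b"
          using gm mats by (simp add: assoc_mult_mat[of _ n n _ n _ n])
        also have "\<dots> = entry (g c * (XD * h c)) a b + (if a = i then \<delta> c / \<phi> (k, j) * entry (XD * h c) k b else 0)"
          using mats r by (intro mprod_shift_left[OF UT(1) _ _ 1(1) k(2) ab]) auto
        also have "entry (XD * h c) k b = \<phi> (k, j) * entry (h c) j b" by (rule XD_row[OF 1(2) UT(2) ab(2)])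
        finally show ?thesis using nonzero[OF 1(2)] mats by (simp add: assoc_mult_mat[of _ n n _ n _ n])
      qed
      have "entry (?g c * XD * h c) (fst \<eta>) (snd \<eta>) = c \<eta>" if \<eta>: "\<eta> \<in> T" for c \<eta>
      proof (cases "\<eta> = \<zeta>")
        case True
        then show ?thesis using e[OF r] UT_entry(2)[OF UT(2) r(2,2) refl] ij by (simp add: \<delta>_def)
      next
        case False
        obtain a b where ab: "\<eta> = (a, b)" by (cases \<eta>)
        have "a \<noteq> i \<or> entry (h c) j b = 0"
          using later[of a b] \<eta> False ab UT_entry(1)[OF UT(2) r(2), of b c] Tr[of a b] by auto
        then show ?thesis using e[of a b c] gh(3)[of \<eta> c] \<eta> False ab Tr[of a b] by auto
      qed
      moreover have "poly_matrix ?g" using r 1 by (intro poly_matrix_shift[OF gh(1) scale]) auto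
      ultimately show ?thesis using gh(2) by blast
    next
      case 2
      have l: "l \<in> {1..n}" "1 \<le> l" using D_pos[OF 2(2)] by auto
      let ?h = "\<lambda>c. shift_entry (h c) l j (\<delta> c / \<phi> (i, l))"
      have e: "entry (g c * XD * ?h c) a b = entry (g c * XD * h c) a b + (if b = j then entry (g c) a i * \<delta> c else 0)"
        if ab: "a \<in> {1..n}" "b \<in> {1..n}" for a b c
      proof -
        have "entry (g c * XD * ?h c) a b = entry (g c * XD * h c) a b + (if b = j then entry (g c * XD) a l * (\<delta> c / \<phi> (i, l)) else 0)"
          using r by (intro mprod_shift_right[OF UT(2) mult_carrier_mat[OF mats(1,3)] l(2) 2(1) _ ab]) auto
        also have "entry (g c * XD) a l = entry (g c) a i * \<phi> (i, l)" by (rule XD_column[OF 2(2) UT(1) ab(1)])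
        finally show ?thesis using nonzero[OF 2(2)] by simp
      qed
      have "entry (g c * XD * ?h c) (fst \<eta>) (snd \<eta>) = c \<eta>" if \<eta>: "\<eta> \<in> T" for c \<eta>
      proof (cases "\<eta> = \<zeta>")
        case True
        then show ?thesis using e[OF r] UT_entry(2)[OF UT(1) r(1,1) refl] ij by (simp add: \<delta>_def)
      next
        case False
        obtain a b where ab: "\<eta> = (a, b)" by (cases \<eta>)
        have "b \<noteq> j \<or> entry (g c) a i = 0"
          using later[of a b] \<eta> False ab UT_entry(1)[OF UT(1) _ r(1), of a c] Tr[of a b] by auto
        then show ?thesis using e[of a b c] gh(3)[of \<eta> c] \<eta> False ab Tr[of a b] by auto
      qed
      moreover have "poly_matrix ?h" using l 2 by (intro poly_matrix_shift[OF gh(2) scale]) auto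
      ultimately show ?thesis using gh(1) by blast
    qed
  qed
qed

lemma S_pos: "S \<subseteq> pos_roots n" by (auto simp: singular_roots_def)

lemma finite_S: "finite S" using finite_subset[OF S_pos finite_pos_roots] .

theorem parametrisation:
  "\<exists>p. (\<forall>c. p c \<in> V) \<and> (\<forall>i<n. \<forall>j<n. (\<lambda>c. p c $$ (i, j)) \<in> coord_polys) \<and>
     (\<forall>c. \<forall>\<zeta>\<in>S. entry (p c) (fst \<zeta>) (snd \<zeta>) = c \<zeta>)"
proof -
  obtain g h where gh: "poly_matrix g" "poly_matrix h"
    "\<And>c \<zeta>. \<zeta> \<in> S \<Longrightarrow> entry (g c * XD * h c) (fst \<zeta>) (snd \<zeta>) = c \<zeta>"
    using section_exists[OF finite_S order_refl] by blast
  let ?p = "\<lambda>c. strict_lower n (g c * XD * h c)"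
  have "?p c \<in> V" for c using gh(1,2) unfolding V_iff poly_matrix_def by blast
  moreover have "(\<lambda>c. ?p c $$ (i, j)) \<in> coord_polys" if "i < n" "j < n" for i j
    using poly_matrix_product[OF gh(1,2) that] that coord_polys.const[of 0] by (cases "j < i") (simp_all add: strict_lower_def)
  moreover have "entry (?p c) (fst \<zeta>) (snd \<zeta>) = c \<zeta>" if "\<zeta> \<in> S" for c \<zeta>
    using strict_lower_entry[of "fst \<zeta>" "snd \<zeta>" "g c * XD * h c"] gh(3)[OF that] subsetD[OF S_pos that] by simp
  ultimately show ?thesis by (intro exI[of _ ?p]) blast
qed

text \<open>Together with \<open>parametrisation\<close>: \<open>V\<close> is the graph of a polynomial map over the coordinates in \<open>S\<close>.\<close>

lemma V_eqI:
  assumes X: "X \<in> V" and Y: "Y \<in> V" and eq: "\<And>\<zeta>. \<zeta> \<in> S \<Longrightarrow> entry X (fst \<zeta>) (snd \<zeta>) = entry Y (fst \<zeta>) (snd \<zeta>)"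
  shows "X = Y"
proof (rule strictly_lower_eqI[OF V_strictly_lower[OF X] V_strictly_lower[OF Y]])
  fix i j assume "(i, j) \<in> pos_roots n"
  then have "entry X (fst (i, j)) (snd (i, j)) = entry Y (fst (i, j)) (snd (i, j))"
  proof (induction "(i, j)" arbitrary: i j rule: root_succ_induct)
    case (step i j)
    show ?case
    proof (cases "(i, j) \<in> S")
      case False
      then show ?thesis using V_determined[OF X Y step(1) False] step(2) by simp
    qed (use eq[of "(i, j)"] in simp)
  qed
  then show "entry X i j = entry Y i j" by simp
qed

end

section \<open>Generic points\<close>

lemma bracket_form_lower_cong:
  assumes A: "A \<in> nilradical n" and B: "B \<in> nilradical n"
    and eq: "\<And>i j. (i, j) \<in> pos_roots n \<Longrightarrow> x i j = z i j"
  shows "bracket_form n x A B = bracket_form n z A B"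
proof -
  have e: "x i l * (\<Sum>j\<in>{1..n}. A l j * B j i) = z i l * (\<Sum>j\<in>{1..n}. A l j * B j i)"
    if A: "A \<in> nilradical n" and B: "B \<in> nilradical n" for A B :: "nat \<Rightarrow> nat \<Rightarrow> 'a" and i l
  proof (cases "(\<Sum>j\<in>{1..n}. A l j * B j i) = 0")
    case False
    then obtain j where "A l j * B j i \<noteq> 0" by (rule sum.not_neutral_contains_not_neutral)
    then have "A l j \<noteq> 0" "B j i \<noteq> 0" by auto
    then have "(i, l) \<in> pos_roots n" using nilradicalD[OF A, of l j] nilradicalD[OF B, of j i] by (auto simp: pos_roots_def)
    then show ?thesis using eq by simp
  qed simp
  have "mtrace n (mprod n x (mprod n A B)) = mtrace n (mprod n z (mprod n A B))"
    if A: "A \<in> nilradical n" and B: "B \<in> nilradical n" for A B :: "nat \<Rightarrow> nat \<Rightarrow> 'a"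
    unfolding mtrace_def mprod_def by (intro sum.cong refl e[OF that])
  from this[OF A B] this[OF B A] show ?thesis unfolding bracket_form_def by simp
qed

lemma dual_pairs_lower_cong:
  assumes "dual_pairs n x (nilradical n) (nilradical n) s"
    and "\<And>i j. (i, j) \<in> pos_roots n \<Longrightarrow> x i j = z i j"
  shows "dual_pairs n z (nilradical n) (nilradical n) s"
  by (rule dual_pairs_map[OF assms(1), where g = "\<lambda>A. A"]) (simp, simp, rule bracket_form_lower_cong[OF _ _ assms(2)])

context weighted_roots
begin

lemma XD_row_zero:
  assumes "\<And>l. (k, l) \<notin> D" "h \<in> carrier (UT n)" "k \<in> {1..n}" "b \<in> {1..n}"
  shows "entry (XD * h) k b = 0"
proof -
  have "entry (XD * h) k b = (\<Sum>l\<in>{1..n}. entry XD k l * entry h l b)"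
    using entry_mult[OF XD_mat UT_mat[OF assms(2)] assms(3,4)] by (simp add: mprod_def)
  also have "\<dots> = 0" using XD_entry[OF assms(3)] assms(1) by (intro sum.neutral ballI) simp
  finally show ?thesis .
qed

lemma row_shape_XD:
  assumes w: "w \<in> carrier (UT n)"
  shows "row_shape 1 {1<..n} (entry (strict_lower n (XD * w)))"
  unfolding row_shape_def
proof (intro ballI allI impI)
  fix a j assume a: "a \<in> {1<..n}" and j: "1 \<le> j" "j < a"
  have r: "a \<in> {1..n}" "j \<in> {1..n}" "(a, j) \<in> pos_roots n" using a j by (auto simp: pos_roots_def)
  note e = strict_lower_entry[OF r(3), of "XD * w"]
  have "entry (strict_lower n (XD * w)) a j = 0" if no: "\<forall>l\<le>j. (a, l) \<notin> D"
  proof (cases "\<exists>l. (a, l) \<in> D")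
    case True
    then obtain l where l: "(a, l) \<in> D" by blast
    then have "j < l" using no by (meson not_le)
    moreover have "l \<in> {1..n}" using D_pos[OF l] by auto
    ultimately show ?thesis using e XD_row[OF l w r(2)] UT_entry(1)[OF w _ r(2), of l] by simp
  next
    case False
    then show ?thesis using e XD_row_zero[OF _ w r(1,2)] by simp
  qed
  moreover have "entry (strict_lower n (XD * w)) a j = \<phi> (a, j)" if "(a, j) \<in> D"
    using e XD_row[OF that w r(2)] UT_entry(2)[OF w r(2,2) refl] by simp
  ultimately show "((\<forall>l\<le>j. (a, l) \<notin> D) \<longrightarrow> entry (strict_lower n (XD * w)) a j = 0) \<and>
    ((a, j) \<in> D \<longrightarrow> entry (strict_lower n (XD * w)) a j = \<phi> (a, j))" by blast
qed

text \<open>If \<open>X\<close> comes from \<open>a X\<^sub>D b\<close>, conjugation by the inverse of \<open>a\<close> leads to \<open>X\<^sub>D (b a)\<close>.\<close>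

lemma V_to_row_shape:
  assumes X: "X \<in> V"
  shows "\<exists>g\<in>carrier (UT n). row_shape 1 {1<..n} (entry (coadj_act n g X))"
proof -
  obtain a b where ab: "a \<in> carrier (UT n)" "b \<in> carrier (UT n)" "X = strict_lower n (a * XD * b)"
    using X by (auto simp: V_iff)
  let ?g = "inv\<^bsub>UT n\<^esub> a"
  note m = UT_mat[OF ab(1)] UT_mat[OF ab(2)] UT_inv(4)[OF ab(1)] XD_mat
  have "coadj_act n ?g X = strict_lower n (?g * (a * XD * b) * inv\<^bsub>UT n\<^esub> ?g)"
    unfolding coadj_act_def ab(3) using m
    by (intro strict_lower_sandwich[OF UT_inv(1)[OF ab(1)] UT_inv(1)[OF UT_inv(1)[OF ab(1)]]]) simp
  also have "?g * (a * XD * b) * inv\<^bsub>UT n\<^esub> ?g = (?g * a) * XD * (b * a)"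
    using m UT_inv(5)[OF ab(1)] by (simp add: assoc_mult_mat[of _ n n _ n _ n])
  also have "\<dots> = XD * (b * a)" using UT_inv(2)[OF ab(1)] m by simp
  finally have "coadj_act n ?g X = strict_lower n (XD * (b * a))" .
  then show ?thesis
    using row_shape_XD[OF UT_mult_closed[OF ab(2,1)]] by (intro bexI[OF _ UT_inv(1)[OF ab(1)]]) simp
qed

text \<open>The free entries of a functional of row shape fill the rows of the right factor \<open>w\<close>: row \<open>l\<close> of \<open>w\<close> is
  read off from the row of \<open>X\<close> that contains the root of \<open>D\<close> in column \<open>l\<close>.\<close>

lemma row_shape_in_V:
  assumes x: "row_shape 1 {1<..n} x"
  shows "\<exists>X\<in>V. \<forall>(i, j)\<in>pos_roots n. entry X i j = x i j"
proof -
  define r where "r l = (SOME a. (a, l) \<in> D)" for l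
  have r: "r l = a" if "(a, l) \<in> D" for a l
    unfolding r_def using that D_col[OF that] by (intro some_equality) blast+
  define w where "w = mat n n (\<lambda>(p, q). if p = q then 1 else if p < q then x (r (Suc p)) (Suc q) / \<phi> (r (Suc p), Suc p) else 0)"
  have w: "w \<in> carrier (UT n)" by (auto simp: UT_iff w_def)
  let ?X = "strict_lower n (XD * w)"
  have "?X \<in> V"
    unfolding V_iff
  proof (rule bexI[of _ "1\<^sub>m n"], rule bexI[OF _ w])
    show "?X = strict_lower n (1\<^sub>m n * XD * w)" using XD_mat by simp
    show "1\<^sub>m n \<in> carrier (UT n :: 'a mat monoid)" by (auto simp: UT_iff)
  qed
  moreover have "entry ?X i j = x i j" if ij: "(i, j) \<in> pos_roots n" for i j
  proof -
    have b: "i \<in> {1..n}" "j \<in> {1..n}" "i \<in> {1<..n}" "1 \<le> j" "j < i" using ij by (auto simp: pos_roots_def)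
    note e = strict_lower_entry[OF ij, of "XD * w"]
    have x1: "(\<forall>l\<le>j. (i, l) \<notin> D) \<Longrightarrow> x i j = 0" and x2: "(i, j) \<in> D \<Longrightarrow> x i j = \<phi> (i, j)"
      using x b unfolding row_shape_def by blast+
    show ?thesis
    proof (cases "\<exists>l. (i, l) \<in> D")
      case True
      then obtain l where l: "(i, l) \<in> D" by blast
      have ln: "l \<in> {1..n}" using D_pos[OF l] by auto
      have e': "entry ?X i j = \<phi> (i, l) * entry w l j" using e XD_row[OF l w b(2)] by simp
      consider "j < l" | "j = l" | "l < j" by linarith
      then show ?thesis
      proof cases
        case 1
        have "(i, l') \<notin> D" if "l' \<le> j" for l'
          using D_row[OF l, of l'] that 1 by linarith
        then show ?thesis using e' x1 UT_entry(1)[OF w ln b(2) 1] by simp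
      next
        case 2
        then show ?thesis using e' x2 l UT_entry(2)[OF w ln b(2)] by simp
      next
        case 3
        then have "entry w l j = x i j / \<phi> (i, l)"
          using r[OF l] ln b by (auto simp: w_def entry_def)
        then show ?thesis using e' nonzero[OF l] by simp
      qed
    next
      case False
      then show ?thesis using e XD_row_zero[OF _ w b(1,2)] x1 by simp
    qed
  qed
  ultimately show ?thesis by (intro bexI[of _ ?X]) auto
qed

definition param :: "(root \<Rightarrow> 'a) \<Rightarrow> 'a mat" where
  "param = (SOME p. (\<forall>c. p c \<in> V) \<and> (\<forall>i<n. \<forall>j<n. (\<lambda>c. p c $$ (i, j)) \<in> coord_polys) \<and>
     (\<forall>c. \<forall>\<zeta>\<in>S. entry (p c) (fst \<zeta>) (snd \<zeta>) = c \<zeta>))"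

lemma param:
  shows "param c \<in> V" "i < n \<Longrightarrow> j < n \<Longrightarrow> (\<lambda>c. param c $$ (i, j)) \<in> coord_polys"
    "\<zeta> \<in> S \<Longrightarrow> entry (param c) (fst \<zeta>) (snd \<zeta>) = c \<zeta>"
  using someI_ex[OF parametrisation] unfolding param_def[symmetric] by blast+

lemma param_poly: "f \<in> poly_functions n \<Longrightarrow> (\<lambda>c. f (param c)) \<in> coord_polys"
  by (rule poly_functions_comp[OF function_algebra_coord_polys param(2)])

lemma param_eqI: "X \<in> V \<Longrightarrow> (\<And>\<zeta>. \<zeta> \<in> S \<Longrightarrow> entry X (fst \<zeta>) (snd \<zeta>) = c \<zeta>) \<Longrightarrow> param c = X"
  by (rule V_eqI[OF param(1)]) (simp_all add: param(3))

text \<open>Irreducibility of \<open>V\<close>: any two of its points lie on a curve, the image of a line in the coordinate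
  space, along which all functions in question are univariate polynomials.\<close>

lemma V_common_nonzero:
  assumes "finite \<F>" "\<F> \<subseteq> poly_functions n" "\<And>f. f \<in> \<F> \<Longrightarrow> \<exists>X\<in>V. f X \<noteq> 0"
  shows "\<exists>X\<in>V. \<forall>f\<in>\<F>. f X \<noteq> 0"
  using assms
proof (induction \<F> rule: finite_induct)
  case empty
  show ?case using param(1) by blast
next
  case (insert f \<F>)
  obtain X1 where X1: "X1 \<in> V" "\<And>f. f \<in> \<F> \<Longrightarrow> f X1 \<noteq> 0" using insert by auto
  obtain X2 where X2: "X2 \<in> V" "f X2 \<noteq> 0" using insert.prems by auto
  define c where "c t = (\<lambda>\<zeta>. entry X1 (fst \<zeta>) (snd \<zeta>) + t * (entry X2 (fst \<zeta>) (snd \<zeta>) - entry X1 (fst \<zeta>) (snd \<zeta>)))" for t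
  have c: "param (c 0) = X1" "param (c 1) = X2" by (rule param_eqI, fact, simp add: c_def)+
  have "\<exists>t. \<forall>h\<in>insert f \<F>. h (param (c t)) \<noteq> 0"
  proof (rule univariate_common_nonzero)
    show "finite (insert f \<F>)" using insert.hyps by simp
    show "(\<lambda>t. h (param (c t))) \<in> univariate_polys" if "h \<in> insert f \<F>" for h
      unfolding c_def by (rule coord_polys_line[OF param_poly]) (use insert.prems that in blast)
    fix h assume "h \<in> insert f \<F>"
    then show "\<exists>t. h (param (c t)) \<noteq> 0" using c X1(2) X2(2) by auto
  qed
  then show ?case using param(1) by blast
qed

text \<open>Nonempty principal open subsets of \<open>V\<close> are dense.\<close>

lemma V_dense:
  assumes "w \<in> poly_functions n" "f \<in> poly_functions n" "X0 \<in> V" "w X0 \<noteq> 0"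
    and "\<And>X. X \<in> V \<Longrightarrow> w X \<noteq> 0 \<Longrightarrow> f X = 0" and "X \<in> V"
  shows "f X = 0"
proof (rule ccontr)
  assume "f X \<noteq> 0"
  then have "\<exists>Y\<in>V. \<forall>h\<in>{w, f}. h Y \<noteq> 0" using assms by (intro V_common_nonzero) auto
  then show False using assms(5) by auto
qed

text \<open>Only finitely many sets of roots occur, and each independence condition is open.\<close>

lemma generic_exists:
  "\<exists>X0\<in>V. \<forall>X\<in>V. \<forall>I\<subseteq>pos_roots n. row_independent n (entry X) I \<longrightarrow> row_independent n (entry X0) I"
proof -
  define \<I> where "\<I> = {I. I \<subseteq> pos_roots n \<and> (\<exists>X\<in>V. row_independent n (entry X) I)}"
  have fin: "finite \<I>" by (rule finite_subset[of _ "Pow (pos_roots n)"]) (auto simp: \<I>_def finite_pos_roots)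
  have "\<exists>u. u \<in> poly_functions n \<and> (\<exists>X\<in>V. u X \<noteq> 0) \<and> (\<forall>X. u X \<noteq> 0 \<longrightarrow> row_independent n (entry X) I)" if I: "I \<in> \<I>" for I
  proof -
    obtain X where X: "X \<in> V" "row_independent n (entry X) I" "I \<subseteq> pos_roots n" using I by (auto simp: \<I>_def)
    obtain u a where u: "u \<in> poly_functions n" "u X \<noteq> 0"
      "\<And>X \<eta> \<eta>'. \<eta> \<in> I \<Longrightarrow> \<eta>' \<in> I \<Longrightarrow> ad n (entry X) (matrix_of n (\<lambda>\<beta>. a \<eta> \<beta> X)) \<eta>' = (if \<eta> = \<eta>' then u X else 0)"
      using row_independent_open[OF X(2,3)] by blast
    have "row_independent n (entry Y) I" if "u Y \<noteq> 0" for Y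
      by (rule row_independentI_dual[OF that u(3)])
    then show ?thesis using u(1,2) X(1) by blast
  qed
  then obtain u where u: "\<forall>I\<in>\<I>. u I \<in> poly_functions n \<and> (\<exists>X\<in>V. u I X \<noteq> 0) \<and> (\<forall>X. u I X \<noteq> 0 \<longrightarrow> row_independent n (entry X) I)"
    using bchoice[of \<I> "\<lambda>I u. u \<in> poly_functions n \<and> (\<exists>X\<in>V. u X \<noteq> 0) \<and> (\<forall>X. u X \<noteq> 0 \<longrightarrow> row_independent n (entry X) I)"] by blast
  obtain X0 where X0: "X0 \<in> V" "\<And>I. I \<in> \<I> \<Longrightarrow> u I X0 \<noteq> 0"
    using V_common_nonzero[of "u ` \<I>"] fin u by blast
  have "row_independent n (entry X0) I" if "X \<in> V" "I \<subseteq> pos_roots n" "row_independent n (entry X) I" for X I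
  proof -
    have "I \<in> \<I>" using that unfolding \<I>_def by blast
    then show ?thesis using u X0(2) by blast
  qed
  then show ?thesis using X0(1) by blast
qed

end

locale generic_point = weighted_roots n D \<phi> for n D and \<phi> :: "root \<Rightarrow> 'a::field_char_0" +
  fixes X0 :: "'a mat"
  assumes X0: "X0 \<in> V"
    and generic: "\<And>X I. X \<in> V \<Longrightarrow> I \<subseteq> pos_roots n \<Longrightarrow> row_independent n (entry X) I \<Longrightarrow> row_independent n (entry X0) I"
begin

abbreviation J :: "root set" where "J \<equiv> jumps n (entry X0)"

lemma jumps_eq_J: "X \<in> V \<Longrightarrow> row_independent n (entry X) J \<Longrightarrow> jumps n (entry X) = J"
  by (rule jumps_eq) (auto intro: generic)

lemma J_S: "J \<subseteq> S" using jumps_V[OF X0] .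

lemma J_pos: "J \<subseteq> pos_roots n" by (auto simp: jumps_def)

text \<open>The orbit of the generic point contains a point of row shape, where the rank is at most \<open>2 q\<close>; and
  some point of row shape has rank \<open>2 q\<close> and lies in \<open>V\<close>, where the rank is at most the generic one.\<close>

lemma card_J:
  assumes q: "swaps 1 id q" and n: "1 \<le> n"
  shows "card J = 2 * q"
proof (rule antisym)
  obtain g where g: "g \<in> carrier (UT n)" "row_shape 1 {1<..n} (entry (coadj_act n g X0))"
    using V_to_row_shape[OF X0] by blast
  let ?Y = "coadj_act n g X0"
  have e: "jumps n (entry ?Y) = J" by (rule jumps_coadj[OF g(1) V_strictly_lower[OF X0]])
  have "row_independent n (entry ?Y) J" using row_independent_jumps[of n "entry ?Y"] unfolding e .
  from row_independent_dual_pairs[OF this J_pos]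
  show "card J \<le> 2 * q" by (rule dual_pairs_upper[OF q n g(2)])
next
  obtain x where x: "row_shape 1 {1<..n} x" "dual_pairs n x (nilradical n) (nilradical n) (2 * q)"
    using dual_pairs_lower[OF q n] by blast
  obtain X where X: "X \<in> V" "\<And>i j. (i, j) \<in> pos_roots n \<Longrightarrow> entry X i j = x i j"
    using row_shape_in_V[OF x(1)] by blast
  have "dual_pairs n (entry X) (nilradical n) (nilradical n) (2 * q)"
    by (rule dual_pairs_lower_cong[OF x(2)]) (simp add: X(2))
  then have 1: "2 * q \<le> card (jumps n (entry X))" by (rule dual_pairs_le_card_jumps)
  have p: "jumps n (entry X) \<subseteq> pos_roots n" by (auto simp: jumps_def)
  have "row_independent n (entry X0) (jumps n (entry X))"
    by (rule generic[OF X(1) p row_independent_jumps])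
  from row_independent_dual_pairs[OF this p] have "card (jumps n (entry X)) \<le> card J"
    by (rule dual_pairs_le_card_jumps)
  then show "2 * q \<le> card J" using 1 by simp
qed

lemma card_free:
  assumes n: "1 \<le> n"
  shows "card (S - J) + card D = card (C_roots n D)"
proof -
  obtain q where q: "swaps 1 id q" "card (S \<union> D) = card (C_roots n D) + 2 * q"
    using crosses_count by blast
  have "S \<inter> D = {}"
  proof -
    have "(i, j) \<notin> D" if ij: "(i, j) \<in> S" for i j
    proof
      assume d: "(i, j) \<in> D"
      have "(\<exists>k>i. (k, j) \<in> D) \<or> (\<exists>l<j. (i, l) \<in> D)" using ij singular_iff[of i j] by blast
      then show False using D_row[OF d] D_col[OF d] by blast
    qed
    then show ?thesis by auto
  qed
  moreover have "D \<subseteq> pos_roots n" using D_pos by (auto simp: pos_roots_def)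
  then have "finite D" using finite_subset finite_pos_roots by blast
  ultimately have "card S + card D = card (C_roots n D) + 2 * q"
    using q(2) finite_S by (simp add: card_Un_disjoint)
  moreover have "card (S - J) = card S - card J" "card J \<le> card S"
    using card_Diff_subset[OF finite_jumps J_S] card_mono[OF finite_S J_S] by auto
  ultimately show ?thesis using card_J[OF q(1) n] by simp
qed

end

section \<open>Normalisation of generic points\<close>

text \<open>Functions that are regular where \<open>w\<close> does not vanish, with no condition on the other points.\<close>

definition localised :: "nat \<Rightarrow> ('a::field mat \<Rightarrow> 'a) \<Rightarrow> ('a mat \<Rightarrow> 'a) set" where
  "localised n w = {f. \<exists>p\<in>poly_functions n. \<exists>k. \<forall>X. w X \<noteq> 0 \<longrightarrow> f X = p X / w X ^ k}"

lemma localisedI: "p \<in> poly_functions n \<Longrightarrow> (\<And>X. w X \<noteq> 0 \<Longrightarrow> f X = p X / w X ^ k) \<Longrightarrow> f \<in> localised n w"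
  unfolding localised_def by blast

lemma localised_poly: "p \<in> poly_functions n \<Longrightarrow> p \<in> localised n w"
  by (rule localisedI[where k = 0]) simp_all

lemma function_algebra_localised:
  assumes w: "w \<in> poly_functions n"
  shows "function_algebra (localised n w)"
  unfolding function_algebra_def
proof (intro conjI allI ballI)
  note P = function_algebra_poly_functions[of n]
  show "(\<lambda>_. c) \<in> localised n w" for c by (rule localised_poly[OF function_algebraD(1)[OF P]])
  fix f g assume "f \<in> localised n w" "g \<in> localised n w"
  then obtain p k q l where p: "p \<in> poly_functions n" "\<And>X. w X \<noteq> 0 \<Longrightarrow> f X = p X / w X ^ k"
    and q: "q \<in> poly_functions n" "\<And>X. w X \<noteq> 0 \<Longrightarrow> g X = q X / w X ^ l"
    unfolding localised_def by blast
  show "(\<lambda>X. f X + g X) \<in> localised n w"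
  proof (rule localisedI)
    show "(\<lambda>X. p X * w X ^ l + q X * w X ^ k) \<in> poly_functions n"
      by (intro function_algebraD(2)[OF P] function_algebraD(3)[OF P] function_algebra_power[OF P] p q w)
    show "f X + g X = (p X * w X ^ l + q X * w X ^ k) / w X ^ (k + l)" if "w X \<noteq> 0" for X
      using p(2)[OF that] q(2)[OF that] that by (simp add: field_simps power_add)
  qed
  show "(\<lambda>X. f X * g X) \<in> localised n w"
  proof (rule localisedI)
    show "(\<lambda>X. p X * q X) \<in> poly_functions n" by (intro function_algebraD(3)[OF P] p q)
    show "f X * g X = p X * q X / w X ^ (k + l)" if "w X \<noteq> 0" for X
      using p(2)[OF that] q(2)[OF that] by (simp add: power_add)
  qed
qed

lemma localised_mono:
  assumes f: "f \<in> localised n w" and v: "v \<in> poly_functions n"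
  shows "f \<in> localised n (\<lambda>X. w X * v X)"
proof -
  note P = function_algebra_poly_functions[of n]
  obtain p k where p: "p \<in> poly_functions n" "\<And>X. w X \<noteq> 0 \<Longrightarrow> f X = p X / w X ^ k"
    using f unfolding localised_def by blast
  show ?thesis
  proof (rule localisedI)
    show "(\<lambda>X. p X * v X ^ k) \<in> poly_functions n"
      by (intro function_algebraD(3)[OF P] function_algebra_power[OF P] p v)
    show "f X = p X * v X ^ k / (w X * v X) ^ k" if "w X * v X \<noteq> 0" for X
      using p(2)[of X] that by (simp add: power_mult_distrib)
  qed
qed

lemma strictly_lower_index_in:
  assumes P: "function_algebra P" and F: "\<And>x. F x \<in> strictly_lower n"
    and e: "\<And>i j. (i, j) \<in> pos_roots n \<Longrightarrow> (\<lambda>x. entry (F x) i j) \<in> P" and ij: "i < n" "j < n"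
  shows "(\<lambda>x. F x $$ (i, j)) \<in> P"
proof (cases "j < i")
  case True
  then show ?thesis using e[of "Suc i" "Suc j"] ij by (simp add: pos_roots_def entry_def)
next
  case False
  then have "F x $$ (i, j) = 0" for x using F[of x] ij by (auto simp: strictly_lower_def)
  then show ?thesis using function_algebraD(1)[OF P] by simp
qed

text \<open>The coordinates of a translate are computed recursively along each row, from left to right, without
  inverting the group element.\<close>

lemma coadj_exp1_in_algebra:
  assumes P: "function_algebra P"
    and Y: "\<And>x. Y x \<in> strictly_lower n" "\<And>i j. (i, j) \<in> pos_roots n \<Longrightarrow> (\<lambda>x. entry (Y x) i j) \<in> P"
    and B: "\<And>x. B x \<in> nilradical n" "\<And>a b. (\<lambda>x. B x a b) \<in> P"
    and ij: "(i, j) \<in> pos_roots n"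
  shows "(\<lambda>x. entry (coadj_act n (exp1 n (B x)) (Y x)) i j) \<in> P"
  using ij
proof (induction j rule: less_induct)
  case (less j)
  have 1: "(i, l) \<in> pos_roots n" if "l \<in> {1..<j}" for l using that less.prems by (auto simp: pos_roots_def)
  have 2: "(l, j) \<in> pos_roots n" if "l \<in> {i<..n}" for l using that less.prems by (auto simp: pos_roots_def)
  have mem: "(\<lambda>x. entry (Y x) i j + (\<Sum>l\<in>{i<..n}. B x i l * entry (Y x) l j)
     - (\<Sum>l\<in>{1..<j}. entry (coadj_act n (exp1 n (B x)) (Y x)) i l * B x l j)) \<in> P"
    using less.IH 1 2
    by (intro function_algebra_diff[OF P] function_algebraD(2)[OF P] function_algebra_sum[OF P] function_algebraD(3)[OF P] Y(2) B(2) less.prems) auto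
  have eq: "(\<lambda>x. entry (coadj_act n (exp1 n (B x)) (Y x)) i j) = (\<lambda>x. entry (Y x) i j + (\<Sum>l\<in>{i<..n}. B x i l * entry (Y x) l j)
     - (\<Sum>l\<in>{1..<j}. entry (coadj_act n (exp1 n (B x)) (Y x)) i l * B x l j))"
    by (rule ext) (rule coadj_entry_formula[OF B(1) Y(1) less.prems])
  show ?case using mem unfolding eq[symmetric] .
qed

context weighted_roots
begin

text \<open>The least root of \<open>T\<close> is treated last, because moving the coordinate of a jump preserves the
  greater ones only.\<close>

lemma move_to_zero:
  assumes X: "X \<in> V" and T: "finite T" "T \<subseteq> jumps n (entry X)"
  shows "\<exists>g\<in>carrier (UT n). \<forall>\<zeta>\<in>T. entry (coadj_act n g X) (fst \<zeta>) (snd \<zeta>) = 0"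
  using T
proof (induction "card T" arbitrary: T rule: less_induct)
  case less
  show ?case
  proof (cases "T = {}")
    case True
    have "1\<^sub>m n \<in> carrier (UT n :: 'a mat monoid)" by (auto simp: UT_iff)
    then show ?thesis using True by blast
  next
    case False
    obtain \<zeta> where \<zeta>: "\<zeta> \<in> T" "\<And>\<eta>. \<eta> \<in> T \<Longrightarrow> \<eta> \<noteq> \<zeta> \<Longrightarrow> root_succ \<eta> \<zeta>"
      using finite_has_least_root[OF less.prems(1) False] by blast
    obtain k m where km: "\<zeta> = (k, m)" by (cases \<zeta>)
    have "card (T - {\<zeta>}) < card T" using less.prems(1) \<zeta>(1) by (rule card_Diff1_less)
    then obtain g where g: "g \<in> carrier (UT n)" "\<And>\<eta>. \<eta> \<in> T - {\<zeta>} \<Longrightarrow> entry (coadj_act n g X) (fst \<eta>) (snd \<eta>) = 0"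
      using less.hyps[of "T - {\<zeta>}"] less.prems by blast
    have jY: "(k, m) \<in> jumps n (entry (coadj_act n g X))"
      unfolding jumps_coadj[OF g(1) V_strictly_lower[OF X]] using \<zeta>(1) less.prems(2) km by blast
    obtain h where h: "h \<in> carrier (UT n)"
      "\<And>a b. (a, b) \<in> pos_roots n \<Longrightarrow> root_succ (a, b) (k, m) \<Longrightarrow> entry (coadj_act n h (coadj_act n g X)) a b = entry (coadj_act n g X) a b"
      "entry (coadj_act n h (coadj_act n g X)) k m = 0"
      using jumpE_coadj[OF coadj_in jY, where t = 0] by blast
    have e: "coadj_act n (h * g) X = coadj_act n h (coadj_act n g X)"
      by (rule coadj_mult[OF h(1) g(1) strictly_lower_mat[OF V_strictly_lower[OF X]]])
    have "entry (coadj_act n (h * g) X) (fst \<eta>) (snd \<eta>) = 0" if \<eta>: "\<eta> \<in> T" for \<eta>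
    proof (cases "\<eta> = \<zeta>")
      case True
      then show ?thesis using h(3) km by (simp add: e)
    next
      case False
      have "\<eta> \<in> pos_roots n" using \<eta> less.prems(2) by (auto simp: jumps_def)
      then show ?thesis
        using h(2)[of "fst \<eta>" "snd \<eta>"] \<zeta>(2)[OF \<eta> False] g(2)[of \<eta>] \<eta> False km by (simp add: e)
    qed
    then show ?thesis by (intro bexI[OF _ UT_mult_closed[OF h(1) g(1)]]) blast
  qed
qed

text \<open>Two points of an orbit that both vanish at all jumps agree at every root, by induction from greater
  to smaller roots: the first difference could only be at a jump.\<close>

lemma normal_point_unique:
  assumes X: "X \<in> V" and g: "g \<in> carrier (UT n)"
    and z: "\<And>\<zeta>. \<zeta> \<in> jumps n (entry X) \<Longrightarrow> entry X (fst \<zeta>) (snd \<zeta>) = 0"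
      "\<And>\<zeta>. \<zeta> \<in> jumps n (entry X) \<Longrightarrow> entry (coadj_act n g X) (fst \<zeta>) (snd \<zeta>) = 0"
  shows "coadj_act n g X = X"
proof (rule strictly_lower_eqI[OF coadj_in V_strictly_lower[OF X]])
  fix i j assume ij: "(i, j) \<in> pos_roots n"
  then have "entry (coadj_act n g X) (fst (i, j)) (snd (i, j)) = entry X (fst (i, j)) (snd (i, j))"
  proof (induction "(i, j)" arbitrary: i j rule: root_succ_induct)
    case (step i j)
    show ?case
    proof (cases "(i, j) \<in> jumps n (entry X)")
      case True
      then show ?thesis using z[of "(i, j)"] by simp
    next
      case False
      then show ?thesis using jumpI_coadj[OF g V_strictly_lower[OF X] step(1)] step(2) by auto
    qed
  qed
  then show "entry (coadj_act n g X) i j = entry X i j" by simp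
qed

end

context generic_point
begin

lemma jumps_orbit: "X \<in> V \<Longrightarrow> g \<in> carrier (UT n) \<Longrightarrow> jumps n (entry (coadj_act n g X)) = jumps n (entry X)"
  by (rule jumps_coadj[OF _ V_strictly_lower])

text \<open>This carries out \<open>move_to_zero\<close> with parameters. Each step uses the dual family of
  \<open>row_independent_open\<close> near the image of the base point \<open>X1\<close> under the map obtained so far, and its
  factor \<open>u\<close> enlarges the denominator \<open>w\<close> by the numerator \<open>v\<close> of \<open>u (F X)\<close>.\<close>

lemma normalisation:
  assumes X1: "X1 \<in> V" "jumps n (entry X1) = J" and T: "finite T" "T \<subseteq> J"
  shows "\<exists>w\<in>poly_functions n. w X1 \<noteq> 0 \<and> (\<exists>F. (\<forall>X. F X \<in> strictly_lower n)
    \<and> (\<forall>i j. (i, j) \<in> pos_roots n \<longrightarrow> (\<lambda>X. entry (F X) i j) \<in> localised n w)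
    \<and> (\<forall>X\<in>V. w X \<noteq> 0 \<longrightarrow> jumps n (entry X) = J \<and> (\<exists>g\<in>carrier (UT n). F X = coadj_act n g X)
        \<and> (\<forall>\<zeta>\<in>T. entry (F X) (fst \<zeta>) (snd \<zeta>) = 0)))"
  using T
proof (induction "card T" arbitrary: T rule: less_induct)
  case less
  note P = function_algebra_poly_functions[of n]
  show ?case
  proof (cases "T = {}")
    case True
    obtain u a where u: "u \<in> poly_functions n" "u X1 \<noteq> 0"
      "\<And>X \<eta> \<eta>'. \<eta> \<in> J \<Longrightarrow> \<eta>' \<in> J \<Longrightarrow> ad n (entry X) (matrix_of n (\<lambda>\<beta>. a \<eta> \<beta> X)) \<eta>' = (if \<eta> = \<eta>' then u X else 0)"
      using row_independent_open[OF row_independent_jumps[of n "entry X1", unfolded X1(2)] J_pos] by blast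
    have j: "jumps n (entry X) = J" if "X \<in> V" "u X \<noteq> 0" for X
      by (rule jumps_eq_J[OF that(1) row_independentI_dual[OF that(2) u(3)]])
    have o: "\<exists>g\<in>carrier (UT n). strict_lower n X = coadj_act n g X" if "X \<in> V" for X
    proof (rule bexI)
      show "strict_lower n X = coadj_act n (1\<^sub>m n) X"
        using V_strictly_lower[OF that] by (simp add: coadj_one strict_lower_id)
      show "1\<^sub>m n \<in> carrier (UT n :: 'a mat monoid)" by (auto simp: UT_iff)
    qed
    have e: "(\<lambda>X. entry (strict_lower n X) i j) \<in> localised n u" if ij: "(i, j) \<in> pos_roots n" for i j
      unfolding strict_lower_entry[OF ij] using ij by (intro localised_poly entry_poly) (auto simp: pos_roots_def)
    show ?thesis
      using u(1,2) j o e True by (intro bexI[OF _ u(1)] conjI exI[of _ "strict_lower n"]) (auto simp: strict_lower_in)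
  next
    case False
    obtain \<zeta> where \<zeta>: "\<zeta> \<in> T" "\<And>\<eta>. \<eta> \<in> T \<Longrightarrow> \<eta> \<noteq> \<zeta> \<Longrightarrow> root_succ \<eta> \<zeta>"
      using finite_has_least_root[OF less.prems(1) False] by blast
    obtain k m where km: "\<zeta> = (k, m)" by (cases \<zeta>)
    have \<zeta>J: "\<zeta> \<in> J" using \<zeta>(1) less.prems(2) by blast
    have p: "(k, m) \<in> pos_roots n" using \<zeta>J J_pos km by blast
    have "card (T - {\<zeta>}) < card T" using less.prems(1) \<zeta>(1) by (rule card_Diff1_less)
    then have "\<exists>w\<in>poly_functions n. w X1 \<noteq> 0 \<and> (\<exists>F. (\<forall>X. F X \<in> strictly_lower n)
      \<and> (\<forall>i j. (i, j) \<in> pos_roots n \<longrightarrow> (\<lambda>X. entry (F X) i j) \<in> localised n w)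
      \<and> (\<forall>X\<in>V. w X \<noteq> 0 \<longrightarrow> jumps n (entry X) = J \<and> (\<exists>g\<in>carrier (UT n). F X = coadj_act n g X)
          \<and> (\<forall>\<eta>\<in>T - {\<zeta>}. entry (F X) (fst \<eta>) (snd \<eta>) = 0)))"
      by (rule less.hyps) (use less.prems in auto)
    then obtain w F where w: "w \<in> poly_functions n" "w X1 \<noteq> 0" and FL: "\<And>X. F X \<in> strictly_lower n"
      and Fe: "\<And>i j. (i, j) \<in> pos_roots n \<Longrightarrow> (\<lambda>X. entry (F X) i j) \<in> localised n w"
      and FJ: "\<And>X. X \<in> V \<Longrightarrow> w X \<noteq> 0 \<Longrightarrow> jumps n (entry X) = J"
      and FO: "\<And>X. X \<in> V \<Longrightarrow> w X \<noteq> 0 \<Longrightarrow> \<exists>g\<in>carrier (UT n). F X = coadj_act n g X"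
      and FZ: "\<And>X \<eta>. X \<in> V \<Longrightarrow> w X \<noteq> 0 \<Longrightarrow> \<eta> \<in> T - {\<zeta>} \<Longrightarrow> entry (F X) (fst \<eta>) (snd \<eta>) = 0"
      by (elim bexE conjE exE) blast
    have FV: "F X \<in> V" "jumps n (entry (F X)) = J" if "X \<in> V" "w X \<noteq> 0" for X
      using FO[OF that] coadj_V[OF _ that(1)] jumps_orbit[OF that(1)] FJ[OF that] by auto
    have "row_independent n (entry (F X1)) J"
      using row_independent_jumps[of n "entry (F X1)"] unfolding FV(2)[OF X1(1) w(2)] .
    from row_independent_open[OF this J_pos]
    obtain u a where u: "u \<in> poly_functions n" "u (F X1) \<noteq> 0"
      and a: "\<And>\<eta> \<beta>. \<eta> \<in> J \<Longrightarrow> \<beta> \<in> pos_roots n \<Longrightarrow> a \<eta> \<beta> \<in> poly_functions n"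
      "\<And>X \<eta> \<eta>'. \<eta> \<in> J \<Longrightarrow> \<eta>' \<in> J \<Longrightarrow> ad n (entry X) (matrix_of n (\<lambda>\<beta>. a \<eta> \<beta> X)) \<eta>' = (if \<eta> = \<eta>' then u X else 0)"
      by blast
    note L = function_algebra_localised[OF w(1)]
    have comp: "(\<lambda>X. f (F X)) \<in> localised n w" if "f \<in> poly_functions n" for f
      by (rule poly_functions_comp[OF L strictly_lower_index_in[OF L FL Fe] that])
    obtain v l where v: "v \<in> poly_functions n" "\<And>X. w X \<noteq> 0 \<Longrightarrow> u (F X) = v X / w X ^ l"
      using comp[OF u(1)] unfolding localised_def by blast
    define w' where "w' X = w X * v X" for X
    have w': "w' \<in> poly_functions n" unfolding w'_def[abs_def] by (rule function_algebraD(3)[OF P w(1) v(1)])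
    have w'0: "w' X1 \<noteq> 0" using v(2)[OF w(2)] u(2) w(2) by (auto simp: w'_def)
    note L' = function_algebra_localised[OF w']
    have mono: "f \<in> localised n w'" if "f \<in> localised n w" for f
      unfolding w'_def[abs_def] by (rule localised_mono[OF that v(1)])
    have inv: "(\<lambda>X. 1 / u (F X)) \<in> localised n w'"
    proof (rule localisedI)
      show "(\<lambda>X. w X ^ Suc l) \<in> poly_functions n" by (rule function_algebra_power[OF P w(1)])
      show "1 / u (F X) = w X ^ Suc l / w' X ^ 1" if "w' X \<noteq> 0" for X
        using that by (simp add: v(2) w'_def)
    qed
    \<comment> \<open>The dual vector of \<open>\<zeta>\<close>, scaled to change the coordinate \<open>\<zeta>\<close> by its negative.\<close>
    define B where "B X = (\<lambda>p q. (- entry (F X) k m * (1 / u (F X))) * matrix_of n (\<lambda>\<beta>. a \<zeta> \<beta> (F X)) p q)" for X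
    have B: "B X \<in> nilradical n" for X unfolding B_def by (rule nilradical_scale[OF matrix_of_nilradical])
    have Be: "(\<lambda>X. B X p q) \<in> localised n w'" for p q
    proof (cases "(q, p) \<in> pos_roots n")
      case True
      have "(\<lambda>X. (- entry (F X) k m * (1 / u (F X))) * a \<zeta> (q, p) (F X)) \<in> localised n w'"
        by (intro function_algebraD(3)[OF L'] function_algebra_uminus[OF L'] inv mono[OF Fe[OF p]] mono[OF comp[OF a(1)[OF \<zeta>J True]]])
      then show ?thesis using True by (simp add: B_def matrix_of_def)
    next
      case False
      then show ?thesis using function_algebraD(1)[OF L', of 0] by (simp add: B_def matrix_of_def)
    qed
    define G where "G X = coadj_act n (exp1 n (B X)) (F X)" for X
    have GL: "G X \<in> strictly_lower n" for X unfolding G_def by (rule coadj_in)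
    have Ge: "(\<lambda>X. entry (G X) i j) \<in> localised n w'" if "(i, j) \<in> pos_roots n" for i j
      unfolding G_def by (rule coadj_exp1_in_algebra[OF L' FL mono[OF Fe] B Be that])
    have good: "jumps n (entry X) = J \<and> (\<exists>g\<in>carrier (UT n). G X = coadj_act n g X)
        \<and> (\<forall>\<eta>\<in>T. entry (G X) (fst \<eta>) (snd \<eta>) = 0)" if X: "X \<in> V" "w' X \<noteq> 0" for X
    proof -
      have wX: "w X \<noteq> 0" and vX: "v X \<noteq> 0" using X(2) by (auto simp: w'_def)
      have uX: "u (F X) \<noteq> 0" using v(2)[OF wX] wX vX by simp
      obtain g where g: "g \<in> carrier (UT n)" "F X = coadj_act n g X" using FO[OF X(1) wX] by blast
      have orb: "G X = coadj_act n (exp1 n (B X) * g) X"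
        unfolding G_def g(2) using coadj_mult[OF exp1_in[OF B] g(1) strictly_lower_mat[OF V_strictly_lower[OF X(1)]]] by simp
      have adB: "ad n (entry (F X)) (B X) \<eta> = (- entry (F X) k m * (1 / u (F X))) * (if \<zeta> = \<eta> then u (F X) else 0)" if "\<eta> \<in> J" for \<eta>
        unfolding B_def ad_scale a(2)[OF \<zeta>J that] by simp
      have van: "ad n (entry (F X)) (B X) \<eta> = 0" if \<eta>: "\<eta> \<in> pos_roots n" "root_succ \<eta> (k, m)" for \<eta>
      proof (rule ad_vanishes[OF B _ \<eta>])
        fix \<xi> assume \<xi>: "\<xi> \<in> jumps n (entry (F X))" "root_succ \<xi> (k, m)"
        then have "\<zeta> \<noteq> \<xi>" using km root_succ_irrefl by blast
        then show "ad n (entry (F X)) (B X) \<xi> = 0" using adB[of \<xi>] \<xi>(1) FV(2)[OF X(1) wX] by simp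
      qed
      have keep: "entry (G X) i j = entry (F X) i j" if "(i, j) \<in> pos_roots n" "root_succ (i, j) (k, m)" for i j
        unfolding G_def by (rule coadj_exp1_keeps[OF B FL van that])
      have "entry (G X) k m = entry (F X) k m + ad n (entry (F X)) (B X) (k, m)"
        unfolding G_def
      proof (rule coadj_exp1_step[OF B FL p])
        fix l assume l: "1 \<le> l" "l < m"
        then have "(k, l) \<in> pos_roots n" "root_succ (k, l) (k, m)"
          using p by (auto simp: pos_roots_def root_succ_def)
        then show "entry (coadj_act n (exp1 n (B X)) (F X)) k l = entry (F X) k l"
          using keep unfolding G_def by blast
      qed
      then have z: "entry (G X) k m = 0" using adB[OF \<zeta>J] uX km by simp
      have "entry (G X) (fst \<eta>) (snd \<eta>) = 0" if \<eta>: "\<eta> \<in> T" for \<eta>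
      proof (cases "\<eta> = \<zeta>")
        case True
        then show ?thesis using z km by simp
      next
        case False
        have "\<eta> \<in> pos_roots n" using \<eta> less.prems(2) J_pos by blast
        then show ?thesis
          using keep[of "fst \<eta>" "snd \<eta>"] \<zeta>(2)[OF \<eta> False] FZ[OF X(1) wX, of \<eta>] \<eta> False km by simp
      qed
      then show ?thesis
        using FJ[OF X(1) wX] orb UT_mult_closed[OF exp1_in[OF B] g(1)] by blast
    qed
    show ?thesis using w'0 GL Ge good by (intro bexI[OF _ w'] conjI exI[of _ G]) auto
  qed
qed

end

text \<open>The base point \<open>X1\<close> lies on the slice itself. This guarantees that the domain \<open>w \<noteq> 0\<close> of the
  normalisation \<open>F\<close> meets the slice, which is needed for algebraic independence. Since not every set of
  independent coordinates need be preserved along the orbit, \<open>X1\<close> is kept apart from the generic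
  point \<open>X0\<close>; both have the same jumps.\<close>

locale normal_form = generic_point n D \<phi> X0 for n D and \<phi> :: "root \<Rightarrow> 'a::field_char_0" and X0 +
  fixes X1 :: "'a mat" and w :: "'a mat \<Rightarrow> 'a" and F :: "'a mat \<Rightarrow> 'a mat"
  assumes X1: "X1 \<in> V" "w X1 \<noteq> 0" "\<And>\<zeta>. \<zeta> \<in> J \<Longrightarrow> entry X1 (fst \<zeta>) (snd \<zeta>) = 0"
    and w: "w \<in> poly_functions n"
    and F_lower: "\<And>X. F X \<in> strictly_lower n"
    and F_entry: "\<And>i j. (i, j) \<in> pos_roots n \<Longrightarrow> (\<lambda>X. entry (F X) i j) \<in> localised n w"
    and jumps_good: "\<And>X. X \<in> V \<Longrightarrow> w X \<noteq> 0 \<Longrightarrow> jumps n (entry X) = J"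
    and F_orbit: "\<And>X. X \<in> V \<Longrightarrow> w X \<noteq> 0 \<Longrightarrow> \<exists>g\<in>carrier (UT n). F X = coadj_act n g X"
    and F_zero: "\<And>X \<zeta>. X \<in> V \<Longrightarrow> w X \<noteq> 0 \<Longrightarrow> \<zeta> \<in> J \<Longrightarrow> entry (F X) (fst \<zeta>) (snd \<zeta>) = 0"
begin

lemma F_V: "X \<in> V \<Longrightarrow> w X \<noteq> 0 \<Longrightarrow> F X \<in> V"
  using F_orbit coadj_V by fastforce

lemma jumps_F: "X \<in> V \<Longrightarrow> w X \<noteq> 0 \<Longrightarrow> jumps n (entry (F X)) = J"
  using F_orbit jumps_orbit jumps_good by fastforce

lemma F_fixes:
  assumes X: "X \<in> V" "w X \<noteq> 0" and z: "\<And>\<zeta>. \<zeta> \<in> J \<Longrightarrow> entry X (fst \<zeta>) (snd \<zeta>) = 0"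
  shows "F X = X"
proof -
  obtain g where g: "g \<in> carrier (UT n)" "F X = coadj_act n g X" using F_orbit[OF X] by blast
  have "coadj_act n g X = X"
    by (rule normal_point_unique[OF X(1) g(1)]) (use z F_zero[OF X] g(2) in \<open>simp_all add: jumps_good[OF X]\<close>)
  then show ?thesis using g(2) by simp
qed

lemma F_invariant:
  assumes X: "X \<in> V" "w X \<noteq> 0" and g: "g \<in> carrier (UT n)" and gX: "w (coadj_act n g X) \<noteq> 0"
  shows "F (coadj_act n g X) = F X"
proof -
  let ?Y = "coadj_act n g X"
  have Y: "?Y \<in> V" by (rule coadj_V[OF g X(1)])
  obtain a where a: "a \<in> carrier (UT n)" "F X = coadj_act n a X" using F_orbit[OF X] by blast
  obtain b where b: "b \<in> carrier (UT n)" "F ?Y = coadj_act n b ?Y" using F_orbit[OF Y gX] by blast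
  note m = strictly_lower_mat[OF V_strictly_lower[OF X(1)]] strictly_lower_mat[OF coadj_in]
  let ?i = "inv\<^bsub>UT n\<^esub> a"
  have bg: "b * g \<in> carrier (UT n)" using UT_mult_closed[OF b(1) g] .
  have "F ?Y = coadj_act n (b * g) (coadj_act n ?i (coadj_act n a X))"
    unfolding b(2) coadj_inv(1)[OF a(1) V_strictly_lower[OF X(1)]] by (rule coadj_mult[OF b(1) g m(1), symmetric])
  also have "\<dots> = coadj_act n (b * g * ?i) (F X)"
    unfolding a(2) by (rule coadj_mult[OF bg UT_inv(1)[OF a(1)] m(2), symmetric])
  finally have e: "F ?Y = coadj_act n (b * g * ?i) (F X)" .
  have "coadj_act n (b * g * ?i) (F X) = F X"
    by (rule normal_point_unique[OF F_V[OF X] UT_mult_closed[OF bg UT_inv(1)[OF a(1)]]])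
       (use F_zero[OF X] F_zero[OF Y gX] in \<open>simp_all add: jumps_F[OF X] e\<close>)
  then show ?thesis using e by simp
qed

end

lemma (in generic_point) normal_form_exists: "\<exists>X1 w F. normal_form n D \<phi> X0 X1 w F"
proof -
  obtain g where g: "g \<in> carrier (UT n)" "\<And>\<zeta>. \<zeta> \<in> J \<Longrightarrow> entry (coadj_act n g X0) (fst \<zeta>) (snd \<zeta>) = 0"
    using move_to_zero[OF X0 finite_jumps order_refl] by blast
  obtain w F where "w \<in> poly_functions n" "w (coadj_act n g X0) \<noteq> 0" "\<And>X. F X \<in> strictly_lower n"
    "\<And>i j. (i, j) \<in> pos_roots n \<Longrightarrow> (\<lambda>X. entry (F X) i j) \<in> localised n w"
    "\<And>X. X \<in> V \<Longrightarrow> w X \<noteq> 0 \<Longrightarrow> jumps n (entry X) = J"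
    "\<And>X. X \<in> V \<Longrightarrow> w X \<noteq> 0 \<Longrightarrow> \<exists>g\<in>carrier (UT n). F X = coadj_act n g X"
    "\<And>X \<zeta>. X \<in> V \<Longrightarrow> w X \<noteq> 0 \<Longrightarrow> \<zeta> \<in> J \<Longrightarrow> entry (F X) (fst \<zeta>) (snd \<zeta>) = 0"
    using normalisation[OF coadj_V[OF g(1) X0] jumps_orbit[OF X0 g(1)] finite_jumps order_refl] by blast
  then have "normal_form n D \<phi> X0 (coadj_act n g X0) w F"
    using g coadj_V[OF g(1) X0] by unfold_locales blast+
  then show ?thesis by blast
qed

section \<open>The field of fractions of a domain\<close>

context domain
begin

lemma fraction_iff:
  "a \<in> carrier R \<Longrightarrow> b \<in> carrier R - {\<zero>} \<Longrightarrow>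
    (c, d) \<in> fraction R a b \<longleftrightarrow> c \<in> carrier R \<and> d \<in> carrier R - {\<zero>} \<and> a \<otimes> d = c \<otimes> b"
  by (auto simp: fraction_def frac_rel_def)

text \<open>Transitivity of the relation between fractions, by cancellation of the middle denominator.\<close>

lemma fraction_eqI:
  assumes c: "a \<in> carrier R" "b \<in> carrier R - {\<zero>}" "c \<in> carrier R" "d \<in> carrier R - {\<zero>}"
    and eq: "a \<otimes> d = c \<otimes> b"
  shows "fraction R a b = fraction R c d"
proof -
  have "c \<otimes> f = e \<otimes> d" if e: "e \<in> carrier R" "f \<in> carrier R" "a \<otimes> f = e \<otimes> b"
    and c: "a \<in> carrier R" "b \<in> carrier R - {\<zero>}" "c \<in> carrier R" "d \<in> carrier R - {\<zero>}" "a \<otimes> d = c \<otimes> b"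
  for a b c d e f
  proof -
    have "b \<otimes> (c \<otimes> f) = (c \<otimes> b) \<otimes> f" using c(1-4) e(1,2) by (simp add: m_ac)
    also have "\<dots> = (a \<otimes> d) \<otimes> f" by (simp only: c(5))
    also have "\<dots> = (a \<otimes> f) \<otimes> d" using c(1-4) e(1,2) by (simp add: m_ac)
    also have "\<dots> = (e \<otimes> b) \<otimes> d" by (simp only: e(3))
    also have "\<dots> = b \<otimes> (e \<otimes> d)" using c(1-4) e(1,2) by (simp add: m_ac)
    finally show ?thesis using c e by (simp add: m_lcancel)
  qed
  from this[OF _ _ _ c eq] this[OF _ _ _ c(3,4,1,2) eq[symmetric]] show ?thesis
    using c by (intro Set.set_eqI) (auto simp: fraction_iff split_paired_all)
qed

lemma fraction_eq_iff:
  assumes "a \<in> carrier R" "b \<in> carrier R - {\<zero>}" "c \<in> carrier R" "d \<in> carrier R - {\<zero>}"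
  shows "fraction R a b = fraction R c d \<longleftrightarrow> a \<otimes> d = c \<otimes> b"
proof
  assume "fraction R a b = fraction R c d"
  moreover have "(c, d) \<in> fraction R c d" using assms by (simp add: fraction_iff)
  ultimately show "a \<otimes> d = c \<otimes> b" using fraction_iff[OF assms(1,2)] by blast
qed (rule fraction_eqI[OF assms])

text \<open>The operations of the field of fractions are unions over representatives; a union over a class of
  constant value is that value.\<close>

lemma fraction_UN:
  assumes "a \<in> carrier R" "b \<in> carrier R - {\<zero>}"
    and "\<And>c d. c \<in> carrier R \<Longrightarrow> d \<in> carrier R - {\<zero>} \<Longrightarrow> a \<otimes> d = c \<otimes> b \<Longrightarrow> f c d = f a b"
  shows "(\<Union>(c, d)\<in>fraction R a b. f c d) = f a b"
proof -
  have "(a, b) \<in> fraction R a b" using assms by (simp add: fraction_iff)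
  moreover have "f c d = f a b" if "(c, d) \<in> fraction R a b" for c d
    using that assms(3) unfolding fraction_iff[OF assms(1,2)] by blast
  ultimately show ?thesis by fast
qed

lemma nonzero_mult: "b \<in> carrier R - {\<zero>} \<Longrightarrow> d \<in> carrier R - {\<zero>} \<Longrightarrow> b \<otimes> d \<in> carrier R - {\<zero>}"
  by (auto simp: integral_iff)

abbreviation Q where "Q \<equiv> frac_field R"

lemma frac_carrier: "x \<in> carrier Q \<longleftrightarrow> (\<exists>a b. a \<in> carrier R \<and> b \<in> carrier R - {\<zero>} \<and> x = fraction R a b)"
  by (auto simp: frac_field_def)

lemma frac_in: "a \<in> carrier R \<Longrightarrow> b \<in> carrier R - {\<zero>} \<Longrightarrow> fraction R a b \<in> carrier Q"
  unfolding frac_carrier by blast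

lemma frac_mult:
  assumes c: "a \<in> carrier R" "b \<in> carrier R - {\<zero>}" "c \<in> carrier R" "d \<in> carrier R - {\<zero>}"
  shows "fraction R a b \<otimes>\<^bsub>Q\<^esub> fraction R c d = fraction R (a \<otimes> c) (b \<otimes> d)"
proof -
  have 1: "(\<Union>(c', d')\<in>fraction R c d. fraction R (a' \<otimes> c') (b' \<otimes> d')) = fraction R (a' \<otimes> c) (b' \<otimes> d)"
    if ab: "a' \<in> carrier R" "b' \<in> carrier R - {\<zero>}" for a' b'
  proof (rule fraction_UN[OF c(3,4)])
    fix c' d' assume c': "c' \<in> carrier R" "d' \<in> carrier R - {\<zero>}" "c \<otimes> d' = c' \<otimes> d"
    have "(a' \<otimes> c') \<otimes> (b' \<otimes> d) = (a' \<otimes> b') \<otimes> (c' \<otimes> d)" using ab c c'(1,2) by (simp add: m_ac)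
    also have "\<dots> = (a' \<otimes> b') \<otimes> (c \<otimes> d')" by (simp only: c'(3))
    also have "\<dots> = (a' \<otimes> c) \<otimes> (b' \<otimes> d')" using ab c c'(1,2) by (simp add: m_ac)
    finally show "fraction R (a' \<otimes> c') (b' \<otimes> d') = fraction R (a' \<otimes> c) (b' \<otimes> d)"
      using ab c c' by (intro fraction_eqI nonzero_mult) auto
  qed
  have "(\<Union>(a', b')\<in>fraction R a b. \<Union>(c', d')\<in>fraction R c d. fraction R (a' \<otimes> c') (b' \<otimes> d'))
      = (\<Union>(c', d')\<in>fraction R c d. fraction R (a \<otimes> c') (b \<otimes> d'))"
  proof (rule fraction_UN[OF c(1,2)])
    fix a' b' assume a': "a' \<in> carrier R" "b' \<in> carrier R - {\<zero>}" "a \<otimes> b' = a' \<otimes> b"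
    have "(a' \<otimes> c) \<otimes> (b \<otimes> d) = (c \<otimes> d) \<otimes> (a' \<otimes> b)" using c a'(1,2) by (simp add: m_ac)
    also have "\<dots> = (c \<otimes> d) \<otimes> (a \<otimes> b')" by (simp only: a'(3))
    also have "\<dots> = (a \<otimes> c) \<otimes> (b' \<otimes> d)" using c a'(1,2) by (simp add: m_ac)
    finally show "(\<Union>(c', d')\<in>fraction R c d. fraction R (a' \<otimes> c') (b' \<otimes> d')) = (\<Union>(c', d')\<in>fraction R c d. fraction R (a \<otimes> c') (b \<otimes> d'))"
      unfolding 1[OF a'(1,2)] 1[OF c(1,2)] using a' c by (intro fraction_eqI nonzero_mult) auto
  qed
  then show ?thesis unfolding 1[OF c(1,2)] by (simp add: frac_field_def)
qed

lemma frac_add: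
  assumes c: "a \<in> carrier R" "b \<in> carrier R - {\<zero>}" "c \<in> carrier R" "d \<in> carrier R - {\<zero>}"
  shows "fraction R a b \<oplus>\<^bsub>Q\<^esub> fraction R c d = fraction R (a \<otimes> d \<oplus> c \<otimes> b) (b \<otimes> d)"
proof -
  have 1: "(\<Union>(c', d')\<in>fraction R c d. fraction R (a' \<otimes> d' \<oplus> c' \<otimes> b') (b' \<otimes> d')) = fraction R (a' \<otimes> d \<oplus> c \<otimes> b') (b' \<otimes> d)"
    if ab: "a' \<in> carrier R" "b' \<in> carrier R - {\<zero>}" for a' b'
  proof (rule fraction_UN[OF c(3,4)])
    fix c' d' assume c': "c' \<in> carrier R" "d' \<in> carrier R - {\<zero>}" "c \<otimes> d' = c' \<otimes> d"
    have "(a' \<otimes> d' \<oplus> c' \<otimes> b') \<otimes> (b' \<otimes> d) = a' \<otimes> d' \<otimes> b' \<otimes> d \<oplus> b' \<otimes> b' \<otimes> (c' \<otimes> d)"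
      using ab c c'(1,2) by (simp add: l_distr r_distr m_ac a_ac)
    also have "\<dots> = a' \<otimes> d' \<otimes> b' \<otimes> d \<oplus> b' \<otimes> b' \<otimes> (c \<otimes> d')" by (simp only: c'(3))
    also have "\<dots> = (a' \<otimes> d \<oplus> c \<otimes> b') \<otimes> (b' \<otimes> d')" using ab c c'(1,2) by (simp add: l_distr r_distr m_ac a_ac)
    finally show "fraction R (a' \<otimes> d' \<oplus> c' \<otimes> b') (b' \<otimes> d') = fraction R (a' \<otimes> d \<oplus> c \<otimes> b') (b' \<otimes> d)"
      using ab c c' by (intro fraction_eqI nonzero_mult) auto
  qed
  have "(\<Union>(a', b')\<in>fraction R a b. \<Union>(c', d')\<in>fraction R c d. fraction R (a' \<otimes> d' \<oplus> c' \<otimes> b') (b' \<otimes> d'))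
      = (\<Union>(c', d')\<in>fraction R c d. fraction R (a \<otimes> d' \<oplus> c' \<otimes> b) (b \<otimes> d'))"
  proof (rule fraction_UN[OF c(1,2)])
    fix a' b' assume a': "a' \<in> carrier R" "b' \<in> carrier R - {\<zero>}" "a \<otimes> b' = a' \<otimes> b"
    have "(a' \<otimes> d \<oplus> c \<otimes> b') \<otimes> (b \<otimes> d) = d \<otimes> d \<otimes> (a' \<otimes> b) \<oplus> c \<otimes> b' \<otimes> b \<otimes> d" using c a'(1,2) by (simp add: l_distr r_distr m_ac a_ac)
    also have "\<dots> = d \<otimes> d \<otimes> (a \<otimes> b') \<oplus> c \<otimes> b' \<otimes> b \<otimes> d" by (simp only: a'(3))
    also have "\<dots> = (a \<otimes> d \<oplus> c \<otimes> b) \<otimes> (b' \<otimes> d)" using c a'(1,2) by (simp add: l_distr r_distr m_ac a_ac)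
    finally show "(\<Union>(c', d')\<in>fraction R c d. fraction R (a' \<otimes> d' \<oplus> c' \<otimes> b') (b' \<otimes> d')) = (\<Union>(c', d')\<in>fraction R c d. fraction R (a \<otimes> d' \<oplus> c' \<otimes> b) (b \<otimes> d'))"
      unfolding 1[OF a'(1,2)] 1[OF c(1,2)] using a' c by (intro fraction_eqI nonzero_mult) auto
  qed
  then show ?thesis unfolding 1[OF c(1,2)] by (simp add: frac_field_def)
qed

lemma frac_one: "\<one>\<^bsub>Q\<^esub> = fraction R \<one> \<one>" and frac_zero: "\<zero>\<^bsub>Q\<^esub> = fraction R \<zero> \<one>"
  by (simp_all add: frac_field_def)

lemma frac_zero_iff:
  assumes "a \<in> carrier R" "b \<in> carrier R - {\<zero>}"
  shows "fraction R a b = \<zero>\<^bsub>Q\<^esub> \<longleftrightarrow> a = \<zero>"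
  unfolding frac_zero using fraction_eq_iff[OF assms, of \<zero> \<one>] assms by simp

lemma frac_self: "b \<in> carrier R - {\<zero>} \<Longrightarrow> fraction R b b = \<one>\<^bsub>Q\<^esub>"
  unfolding frac_one by (intro fraction_eqI) auto

lemma frac_cring: "cring Q"
proof (rule cringI)
  have one: "\<one> \<in> carrier R - {\<zero>}" by simp
  show "abelian_group Q"
  proof (rule abelian_groupI)
    show "\<zero>\<^bsub>Q\<^esub> \<in> carrier Q" unfolding frac_zero using one by (intro frac_in) auto
  next
    fix x y assume "x \<in> carrier Q" "y \<in> carrier Q"
    then obtain a b c d where x: "a \<in> carrier R" "b \<in> carrier R - {\<zero>}" "x = fraction R a b"
      and y: "c \<in> carrier R" "d \<in> carrier R - {\<zero>}" "y = fraction R c d" by (auto simp: frac_carrier)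
    note s = frac_add[OF x(1,2) y(1,2)] frac_add[OF y(1,2) x(1,2)]
    show "x \<oplus>\<^bsub>Q\<^esub> y \<in> carrier Q" unfolding x(3) y(3) s using x y nonzero_mult by (intro frac_in) auto
    show "x \<oplus>\<^bsub>Q\<^esub> y = y \<oplus>\<^bsub>Q\<^esub> x" unfolding x(3) y(3) s using x y by (simp add: m_comm a_comm)
  next
    fix x y z assume "x \<in> carrier Q" "y \<in> carrier Q" "z \<in> carrier Q"
    then obtain a b c d e f where x: "a \<in> carrier R" "b \<in> carrier R - {\<zero>}" "x = fraction R a b"
      and y: "c \<in> carrier R" "d \<in> carrier R - {\<zero>}" "y = fraction R c d"
      and z: "e \<in> carrier R" "f \<in> carrier R - {\<zero>}" "z = fraction R e f" by (auto simp: frac_carrier)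
    have "a \<otimes> d \<oplus> c \<otimes> b \<in> carrier R" "c \<otimes> f \<oplus> e \<otimes> d \<in> carrier R" using x y z by auto
    then show "x \<oplus>\<^bsub>Q\<^esub> y \<oplus>\<^bsub>Q\<^esub> z = x \<oplus>\<^bsub>Q\<^esub> (y \<oplus>\<^bsub>Q\<^esub> z)"
      unfolding x(3) y(3) z(3) frac_add[OF x(1,2) y(1,2)] frac_add[OF y(1,2) z(1,2)]
      using x y z nonzero_mult[OF x(2) y(2)] nonzero_mult[OF y(2) z(2)] by (simp add: frac_add l_distr r_distr m_ac a_ac)
  next
    fix x assume "x \<in> carrier Q"
    then obtain a b where x: "a \<in> carrier R" "b \<in> carrier R - {\<zero>}" "x = fraction R a b" by (auto simp: frac_carrier)
    show "\<zero>\<^bsub>Q\<^esub> \<oplus>\<^bsub>Q\<^esub> x = x" unfolding frac_zero x(3) using x one by (simp add: frac_add)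
    have "fraction R (\<ominus> a) b \<oplus>\<^bsub>Q\<^esub> x = fraction R \<zero> (b \<otimes> b)"
      unfolding x(3) using x by (simp add: frac_add l_minus l_neg)
    also have "\<dots> = \<zero>\<^bsub>Q\<^esub>" using frac_zero_iff[OF zero_closed nonzero_mult[OF x(2,2)]] by simp
    finally show "\<exists>y\<in>carrier Q. y \<oplus>\<^bsub>Q\<^esub> x = \<zero>\<^bsub>Q\<^esub>"
      using x by (intro bexI[of _ "fraction R (\<ominus> a) b"] frac_in) auto
  qed
  show "comm_monoid Q"
  proof (rule comm_monoidI)
    show "\<one>\<^bsub>Q\<^esub> \<in> carrier Q" unfolding frac_one using one by (intro frac_in) auto
  next
    fix x y assume "x \<in> carrier Q" "y \<in> carrier Q"
    then obtain a b c d where x: "a \<in> carrier R" "b \<in> carrier R - {\<zero>}" "x = fraction R a b"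
      and y: "c \<in> carrier R" "d \<in> carrier R - {\<zero>}" "y = fraction R c d" by (auto simp: frac_carrier)
    note s = frac_mult[OF x(1,2) y(1,2)] frac_mult[OF y(1,2) x(1,2)]
    show "x \<otimes>\<^bsub>Q\<^esub> y \<in> carrier Q" unfolding x(3) y(3) s using x y nonzero_mult by (intro frac_in) auto
    show "x \<otimes>\<^bsub>Q\<^esub> y = y \<otimes>\<^bsub>Q\<^esub> x" unfolding x(3) y(3) s using x y by (simp add: m_comm)
  next
    fix x y z assume "x \<in> carrier Q" "y \<in> carrier Q" "z \<in> carrier Q"
    then obtain a b c d e f where x: "a \<in> carrier R" "b \<in> carrier R - {\<zero>}" "x = fraction R a b"
      and y: "c \<in> carrier R" "d \<in> carrier R - {\<zero>}" "y = fraction R c d"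
      and z: "e \<in> carrier R" "f \<in> carrier R - {\<zero>}" "z = fraction R e f" by (auto simp: frac_carrier)
    show "x \<otimes>\<^bsub>Q\<^esub> y \<otimes>\<^bsub>Q\<^esub> z = x \<otimes>\<^bsub>Q\<^esub> (y \<otimes>\<^bsub>Q\<^esub> z)"
      unfolding x(3) y(3) z(3) frac_mult[OF x(1,2) y(1,2)] frac_mult[OF y(1,2) z(1,2)]
      using x y z nonzero_mult[OF x(2) y(2)] nonzero_mult[OF y(2) z(2)] by (simp add: frac_mult m_ac)
  next
    fix x assume "x \<in> carrier Q"
    then obtain a b where x: "a \<in> carrier R" "b \<in> carrier R - {\<zero>}" "x = fraction R a b" by (auto simp: frac_carrier)
    show "\<one>\<^bsub>Q\<^esub> \<otimes>\<^bsub>Q\<^esub> x = x" unfolding frac_one x(3) using x one by (simp add: frac_mult)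
  qed
  fix x y z assume "x \<in> carrier Q" "y \<in> carrier Q" "z \<in> carrier Q"
  then obtain a b c d e f where x: "a \<in> carrier R" "b \<in> carrier R - {\<zero>}" "x = fraction R a b"
    and y: "c \<in> carrier R" "d \<in> carrier R - {\<zero>}" "y = fraction R c d"
    and z: "e \<in> carrier R" "f \<in> carrier R - {\<zero>}" "z = fraction R e f" by (auto simp: frac_carrier)
  have s: "a \<otimes> d \<oplus> c \<otimes> b \<in> carrier R" using x y z by auto
  note bd = nonzero_mult[OF x(2) y(2)] and bf = nonzero_mult[OF x(2) z(2)] and df = nonzero_mult[OF y(2) z(2)]
  have "(x \<oplus>\<^bsub>Q\<^esub> y) \<otimes>\<^bsub>Q\<^esub> z = fraction R ((a \<otimes> d \<oplus> c \<otimes> b) \<otimes> e) (b \<otimes> d \<otimes> f)"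
    unfolding x(3) y(3) z(3) frac_add[OF x(1,2) y(1,2)] by (rule frac_mult[OF s bd z(1,2)])
  also have "\<dots> = fraction R (a \<otimes> e \<otimes> (d \<otimes> f) \<oplus> c \<otimes> e \<otimes> (b \<otimes> f)) (b \<otimes> f \<otimes> (d \<otimes> f))"
    using x y z s bd bf df nonzero_mult[OF bd z(2)] nonzero_mult[OF bf df]
    by (intro fraction_eqI) (auto simp: l_distr r_distr m_ac)
  also have "\<dots> = (x \<otimes>\<^bsub>Q\<^esub> z) \<oplus>\<^bsub>Q\<^esub> (y \<otimes>\<^bsub>Q\<^esub> z)"
    unfolding x(3) y(3) z(3) frac_mult[OF x(1,2) z(1,2)] frac_mult[OF y(1,2) z(1,2)]
    using x y z bf df by (simp add: frac_add)
  finally show "(x \<oplus>\<^bsub>Q\<^esub> y) \<otimes>\<^bsub>Q\<^esub> z = (x \<otimes>\<^bsub>Q\<^esub> z) \<oplus>\<^bsub>Q\<^esub> (y \<otimes>\<^bsub>Q\<^esub> z)" .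
qed

lemma frac_inverse:
  assumes "a \<in> carrier R - {\<zero>}" "b \<in> carrier R - {\<zero>}"
  shows "fraction R a b \<otimes>\<^bsub>Q\<^esub> fraction R b a = \<one>\<^bsub>Q\<^esub>"
  using assms frac_self[OF nonzero_mult[OF assms]] by (simp add: frac_mult m_comm)

lemma frac_is_field: "Ring.field Q"
proof (rule cring.cring_fieldI2[OF frac_cring])
  show "\<zero>\<^bsub>Q\<^esub> \<noteq> \<one>\<^bsub>Q\<^esub>" using frac_zero_iff[of \<one> \<one>] unfolding frac_one by auto
  fix x assume x: "x \<in> carrier Q" "x \<noteq> \<zero>\<^bsub>Q\<^esub>"
  then obtain a b where ab: "a \<in> carrier R" "b \<in> carrier R - {\<zero>}" "x = fraction R a b" by (auto simp: frac_carrier)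
  then have a: "a \<in> carrier R - {\<zero>}" using x(2) frac_zero_iff[OF ab(1,2)] by auto
  then show "\<exists>y\<in>carrier Q. x \<otimes>\<^bsub>Q\<^esub> y = \<one>\<^bsub>Q\<^esub>"
    using ab frac_inverse[OF a ab(2)] frac_in[of b a] by auto
qed

lemma frac_m_inv:
  assumes "a \<in> carrier R - {\<zero>}" "b \<in> carrier R - {\<zero>}"
  shows "inv\<^bsub>Q\<^esub> (fraction R a b) = fraction R b a"
proof -
  interpret Q: cring Q by (rule frac_cring)
  show ?thesis using frac_inverse[OF assms] assms by (intro Q.comm_inv_char frac_in) auto
qed

lemma frac_a_inv:
  assumes "a \<in> carrier R" "b \<in> carrier R - {\<zero>}"
  shows "\<ominus>\<^bsub>Q\<^esub> (fraction R a b) = fraction R (\<ominus> a) b"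
proof -
  interpret Q: cring Q by (rule frac_cring)
  have "fraction R (\<ominus> a) b \<oplus>\<^bsub>Q\<^esub> fraction R a b = \<zero>\<^bsub>Q\<^esub>"
    using assms frac_zero_iff[OF zero_closed nonzero_mult[OF assms(2,2)]] by (simp add: frac_add l_minus l_neg)
  then show ?thesis using assms by (intro Q.minus_equality frac_in) auto
qed

lemma subfield_fractions:
  assumes K: "K \<subseteq> carrier Q" and one: "\<one>\<^bsub>Q\<^esub> \<in> K"
    and neg: "\<And>a b. a \<in> carrier R \<Longrightarrow> b \<in> carrier R - {\<zero>} \<Longrightarrow> fraction R a b \<in> K \<Longrightarrow> fraction R (\<ominus> a) b \<in> K"
    and inv: "\<And>a b. a \<in> carrier R - {\<zero>} \<Longrightarrow> b \<in> carrier R - {\<zero>} \<Longrightarrow> fraction R a b \<in> K \<Longrightarrow> fraction R b a \<in> K"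
    and add: "\<And>x y. x \<in> K \<Longrightarrow> y \<in> K \<Longrightarrow> x \<oplus>\<^bsub>Q\<^esub> y \<in> K"
    and mult: "\<And>x y. x \<in> K \<Longrightarrow> y \<in> K \<Longrightarrow> x \<otimes>\<^bsub>Q\<^esub> y \<in> K"
  shows "subfield K Q"
proof -
  interpret Q: Ring.field Q by (rule frac_is_field)
  have rep: "\<exists>a b. a \<in> carrier R \<and> b \<in> carrier R - {\<zero>} \<and> x = fraction R a b" if "x \<in> K" for x
    using that K frac_carrier by blast
  show ?thesis
  proof (rule Q.subfieldI'[OF Q.subringI[OF K one _ mult add]])
    fix x assume "x \<in> K"
    then obtain a b where ab: "a \<in> carrier R" "b \<in> carrier R - {\<zero>}" "x = fraction R a b" using rep by blast
    then show "\<ominus>\<^bsub>Q\<^esub> x \<in> K" using neg[OF ab(1,2)] \<open>x \<in> K\<close> by (simp add: frac_a_inv)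
  next
    fix x assume x: "x \<in> K - {\<zero>\<^bsub>Q\<^esub>}"
    then obtain a b where ab: "a \<in> carrier R" "b \<in> carrier R - {\<zero>}" "x = fraction R a b" using rep by blast
    then have a: "a \<in> carrier R - {\<zero>}" using x frac_zero_iff[OF ab(1,2)] by auto
    show "inv\<^bsub>Q\<^esub> x \<in> K" unfolding ab(3) frac_m_inv[OF a ab(2)] using inv[OF a ab(2)] x ab(3) by blast
  qed
qed

definition frac_map :: "('a \<Rightarrow> 'a) \<Rightarrow> ('a \<times> 'a) set \<Rightarrow> ('a \<times> 'a) set" where
  "frac_map \<sigma> x = (\<Union>(p, q)\<in>x. fraction R (\<sigma> p) (\<sigma> q))"

lemma frac_map:
  assumes \<sigma>: "\<sigma> \<in> Ring.ring_hom R R" and inj: "\<And>a. a \<in> carrier R \<Longrightarrow> \<sigma> a = \<zero> \<Longrightarrow> a = \<zero>"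
    and ab: "a \<in> carrier R" "b \<in> carrier R - {\<zero>}"
  shows "frac_map \<sigma> (fraction R a b) = fraction R (\<sigma> a) (\<sigma> b)"
  unfolding frac_map_def
proof (rule fraction_UN[OF ab])
  fix c d assume cd: "c \<in> carrier R" "d \<in> carrier R - {\<zero>}" "a \<otimes> d = c \<otimes> b"
  have "\<sigma> c \<otimes> \<sigma> b = \<sigma> a \<otimes> \<sigma> d"
    using cd ab Ring.ring_hom_mult[OF \<sigma>, of c b] Ring.ring_hom_mult[OF \<sigma>, of a d] by simp
  then show "fraction R (\<sigma> c) (\<sigma> d) = fraction R (\<sigma> a) (\<sigma> b)"
    using cd ab inj Ring.ring_hom_closed[OF \<sigma>] by (intro fraction_eqI) auto
qed

text \<open>Injective endomorphisms of the domain extend to the field of fractions; their common fixed points form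
  a subfield.\<close>

lemma subfield_fixed:
  assumes \<sigma>: "\<And>\<sigma>. \<sigma> \<in> \<Sigma> \<Longrightarrow> \<sigma> \<in> Ring.ring_hom R R" and inj: "\<And>\<sigma> a. \<sigma> \<in> \<Sigma> \<Longrightarrow> a \<in> carrier R \<Longrightarrow> \<sigma> a = \<zero> \<Longrightarrow> a = \<zero>"
  shows "subfield {x \<in> carrier Q. \<forall>\<sigma>\<in>\<Sigma>. frac_map \<sigma> x = x} Q"
proof -
  interpret Q: cring Q by (rule frac_cring)
  have m: "frac_map \<sigma> (fraction R a b) = fraction R (\<sigma> a) (\<sigma> b)"
    if "\<sigma> \<in> \<Sigma>" "a \<in> carrier R" "b \<in> carrier R - {\<zero>}" for \<sigma> a b
    by (rule frac_map[OF \<sigma>[OF that(1)] inj[OF that(1)] that(2,3)])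
  have nz: "\<sigma> b \<in> carrier R - {\<zero>}" if "\<sigma> \<in> \<Sigma>" "b \<in> carrier R - {\<zero>}" for \<sigma> b
    using that inj[OF that(1), of b] Ring.ring_hom_closed[OF \<sigma>[OF that(1)], of b] by auto
  show ?thesis
  proof (rule subfield_fractions)
    have "frac_map \<sigma> \<one>\<^bsub>Q\<^esub> = \<one>\<^bsub>Q\<^esub>" if "\<sigma> \<in> \<Sigma>" for \<sigma>
      using m[OF that, of \<one> \<one>] Ring.ring_hom_one[OF \<sigma>[OF that]] by (simp add: frac_one)
    then show "\<one>\<^bsub>Q\<^esub> \<in> {x \<in> carrier Q. \<forall>\<sigma>\<in>\<Sigma>. frac_map \<sigma> x = x}"
      using frac_in[of \<one> \<one>] by (simp add: frac_one)
  next
    fix a b assume ab: "a \<in> carrier R" "b \<in> carrier R - {\<zero>}" "fraction R a b \<in> {x \<in> carrier Q. \<forall>\<sigma>\<in>\<Sigma>. frac_map \<sigma> x = x}"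
    have "frac_map \<sigma> (fraction R (\<ominus> a) b) = fraction R (\<ominus> a) b" if s: "\<sigma> \<in> \<Sigma>" for \<sigma>
    proof -
      have e: "fraction R (\<sigma> a) (\<sigma> b) = fraction R a b" using ab s m[OF s ab(1,2) ] by auto
      have c: "\<sigma> a \<in> carrier R" "\<sigma> b \<in> carrier R - {\<zero>}" using Ring.ring_hom_closed[OF \<sigma>[OF s] ab(1)] nz[OF s ab(2)] by auto
      have e': "\<sigma> a \<otimes> b = a \<otimes> \<sigma> b" using e fraction_eq_iff[OF c ab(1,2)] by simp
      have "\<sigma> (\<ominus> a) = \<ominus> \<sigma> a"
        using ring_hom_cring.hom_a_inv[of R R \<sigma> a] \<sigma>[OF s] ab(1) is_cring
        by (simp add: ring_hom_cring_def ring_hom_cring_axioms_def)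
      then have "frac_map \<sigma> (fraction R (\<ominus> a) b) = fraction R (\<ominus> \<sigma> a) (\<sigma> b)" using m[OF s _ ab(2), of "\<ominus> a"] ab(1) by simp
      also have "\<dots> = fraction R (\<ominus> a) b" using c ab(1,2) e' by (intro fraction_eqI) (auto simp: l_minus)
      finally show ?thesis .
    qed
    then show "fraction R (\<ominus> a) b \<in> {x \<in> carrier Q. \<forall>\<sigma>\<in>\<Sigma>. frac_map \<sigma> x = x}" using ab by (auto intro: frac_in)
  next
    fix a b assume ab: "a \<in> carrier R - {\<zero>}" "b \<in> carrier R - {\<zero>}" "fraction R a b \<in> {x \<in> carrier Q. \<forall>\<sigma>\<in>\<Sigma>. frac_map \<sigma> x = x}"
    have "frac_map \<sigma> (fraction R b a) = fraction R b a" if s: "\<sigma> \<in> \<Sigma>" for \<sigma>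
    proof -
      have e: "fraction R (\<sigma> a) (\<sigma> b) = fraction R a b" using ab s m[OF s _ ab(2), of a] by auto
      have c: "\<sigma> a \<in> carrier R - {\<zero>}" "\<sigma> b \<in> carrier R - {\<zero>}" using nz[OF s ab(1)] nz[OF s ab(2)] by auto
      have e': "\<sigma> a \<otimes> b = a \<otimes> \<sigma> b" using e fraction_eq_iff[of "\<sigma> a" "\<sigma> b" a b] c ab(1,2) by simp
      have "frac_map \<sigma> (fraction R b a) = fraction R (\<sigma> b) (\<sigma> a)" using m[OF s _ ab(1), of b] ab(2) by simp
      also have "\<dots> = fraction R b a" using c ab(1,2) e' by (intro fraction_eqI) (auto simp: m_comm)
      finally show ?thesis .
    qed
    then show "fraction R b a \<in> {x \<in> carrier Q. \<forall>\<sigma>\<in>\<Sigma>. frac_map \<sigma> x = x}" using ab by (auto intro: frac_in)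
  next
    fix x y assume xy: "x \<in> {x \<in> carrier Q. \<forall>\<sigma>\<in>\<Sigma>. frac_map \<sigma> x = x}" "y \<in> {x \<in> carrier Q. \<forall>\<sigma>\<in>\<Sigma>. frac_map \<sigma> x = x}"
    then obtain a b c d where x: "a \<in> carrier R" "b \<in> carrier R - {\<zero>}" "x = fraction R a b"
      and y: "c \<in> carrier R" "d \<in> carrier R - {\<zero>}" "y = fraction R c d" by (auto simp: frac_carrier)
    have "frac_map \<sigma> (x \<oplus>\<^bsub>Q\<^esub> y) = x \<oplus>\<^bsub>Q\<^esub> y \<and> frac_map \<sigma> (x \<otimes>\<^bsub>Q\<^esub> y) = x \<otimes>\<^bsub>Q\<^esub> y" if s: "\<sigma> \<in> \<Sigma>" for \<sigma>
    proof -
      note h = \<sigma>[OF s]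
      have c: "\<sigma> a \<in> carrier R" "\<sigma> b \<in> carrier R - {\<zero>}" "\<sigma> c \<in> carrier R" "\<sigma> d \<in> carrier R - {\<zero>}"
        using Ring.ring_hom_closed[OF h] x y nz[OF s] by auto
      have ex: "fraction R (\<sigma> a) (\<sigma> b) = x" "fraction R (\<sigma> c) (\<sigma> d) = y"
        using xy s m[OF s x(1,2)] m[OF s y(1,2)] x(3) y(3) by auto
      have "frac_map \<sigma> (x \<oplus>\<^bsub>Q\<^esub> y) = fraction R (\<sigma> (a \<otimes> d \<oplus> c \<otimes> b)) (\<sigma> (b \<otimes> d))"
        unfolding x(3) y(3) frac_add[OF x(1,2) y(1,2)] using x y by (intro m[OF s] nonzero_mult) auto
      also have "\<dots> = x \<oplus>\<^bsub>Q\<^esub> y"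
        unfolding ex[symmetric] frac_add[OF c] using x y by (simp add: Ring.ring_hom_add[OF h] Ring.ring_hom_mult[OF h])
      finally have 1: "frac_map \<sigma> (x \<oplus>\<^bsub>Q\<^esub> y) = x \<oplus>\<^bsub>Q\<^esub> y" .
      have "frac_map \<sigma> (x \<otimes>\<^bsub>Q\<^esub> y) = fraction R (\<sigma> (a \<otimes> c)) (\<sigma> (b \<otimes> d))"
        unfolding x(3) y(3) frac_mult[OF x(1,2) y(1,2)] using x y by (intro m[OF s] nonzero_mult) auto
      also have "\<dots> = x \<otimes>\<^bsub>Q\<^esub> y"
        unfolding ex[symmetric] frac_mult[OF c] using x y by (simp add: Ring.ring_hom_mult[OF h])
      finally show ?thesis using 1 by blast
    qed
    then show "x \<oplus>\<^bsub>Q\<^esub> y \<in> {x \<in> carrier Q. \<forall>\<sigma>\<in>\<Sigma>. frac_map \<sigma> x = x}"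
      "x \<otimes>\<^bsub>Q\<^esub> y \<in> {x \<in> carrier Q. \<forall>\<sigma>\<in>\<Sigma>. frac_map \<sigma> x = x}"
      using xy by auto
  qed auto
qed

end

section \<open>Rational functions on a basic variety\<close>

lemma coord_ring_simps:
  "carrier (coord_ring n V) = (\<lambda>p. restrict p V) ` poly_functions n"
  "f \<otimes>\<^bsub>coord_ring n V\<^esub> g = (\<lambda>X\<in>V. f X * g X)" "f \<oplus>\<^bsub>coord_ring n V\<^esub> g = (\<lambda>X\<in>V. f X + g X)"
  "\<one>\<^bsub>coord_ring n V\<^esub> = (\<lambda>X\<in>V. 1)" "\<zero>\<^bsub>coord_ring n V\<^esub> = (\<lambda>X\<in>V. 0)"
  by (auto simp: coord_ring_def)

lemma restrict_eq_iff: "restrict f V = restrict g V \<longleftrightarrow> (\<forall>X\<in>V. f X = g X)"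
  by (auto simp: restrict_def fun_eq_iff)

lemma coord_ring_cring: "cring (coord_ring n V)"
proof (rule cringI)
  note P = function_algebra_poly_functions[of n]
  have cl: "restrict p V \<in> carrier (coord_ring n V)" if "p \<in> poly_functions n" for p
    using that by (auto simp: coord_ring_simps)
  show "abelian_group (coord_ring n V)"
  proof (rule abelian_groupI)
    show "\<zero>\<^bsub>coord_ring n V\<^esub> \<in> carrier (coord_ring n V)"
      using cl[OF function_algebraD(1)[OF P, of 0]] by (simp add: coord_ring_simps(5))
  next
    fix f g assume "f \<in> carrier (coord_ring n V)" "g \<in> carrier (coord_ring n V)"
    then obtain p q where pq: "p \<in> poly_functions n" "q \<in> poly_functions n" "f = restrict p V" "g = restrict q V"
      by (auto simp: coord_ring_simps)
    have "f \<oplus>\<^bsub>coord_ring n V\<^esub> g = restrict (\<lambda>X. p X + q X) V"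
      by (auto simp: coord_ring_simps(3) pq restrict_eq_iff)
    then show "f \<oplus>\<^bsub>coord_ring n V\<^esub> g \<in> carrier (coord_ring n V)"
      using cl[OF function_algebraD(2)[OF P pq(1,2)]] by simp
    show "f \<oplus>\<^bsub>coord_ring n V\<^esub> g = g \<oplus>\<^bsub>coord_ring n V\<^esub> f" by (simp add: coord_ring_simps(3) add.commute)
  next
    fix f g h
    show "f \<oplus>\<^bsub>coord_ring n V\<^esub> g \<oplus>\<^bsub>coord_ring n V\<^esub> h = f \<oplus>\<^bsub>coord_ring n V\<^esub> (g \<oplus>\<^bsub>coord_ring n V\<^esub> h)"
      by (auto simp: coord_ring_simps(3) restrict_eq_iff add.assoc)
  next
    fix f assume "f \<in> carrier (coord_ring n V)"
    then obtain p where p: "p \<in> poly_functions n" "f = restrict p V" by (auto simp: coord_ring_simps)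
    show "\<zero>\<^bsub>coord_ring n V\<^esub> \<oplus>\<^bsub>coord_ring n V\<^esub> f = f" by (auto simp: coord_ring_simps(3,5) p restrict_eq_iff)
    show "\<exists>g\<in>carrier (coord_ring n V). g \<oplus>\<^bsub>coord_ring n V\<^esub> f = \<zero>\<^bsub>coord_ring n V\<^esub>"
      by (rule bexI[OF _ cl[OF function_algebra_uminus[OF P p(1)]]]) (auto simp: coord_ring_simps(3,5) p restrict_eq_iff)
  qed
  show "comm_monoid (coord_ring n V)"
  proof (rule comm_monoidI)
    show "\<one>\<^bsub>coord_ring n V\<^esub> \<in> carrier (coord_ring n V)"
      using cl[OF function_algebraD(1)[OF P, of 1]] by (simp add: coord_ring_simps(4))
  next
    fix f g assume "f \<in> carrier (coord_ring n V)" "g \<in> carrier (coord_ring n V)"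
    then obtain p q where pq: "p \<in> poly_functions n" "q \<in> poly_functions n" "f = restrict p V" "g = restrict q V"
      by (auto simp: coord_ring_simps)
    have "f \<otimes>\<^bsub>coord_ring n V\<^esub> g = restrict (\<lambda>X. p X * q X) V"
      by (auto simp: coord_ring_simps(2) pq restrict_eq_iff)
    then show "f \<otimes>\<^bsub>coord_ring n V\<^esub> g \<in> carrier (coord_ring n V)"
      using cl[OF function_algebraD(3)[OF P pq(1,2)]] by simp
    show "f \<otimes>\<^bsub>coord_ring n V\<^esub> g = g \<otimes>\<^bsub>coord_ring n V\<^esub> f" by (simp add: coord_ring_simps(2) mult.commute)
  next
    fix f g h
    show "f \<otimes>\<^bsub>coord_ring n V\<^esub> g \<otimes>\<^bsub>coord_ring n V\<^esub> h = f \<otimes>\<^bsub>coord_ring n V\<^esub> (g \<otimes>\<^bsub>coord_ring n V\<^esub> h)"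
      by (auto simp: coord_ring_simps(2) restrict_eq_iff mult.assoc)
  next
    fix f assume "f \<in> carrier (coord_ring n V)"
    then obtain p where p: "p \<in> poly_functions n" "f = restrict p V" by (auto simp: coord_ring_simps)
    show "\<one>\<^bsub>coord_ring n V\<^esub> \<otimes>\<^bsub>coord_ring n V\<^esub> f = f" by (auto simp: coord_ring_simps(2,4) p restrict_eq_iff)
  qed
  fix f g h
  show "(f \<oplus>\<^bsub>coord_ring n V\<^esub> g) \<otimes>\<^bsub>coord_ring n V\<^esub> h = f \<otimes>\<^bsub>coord_ring n V\<^esub> h \<oplus>\<^bsub>coord_ring n V\<^esub> g \<otimes>\<^bsub>coord_ring n V\<^esub> h"
    by (auto simp: coord_ring_simps(2,3) restrict_eq_iff algebra_simps)
qed

context weighted_roots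
begin

abbreviation A where "A \<equiv> coord_ring n V"

text \<open>Absence of zero divisors is the irreducibility of \<open>V\<close>.\<close>

lemma coord_ring_domain: "domain A"
proof -
  interpret A: cring A by (rule coord_ring_cring)
  show ?thesis
  proof (intro domain.intro domain_axioms.intro coord_ring_cring)
    show "\<one>\<^bsub>A\<^esub> \<noteq> \<zero>\<^bsub>A\<^esub>" using param(1) unfolding coord_ring_simps restrict_eq_iff by auto
    fix f g assume fg: "f \<otimes>\<^bsub>A\<^esub> g = \<zero>\<^bsub>A\<^esub>" "f \<in> carrier A" "g \<in> carrier A"
    obtain p q where pq: "p \<in> poly_functions n" "q \<in> poly_functions n" "f = restrict p V" "g = restrict q V"
      using fg(2,3) by (auto simp: coord_ring_simps)
    show "f = \<zero>\<^bsub>A\<^esub> \<or> g = \<zero>\<^bsub>A\<^esub>"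
    proof (rule ccontr)
      assume "\<not> ?thesis"
      then have "\<exists>X\<in>V. p X \<noteq> 0" "\<exists>X\<in>V. q X \<noteq> 0" by (auto simp: coord_ring_simps(5) pq restrict_eq_iff)
      then have "\<exists>X\<in>V. \<forall>h\<in>{p, q}. h X \<noteq> 0" using pq by (intro V_common_nonzero) auto
      moreover have "\<forall>X\<in>V. p X * q X = 0"
        using fg(1) by (auto simp: coord_ring_simps(2,5) pq restrict_eq_iff)
      ultimately show False by auto
    qed
  qed
qed

sublocale A: domain A by (rule coord_ring_domain)

abbreviation quotient :: "('a mat \<Rightarrow> 'a) \<Rightarrow> ('a mat \<Rightarrow> 'a) \<Rightarrow> (('a mat \<Rightarrow> 'a) \<times> ('a mat \<Rightarrow> 'a)) set" where
  "quotient p q \<equiv> fraction A (restrict p V) (restrict q V)"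

definition denominators :: "('a mat \<Rightarrow> 'a) set" where
  "denominators = {q \<in> poly_functions n. \<exists>X\<in>V. q X \<noteq> 0}"

lemma restrict_in: "p \<in> poly_functions n \<Longrightarrow> restrict p V \<in> carrier A"
  by (auto simp: coord_ring_simps)

lemma restrict_nonzero: "q \<in> denominators \<Longrightarrow> restrict q V \<in> carrier A - {\<zero>\<^bsub>A\<^esub>}"
  by (auto simp: denominators_def restrict_in coord_ring_simps(5) restrict_eq_iff)

lemma denominators_poly: "q \<in> denominators \<Longrightarrow> q \<in> poly_functions n"
  by (simp add: denominators_def)

lemma nonzeroE:
  assumes "f \<in> carrier A - {\<zero>\<^bsub>A\<^esub>}"
  obtains q where "q \<in> denominators" "f = restrict q V"
  using assms by (auto simp: coord_ring_simps(1,5) restrict_eq_iff denominators_def)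

lemma quotientE:
  assumes "x \<in> carrier A.Q"
  obtains p q where "p \<in> poly_functions n" "q \<in> denominators" "x = quotient p q"
proof -
  obtain a b where ab: "a \<in> carrier A" "b \<in> carrier A - {\<zero>\<^bsub>A\<^esub>}" "x = fraction A a b"
    using assms by (auto simp: A.frac_carrier)
  obtain q where "q \<in> denominators" "b = restrict q V" using nonzeroE[OF ab(2)] .
  moreover obtain p where "p \<in> poly_functions n" "a = restrict p V" using ab(1) by (auto simp: coord_ring_simps(1))
  ultimately show thesis using ab(3) that by blast
qed

lemma quotient_in: "p \<in> poly_functions n \<Longrightarrow> q \<in> denominators \<Longrightarrow> quotient p q \<in> carrier A.Q"
  by (intro A.frac_in restrict_in restrict_nonzero)

lemma quotient_eq_iff:
  assumes "p \<in> poly_functions n" "q \<in> denominators" "p' \<in> poly_functions n" "q' \<in> denominators"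
  shows "quotient p q = quotient p' q' \<longleftrightarrow> (\<forall>X\<in>V. p X * q' X = p' X * q X)"
  unfolding A.fraction_eq_iff[OF restrict_in[OF assms(1)] restrict_nonzero[OF assms(2)] restrict_in[OF assms(3)] restrict_nonzero[OF assms(4)]]
  by (auto simp: coord_ring_simps(2) restrict_eq_iff)

lemma denominators_mult: "q \<in> denominators \<Longrightarrow> q' \<in> denominators \<Longrightarrow> (\<lambda>X. q X * q' X) \<in> denominators"
proof -
  assume q: "q \<in> denominators" "q' \<in> denominators"
  then have "\<exists>X\<in>V. \<forall>h\<in>{q, q'}. h X \<noteq> 0" by (intro V_common_nonzero) (auto simp: denominators_def)
  then show ?thesis using q function_algebraD(3)[OF function_algebra_poly_functions] by (auto simp: denominators_def)
qed

lemma denominators_one: "(\<lambda>X. 1) \<in> denominators"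
  using param(1) by (auto simp: denominators_def intro: poly_functions.const)

lemma quotient_mult:
  assumes "p \<in> poly_functions n" "q \<in> denominators" "p' \<in> poly_functions n" "q' \<in> denominators"
  shows "quotient p q \<otimes>\<^bsub>A.Q\<^esub> quotient p' q' = quotient (\<lambda>X. p X * p' X) (\<lambda>X. q X * q' X)"
proof -
  have "quotient p q \<otimes>\<^bsub>A.Q\<^esub> quotient p' q' = fraction A (restrict p V \<otimes>\<^bsub>A\<^esub> restrict p' V) (restrict q V \<otimes>\<^bsub>A\<^esub> restrict q' V)"
    by (intro A.frac_mult restrict_in restrict_nonzero assms)
  moreover have "restrict p V \<otimes>\<^bsub>A\<^esub> restrict p' V = restrict (\<lambda>X. p X * p' X) V" for p p'
    by (auto simp: coord_ring_simps(2) restrict_eq_iff)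
  ultimately show ?thesis by simp
qed

lemma quotient_add:
  assumes "p \<in> poly_functions n" "q \<in> denominators" "p' \<in> poly_functions n" "q' \<in> denominators"
  shows "quotient p q \<oplus>\<^bsub>A.Q\<^esub> quotient p' q' = quotient (\<lambda>X. p X * q' X + p' X * q X) (\<lambda>X. q X * q' X)"
proof -
  have "quotient p q \<oplus>\<^bsub>A.Q\<^esub> quotient p' q' =
      fraction A (restrict p V \<otimes>\<^bsub>A\<^esub> restrict q' V \<oplus>\<^bsub>A\<^esub> restrict p' V \<otimes>\<^bsub>A\<^esub> restrict q V) (restrict q V \<otimes>\<^bsub>A\<^esub> restrict q' V)"
    by (intro A.frac_add restrict_in restrict_nonzero assms)
  moreover have "restrict p V \<otimes>\<^bsub>A\<^esub> restrict p' V = restrict (\<lambda>X. p X * p' X) V" for p p'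
    by (auto simp: coord_ring_simps(2) restrict_eq_iff)
  moreover have "restrict p V \<oplus>\<^bsub>A\<^esub> restrict p' V = restrict (\<lambda>X. p X + p' X) V" for p p'
    by (auto simp: coord_ring_simps(3) restrict_eq_iff)
  ultimately show ?thesis by simp
qed

text \<open>The entries of the translate are polynomial on all matrices once the product is written out; the
  resulting function need agree with the action on \<open>V\<close> only.\<close>

lemma coadj_poly:
  assumes g: "g \<in> carrier (UT n)" and p: "p \<in> poly_functions n"
  shows "\<exists>p'\<in>poly_functions n. \<forall>X\<in>V. p' X = p (coadj_act n g X)"
proof -
  let ?i = "inv\<^bsub>UT n\<^esub> g"
  define F where "F X = mat n n (\<lambda>(i, j). if j < i then (\<Sum>l\<in>{0..<n}. (\<Sum>k\<in>{0..<n}. g $$ (i, k) * X $$ (k, l)) * ?i $$ (l, j)) else 0)" for X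
  note P = function_algebra_poly_functions[of n]
  have "(\<lambda>X. F X $$ (i, j)) \<in> poly_functions n" if "i < n" "j < n" for i j
  proof (cases "j < i")
    case True
    have "(\<lambda>X. \<Sum>l\<in>{0..<n}. (\<Sum>k\<in>{0..<n}. g $$ (i, k) * X $$ (k, l)) * ?i $$ (l, j)) \<in> poly_functions n"
      by (intro function_algebra_sum[OF P] function_algebraD(3)[OF P] function_algebraD(1)[OF P] poly_functions.entry) auto
    then show ?thesis using True that by (simp add: F_def)
  qed (use that poly_functions.const[of 0 n] in \<open>simp add: F_def\<close>)
  then have "(\<lambda>X. p (F X)) \<in> poly_functions n" by (rule poly_functions_comp[OF P _ p])
  moreover have "F X = coadj_act n g X" if "X \<in> V" for X
  proof (rule eq_matI)
    note m = UT_mat[OF g] strictly_lower_mat[OF V_strictly_lower[OF that]] UT_inv(4)[OF g]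
    fix i j assume ij: "i < dim_row (coadj_act n g X)" "j < dim_col (coadj_act n g X)"
    then have ij: "i < n" "j < n" by (simp_all add: coadj_act_def strict_lower_def)
    show "F X $$ (i, j) = coadj_act n g X $$ (i, j)"
      using ij by (simp add: F_def coadj_act_def strict_lower_def triple_index[OF m ij] del: assoc_mult_mat)
  qed (simp_all add: F_def coadj_act_def strict_lower_def)
  ultimately show ?thesis by (intro bexI) auto
qed

lemma act_fun_ring_hom:
  assumes g: "g \<in> carrier (UT n)"
  shows "act_fun n V g \<in> Ring.ring_hom A A" "f \<in> carrier A \<Longrightarrow> act_fun n V g f = \<zero>\<^bsub>A\<^esub> \<Longrightarrow> f = \<zero>\<^bsub>A\<^esub>"
proof -
  note i = UT_inv(1)[OF g]
  have iV: "coadj_act n (inv\<^bsub>UT n\<^esub> g) X \<in> V" if "X \<in> V" for X by (rule coadj_V[OF i that])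
  show "act_fun n V g \<in> Ring.ring_hom A A"
  proof (rule Ring.ring_hom_memI)
    fix f assume "f \<in> carrier A"
    then obtain p where p: "p \<in> poly_functions n" "f = restrict p V" by (auto simp: coord_ring_simps(1))
    obtain p' where p': "p' \<in> poly_functions n" "\<And>X. X \<in> V \<Longrightarrow> p' X = p (coadj_act n (inv\<^bsub>UT n\<^esub> g) X)"
      using coadj_poly[OF i p(1)] by blast
    have "act_fun n V g f = restrict p' V"
      unfolding act_fun_def p(2) restrict_eq_iff using p'(2) iV by simp
    then show "act_fun n V g f \<in> carrier A" using restrict_in[OF p'(1)] by simp
  qed (use iV in \<open>auto simp: act_fun_def coord_ring_simps(2-5) restrict_eq_iff\<close>)
  assume f: "f \<in> carrier A" "act_fun n V g f = \<zero>\<^bsub>A\<^esub>"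
  obtain p where p: "p \<in> poly_functions n" "f = restrict p V" using f(1) by (auto simp: coord_ring_simps(1))
  have z: "f (coadj_act n (inv\<^bsub>UT n\<^esub> g) X) = 0" if "X \<in> V" for X
    using f(2) that by (auto simp: act_fun_def coord_ring_simps(5) restrict_eq_iff)
  have "p X = 0" if X: "X \<in> V" for X
    using z[OF coadj_V[OF g X]] p(2) X by (simp add: coadj_inv(1)[OF g V_strictly_lower[OF X]])
  then show "f = \<zero>\<^bsub>A\<^esub>" by (auto simp: p coord_ring_simps(5) restrict_eq_iff)
qed

lemma invariant_field_eq:
  "invariant_field n V = {x \<in> carrier A.Q. \<forall>\<sigma>\<in>act_fun n V ` carrier (UT n). A.frac_map \<sigma> x = x}"
  by (simp add: invariant_field_def act_rat_def A.frac_map_def)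

lemma subfield_invariants: "subfield (invariant_field n V) A.Q"
  unfolding invariant_field_eq by (rule A.subfield_fixed) (use act_fun_ring_hom in blast)+

text \<open>Invariance of a fraction is an identity between polynomial functions on \<open>V\<close>, while numerator and
  denominator themselves may fail to be invariant.\<close>

lemma quotient_invariant_iff:
  assumes p: "p \<in> poly_functions n" and q: "q \<in> denominators"
  shows "quotient p q \<in> invariant_field n V \<longleftrightarrow>
    (\<forall>g\<in>carrier (UT n). \<forall>X\<in>V. p (coadj_act n g X) * q X = p X * q (coadj_act n g X))"
proof -
  have 1: "A.frac_map (act_fun n V g) (quotient p q) = quotient p q \<longleftrightarrow>
      (\<forall>X\<in>V. p (coadj_act n (inv\<^bsub>UT n\<^esub> g) X) * q X = p X * q (coadj_act n (inv\<^bsub>UT n\<^esub> g) X))" if g: "g \<in> carrier (UT n)" for g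
  proof -
    note h = act_fun_ring_hom[OF g]
    note c = restrict_in[OF p] restrict_nonzero[OF q]
    have c': "act_fun n V g (restrict p V) \<in> carrier A" "act_fun n V g (restrict q V) \<in> carrier A - {\<zero>\<^bsub>A\<^esub>}"
      using Ring.ring_hom_closed[OF h(1)] c h(2)[of "restrict q V"] by auto
    have e: "A.frac_map (act_fun n V g) (quotient p q) = fraction A (act_fun n V g (restrict p V)) (act_fun n V g (restrict q V))"
      by (rule A.frac_map[OF h c])
    show ?thesis
      unfolding e A.fraction_eq_iff[OF c' c]
      using coadj_V[OF UT_inv(1)[OF g]] by (auto simp: act_fun_def coord_ring_simps(2) restrict_eq_iff)
  qed
  have "quotient p q \<in> invariant_field n V \<longleftrightarrow> (\<forall>g\<in>carrier (UT n). \<forall>X\<in>V. p (coadj_act n (inv\<^bsub>UT n\<^esub> g) X) * q X = p X * q (coadj_act n (inv\<^bsub>UT n\<^esub> g) X))"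
    unfolding invariant_field_eq using 1 quotient_in[OF p q] by simp
  also have "\<dots> \<longleftrightarrow> (\<forall>g\<in>carrier (UT n). \<forall>X\<in>V. p (coadj_act n g X) * q X = p X * q (coadj_act n g X))"
  proof (intro iffI ballI)
    fix g :: "'a mat" and X assume a: "\<forall>g\<in>carrier (UT n). \<forall>X\<in>V. p (coadj_act n (inv\<^bsub>UT n\<^esub> g) X) * q X = p X * q (coadj_act n (inv\<^bsub>UT n\<^esub> g) X)"
      and g: "g \<in> carrier (UT n)" and X: "X \<in> V"
    show "p (coadj_act n g X) * q X = p X * q (coadj_act n g X)"
      using bspec[OF bspec[OF a UT_inv(1)[OF g]] X] by (simp add: UT_inv(5)[OF g])
  qed (use UT_inv(1) in blast)
  finally show ?thesis .
qed

lemma const_functions_eq: "const_functions n V = {quotient (\<lambda>X. c) (\<lambda>X. 1) | c. True}"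
  by (simp add: const_functions_def)

lemma const_invariant: "const_functions n V \<subseteq> invariant_field n V"
  using quotient_invariant_iff[OF poly_functions.const denominators_one] by (auto simp: const_functions_eq)

lemma subfield_const: "subfield (const_functions n V) A.Q"
proof (rule A.subfield_fractions)
  note c = poly_functions.const[where n = n] and o = denominators_one
  show "const_functions n V \<subseteq> carrier A.Q" unfolding const_functions_eq using quotient_in[OF c o] by auto
  show "\<one>\<^bsub>A.Q\<^esub> \<in> const_functions n V"
    unfolding const_functions_eq A.frac_one by (auto simp: coord_ring_simps(4))
next
  fix x y assume "x \<in> const_functions n V" "y \<in> const_functions n V"
  then obtain a b where ab: "x = quotient (\<lambda>X. a) (\<lambda>X. 1)" "y = quotient (\<lambda>X. b) (\<lambda>X. 1)" by (auto simp: const_functions_eq)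
  note c = poly_functions.const[where n = n] and o = denominators_one
  show "x \<oplus>\<^bsub>A.Q\<^esub> y \<in> const_functions n V" "x \<otimes>\<^bsub>A.Q\<^esub> y \<in> const_functions n V"
    unfolding ab quotient_add[OF c o c o] quotient_mult[OF c o c o] const_functions_eq by auto
next
  fix a b assume ab: "a \<in> carrier A" "b \<in> carrier A - {\<zero>\<^bsub>A\<^esub>}" "fraction A a b \<in> const_functions n V"
  note c = poly_functions.const[where n = n] and o = denominators_one
  obtain k where "fraction A a b = quotient (\<lambda>X. k) (\<lambda>X. 1)" using ab(3) by (auto simp: const_functions_eq)
  then have 1: "a \<otimes>\<^bsub>A\<^esub> restrict (\<lambda>X. 1) V = restrict (\<lambda>X. k) V \<otimes>\<^bsub>A\<^esub> b"
    using A.fraction_eq_iff[OF ab(1,2) restrict_in[OF c] restrict_nonzero[OF o]] by simp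
  obtain p where p: "p \<in> poly_functions n" "a = restrict p V" using ab(1) by (auto simp: coord_ring_simps(1))
  obtain q where q: "q \<in> denominators" "b = restrict q V" using nonzeroE[OF ab(2)] .
  have pk: "p X = k * q X" if "X \<in> V" for X
    using 1 that unfolding p q coord_ring_simps(2) restrict_eq_iff by simp
  interpret Q: Ring.field A.Q by (rule A.frac_is_field)
  have e: "\<ominus>\<^bsub>A\<^esub> a = restrict (\<lambda>X. - p X) V"
  proof (rule A.minus_equality)
    show "restrict (\<lambda>X. - p X) V \<oplus>\<^bsub>A\<^esub> a = \<zero>\<^bsub>A\<^esub>" by (auto simp: p coord_ring_simps(3,5) restrict_eq_iff)
  qed (use ab(1) restrict_in[OF function_algebra_uminus[OF function_algebra_poly_functions p(1)]] in auto)
  have "quotient (\<lambda>X. - p X) q = quotient (\<lambda>X. - k) (\<lambda>X. 1)"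
    using quotient_eq_iff[OF function_algebra_uminus[OF function_algebra_poly_functions p(1)] q(1) c o] pk by simp
  then show "fraction A (\<ominus>\<^bsub>A\<^esub> a) b \<in> const_functions n V" unfolding e q(2) const_functions_eq by blast
next
  fix a b assume ab: "a \<in> carrier A - {\<zero>\<^bsub>A\<^esub>}" "b \<in> carrier A - {\<zero>\<^bsub>A\<^esub>}" "fraction A a b \<in> const_functions n V"
  note c = poly_functions.const[where n = n] and o = denominators_one
  obtain k where "fraction A a b = quotient (\<lambda>X. k) (\<lambda>X. 1)" using ab(3) by (auto simp: const_functions_eq)
  then have 1: "a \<otimes>\<^bsub>A\<^esub> restrict (\<lambda>X. 1) V = restrict (\<lambda>X. k) V \<otimes>\<^bsub>A\<^esub> b"
    using A.fraction_eq_iff[OF DiffD1[OF ab(1)] ab(2) restrict_in[OF c] restrict_nonzero[OF o]] by simp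
  obtain p where p: "p \<in> denominators" "a = restrict p V" using nonzeroE[OF ab(1)] .
  obtain q where q: "q \<in> denominators" "b = restrict q V" using nonzeroE[OF ab(2)] .
  have pk: "p X = k * q X" if "X \<in> V" for X
    using 1 that unfolding p q coord_ring_simps(2) restrict_eq_iff by simp
  then have "k \<noteq> 0" using p(1) by (auto simp: denominators_def)
  then have "quotient q p = quotient (\<lambda>X. 1 / k) (\<lambda>X. 1)"
    using quotient_eq_iff[OF denominators_poly[OF q(1)] p(1) c o] pk by simp
  then show "fraction A b a \<in> const_functions n V" unfolding p(2) q(2) const_functions_eq by blast
qed

end

section \<open>The field of invariants\<close>

text \<open>A polynomial over an infinite field that vanishes everywhere has zero coefficients. The set \<open>E\<close> of
  exponent vectors is kept general, and it is only required that the first \<open>d\<close> exponents separate its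
  elements, so that the induction can split off the last variable.\<close>

lemma monomials_independent:
  fixes \<kappa> :: "(nat \<Rightarrow> nat) \<Rightarrow> 'a::field_char_0"
  assumes "finite E" "\<And>e e'. e \<in> E \<Longrightarrow> e' \<in> E \<Longrightarrow> (\<forall>i<d. e i = e' i) \<Longrightarrow> e = e'"
    and "\<And>y. (\<Sum>e\<in>E. \<kappa> e * (\<Prod>i<d. y i ^ e i)) = 0" and "e \<in> E"
  shows "\<kappa> e = 0"
  using assms
proof (induction d arbitrary: E e)
  case 0
  then have "E = {e}" by auto
  then show ?case using 0(3) by simp
next
  case (Suc d)
  define E' where "E' = {e' \<in> E. e' d = e d}"
  have 1: "(\<Sum>e\<in>E'. \<kappa> e * (\<Prod>i<d. y i ^ e i)) = 0" for y
  proof -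
    define P where "P = (\<Sum>e\<in>E. monom (\<kappa> e * (\<Prod>i<d. y i ^ e i)) (e d))"
    have "poly P t = 0" for t
    proof -
      have "(\<Prod>i<d. (y(d := t)) i ^ e i) = (\<Prod>i<d. y i ^ e i)" for e by (intro prod.cong) auto
      then show ?thesis using Suc.prems(3)[of "y(d := t)"] by (simp add: P_def poly_sum poly_monom mult.assoc)
    qed
    then have "P = 0" using poly_all_0_iff_0 by blast
    then have "0 = coeff P (e d)" by simp
    also have "\<dots> = (\<Sum>e'\<in>E. if e' d = e d then \<kappa> e' * (\<Prod>i<d. y i ^ e' i) else 0)"
      unfolding P_def coeff_sum by (intro sum.cong) auto
    also have "\<dots> = (\<Sum>e\<in>E'. \<kappa> e * (\<Prod>i<d. y i ^ e i))"
      unfolding E'_def using Suc.prems(1) by (simp add: sum.inter_filter)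
    finally show ?thesis by simp
  qed
  have 2: "e1 = e2" if "e1 \<in> E'" "e2 \<in> E'" "\<forall>i<d. e1 i = e2 i" for e1 e2
    using that Suc.prems(2)[of e1 e2] by (auto simp: E'_def less_Suc_eq)
  show ?case
    by (rule Suc.IH[of E', OF _ 2 1]) (use Suc.prems(1,4) in \<open>auto simp: E'_def\<close>)
qed

lemma coord_polys_dense:
  fixes H :: "('i \<Rightarrow> 'a::field_char_0) \<Rightarrow> 'a"
  assumes "H \<in> coord_polys" "v \<in> coord_polys" "v y1 \<noteq> 0" "\<And>y. v y \<noteq> 0 \<Longrightarrow> H y = 0"
  shows "H y = 0"
proof (rule ccontr)
  assume H: "H y \<noteq> 0"
  define l where "l t = (\<lambda>i. y1 i + t * (y i - y1 i))" for t
  have l: "l 0 = y1" "l 1 = y" by (simp_all add: l_def)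
  have "\<exists>t. \<forall>f\<in>{H, v}. f (l t) \<noteq> 0"
  proof (rule univariate_common_nonzero)
    show "(\<lambda>t. f (l t)) \<in> univariate_polys" if "f \<in> {H, v}" for f
      unfolding l_def by (rule coord_polys_line) (use assms that in auto)
    show "\<exists>t. f (l t) \<noteq> 0" if "f \<in> {H, v}" for f
      using that l H assms(3) by (metis insert_iff singletonD)
  qed simp
  then show False using assms(4) by auto
qed

context normal_form
begin

lemma w_denominator: "w \<in> denominators"
  using w X1 by (auto simp: denominators_def)

lemma agree_everywhere:
  assumes "p \<in> poly_functions n" "q \<in> poly_functions n" "\<And>X. X \<in> V \<Longrightarrow> w X \<noteq> 0 \<Longrightarrow> p X = q X" "X \<in> V"
  shows "p X = q X"
  using V_dense[OF w function_algebra_diff[OF function_algebra_poly_functions assms(1,2)] X1(1,2) _ assms(4)] assms(3) by simp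

text \<open>The class \<open>x\<close> is represented by a fraction that is regular for \<open>w \<noteq> 0\<close>, and \<open>f\<close> is its value there.
  This turns computations in the field of fractions into pointwise ones.\<close>

definition has_value :: "(('a mat \<Rightarrow> 'a) \<times> ('a mat \<Rightarrow> 'a)) set \<Rightarrow> ('a mat \<Rightarrow> 'a) \<Rightarrow> bool" where
  "has_value x f \<longleftrightarrow> (\<exists>p\<in>poly_functions n. \<exists>q\<in>denominators. x = quotient p q \<and>
     (\<forall>X\<in>V. w X \<noteq> 0 \<longrightarrow> q X \<noteq> 0 \<and> p X = f X * q X))"

lemma has_valueE:
  assumes "has_value x f"
  obtains p q where "p \<in> poly_functions n" "q \<in> denominators" "x = quotient p q"
    "\<And>X. X \<in> V \<Longrightarrow> w X \<noteq> 0 \<Longrightarrow> q X \<noteq> 0" "\<And>X. X \<in> V \<Longrightarrow> w X \<noteq> 0 \<Longrightarrow> p X = f X * q X"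
  using assms unfolding has_value_def by blast

lemma has_value_in: "has_value x f \<Longrightarrow> x \<in> carrier A.Q"
  by (erule has_valueE) (simp add: quotient_in)

lemma has_value_const: "has_value (quotient (\<lambda>X. c) (\<lambda>X. 1)) (\<lambda>X. c)"
  unfolding has_value_def using poly_functions.const denominators_one
  by (intro bexI[of _ "\<lambda>X. c"] bexI[of _ "\<lambda>X. 1"]) auto

lemma has_value_add:
  assumes "has_value x f" "has_value y g"
  shows "has_value (x \<oplus>\<^bsub>A.Q\<^esub> y) (\<lambda>X. f X + g X)"
proof -
  note P = function_algebra_poly_functions[of n]
  obtain p q where x: "p \<in> poly_functions n" "q \<in> denominators" "x = quotient p q"
    "\<And>X. X \<in> V \<Longrightarrow> w X \<noteq> 0 \<Longrightarrow> q X \<noteq> 0" "\<And>X. X \<in> V \<Longrightarrow> w X \<noteq> 0 \<Longrightarrow> p X = f X * q X"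
    by (rule has_valueE[OF assms(1)]) blast
  obtain p' q' where y: "p' \<in> poly_functions n" "q' \<in> denominators" "y = quotient p' q'"
    "\<And>X. X \<in> V \<Longrightarrow> w X \<noteq> 0 \<Longrightarrow> q' X \<noteq> 0" "\<And>X. X \<in> V \<Longrightarrow> w X \<noteq> 0 \<Longrightarrow> p' X = g X * q' X"
    by (rule has_valueE[OF assms(2)]) blast
  show ?thesis
    unfolding has_value_def x(3) y(3) quotient_add[OF x(1,2) y(1,2)]
  proof (intro bexI conjI ballI impI)
    show "(\<lambda>X. p X * q' X + p' X * q X) \<in> poly_functions n"
      by (intro function_algebraD(2)[OF P] function_algebraD(3)[OF P] denominators_poly[OF x(2)] denominators_poly[OF y(2)] x(1) y(1))
    fix X assume X: "X \<in> V" "w X \<noteq> 0"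
    show "q X * q' X \<noteq> 0" using x(4)[OF X] y(4)[OF X] by simp
    show "p X * q' X + p' X * q X = (f X + g X) * (q X * q' X)" by (simp add: x(5)[OF X] y(5)[OF X] algebra_simps)
  qed (use denominators_mult[OF x(2) y(2)] in auto)
qed

lemma has_value_mult:
  assumes "has_value x f" "has_value y g"
  shows "has_value (x \<otimes>\<^bsub>A.Q\<^esub> y) (\<lambda>X. f X * g X)"
proof -
  note P = function_algebra_poly_functions[of n]
  obtain p q where x: "p \<in> poly_functions n" "q \<in> denominators" "x = quotient p q"
    "\<And>X. X \<in> V \<Longrightarrow> w X \<noteq> 0 \<Longrightarrow> q X \<noteq> 0" "\<And>X. X \<in> V \<Longrightarrow> w X \<noteq> 0 \<Longrightarrow> p X = f X * q X"
    by (rule has_valueE[OF assms(1)]) blast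
  obtain p' q' where y: "p' \<in> poly_functions n" "q' \<in> denominators" "y = quotient p' q'"
    "\<And>X. X \<in> V \<Longrightarrow> w X \<noteq> 0 \<Longrightarrow> q' X \<noteq> 0" "\<And>X. X \<in> V \<Longrightarrow> w X \<noteq> 0 \<Longrightarrow> p' X = g X * q' X"
    by (rule has_valueE[OF assms(2)]) blast
  show ?thesis
    unfolding has_value_def x(3) y(3) quotient_mult[OF x(1,2) y(1,2)]
  proof (intro bexI conjI ballI impI)
    show "(\<lambda>X. p X * p' X) \<in> poly_functions n"
      using x y by (intro function_algebraD(3)[OF P])
    fix X assume X: "X \<in> V" "w X \<noteq> 0"
    show "q X * q' X \<noteq> 0" using x(4)[OF X] y(4)[OF X] by simp
    show "p X * p' X = (f X * g X) * (q X * q' X)" by (simp add: x(5)[OF X] y(5)[OF X] algebra_simps)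
  qed (use denominators_mult[OF x(2) y(2)] in auto)
qed

text \<open>Regularity of the representing fraction makes the value of the zero class vanish wherever \<open>w\<close> does
  not, and not only generically.\<close>

lemma has_value_zero:
  assumes "has_value \<zero>\<^bsub>A.Q\<^esub> f" "X \<in> V" "w X \<noteq> 0"
  shows "f X = 0"
proof -
  obtain p q where x: "p \<in> poly_functions n" "q \<in> denominators" "\<zero>\<^bsub>A.Q\<^esub> = quotient p q"
    "\<And>X. X \<in> V \<Longrightarrow> w X \<noteq> 0 \<Longrightarrow> q X \<noteq> 0" "\<And>X. X \<in> V \<Longrightarrow> w X \<noteq> 0 \<Longrightarrow> p X = f X * q X"
    by (rule has_valueE[OF assms(1)]) blast
  have "restrict p V = \<zero>\<^bsub>A\<^esub>" using A.frac_zero_iff[OF restrict_in[OF x(1)] restrict_nonzero[OF x(2)]] x(3) by simp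
  then have "p X = 0" using assms(2) by (auto simp: coord_ring_simps(5) restrict_eq_iff)
  then show ?thesis using x(4)[OF assms(2,3)] x(5)[OF assms(2,3)] by simp
qed

lemma has_value_localised:
  assumes "f \<in> localised n w"
  shows "\<exists>x. has_value x f"
proof -
  obtain p k where p: "p \<in> poly_functions n" "\<And>X. w X \<noteq> 0 \<Longrightarrow> f X = p X / w X ^ k"
    using assms unfolding localised_def by blast
  have q: "(\<lambda>X. w X ^ k) \<in> denominators"
    using X1 function_algebra_power[OF function_algebra_poly_functions w] by (auto simp: denominators_def)
  have "has_value (quotient p (\<lambda>X. w X ^ k)) f"
    unfolding has_value_def by (intro bexI[OF _ p(1)] bexI[OF _ q]) (simp add: p(2))
  then show ?thesis by blast
qed

lemma has_value_one: "has_value \<one>\<^bsub>A.Q\<^esub> (\<lambda>X. 1)"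
  using has_value_const[of 1] by (simp add: A.frac_one coord_ring_simps(4))

lemma has_value_power:
  assumes "has_value x f"
  shows "has_value (x [^]\<^bsub>A.Q\<^esub> (k::nat)) (\<lambda>X. f X ^ k)"
proof (induction k)
  case 0
  show ?case using has_value_one by simp
next
  case (Suc k)
  show ?case using has_value_mult[OF Suc assms] by (simp add: mult.commute)
qed

lemma has_value_finprod:
  assumes "finite I" "\<And>i. i \<in> I \<Longrightarrow> has_value (x i) (f i)"
  shows "has_value (\<Otimes>\<^bsub>A.Q\<^esub>i\<in>I. x i) (\<lambda>X. \<Prod>i\<in>I. f i X)"
  using assms
proof (induction I rule: finite_induct)
  case empty
  interpret Q: cring A.Q by (rule A.frac_cring)
  show ?case using has_value_one by simp
next
  case (insert i I)
  interpret Q: cring A.Q by (rule A.frac_cring)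
  have "(\<Otimes>\<^bsub>A.Q\<^esub>i\<in>insert i I. x i) = x i \<otimes>\<^bsub>A.Q\<^esub> (\<Otimes>\<^bsub>A.Q\<^esub>i\<in>I. x i)"
    using insert.hyps insert.prems has_value_in by (intro Q.finprod_insert) blast+
  then show ?case using has_value_mult[OF insert.prems[of i] insert.IH] insert by simp
qed

lemma has_value_finsum:
  assumes "finite I" "\<And>i. i \<in> I \<Longrightarrow> has_value (x i) (f i)"
  shows "has_value (\<Oplus>\<^bsub>A.Q\<^esub>i\<in>I. x i) (\<lambda>X. \<Sum>i\<in>I. f i X)"
  using assms
proof (induction I rule: finite_induct)
  case empty
  interpret Q: cring A.Q by (rule A.frac_cring)
  show ?case using has_value_const[of 0] by (simp add: A.frac_zero coord_ring_simps(4,5))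
next
  case (insert i I)
  interpret Q: cring A.Q by (rule A.frac_cring)
  have "(\<Oplus>\<^bsub>A.Q\<^esub>i\<in>insert i I. x i) = x i \<oplus>\<^bsub>A.Q\<^esub> (\<Oplus>\<^bsub>A.Q\<^esub>i\<in>I. x i)"
    using insert.hyps insert.prems has_value_in by (intro Q.finsum_insert) blast+
  then show ?case using has_value_add[OF insert.prems[of i] insert.IH] insert by simp
qed

text \<open>Values that are constant along orbits give invariant classes: the identity of
  \<open>quotient_invariant_iff\<close> holds where \<open>w\<close> does not vanish at \<open>X\<close> and its translate, and this set is dense.\<close>

lemma has_value_invariant:
  assumes x: "has_value x f"
    and f: "\<And>g X. g \<in> carrier (UT n) \<Longrightarrow> X \<in> V \<Longrightarrow> w X \<noteq> 0 \<Longrightarrow> w (coadj_act n g X) \<noteq> 0 \<Longrightarrow> f (coadj_act n g X) = f X"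
  shows "x \<in> invariant_field n V"
proof -
  note P = function_algebra_poly_functions[of n]
  obtain p q where x: "p \<in> poly_functions n" "q \<in> denominators" "x = quotient p q"
    "\<And>X. X \<in> V \<Longrightarrow> w X \<noteq> 0 \<Longrightarrow> q X \<noteq> 0" "\<And>X. X \<in> V \<Longrightarrow> w X \<noteq> 0 \<Longrightarrow> p X = f X * q X"
    by (rule has_valueE[OF x]) blast
  show ?thesis
    unfolding x(3) quotient_invariant_iff[OF x(1,2)]
  proof (intro ballI)
    fix g :: "'a mat" and X assume g: "g \<in> carrier (UT n)" and X: "X \<in> V"
    obtain p' where p': "p' \<in> poly_functions n" "\<And>X. X \<in> V \<Longrightarrow> p' X = p (coadj_act n g X)" using coadj_poly[OF g x(1)] by blast
    obtain q' where q': "q' \<in> poly_functions n" "\<And>X. X \<in> V \<Longrightarrow> q' X = q (coadj_act n g X)" using coadj_poly[OF g denominators_poly[OF x(2)]] by blast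
    obtain w' where w': "w' \<in> poly_functions n" "\<And>X. X \<in> V \<Longrightarrow> w' X = w (coadj_act n g X)" using coadj_poly[OF g w] by blast
    have "w' (coadj_act n (inv\<^bsub>UT n\<^esub> g) X1) \<noteq> 0"
      using w'(2)[OF coadj_V[OF UT_inv(1)[OF g] X1(1)]] coadj_inv(2)[OF g V_strictly_lower[OF X1(1)]] X1(2) by simp
    then have "w' \<in> denominators" using w'(1) coadj_V[OF UT_inv(1)[OF g] X1(1)] by (auto simp: denominators_def)
    from denominators_mult[OF w_denominator this] obtain Y where Y: "(\<lambda>X. w X * w' X) \<in> poly_functions n" "Y \<in> V" "w Y * w' Y \<noteq> 0"
      by (auto simp: denominators_def)
    have "p' X * q X - p X * q' X = 0"
    proof (rule V_dense[OF Y(1) _ Y(2,3) _ X])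
      show "(\<lambda>X. p' X * q X - p X * q' X) \<in> poly_functions n"
        by (intro function_algebra_diff[OF P] function_algebraD(3)[OF P] p'(1) q'(1) x(1) denominators_poly[OF x(2)])
      fix X assume X: "X \<in> V" "w X * w' X \<noteq> 0"
      then have wX: "w X \<noteq> 0" "w (coadj_act n g X) \<noteq> 0" using w'(2) by auto
      show "p' X * q X - p X * q' X = 0"
        unfolding p'(2)[OF X(1)] q'(2)[OF X(1)] x(5)[OF X(1) wX(1)] x(5)[OF coadj_V[OF g X(1)] wX(2)] f[OF g X(1) wX] by simp
    qed
    then show "p (coadj_act n g X) * q X = p X * q (coadj_act n g X)" using p'(2)[OF X] q'(2)[OF X] by simp
  qed
qed

definition coordinate :: "root \<Rightarrow> (('a mat \<Rightarrow> 'a) \<times> ('a mat \<Rightarrow> 'a)) set" where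
  "coordinate \<zeta> = (SOME x. has_value x (\<lambda>X. entry (F X) (fst \<zeta>) (snd \<zeta>)))"

lemma coordinate:
  assumes "\<zeta> \<in> S"
  shows "has_value (coordinate \<zeta>) (\<lambda>X. entry (F X) (fst \<zeta>) (snd \<zeta>))"
proof -
  have "(fst \<zeta>, snd \<zeta>) \<in> pos_roots n" using assms S_pos by auto
  from has_value_localised[OF F_entry[OF this]] show ?thesis
    unfolding coordinate_def by (rule someI_ex)
qed

lemma coordinate_invariant: "\<zeta> \<in> S \<Longrightarrow> coordinate \<zeta> \<in> invariant_field n V"
  by (rule has_value_invariant[OF coordinate]) (simp_all add: F_invariant)

text \<open>The coordinates of the normal form \<open>F X\<close> from which \<open>param\<close> recovers it.\<close>

definition free_coords :: "'a mat \<Rightarrow> root \<Rightarrow> 'a" where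
  "free_coords X \<zeta> = (if \<zeta> \<in> S - J then entry (F X) (fst \<zeta>) (snd \<zeta>) else 0)"

lemma param_free_coords:
  assumes "X \<in> V" "w X \<noteq> 0"
  shows "param (free_coords X) = F X"
  by (rule param_eqI[OF F_V[OF assms]]) (auto simp: free_coords_def F_zero[OF assms])

text \<open>A polynomial in the free coordinates is the value of an element generated by their classes.\<close>

lemma generated_value:
  assumes H: "H \<in> coord_polys"
  shows "\<exists>y\<in>generate_field A.Q (const_functions n V \<union> coordinate ` (S - J)). has_value y (\<lambda>X. H (free_coords X))"
  using H
proof induction
  case (const c)
  have "quotient (\<lambda>X. c) (\<lambda>X. 1) \<in> const_functions n V" unfolding const_functions_eq by blast
  then show ?case using has_value_const[of c] by (intro bexI[OF _ generate_field.incl]) auto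
next
  case (coord \<zeta>)
  show ?case
  proof (cases "\<zeta> \<in> S - J")
    case True
    then have "has_value (coordinate \<zeta>) (\<lambda>X. free_coords X \<zeta>)" using coordinate[of \<zeta>] by (simp add: free_coords_def)
    then show ?thesis using True by (intro bexI[OF _ generate_field.incl]) auto
  next
    case False
    have "quotient (\<lambda>X. 0) (\<lambda>X. 1) \<in> const_functions n V" unfolding const_functions_eq by blast
    moreover have "(\<lambda>X. free_coords X \<zeta>) = (\<lambda>X. 0)" using False by (auto simp: free_coords_def)
    ultimately show ?thesis using has_value_const[of 0] by (intro bexI[OF _ generate_field.incl]) auto
  qed
next
  case (add H H')
  then obtain y y' where y: "y \<in> generate_field A.Q (const_functions n V \<union> coordinate ` (S - J))" "has_value y (\<lambda>X. H (free_coords X))"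
    "y' \<in> generate_field A.Q (const_functions n V \<union> coordinate ` (S - J))" "has_value y' (\<lambda>X. H' (free_coords X))" by blast
  show ?case using has_value_add[OF y(2,4)] generate_field.eng_add[OF y(1,3)] by blast
next
  case (mult H H')
  then obtain y y' where y: "y \<in> generate_field A.Q (const_functions n V \<union> coordinate ` (S - J))" "has_value y (\<lambda>X. H (free_coords X))"
    "y' \<in> generate_field A.Q (const_functions n V \<union> coordinate ` (S - J))" "has_value y' (\<lambda>X. H' (free_coords X))" by blast
  show ?case using has_value_mult[OF y(2,4)] generate_field.eng_mult[OF y(1,3)] by blast
qed

text \<open>Let \<open>x = p / q\<close> be invariant. On generic \<open>X\<close> one would like to write \<open>x = p (F X) / q (F X)\<close>, but \<open>q\<close> may
  vanish on the slice. Fix a point \<open>X'\<close> with \<open>q X' \<noteq> 0\<close> and an element \<open>g\<close> that brings it to normal form;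
  then \<open>p\<close> and \<open>q\<close>, composed with the inverse of \<open>g\<close>, serve instead, since \<open>q\<close> does not vanish at the
  translate of \<open>F X'\<close>, which is \<open>X'\<close>.\<close>

lemma invariants_generated:
  assumes x: "x \<in> invariant_field n V"
  shows "x \<in> generate_field A.Q (const_functions n V \<union> coordinate ` (S - J))"
proof -
  let ?G = "generate_field A.Q (const_functions n V \<union> coordinate ` (S - J))"
  interpret Q: Ring.field A.Q by (rule A.frac_is_field)
  note P = function_algebra_poly_functions[of n]
  have xQ: "x \<in> carrier A.Q" using x by (simp add: invariant_field_def)
  then obtain p q where pq: "p \<in> poly_functions n" "q \<in> denominators" "x = quotient p q" using quotientE by blast
  have inv: "p (coadj_act n g X) * q X = p X * q (coadj_act n g X)" if "g \<in> carrier (UT n)" "X \<in> V" for g X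
    using x that unfolding pq(3) quotient_invariant_iff[OF pq(1,2)] by blast
  obtain X' where X': "X' \<in> V" "w X' \<noteq> 0" "q X' \<noteq> 0"
    using denominators_mult[OF w_denominator pq(2)] by (auto simp: denominators_def)
  obtain g where g: "g \<in> carrier (UT n)" "F X' = coadj_act n g X'" using F_orbit[OF X'(1,2)] by blast
  let ?g = "inv\<^bsub>UT n\<^esub> g"
  note i = UT_inv(1)[OF g(1)]
  obtain p' where p': "p' \<in> poly_functions n" "\<And>X. X \<in> V \<Longrightarrow> p' X = p (coadj_act n ?g X)" using coadj_poly[OF i pq(1)] by blast
  obtain q' where q': "q' \<in> poly_functions n" "\<And>X. X \<in> V \<Longrightarrow> q' X = q (coadj_act n ?g X)" using coadj_poly[OF i denominators_poly[OF pq(2)]] by blast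
  obtain yp where yp: "yp \<in> ?G" "has_value yp (\<lambda>X. p' (param (free_coords X)))" using generated_value[OF param_poly[OF p'(1)]] by blast
  obtain yq where yq: "yq \<in> ?G" "has_value yq (\<lambda>X. q' (param (free_coords X)))" using generated_value[OF param_poly[OF q'(1)]] by blast
  obtain a b where a: "a \<in> poly_functions n" "b \<in> denominators" "yp = quotient a b"
    "\<And>X. X \<in> V \<Longrightarrow> w X \<noteq> 0 \<Longrightarrow> b X \<noteq> 0" "\<And>X. X \<in> V \<Longrightarrow> w X \<noteq> 0 \<Longrightarrow> a X = p' (param (free_coords X)) * b X"
    by (rule has_valueE[OF yp(2)]) blast
  obtain c d where c: "c \<in> poly_functions n" "d \<in> denominators" "yq = quotient c d"
    "\<And>X. X \<in> V \<Longrightarrow> w X \<noteq> 0 \<Longrightarrow> d X \<noteq> 0" "\<And>X. X \<in> V \<Longrightarrow> w X \<noteq> 0 \<Longrightarrow> c X = q' (param (free_coords X)) * d X"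
    by (rule has_valueE[OF yq(2)]) blast
  have "x \<otimes>\<^bsub>A.Q\<^esub> yq = quotient (\<lambda>X. p X * c X) (\<lambda>X. q X * d X)"
    unfolding pq(3) c(3) by (rule quotient_mult[OF pq(1,2) c(1,2)])
  also have "\<dots> = yp"
    unfolding a(3) quotient_eq_iff[OF function_algebraD(3)[OF P pq(1) c(1)] denominators_mult[OF pq(2) c(2)] a(1,2)]
  proof
    fix X assume "X \<in> V"
    then show "p X * c X * b X = a X * (q X * d X)"
    proof (rule agree_everywhere[rotated -1])
      fix X assume X: "X \<in> V" "w X \<noteq> 0"
      obtain h where h: "h \<in> carrier (UT n)" "F X = coadj_act n h X" using F_orbit[OF X] by blast
      have e: "coadj_act n ?g (F X) = coadj_act n (?g * h) X"
        unfolding h(2) by (rule coadj_mult[OF i h(1) strictly_lower_mat[OF V_strictly_lower[OF X(1)]], symmetric])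
      have "p' (F X) * q X = p X * q' (F X)"
        unfolding p'(2)[OF F_V[OF X]] q'(2)[OF F_V[OF X]] e by (rule inv[OF UT_mult_closed[OF i h(1)] X(1)])
      then show "p X * c X * b X = a X * (q X * d X)"
        unfolding a(5)[OF X] c(5)[OF X] param_free_coords[OF X] by (simp add: algebra_simps)
    qed (intro function_algebraD(3)[OF P] pq(1) c(1) a(1) denominators_poly a(2) c(2) pq(2))+
  qed
  finally have e: "x \<otimes>\<^bsub>A.Q\<^esub> yq = yp" .
  have yQ: "yq \<in> carrier A.Q" by (rule has_value_in[OF yq(2)])
  have nz: "yq \<noteq> \<zero>\<^bsub>A.Q\<^esub>"
  proof
    assume "yq = \<zero>\<^bsub>A.Q\<^esub>"
    then have "q' (param (free_coords X')) = 0" using has_value_zero[of "\<lambda>X. q' (param (free_coords X))"] yq(2) X'(1,2) by simp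
    then show False
      using X' q'(2)[OF F_V[OF X'(1,2)]] coadj_inv(1)[OF g(1) V_strictly_lower[OF X'(1)]]
      by (simp add: param_free_coords[OF X'(1,2)] g(2))
  qed
  have yU: "yq \<in> Units A.Q" using yQ nz by (simp add: Q.field_Units)
  have "yp \<otimes>\<^bsub>A.Q\<^esub> inv\<^bsub>A.Q\<^esub> yq = x \<otimes>\<^bsub>A.Q\<^esub> (yq \<otimes>\<^bsub>A.Q\<^esub> inv\<^bsub>A.Q\<^esub> yq)"
    unfolding e[symmetric] by (rule Q.m_assoc[OF xQ yQ Q.Units_inv_closed[OF yU]])
  then have "x = yp \<otimes>\<^bsub>A.Q\<^esub> inv\<^bsub>A.Q\<^esub> yq" using Q.Units_r_inv[OF yU] xQ by simp
  then show ?thesis using generate_field.eng_mult[OF yp(1) generate_field.m_inv[OF yq(1) nz]] by simp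
qed

text \<open>An algebraic relation between the classes of the free coordinates gives a polynomial \<open>H\<close> that vanishes
  at the values of the free coordinates. On the slice, where \<open>F\<close> is the identity, these values are arbitrary
  up to the condition \<open>w \<noteq> 0\<close>, whence \<open>H = 0\<close>.\<close>

theorem invariants_purely_transcendental:
  "purely_transcendental A.Q (const_functions n V) (invariant_field n V) (card (S - J))"
proof -
  let ?d = "card (S - J)"
  interpret Q: Ring.field A.Q by (rule A.frac_is_field)
  note P = function_algebra_coord_polys
  obtain b where b: "bij_betw b {0..<?d} (S - J)" using ex_bij_betw_nat_finite[of "S - J"] finite_S by blast
  then have b: "bij_betw b {..<?d} (S - J)" by (simp add: atLeast0LessThan)
  have bS: "b i \<in> S - J" if "i < ?d" for i using bij_betwE[OF b] that by blast
  define ind where "ind = the_inv_into {..<?d} b"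
  have ind: "ind (b i) = i" if "i < ?d" for i
    unfolding ind_def using that b by (intro the_inv_into_f_f) (auto simp: bij_betw_def)
  have ind': "b (ind \<zeta>) = \<zeta>" if "\<zeta> \<in> S - J" for \<zeta>
    unfolding ind_def using that b by (intro f_the_inv_into_f) (auto simp: bij_betw_def)
  let ?t = "\<lambda>i. coordinate (b i)"
  have img: "?t ` {..<?d} = coordinate ` (S - J)"
    using b by (auto simp: bij_betw_def image_image[symmetric])
  have "alg_independent A.Q (const_functions n V) ?d ?t"
    unfolding alg_independent_def
  proof (intro allI impI ballI)
    fix E :: "(nat \<Rightarrow> nat) set" and c e
    assume E: "finite E" "E \<subseteq> {..<?d} \<rightarrow>\<^sub>E UNIV" and c: "c \<in> E \<rightarrow> const_functions n V"
      and z: "(\<Oplus>\<^bsub>A.Q\<^esub>e\<in>E. c e \<otimes>\<^bsub>A.Q\<^esub> (\<Otimes>\<^bsub>A.Q\<^esub>i\<in>{..<?d}. ?t i [^]\<^bsub>A.Q\<^esub> e i)) = \<zero>\<^bsub>A.Q\<^esub>" and e: "e \<in> E"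
    have "\<forall>e\<in>E. \<exists>k. c e = quotient (\<lambda>X. k) (\<lambda>X. 1)" using c by (auto simp: const_functions_eq Pi_def)
    then obtain \<kappa> where \<kappa>: "\<And>e. e \<in> E \<Longrightarrow> c e = quotient (\<lambda>X. \<kappa> e) (\<lambda>X. 1)" using bchoice[of E "\<lambda>e k. c e = quotient (\<lambda>X. k) (\<lambda>X. 1)"] by blast
    define H where "H y = (\<Sum>e\<in>E. \<kappa> e * (\<Prod>i<?d. y i ^ e i))" for y
    have "has_value (\<Oplus>\<^bsub>A.Q\<^esub>e\<in>E. c e \<otimes>\<^bsub>A.Q\<^esub> (\<Otimes>\<^bsub>A.Q\<^esub>i\<in>{..<?d}. ?t i [^]\<^bsub>A.Q\<^esub> e i))
        (\<lambda>X. \<Sum>e\<in>E. \<kappa> e * (\<Prod>i<?d. entry (F X) (fst (b i)) (snd (b i)) ^ e i))"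
    proof (rule has_value_finsum[OF E(1)])
      fix e assume e: "e \<in> E"
      have 1: "has_value (\<Otimes>\<^bsub>A.Q\<^esub>i\<in>{..<?d}. ?t i [^]\<^bsub>A.Q\<^esub> e i) (\<lambda>X. \<Prod>i<?d. entry (F X) (fst (b i)) (snd (b i)) ^ e i)"
      proof (rule has_value_finprod[OF finite_lessThan])
        fix i assume "i \<in> {..<?d}"
        then have "b i \<in> S" using bS by blast
        then show "has_value (?t i [^]\<^bsub>A.Q\<^esub> e i) (\<lambda>X. entry (F X) (fst (b i)) (snd (b i)) ^ e i)"
          by (rule has_value_power[OF coordinate])
      qed
      have 2: "has_value (c e) (\<lambda>X. \<kappa> e)" unfolding \<kappa>[OF e] by (rule has_value_const)
      show "has_value (c e \<otimes>\<^bsub>A.Q\<^esub> (\<Otimes>\<^bsub>A.Q\<^esub>i\<in>{..<?d}. ?t i [^]\<^bsub>A.Q\<^esub> e i))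
          (\<lambda>X. \<kappa> e * (\<Prod>i<?d. entry (F X) (fst (b i)) (snd (b i)) ^ e i))"
        by (rule has_value_mult[OF 2 1])
    qed
    then have val: "has_value \<zero>\<^bsub>A.Q\<^esub> (\<lambda>X. H (\<lambda>i. entry (F X) (fst (b i)) (snd (b i))))"
      unfolding H_def z .
    \<comment> \<open>Points of the slice with given free coordinates \<open>y\<close> are of the form \<open>param (ext y)\<close>.\<close>
    define ext where "ext y \<zeta> = (if \<zeta> \<in> S - J then y (ind \<zeta>) else 0)" for y :: "nat \<Rightarrow> 'a" and \<zeta>
    have v: "(\<lambda>y. w (param (ext y))) \<in> coord_polys"
    proof (rule coord_polys_comp[OF P _ param_poly[OF w]])
      show "(\<lambda>y. ext y \<zeta>) \<in> coord_polys" for \<zeta>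
        unfolding ext_def by (cases "\<zeta> \<in> S - J") (auto intro: coord_polys.intros)
    qed
    have HP: "H \<in> coord_polys"
      unfolding H_def[abs_def]
    proof (rule function_algebra_sum[OF P])
      fix e
      have "(\<lambda>y. \<Prod>i<?d. y i ^ e i) \<in> coord_polys"
        by (rule function_algebra_prod[OF P]) (rule function_algebra_power[OF P coord_polys.coord])
      then show "(\<lambda>y. \<kappa> e * (\<Prod>i<?d. y i ^ e i)) \<in> coord_polys"
        by (rule function_algebraD(3)[OF P function_algebraD(1)[OF P]])
    qed
    have v1: "w (param (ext (\<lambda>i. entry X1 (fst (b i)) (snd (b i))))) \<noteq> 0"
    proof -
      have "param (ext (\<lambda>i. entry X1 (fst (b i)) (snd (b i)))) = X1"
        by (rule param_eqI[OF X1(1)]) (auto simp: ext_def ind' X1(3))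
      then show ?thesis using X1(2) by simp
    qed
    have "H y = 0" for y
    proof (rule coord_polys_dense[where v = "\<lambda>y. w (param (ext y))" and ?y1.0 = "\<lambda>i. entry X1 (fst (b i)) (snd (b i))", OF HP v v1])
      fix y assume wy: "w (param (ext y)) \<noteq> 0"
      let ?X = "param (ext y)"
      have "F ?X = ?X"
      proof (rule F_fixes[OF param(1) wy])
        fix \<zeta> assume "\<zeta> \<in> J"
        then show "entry ?X (fst \<zeta>) (snd \<zeta>) = 0" using J_S param(3)[of \<zeta> "ext y"] by (auto simp: ext_def)
      qed
      then have "(\<Prod>i<?d. entry (F ?X) (fst (b i)) (snd (b i)) ^ e i) = (\<Prod>i<?d. y i ^ e i)" for e
        using bS ind by (intro prod.cong refl) (auto simp: param(3) ext_def)
      then show "H y = 0" using has_value_zero[OF val param(1) wy] by (simp add: H_def)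
    qed
    then have "\<kappa> e = 0"
    proof (intro monomials_independent[OF E(1) _ _ e, of ?d \<kappa>])
      fix e1 e2 assume "e1 \<in> E" "e2 \<in> E" "\<forall>i<?d. e1 i = e2 i"
      then show "e1 = e2" using E(2) by (intro PiE_ext[of e1 "{..<?d}" "\<lambda>_. UNIV"]) auto
    qed (simp add: H_def)
    then show "c e = \<zero>\<^bsub>A.Q\<^esub>" using \<kappa>[OF e] by (simp add: A.frac_zero coord_ring_simps(4,5))
  qed
  moreover have "invariant_field n V = generate_field A.Q (const_functions n V \<union> ?t ` {..<?d})"
    unfolding img
  proof (rule Set.equalityI)
    have "const_functions n V \<union> coordinate ` (S - J) \<subseteq> invariant_field n V"
      using const_invariant coordinate_invariant by blast
    moreover have "invariant_field n V \<subseteq> carrier A.Q" by (auto simp: invariant_field_def)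
    ultimately show "generate_field A.Q (const_functions n V \<union> coordinate ` (S - J)) \<subseteq> invariant_field n V"
      by (intro Q.generate_field_min_subfield1 subfield_invariants) blast+
  qed (use invariants_generated in blast)
  moreover have "?t \<in> {..<?d} \<rightarrow> invariant_field n V" using bS coordinate_invariant by auto
  ultimately show ?thesis
    unfolding purely_transcendental_def
    using A.frac_is_field subfield_const subfield_invariants const_invariant by blast
qed

end

theorem theorem1p11:
  fixes n :: nat and D :: "root set" and \<phi> :: "root \<Rightarrow> 'a :: field_char_0"
  assumes "n \<ge> 1"
    and "basic_subset n D"
    and "\<forall>\<xi>\<in>D. \<phi> \<xi> \<noteq> 0"
  shows "\<exists>d. int d = int (card (C_roots n D)) - int (card D) \<and>
     purely_transcendental
       (rational_functions n (basic_variety n D \<phi>))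
       (const_functions n (basic_variety n D \<phi>))
       (invariant_field n (basic_variety n D \<phi>))
       d"
proof -
  interpret weighted_roots n D \<phi> by unfold_locales (use assms in auto)
  obtain X0 where "generic_point n D \<phi> X0"
    using generic_exists by (auto simp: generic_point_def generic_point_axioms_def intro: weighted_roots_axioms)
  then interpret g: generic_point n D \<phi> X0 .
  obtain X1 w F where "normal_form n D \<phi> X0 X1 w F" using g.normal_form_exists by blast
  then interpret f: normal_form n D \<phi> X0 X1 w F .
  show ?thesis
    using f.invariants_purely_transcendental g.card_free[OF assms(1)] by (intro exI[of _ "card (S - g.J)"]) auto
qed

end
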